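(* Let $(R,\Delta)$ be a Hermitian form ring with $R$ commutative. Suppose that $H\lhd_d G$ where $d$ is a positive integer and $G$ is a subgroup of $\mathrm{U}_{7}(R,\Delta)$ containing $\mathrm{EU}_{7}(R,\Delta)$. Suppose $U(H)=(I,\Omega)$. Then \[\mathrm{EU}_{7}((R,\Delta),U(H)\ast I^{k})\leq H \leq \mathrm{CU}_{7}((R,\Delta),U(H))\] where $k=\frac{12^d-1}{11}-1$.
   Context: Subnormality. $H\lhd_d G$ means that there are subgroups $H=H_0\lhd H_1\lhd\dots\lhd H_{d-1}\lhd H_d=G$, each normal in the next. Convention: $I^0=R$. Form rings. Rings are associative with $1\neq 0$; $R$ is a commutative ring. A Hermitian ring $(R,\bar{\ },\lambda,\mu)$ consists of $R$, a bijection $x\mapsto\bar x$ of $R$ with $\overline{x+y}=\bar x+\bar y$, $\overline{xy}=\bar y\bar x$, $\bar 1=1$, an element $\lambda\in R$ with $\bar{\bar x}=\lambda x\bar\lambda$ for all $x\in R$ (it follows that $\bar\lambda=\lambda^{-1}$), and an element $\mu\in R$ with $\mu=\bar\mu\lambda$. A subset $A\subseteq R$ is involution invariant if $\bar x\in A$ for all $x\in A$. The Heisenberg group $\mathfrak{H}$ is $R\times R$ with group operation $(x_1,y_1)\dotplus(x_2,y_2)=(x_1+x_2,\,y_1+y_2-\bar x_1\mu x_2)$; the inverse of $\alpha$ is written $\dot{-}\alpha$, and $\alpha\,\dot{-}\,\beta:=\alpha\dotplus(\dot{-}\beta)$. For $a\in R$ put $(x,y)\circ a=(xa,\bar a y a)$;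 $\circ$ has higher priority than $\dotplus$ and $\dot{-}$. An $R^{\bullet}$-submodule of $\mathfrak{H}$ is a subgroup stable under all maps $\alpha\mapsto\alpha\circ a$ ($a\in R$). For $A\subseteq\mathfrak{H}$, $B\subseteq R$, $A\circ B$ is the subgroup of $\mathfrak{H}$ generated by all $\alpha\circ b$ ($\alpha\in A$, $b\in B$); for $A,B\subseteq \mathfrak{H}$, $A\dotplus B=\{\alpha\dotplus\beta\mid\alpha\in A,\beta\in B\}$. For a subgroup $\Omega$ of $\mathfrak{H}$, $\alpha\equiv\beta\bmod\Omega$ means $\alpha\,\dot{-}\,\beta\in\Omega$. Let $\Delta_{\min}=\{(0,x-\bar x\lambda)\mid x\in R\}$ and $\Delta_{\max}=\{(x,y)\mid \bar x\mu x+y+\bar y\lambda=0\}$. An odd form parameter is an $R^\bullet$-submodule $\Delta$ of $\mathfrak{H}$ with $\Delta_{\min}\subseteq\Delta\subseteq\Delta_{\max}$; then $(R,\Delta)$ (short for $((R,\bar{\ },\lambda,\mu),\Delta)$) is called a Hermitian form ring. Put $J(\Delta)=\{y\in R\mid\exists z\in R:(y,z)\in\Delta\}$. For an involution invariant ideal $I$ of $R$ put $\tilde I=\{x\in R\mid\overline{J(\Delta)}\mu x\subseteq I\}$, $\Omega^I_{\min}=\{(0,x-\bar x\lambda)\mid x\in I\}\dotplus\Delta\circ I$ and $\Omega^I_{\max}=\Delta\cap(\tilde I\times I)$. An odd form ideal of $(R,\Delta)$ is a pair $(I,\Omega)$ where $I$ is an involution invariant ideal and $\Omega$ is an $R^\bullet$-submodule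 of $\mathfrak{H}$ with $\Omega^I_{\min}\subseteq\Omega\subseteq\Omega^I_{\max}$. Put $\Delta^{1}=\Delta$, $\Delta^{-1}=\{(x,y)\mid(x,\bar y)\in\Delta\}$, $\Omega^1=\Omega$, $\Omega^{-1}=\{(x,y)\mid(x,\bar y)\in\Omega\}$. Product. For an odd form ideal $(J,\Sigma)$ and an involution invariant ideal $K$, $(J,\Sigma)\ast K$ is the odd form ideal $(JK,\Omega^{JK}_{\min}\dotplus\Sigma\circ K)$. Groups (for $n\in\mathbb{N}$; here $n=3$). Let $\Theta_+=\{1,\dots,n\}$, $\Theta_-=\{-n,\dots,-1\}$, $\Theta=\Theta_+\cup\{0\}\cup\Theta_-$, $\Theta_{\mathrm{hb}}=\Theta\setminus\{0\}$, $\epsilon(i)=1$ for $i\in\Theta_+$ and $\epsilon(i)=-1$ for $i\in\Theta_-$. Coordinates of $M=R^{2n+1}$ (columns) and rows/columns of $(2n+1)\times(2n+1)$ matrices are indexed by $\Theta$ in the order $1,\dots,n,0,-n,\dots,-1$. $\sigma_{ij}$ is the $(i,j)$ entry and $\sigma_{*j}$ the $j$-th column of $\sigma$; $\sigma_{\mathrm{hb}}=(\sigma_{ij})_{i,j\in\Theta_{\mathrm{hb}}}$; $e$ is the identity matrix, $e^{ij}$ a matrix unit. For $u,v\in M$ let $B(u,v)=\sum_{i=1}^n\bar u_iv_{-i}+\bar u_0\mu v_0+\sum_{i=-n}^{-1}\bar u_i\lambda v_{-i}$ and $Q(u)=(u_0,\sum_{i=1}^n\bar u_iu_{-i})\in\mathfrak{H}$.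 $\mathrm{U}_{2n+1}(R,\Delta)$ is the group of $\sigma\in\mathrm{GL}_{2n+1}(R)$ with $B(\sigma u,\sigma v)=B(u,v)$ and $Q(\sigma u)\equiv Q(u)\bmod\Delta$ for all $u,v\in M$. Elementary subgroups. For $i,j\in\Theta_{\mathrm{hb}}$, $i\neq\pm j$, $x\in R$: $T_{ij}(x)=e+xe^{ij}-\lambda^{(\epsilon(j)-1)/2}\bar x\lambda^{(1-\epsilon(i))/2}e^{-j,-i}$. For $i\in\Theta_{\mathrm{hb}}$, $(x,y)\in\Delta^{-\epsilon(i)}$: $T_i(x,y)=e+xe^{0,-i}-\lambda^{-(1+\epsilon(i))/2}\bar x\mu e^{i0}+ye^{i,-i}$. $\mathrm{EU}_{2n+1}(R,\Delta)$ is the subgroup of $\mathrm{U}_{2n+1}(R,\Delta)$ generated by all these elements. For an odd form ideal $(I,\Omega)$, $\mathrm{EU}_{2n+1}(I,\Omega)$ is the subgroup generated by all $T_{ij}(x)$ with $x\in I$ and all $T_i(x,y)$ with $(x,y)\in\Omega^{-\epsilon(i)}$, and $\mathrm{EU}_{2n+1}((R,\Delta),(I,\Omega))$ is the normal closure of $\mathrm{EU}_{2n+1}(I,\Omega)$ in $\mathrm{EU}_{2n+1}(R,\Delta)$. Congruence subgroups. Let $M(R,\Delta)=\{u\in M\mid u_0\in J(\Delta)\}$. $\mathrm{U}_{2n+1}((R,\Delta),(I,\Omega))$ is the group of $\sigma\in\mathrm{U}_{2n+1}(R,\Delta)$ with $\sigma_{\mathrm{hb}}\equiv e_{\mathrm{hb}}\bmod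 I$ and $Q(\sigma u)\equiv Q(u)\bmod\Omega$ for all $u\in M(R,\Delta)$. $\mathrm{NU}_{2n+1}((R,\Delta),(I,\Omega))$ is its normaliser in $\mathrm{U}_{2n+1}(R,\Delta)$, and $\mathrm{CU}_{2n+1}((R,\Delta),(I,\Omega))=\{\sigma\in\mathrm{NU}_{2n+1}((R,\Delta),(I,\Omega))\mid[\sigma,\mathrm{EU}_{2n+1}(R,\Delta)]\leq\mathrm{U}_{2n+1}((R,\Delta),(I,\Omega))\}$, where $[g,h]=ghg^{-1}h^{-1}$. Upper level. For a subgroup $H\leq\mathrm{U}_{2n+1}(R,\Delta)$, the upper level $U(H)$ is the odd form ideal $(J,\Sigma)$ where $J$ is the ideal generated by $Y\cup\bar Y$, $Y$ being the set of all elements $\sigma_{ij}$, $\sigma_{ii}-\sigma_{jj}$ and all elements of the sets $\sigma_{i0}J(\Delta)$, $\overline{J(\Delta)}\mu\sigma_{0j}$, $\overline{J(\Delta)}\mu(\sigma_{00}-\sigma_{jj})J(\Delta)$ with $\sigma\in H$, $i\neq j\in\Theta_{\mathrm{hb}}$; and $\Sigma=\Omega^J_{\min}\dotplus Z\circ R$, where $Z$ is the set of all $Q(\sigma_{*j})$ and $(Q(\sigma_{*0})\,\dot{-}\,(1,0))\circ y\dotplus(y,z)\,\dot{-}\,(y,z)\circ\sigma_{ii}$ with $\sigma\in H$, $i,j\in\Theta_{\mathrm{hb}}$, $(y,z)\in\Delta$. *)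

theory Defs
  imports
    "HOL-Analysis.Cartesian_Space"
    "HOL-Algebra.Generated_Groups"
    "HOL-Algebra.Group_Action"
    "HOL-Algebra.Ideal_Product"
    "HOL-Algebra.Algebraic_Closure_Type"
begin

section \<open>Subnormality and normal closures\<close>

definition subnormal_chain :: "('g, 'm) monoid_scheme \<Rightarrow> nat \<Rightarrow> 'g set \<Rightarrow> 'g set \<Rightarrow> bool" where
  "subnormal_chain G d H K \<longleftrightarrow>
     (\<exists>Hs :: nat \<Rightarrow> 'g set.
        Hs 0 = H \<and> Hs d = K \<and> (\<forall>i\<le>d. subgroup (Hs i) G) \<and>
        (\<forall>i<d. Hs i \<lhd> G\<lparr>carrier := Hs (Suc i)\<rparr>))"

definition normal_closure :: "('g, 'm) monoid_scheme \<Rightarrow> 'g set \<Rightarrow> 'g set" where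
  "normal_closure G S = \<Inter>{N. N \<lhd> G \<and> S \<subseteq> N}"


section \<open>Hermitian rings and the Heisenberg group\<close>

record 'a hermitian_ring =
  bar :: "'a \<Rightarrow> 'a"
  lam :: 'a
  mu :: 'a

locale hermitian_ring =
  fixes R :: "('a :: comm_ring_1, 'm) hermitian_ring_scheme"
  assumes bar_bij: "bij (bar R)"
    and bar_add: "bar R (x + y) = bar R x + bar R y"
    and bar_mult: "bar R (x * y) = bar R y * bar R x"
    and bar_one: "bar R 1 = 1"
    and bar_bar: "bar R (bar R x) = lam R * x * bar R (lam R)"
    and mu_eq: "mu R = bar R (mu R) * lam R"

lemma (in hermitian_ring) lam_mult_bar_lam: "lam R * bar R (lam R) = 1"
  using bar_bar[of 1] by (simp add: bar_one)

text \<open>Integer powers of \<open>\<lambda>\<close>; by the lemma above, \<open>bar R (lam R)\<close> is the inverse of \<open>\<lambda>\<close>.\<close>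

definition lam_pow :: "('a :: comm_ring_1, 'm) hermitian_ring_scheme \<Rightarrow> int \<Rightarrow> 'a" where
  "lam_pow R k = (if k \<ge> 0 then lam R ^ nat k else bar R (lam R) ^ nat (- k))"

definition bar_invariant :: "('a :: comm_ring_1, 'm) hermitian_ring_scheme \<Rightarrow> 'a set \<Rightarrow> bool" where
  "bar_invariant R A \<longleftrightarrow> (\<forall>x\<in>A. bar R x \<in> A)"

definition heis :: "('a :: comm_ring_1, 'm) hermitian_ring_scheme \<Rightarrow> ('a \<times> 'a) monoid" where
  "heis R = \<lparr>carrier = UNIV,
     monoid.mult = (\<lambda>(x1, y1) (x2, y2). (x1 + x2, y1 + y2 - bar R x1 * mu R * x2)),
     one = (0, 0)\<rparr>"

definition heis_minus ::
    "('a :: comm_ring_1, 'm) hermitian_ring_scheme \<Rightarrow> 'a \<times> 'a \<Rightarrow> 'a \<times> 'a \<Rightarrow> 'a \<times> 'a" where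
  "heis_minus R \<alpha> \<beta> = \<alpha> \<otimes>\<^bsub>heis R\<^esub> inv\<^bsub>heis R\<^esub> \<beta>"

definition heis_cong ::
    "('a :: comm_ring_1, 'm) hermitian_ring_scheme \<Rightarrow> ('a \<times> 'a) set \<Rightarrow> 'a \<times> 'a \<Rightarrow> 'a \<times> 'a \<Rightarrow> bool" where
  "heis_cong R \<Omega> \<alpha> \<beta> \<longleftrightarrow> heis_minus R \<alpha> \<beta> \<in> \<Omega>"

definition heis_act ::
    "('a :: comm_ring_1, 'm) hermitian_ring_scheme \<Rightarrow> 'a \<times> 'a \<Rightarrow> 'a \<Rightarrow> 'a \<times> 'a" where
  "heis_act R \<alpha> a = (fst \<alpha> * a, bar R a * snd \<alpha> * a)"

definition heis_set_act ::
    "('a :: comm_ring_1, 'm) hermitian_ring_scheme \<Rightarrow> ('a \<times> 'a) set \<Rightarrow> 'a set \<Rightarrow> ('a \<times> 'a) set" where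
  "heis_set_act R A B = generate (heis R) {heis_act R \<alpha> b |\<alpha> b. \<alpha> \<in> A \<and> b \<in> B}"

definition heis_submodule ::
    "('a :: comm_ring_1, 'm) hermitian_ring_scheme \<Rightarrow> ('a \<times> 'a) set \<Rightarrow> bool" where
  "heis_submodule R \<Omega> \<longleftrightarrow>
     subgroup \<Omega> (heis R) \<and> (\<forall>\<alpha>\<in>\<Omega>. \<forall>a. heis_act R \<alpha> a \<in> \<Omega>)"


section \<open>Hermitian form rings and odd form ideals\<close>

record 'a hermitian_form_ring = "'a hermitian_ring" +
  form_par :: "('a \<times> 'a) set"

definition Delta_min :: "('a :: comm_ring_1, 'm) hermitian_ring_scheme \<Rightarrow> ('a \<times> 'a) set" where
  "Delta_min R = {(0, x - bar R x * lam R) |x. True}"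

definition Delta_max :: "('a :: comm_ring_1, 'm) hermitian_ring_scheme \<Rightarrow> ('a \<times> 'a) set" where
  "Delta_max R = {(x, y). bar R x * mu R * x + y + bar R y * lam R = 0}"

locale hermitian_form_ring = hermitian_ring R
  for R :: "('a :: comm_ring_1, 'm) hermitian_form_ring_scheme" +
  assumes form_par_submodule: "heis_submodule R (form_par R)"
    and Delta_min_subset: "Delta_min R \<subseteq> form_par R"
    and form_par_subset: "form_par R \<subseteq> Delta_max R"

definition J_par :: "('a :: comm_ring_1) hermitian_form_ring \<Rightarrow> 'a set" where
  "J_par R = {y. \<exists>z. (y, z) \<in> form_par R}"

definition ideal_tilde :: "('a :: comm_ring_1) hermitian_form_ring \<Rightarrow> 'a set \<Rightarrow> 'a set" where
  "ideal_tilde R I = {x. \<forall>a\<in>J_par R. bar R a * mu R * x \<in> I}"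

definition Omega_min :: "('a :: comm_ring_1) hermitian_form_ring \<Rightarrow> 'a set \<Rightarrow> ('a \<times> 'a) set" where
  "Omega_min R I =
     {(0, x - bar R x * lam R) |x. x \<in> I} <#>\<^bsub>heis R\<^esub> heis_set_act R (form_par R) I"

definition Omega_max :: "('a :: comm_ring_1) hermitian_form_ring \<Rightarrow> 'a set \<Rightarrow> ('a \<times> 'a) set" where
  "Omega_max R I = form_par R \<inter> (ideal_tilde R I \<times> I)"

definition odd_form_ideal ::
    "('a :: comm_ring_1) hermitian_form_ring \<Rightarrow> 'a set \<times> ('a \<times> 'a) set \<Rightarrow> bool" where
  "odd_form_ideal R = (\<lambda>(I, \<Omega>).
     ideal I ring_of_type_algebra \<and> bar_invariant R I \<and> heis_submodule R \<Omega> \<and>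
     Omega_min R I \<subseteq> \<Omega> \<and> \<Omega> \<subseteq> Omega_max R I)"

text \<open>\<open>\<Omega>\<^sup>s\<close> for \<open>s \<in> {1, -1}\<close>.\<close>

definition par_pm ::
    "('a :: comm_ring_1) hermitian_form_ring \<Rightarrow> ('a \<times> 'a) set \<Rightarrow> int \<Rightarrow> ('a \<times> 'a) set" where
  "par_pm R \<Omega> s = (if s = 1 then \<Omega> else {(x, y). (x, bar R y) \<in> \<Omega>})"

definition odd_form_prod ::
    "('a :: comm_ring_1) hermitian_form_ring \<Rightarrow> 'a set \<times> ('a \<times> 'a) set \<Rightarrow> 'a set
       \<Rightarrow> 'a set \<times> ('a \<times> 'a) set" where
  "odd_form_prod R = (\<lambda>(J, \<Sigma>) K.
     let JK = ideal_prod ring_of_type_algebra J K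
     in (JK, Omega_min R JK <#>\<^bsub>heis R\<^esub> heis_set_act R \<Sigma> K))"

text \<open>The unit of \<open>ideals_set\<close> is the whole ring, so \<open>I\<^sup>0 = R\<close>.\<close>

definition ideal_pow :: "'a :: comm_ring_1 set \<Rightarrow> nat \<Rightarrow> 'a set" where
  "ideal_pow I k = I [^]\<^bsub>ideals_set ring_of_type_algebra\<^esub> k"


section \<open>Odd-dimensional unitary groups\<close>

text \<open>
  The index set \<open>\<Theta> = {1, \<dots>, n, 0, -n, \<dots>, -1}\<close> with \<open>n = CARD('n)\<close>:
  \<open>PosI i\<close>, \<open>ZeroI\<close> and \<open>NegI i\<close> stand for \<open>i\<close>, \<open>0\<close> and \<open>-i\<close>.
\<close>

datatype 'n theta = PosI 'n | ZeroI | NegI 'n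

lemma UNIV_theta: "(UNIV :: 'n theta set) = range PosI \<union> {ZeroI} \<union> range NegI"
proof -
  have "t \<in> range PosI \<union> {ZeroI} \<union> range NegI" for t :: "'n theta"
    by (cases t) auto
  then show ?thesis
    by blast
qed

instance theta :: (finite) finite
  by standard (simp add: UNIV_theta)

instantiation theta :: (type) uminus
begin

fun uminus_theta :: "'a theta \<Rightarrow> 'a theta" where
  "- PosI i = NegI i"
| "- ZeroI = ZeroI"
| "- NegI i = PosI i"

instance ..

end

definition theta_hb :: "'n theta set" where
  "theta_hb = - {ZeroI}"

text \<open>The value at \<open>ZeroI\<close> is never used.\<close>

fun eps :: "'n theta \<Rightarrow> int" where
  "eps (PosI i) = 1"
| "eps ZeroI = 0"
| "eps (NegI i) = - 1"

type_synonym ('a, 'n) tvec = "('a, 'n theta) vec"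
type_synonym ('a, 'n) tmat = "(('a, 'n theta) vec, 'n theta) vec"

definition formB ::
    "('a :: comm_ring_1) hermitian_form_ring \<Rightarrow> ('a, 'n :: finite) tvec \<Rightarrow> ('a, 'n) tvec \<Rightarrow> 'a" where
  "formB R u v =
     (\<Sum>i\<in>range PosI. bar R (u $ i) * v $ (- i)) + bar R (u $ ZeroI) * mu R * v $ ZeroI
     + (\<Sum>i\<in>range NegI. bar R (u $ i) * lam R * v $ (- i))"

definition formQ ::
    "('a :: comm_ring_1) hermitian_form_ring \<Rightarrow> ('a, 'n :: finite) tvec \<Rightarrow> 'a \<times> 'a" where
  "formQ R u = (u $ ZeroI, \<Sum>i\<in>range PosI. bar R (u $ i) * u $ (- i))"

definition unitary_group ::
    "('a :: comm_ring_1) hermitian_form_ring \<Rightarrow> ('a, 'n :: finite) tmat monoid" where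
  "unitary_group R = \<lparr>carrier = {\<sigma>. invertible \<sigma> \<and>
        (\<forall>u v. formB R (\<sigma> *v u) (\<sigma> *v v) = formB R u v) \<and>
        (\<forall>u. heis_cong R (form_par R) (formQ R (\<sigma> *v u)) (formQ R u))},
     monoid.mult = (**), one = mat 1\<rparr>"


section \<open>Elementary subgroups\<close>

text \<open>\<open>munit x i j\<close> is \<open>x e\<^sup>i\<^sup>j\<close>.\<close>

definition munit :: "'a :: comm_ring_1 \<Rightarrow> 'n theta \<Rightarrow> 'n theta \<Rightarrow> ('a, 'n :: finite) tmat" where
  "munit x i j = (\<chi> k l. if k = i \<and> l = j then x else 0)"

text \<open>All exponents of \<open>\<lambda>\<close> below are integers, as \<open>eps i\<close> and \<open>eps j\<close> are odd.\<close>

definition T_short ::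
    "('a :: comm_ring_1) hermitian_form_ring \<Rightarrow> 'n theta \<Rightarrow> 'n theta \<Rightarrow> 'a \<Rightarrow> ('a, 'n :: finite) tmat" where
  "T_short R i j x =
     mat 1 + munit x i j
     - munit (lam_pow R ((eps j - 1) div 2) * bar R x * lam_pow R ((1 - eps i) div 2)) (- j) (- i)"

definition T_long ::
    "('a :: comm_ring_1) hermitian_form_ring \<Rightarrow> 'n theta \<Rightarrow> 'a \<times> 'a \<Rightarrow> ('a, 'n :: finite) tmat" where
  "T_long R i = (\<lambda>(x, y).
     mat 1 + munit x ZeroI (- i)
     - munit (lam_pow R (- (1 + eps i) div 2) * bar R x * mu R) i ZeroI
     + munit y i (- i))"

definition elem_gens ::
    "('a :: comm_ring_1) hermitian_form_ring \<Rightarrow> 'a set \<Rightarrow> ('a \<times> 'a) set \<Rightarrow> ('a, 'n :: finite) tmat set" where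
  "elem_gens R I \<Omega> =
     {T_short R i j x |i j x. i \<in> theta_hb \<and> j \<in> theta_hb \<and> i \<noteq> j \<and> i \<noteq> - j \<and> x \<in> I} \<union>
     {T_long R i \<alpha> |i \<alpha>. i \<in> theta_hb \<and> \<alpha> \<in> par_pm R \<Omega> (- eps i)}"

definition EU :: "('a :: comm_ring_1) hermitian_form_ring \<Rightarrow> ('a, 'n :: finite) tmat set" where
  "EU R = generate (unitary_group R) (elem_gens R UNIV (form_par R))"

definition EU_pre ::
    "('a :: comm_ring_1) hermitian_form_ring \<Rightarrow> 'a set \<times> ('a \<times> 'a) set \<Rightarrow> ('a, 'n :: finite) tmat set" where
  "EU_pre R = (\<lambda>(I, \<Omega>). generate (unitary_group R) (elem_gens R I \<Omega>))"

definition EU_rel ::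
    "('a :: comm_ring_1) hermitian_form_ring \<Rightarrow> 'a set \<times> ('a \<times> 'a) set \<Rightarrow> ('a, 'n :: finite) tmat set" where
  "EU_rel R I\<Omega> = normal_closure ((unitary_group R)\<lparr>carrier := EU R\<rparr>) (EU_pre R I\<Omega>)"


section \<open>Congruence subgroups\<close>

definition M_par :: "('a :: comm_ring_1) hermitian_form_ring \<Rightarrow> ('a, 'n :: finite) tvec set" where
  "M_par R = {u. u $ ZeroI \<in> J_par R}"

definition U_rel ::
    "('a :: comm_ring_1) hermitian_form_ring \<Rightarrow> 'a set \<times> ('a \<times> 'a) set \<Rightarrow> ('a, 'n :: finite) tmat set" where
  "U_rel R = (\<lambda>(I, \<Omega>). {\<sigma> \<in> carrier (unitary_group R).
     (\<forall>i\<in>theta_hb. \<forall>j\<in>theta_hb. \<sigma> $ i $ j - mat 1 $ i $ j \<in> I) \<and>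
     (\<forall>u\<in>M_par R. heis_cong R \<Omega> (formQ R (\<sigma> *v u)) (formQ R u))})"

definition NU_rel ::
    "('a :: comm_ring_1) hermitian_form_ring \<Rightarrow> 'a set \<times> ('a \<times> 'a) set \<Rightarrow> ('a, 'n :: finite) tmat set" where
  "NU_rel R I\<Omega> = normalizer (unitary_group R) (U_rel R I\<Omega>)"

definition CU_rel ::
    "('a :: comm_ring_1) hermitian_form_ring \<Rightarrow> 'a set \<times> ('a \<times> 'a) set \<Rightarrow> ('a, 'n :: finite) tmat set" where
  "CU_rel R I\<Omega> = {\<sigma> \<in> NU_rel R I\<Omega>.
     generate (unitary_group R)
       {\<sigma> \<otimes>\<^bsub>unitary_group R\<^esub> \<tau> \<otimes>\<^bsub>unitary_group R\<^esub> inv\<^bsub>unitary_group R\<^esub> \<sigma>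
          \<otimes>\<^bsub>unitary_group R\<^esub> inv\<^bsub>unitary_group R\<^esub> \<tau> |\<tau>. \<tau> \<in> EU R}
     \<subseteq> U_rel R I\<Omega>}"


section \<open>The upper level\<close>

definition upper_Y ::
    "('a :: comm_ring_1) hermitian_form_ring \<Rightarrow> ('a, 'n :: finite) tmat set \<Rightarrow> 'a set" where
  "upper_Y R H = (\<Union>\<sigma>\<in>H. \<Union>i\<in>theta_hb. \<Union>j\<in>theta_hb - {i}.
     {\<sigma> $ i $ j, \<sigma> $ i $ i - \<sigma> $ j $ j}
     \<union> {\<sigma> $ i $ ZeroI * a |a. a \<in> J_par R}
     \<union> {bar R a * mu R * \<sigma> $ ZeroI $ j |a. a \<in> J_par R}
     \<union> {bar R a * mu R * (\<sigma> $ ZeroI $ ZeroI - \<sigma> $ j $ j) * b |a b. a \<in> J_par R \<and> b \<in> J_par R})"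

definition upper_Z ::
    "('a :: comm_ring_1) hermitian_form_ring \<Rightarrow> ('a, 'n :: finite) tmat set \<Rightarrow> ('a \<times> 'a) set" where
  "upper_Z R H =
     {formQ R (column j \<sigma>) |j \<sigma>. j \<in> theta_hb \<and> \<sigma> \<in> H} \<union>
     {heis_minus R
        (heis_act R (heis_minus R (formQ R (column ZeroI \<sigma>)) (1, 0)) y \<otimes>\<^bsub>heis R\<^esub> (y, z))
        (heis_act R (y, z) (\<sigma> $ i $ i)) |i \<sigma> y z.
        i \<in> theta_hb \<and> \<sigma> \<in> H \<and> (y, z) \<in> form_par R}"

definition upper_level ::
    "('a :: comm_ring_1) hermitian_form_ring \<Rightarrow> ('a, 'n :: finite) tmat set
       \<Rightarrow> 'a set \<times> ('a \<times> 'a) set" where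
  "upper_level R H =
     (let Y = upper_Y R H; J = genideal ring_of_type_algebra (Y \<union> bar R ` Y)
      in (J, Omega_min R J <#>\<^bsub>heis R\<^esub> heis_set_act R (upper_Z R H) UNIV))"

end

theory Submission
  imports Defs
begin

text \<open>Write \<open>U(H) = (I, \<Omega>)\<close>. Both inclusions come from watching how matrices act on vectors.

  Upper bound. Two vectors are compared modulo an odd form ideal \<open>(J, \<Sigma>)\<close> by comparing their hyperbolic
  coordinates modulo \<open>J\<close> and their values \<open>Q\<close>, after a common hyperbolic part has been split off, modulo \<open>\<Sigma>\<close>
  (\<open>rel\<close>). This relation is additive in the vectors and invariant under elementary matrices (\<open>rel_add\<close>,
  \<open>rel_EU\<close>). So a matrix acts as a scalar modulo \<open>(J, \<Sigma>)\<close> as soon as it does so on basis vectors, and the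
  generators of the upper level are precisely the obstructions: \<open>U(H)\<close> is the least odd form ideal modulo
  which all elements of \<open>H\<close> act as scalars (\<open>upper_scalar_mod\<close>, \<open>scalar_mod_upper\<close>, \<open>upper_level_least\<close>). Scalars commute
  with everything modulo \<open>(I, \<Omega>)\<close>, which gives \<open>H \<le> CU((R, \<Delta>), U(H))\<close> (\<open>subgroup_le_CU\<close>). The same
  description shows that conjugating \<open>H\<close> by elementary matrices does not change \<open>U(H)\<close>.

  Lower bound. Let \<open>K\<close> be an involution invariant ideal such that \<open>H\<close> is normalised by the elementary
  conjugates of all root elements with parameters in \<open>K\<close>. Then \<open>EU((R, \<Delta>), U(H) * K\<^sup>1\<^sup>2) \<le> H\<close>
  (\<open>EU_rel_product\<close>). This is applied along the chain: if \<open>H\<close> is normal in \<open>H\<^sub>1\<close> and \<open>H\<^sub>1\<close> contains the root elements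
  for the power \<open>I\<^sup>e\<close>, take \<open>K = I\<^sup>e\<close>. The exponents start with \<open>0\<close> for \<open>G\<close> and obey \<open>e \<mapsto> 12 e + 1\<close>, the
  additional factor being \<open>I\<close> itself; hence \<open>e = (12\<^sup>d - 1) / 11\<close> after \<open>d\<close> steps, and \<open>k = e - 1\<close>.

  For a single \<open>H\<close> the engine is \<open>extraction_principle\<close>. If \<open>\<sigma>\<close> is in \<open>H\<close> and \<open>\<tau>\<close> normalises \<open>H\<close>, then
  \<open>\<sigma> \<tau> \<sigma>\<^sup>-\<^sup>1\<close> agrees with \<open>\<tau>\<close> modulo \<open>H\<close>, and so do all iterated commutators formed with them. Let \<open>\<tau>\<close> be an
  Eichler transvection whose two vectors are orthogonal to the row \<open>a\<close> of \<open>\<sigma>\<close>. Then \<open>\<sigma> \<tau> \<sigma>\<^sup>-\<^sup>1\<close> fixes the basis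
  vector \<open>a\<close>, and its iterated commutators with suitable root elements become trivial, whereas those of \<open>\<tau>\<close>
  are root elements whose parameters are products of two entries of that row (\<open>extract_product\<close>,
  \<open>extract_product_diag\<close>). Rows are unimodular, so the entries themselves follow (\<open>extract_entry\<close>); the
  remaining generators of \<open>I\<close> become such entries after conjugation by elementary matrices. Every
  commutator costs a factor from \<open>K\<close>: seven for a single entry at one root, ten for all generators of \<open>I\<close> at
  all short roots (\<open>upper_Y_All\<close>), and two more for the long roots, whose parameters have to reach \<open>\<Omega>\<close>
  (\<open>column_long_product\<close>, \<open>column0_long\<close>).\<close>

text \<open>The symbol \<open>$\<close> is reserved for the entries of vectors and matrices; the competing notation for
  coefficients of formal power series makes nested entries ambiguous.\<close>

no_notation fps_nth (infixl \<open>$\<close> 75)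

section \<open>Scalars, indices and the two forms\<close>

lemma theta_minus_minus [simp]: "- (- i) = (i :: 'n theta)"
  by (cases i) auto

lemma theta_minus_eq_iff [simp]: "- i = - j \<longleftrightarrow> i = (j :: 'n theta)"
  by (metis theta_minus_minus)

lemma theta_minus_eq: "- i = j \<longleftrightarrow> i = - (j :: 'n theta)"
  by (metis theta_minus_minus)

lemma ZeroI_notin_theta_hb [simp]: "ZeroI \<notin> theta_hb"
  by (simp add: theta_hb_def)

lemma theta_hb_iff: "i \<in> theta_hb \<longleftrightarrow> i \<noteq> ZeroI"
  by (simp add: theta_hb_def)

lemma minus_theta_hb [simp]: "- i \<in> theta_hb \<longleftrightarrow> i \<in> theta_hb"
  by (cases i) (auto simp: theta_hb_def)

lemma minus_theta_neq: "i \<in> theta_hb \<Longrightarrow> - i \<noteq> i" "i \<in> theta_hb \<Longrightarrow> i \<noteq> - i"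
  by (cases i; auto simp: theta_hb_def)+

lemma minus_eq_ZeroI [simp]: "- i = ZeroI \<longleftrightarrow> i = ZeroI" "ZeroI = - i \<longleftrightarrow> i = ZeroI"
  by (cases i; auto)+

text \<open>Two indices are apart if they lie over different elements of \<open>{1, \<dots>, n}\<close>;
  these are the pairs for which short root elements exist.\<close>

definition apart :: "'n theta \<Rightarrow> 'n theta \<Rightarrow> bool" where
  "apart i j \<longleftrightarrow> i \<in> theta_hb \<and> j \<in> theta_hb \<and> i \<noteq> j \<and> i \<noteq> - j"

lemma apart_sym: "apart i j \<longleftrightarrow> apart j i"
  by (auto simp: apart_def)

lemma apart_minus [simp]: "apart (- i) j \<longleftrightarrow> apart i j" "apart i (- j) \<longleftrightarrow> apart i j"
  by (auto simp: apart_def theta_minus_eq)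

lemma apartD:
  assumes "apart i j"
  shows "i \<in> theta_hb" "j \<in> theta_hb" "i \<noteq> ZeroI" "j \<noteq> ZeroI" "i \<noteq> j" "j \<noteq> i" "i \<noteq> - j" "j \<noteq> - i"
    "- i \<noteq> j" "- j \<noteq> i" "- i \<noteq> - j" "- j \<noteq> - i"
    "- i \<noteq> i" "i \<noteq> - i" "- j \<noteq> j" "j \<noteq> - j"
  using assms minus_theta_neq[of i] minus_theta_neq[of j] by (auto simp: apart_def theta_hb_iff)

lemma finite_theta [simp]: "finite (UNIV :: 'n :: finite theta set)"
  by simp

lemma sum_theta:
  fixes f :: "'n :: finite theta \<Rightarrow> 'b :: comm_monoid_add"
  shows "sum f UNIV = sum f (range PosI) + f ZeroI + sum f (range NegI)"
proof -
  have "sum f (UNIV :: 'n theta set) = sum f ((range PosI \<union> {ZeroI}) \<union> range NegI)"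
    by (simp add: UNIV_theta)
  also have "\<dots> = sum f (range PosI \<union> {ZeroI}) + sum f (range NegI)"
    by (rule sum.union_disjoint) auto
  also have "sum f (range PosI \<union> {ZeroI}) = sum f (range PosI) + f ZeroI"
    by (subst sum.union_disjoint) auto
  finally show ?thesis .
qed

definition ax :: "'n theta \<Rightarrow> ('a :: comm_ring_1, 'n :: finite) tvec" where
  "ax i = axis i 1"

lemma ax_nth: "ax i $ j = (if j = i then 1 else 0)"
  by (auto simp: ax_def axis_def)

lemma ax_nth_simps [simp]: "ax i $ i = 1" "i \<noteq> j \<Longrightarrow> ax i $ j = 0" "j \<noteq> i \<Longrightarrow> ax i $ j = 0"
  by (auto simp: ax_nth)

lemma vec_expand: "(v :: ('a :: comm_ring_1, 'n :: finite) tvec) = (\<Sum>i\<in>UNIV. v $ i *s ax i)"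
proof -
  have "(\<Sum>i\<in>UNIV. v $ i *s ax i) $ k = v $ k" for k
  proof -
    have "(\<Sum>i\<in>UNIV. v $ i *s ax i) $ k = (\<Sum>i\<in>UNIV. if i = k then v $ i else 0)"
      unfolding sum_component by (rule sum.cong) (auto simp: ax_nth)
    then show ?thesis by simp
  qed
  then show ?thesis by (simp add: vec_eq_iff)
qed

lemma matrix_vector_smult: "(A :: 'a :: comm_ring_1 ^ 'n ^ 'm) *v (c *s x) = c *s (A *v x)"
  by (simp add: vector_scalar_mult_def matrix_vector_mult_def mult_ac sum_distrib_left)

lemma matrix_vector_sum: "(A :: 'a :: comm_ring_1 ^ 'n ^ 'm) *v (\<Sum>i\<in>S. f i) = (\<Sum>i\<in>S. A *v f i)"
  by (induction S rule: infinite_finite_induct) (auto simp: matrix_vector_right_distrib)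

lemma mat_ax: "(A :: ('a :: comm_ring_1, 'n :: finite) tmat) *v ax j = column j A"
  by (simp add: matrix_vector_mult_def ax_nth vec_eq_iff column_def if_distrib cong: if_cong)

lemma mat_ax_nth: "((A :: ('a :: comm_ring_1, 'n :: finite) tmat) *v ax j) $ i = A $ i $ j"
  by (simp add: mat_ax column_def)

lemma vector_minus_smult: "- (c *s x) = (- c) *s (x :: 'a :: comm_ring_1 ^ 'n)"
  by (simp add: vec_eq_iff)

locale unitary = hermitian_form_ring R
  for R :: "'a :: comm_ring_1 hermitian_form_ring"
begin

abbreviation cj :: "'a \<Rightarrow> 'a" where "cj \<equiv> bar R"
abbreviation L :: 'a where "L \<equiv> lam R"
abbreviation m :: 'a where "m \<equiv> mu R"
abbreviation B :: "('a, 'n :: finite) tvec \<Rightarrow> ('a, 'n) tvec \<Rightarrow> 'a" where "B \<equiv> formB R"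
abbreviation Q :: "('a, 'n :: finite) tvec \<Rightarrow> 'a \<times> 'a" where "Q \<equiv> formQ R"
abbreviation \<Delta> :: "('a \<times> 'a) set" where "\<Delta> \<equiv> form_par R"

lemma L_cj_L [simp]: "L * cj L = 1" "cj L * L = 1"
  using lam_mult_bar_lam by (simp_all add: mult.commute)

lemma L_cj_L_left [simp]: "L * (cj L * x) = x" "cj L * (L * x) = x"
  by (simp_all add: mult.assoc[symmetric])

text \<open>Cancelling \<open>\<lambda>\<close> against its inverse inside products that are normalised by associativity and
  commutativity, where the two factors need not be adjacent.\<close>

lemma L_cancel [simp]:
  "L * (a * (cj L)) = a"
  "L * (a * (cj L * t)) = a * (t)"
  "L * (a * (b * (cj L))) = a * (b)"
  "L * (a * (b * (cj L * t))) = a * (b * (t))"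
  "L * (a * (b * (c * (cj L)))) = a * (b * (c))"
  "L * (a * (b * (c * (cj L * t)))) = a * (b * (c * (t)))"
  "L * (a * (b * (c * (d * (cj L))))) = a * (b * (c * (d)))"
  "L * (a * (b * (c * (d * (cj L * t))))) = a * (b * (c * (d * (t))))"
  "cj L * (a * (L)) = a"
  "cj L * (a * (L * t)) = a * (t)"
  "cj L * (a * (b * (L))) = a * (b)"
  "cj L * (a * (b * (L * t))) = a * (b * (t))"
  "cj L * (a * (b * (c * (L)))) = a * (b * (c))"
  "cj L * (a * (b * (c * (L * t)))) = a * (b * (c * (t)))"
  "cj L * (a * (b * (c * (d * (L))))) = a * (b * (c * (d)))"
  "cj L * (a * (b * (c * (d * (L * t))))) = a * (b * (c * (d * (t))))"
  by (simp_all add: mult_ac mult.left_commute[of L "cj L"] mult.left_commute[of "cj L" L])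

text \<open>Commutativity makes the anti-automorphism an honest involution.\<close>

lemma cj_cj [simp]: "cj (cj x) = x"
  using bar_bar[of x] by (simp add: mult.commute mult.left_commute)

lemma cj_add [simp]: "cj (x + y) = cj x + cj y" by (rule bar_add)
lemma cj_mult [simp]: "cj (x * y) = cj x * cj y" by (simp add: bar_mult mult.commute)
lemma cj_one [simp]: "cj 1 = 1" by (rule bar_one)
lemma cj_zero [simp]: "cj 0 = 0" using cj_add[of 0 0] by simp
lemma cj_minus [simp]: "cj (- x) = - cj x"
  using cj_add[of x "- x"] by (simp add: eq_neg_iff_add_eq_0 add.commute)
lemma cj_diff [simp]: "cj (x - y) = cj x - cj y"
  using cj_add[of x "- y"] by simp
lemma cj_sum: "cj (sum f S) = (\<Sum>i\<in>S. cj (f i))"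
  by (induction S rule: infinite_finite_induct) auto
lemma cj_m: "cj m = cj L * m"
  using mu_eq by (metis L_cj_L_left(2) mult.commute)

lemma cj_m_L: "cj m * L = m"
  using mu_eq by simp

subsection \<open>The form B\<close>

text \<open>The entry of the Gram matrix of \<open>B\<close> at the position \<open>(i, -i)\<close>.\<close>

definition be :: "'n theta \<Rightarrow> 'a" where
  "be i = (case i of PosI _ \<Rightarrow> 1 | ZeroI \<Rightarrow> m | NegI _ \<Rightarrow> L)"

lemma be_simps [simp]: "be (PosI i) = 1" "be ZeroI = m" "be (NegI i) = L"
  by (simp_all add: be_def)

lemma B_alt: "B u v = (\<Sum>i\<in>UNIV. cj (u $ i) * be i * v $ (- i))"
  unfolding formB_def sum_theta by (auto intro!: arg_cong2[where f = "(+)"] sum.cong)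

lemma be_cj_be: "i \<in> theta_hb \<Longrightarrow> be i * cj (be i) = 1"
  by (cases i) (auto simp: theta_hb_def)

lemma be_minus: "cj (be i) * L = be (- i)"
  by (cases i) (auto simp: cj_m_L)

lemma B_add_left [simp]: "B (u + u') v = B u v + B u' v"
  by (simp add: B_alt algebra_simps sum.distrib)
lemma B_add_right [simp]: "B u (v + v') = B u v + B u v'"
  by (simp add: B_alt algebra_simps sum.distrib)
lemma B_diff_left [simp]: "B (u - u') v = B u v - B u' v"
  by (simp add: B_alt algebra_simps sum_subtractf)
lemma B_diff_right [simp]: "B u (v - v') = B u v - B u v'"
  by (simp add: B_alt algebra_simps sum_subtractf)
lemma B_minus_left [simp]: "B (- u) v = - B u v"
  by (simp add: B_alt sum_negf)
lemma B_minus_right [simp]: "B u (- v) = - B u v"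
  by (simp add: B_alt sum_negf)
lemma B_smult_left [simp]: "B (c *s u) v = cj c * B u v"
  by (simp add: B_alt sum_distrib_left mult_ac)
lemma B_smult_right [simp]: "B u (c *s v) = c * B u v"
  by (simp add: B_alt sum_distrib_left mult_ac)
lemma B_zero_left [simp]: "B 0 v = 0" by (simp add: B_alt)
lemma B_zero_right [simp]: "B u 0 = 0" by (simp add: B_alt)

lemma B_sum_right: "B u (sum f S) = (\<Sum>i\<in>S. B u (f i))"
  by (induction S rule: infinite_finite_induct) auto

lemma B_flip: "B v u = cj (B u v) * L"
proof -
  have "cj (B u v) * L = (\<Sum>i\<in>UNIV. u $ i * be (- i) * cj (v $ (- i)))"
    by (simp add: B_alt cj_sum sum_distrib_right sum_distrib_left be_minus[symmetric] mult_ac)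
  also have "\<dots> = (\<Sum>i\<in>UNIV. cj (v $ i) * be i * u $ (- i))"
    by (rule sum.reindex_bij_witness[of _ uminus uminus]) (auto simp: mult_ac)
  finally show ?thesis by (simp add: B_alt)
qed

lemma B_eq_0_flip: "B u v = 0 \<Longrightarrow> B v u = 0"
  by (subst B_flip) simp

lemma B_ax_left: "B (ax i) v = be i * v $ (- i)"
proof -
  have "B (ax i) v = (\<Sum>k\<in>UNIV. if k = i then be k * v $ (- k) else 0)"
    unfolding B_alt by (rule sum.cong) (auto simp: ax_nth)
  then show ?thesis by simp
qed

lemma B_ax_right: "B v (ax i) = cj (v $ (- i)) * be (- i)"
  by (subst B_flip) (simp add: B_ax_left be_minus[symmetric] mult_ac)

lemma B_ax_ax: "B (ax i) (ax j) = (if j = - i then be i else 0)"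
  by (auto simp: B_ax_left ax_nth)

lemma nth_eq_B: "i \<in> theta_hb \<Longrightarrow> v $ i = cj (be (- i)) * B (ax (- i)) v"
proof -
  assume "i \<in> theta_hb"
  then have "cj (be (- i)) * be (- i) = 1"
    using be_cj_be[of "- i"] by (simp add: mult.commute)
  then have "cj (be (- i)) * (be (- i) * v $ i) = v $ i"
    by (simp only: mult.assoc[symmetric] mult_1_left)
  then show ?thesis by (simp add: B_ax_left)
qed

subsection \<open>The form Q\<close>

text \<open>\<open>bq\<close> polarises the second component of \<open>Q\<close>; it is not symmetric, and \<open>B_bq\<close> measures by how much.\<close>

definition bq :: "('a, 'n :: finite) tvec \<Rightarrow> ('a, 'n) tvec \<Rightarrow> 'a" where
  "bq u v = (\<Sum>i\<in>range PosI. cj (u $ i) * v $ (- i))"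

text \<open>The pairs \<open>(0, tr x)\<close> are exactly the elements of \<open>\<Delta>\<^sub>m\<^sub>i\<^sub>n\<close>.\<close>

definition tr :: "'a \<Rightarrow> 'a" where "tr x = x - cj x * L"

lemma Q_alt: "Q u = (u $ ZeroI, bq u u)"
  by (simp add: formQ_def bq_def)

lemma bq_add_left [simp]: "bq (u + u') v = bq u v + bq u' v"
  by (simp add: bq_def algebra_simps sum.distrib)
lemma bq_add_right [simp]: "bq u (v + v') = bq u v + bq u v'"
  by (simp add: bq_def algebra_simps sum.distrib)
lemma bq_diff_left [simp]: "bq (u - u') v = bq u v - bq u' v"
  by (simp add: bq_def algebra_simps sum_subtractf)
lemma bq_smult_left [simp]: "bq (c *s u) v = cj c * bq u v"
  by (simp add: bq_def sum_distrib_left mult_ac)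
lemma bq_smult_right [simp]: "bq u (c *s v) = c * bq u v"
  by (simp add: bq_def sum_distrib_left mult_ac)
lemma bq_zero_right [simp]: "bq u 0 = 0" by (simp add: bq_def)

lemma bq_ax_left: "bq (ax i) v = (case i of PosI _ \<Rightarrow> v $ (- i) | _ \<Rightarrow> 0)"
proof -
  have "bq (ax i) v = (\<Sum>k\<in>range PosI. if k = i then v $ (- k) else 0)"
    unfolding bq_def by (rule sum.cong) (auto simp: ax_nth)
  then show ?thesis by (cases i) (auto simp: sum.If_cases)
qed

lemma bq_ax_ax: "j \<noteq> - i \<Longrightarrow> bq (ax i) (ax j) = 0"
  by (auto simp: bq_ax_left split: theta.split)

text \<open>The hyperbolic part of \<open>B\<close> is the \<open>\<lambda>\<close>-hermitian closure of \<open>bq\<close>.\<close>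

lemma B_bq: "B u v = bq u v + cj (u $ ZeroI) * m * v $ ZeroI + cj (bq v u) * L"
proof -
  have "(\<Sum>i\<in>range NegI. cj (u $ i) * L * v $ (- i)) = (\<Sum>i\<in>range PosI. v $ i * cj (u $ (- i)) * L)"
    by (rule sum.reindex_bij_witness[of _ uminus uminus]) (auto simp: mult_ac)
  then show ?thesis
    by (simp add: formB_def bq_def cj_sum sum_distrib_right)
qed

lemma tr_add: "tr (x + y) = tr x + tr y" and tr_minus: "tr (- x) = - tr x"
  and tr_zero [simp]: "tr 0 = 0" and tr_diff: "tr (x - y) = tr x - tr y"
  by (simp_all add: tr_def algebra_simps)

lemma Q_smult: "Q (c *s u) = heis_act R (Q u) c"
  by (simp add: Q_alt heis_act_def mult_ac)

subsection \<open>The Heisenberg group\<close>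

definition hplus :: "'a \<times> 'a \<Rightarrow> 'a \<times> 'a \<Rightarrow> 'a \<times> 'a"  (infixl \<open>\<oplus>\<^sub>h\<close> 65) where
  "\<alpha> \<oplus>\<^sub>h \<beta> = (fst \<alpha> + fst \<beta>, snd \<alpha> + snd \<beta> - cj (fst \<alpha>) * m * fst \<beta>)"

definition hneg :: "'a \<times> 'a \<Rightarrow> 'a \<times> 'a" where
  "hneg \<alpha> = (- fst \<alpha>, - snd \<alpha> - cj (fst \<alpha>) * m * fst \<alpha>)"

abbreviation hact :: "'a \<times> 'a \<Rightarrow> 'a \<Rightarrow> 'a \<times> 'a"  (infixl \<open>\<odot>\<^sub>h\<close> 75) where "hact \<equiv> heis_act R"

lemma mult_heis: "\<alpha> \<otimes>\<^bsub>heis R\<^esub> \<beta> = \<alpha> \<oplus>\<^sub>h \<beta>"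
  by (simp add: heis_def hplus_def split: prod.split)

lemma one_heis: "\<one>\<^bsub>heis R\<^esub> = (0, 0)"
  by (simp add: heis_def)

lemma carrier_heis [simp]: "carrier (heis R) = UNIV"
  by (simp add: heis_def)

lemma hplus_assoc: "(\<alpha> \<oplus>\<^sub>h \<beta>) \<oplus>\<^sub>h \<gamma> = \<alpha> \<oplus>\<^sub>h (\<beta> \<oplus>\<^sub>h \<gamma>)"
  by (simp add: hplus_def algebra_simps)

lemma hneg_hplus [simp]: "hneg \<alpha> \<oplus>\<^sub>h \<alpha> = (0, 0)" "\<alpha> \<oplus>\<^sub>h hneg \<alpha> = (0, 0)"
  by (simp_all add: hplus_def hneg_def algebra_simps)

lemma hplus_zero [simp]: "(0, 0) \<oplus>\<^sub>h \<alpha> = \<alpha>" "\<alpha> \<oplus>\<^sub>h (0, 0) = \<alpha>"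
  by (simp_all add: hplus_def)

lemma hneg_cancel [simp]: "hneg \<alpha> \<oplus>\<^sub>h (\<alpha> \<oplus>\<^sub>h \<beta>) = \<beta>" "\<alpha> \<oplus>\<^sub>h (hneg \<alpha> \<oplus>\<^sub>h \<beta>) = \<beta>"
  by (simp_all add: hplus_assoc[symmetric])

lemma hneg_hneg [simp]: "hneg (hneg \<alpha>) = \<alpha>"
  by (simp add: hneg_def)

lemma group_heis: "group (heis R)"
  by (rule groupI) (auto simp: mult_heis one_heis hplus_assoc simp del: split_paired_Ex intro: hneg_hplus(1))

lemma inv_heis: "inv\<^bsub>heis R\<^esub> \<alpha> = hneg \<alpha>"
  by (rule group.inv_equality[OF group_heis]) (auto simp: mult_heis one_heis)

lemma heis_minus_alt: "heis_minus R \<alpha> \<beta> = \<alpha> \<oplus>\<^sub>h hneg \<beta>"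
  by (simp add: heis_minus_def mult_heis inv_heis)

lemma subgroup_heis_iff:
  "subgroup A (heis R) \<longleftrightarrow> (0, 0) \<in> A \<and> (\<forall>\<alpha>\<in>A. \<forall>\<beta>\<in>A. \<alpha> \<oplus>\<^sub>h \<beta> \<in> A) \<and> (\<forall>\<alpha>\<in>A. hneg \<alpha> \<in> A)"
  by (auto simp: subgroup_def mult_heis one_heis inv_heis)

lemma hact_hplus: "(\<alpha> \<oplus>\<^sub>h \<beta>) \<odot>\<^sub>h c = \<alpha> \<odot>\<^sub>h c \<oplus>\<^sub>h \<beta> \<odot>\<^sub>h c"
  by (simp add: hplus_def heis_act_def algebra_simps)

lemma hact_hneg: "hneg \<alpha> \<odot>\<^sub>h c = hneg (\<alpha> \<odot>\<^sub>h c)"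
  by (simp add: hneg_def heis_act_def algebra_simps)

lemma hact_hact: "\<alpha> \<odot>\<^sub>h c \<odot>\<^sub>h d = \<alpha> \<odot>\<^sub>h (c * d)"
  by (simp add: heis_act_def algebra_simps)

lemma hact_zero [simp]: "(0, 0) \<odot>\<^sub>h c = (0, 0)" "\<alpha> \<odot>\<^sub>h 0 = (0, 0)"
  by (simp_all add: heis_act_def)

lemma hact_one [simp]: "\<alpha> \<odot>\<^sub>h 1 = \<alpha>"
  by (simp add: heis_act_def)

lemma hneg_zero_pair [simp]: "hneg (0, t) = (0, - t)"
  by (simp add: hneg_def)

lemma hplus_zero_pair: "(0, t) \<oplus>\<^sub>h \<alpha> = \<alpha> \<oplus>\<^sub>h (0, t)"
  by (simp add: hplus_def)

lemma zero_pair_hplus [simp]: "(0, s) \<oplus>\<^sub>h (0, t) = (0, s + t)"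
  by (simp add: hplus_def)

lemma Delta_max_iff: "\<alpha> \<in> Delta_max R \<longleftrightarrow> cj (fst \<alpha>) * m * fst \<alpha> + snd \<alpha> + cj (snd \<alpha>) * L = 0"
  by (cases \<alpha>) (simp add: Delta_max_def)

text \<open>The action is quadratic rather than linear in the ring argument, but on \<open>\<Delta>\<^sub>m\<^sub>a\<^sub>x\<close> the defect
  lies in \<open>\<Delta>\<^sub>m\<^sub>i\<^sub>n\<close>, so that it can be controlled by ideals.\<close>

lemma hact_add:
  assumes "\<alpha> \<in> Delta_max R"
  shows "\<alpha> \<odot>\<^sub>h (c + d) = \<alpha> \<odot>\<^sub>h c \<oplus>\<^sub>h \<alpha> \<odot>\<^sub>h d \<oplus>\<^sub>h (0, tr (cj d * snd \<alpha> * c))"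
proof -
  have 1: "cj (fst \<alpha>) * m * fst \<alpha> = - snd \<alpha> - cj (snd \<alpha>) * L"
    using assms[unfolded Delta_max_iff] by (simp add: algebra_simps eq_neg_iff_add_eq_0)
  have 2: "cj (fst \<alpha> * c) * m * (fst \<alpha> * d) = cj c * d * (- snd \<alpha> - cj (snd \<alpha>) * L)"
    unfolding 1[symmetric] by (simp add: algebra_simps)
  show ?thesis
    using 2 by (simp add: hplus_def heis_act_def tr_def algebra_simps)
qed

lemma Delta_subgroup: "subgroup \<Delta> (heis R)"
  using form_par_submodule by (simp add: heis_submodule_def)

lemma Delta_hplus: "\<alpha> \<in> \<Delta> \<Longrightarrow> \<beta> \<in> \<Delta> \<Longrightarrow> \<alpha> \<oplus>\<^sub>h \<beta> \<in> \<Delta>"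
  and Delta_hneg: "\<alpha> \<in> \<Delta> \<Longrightarrow> hneg \<alpha> \<in> \<Delta>"
  and Delta_zero [simp]: "(0, 0) \<in> \<Delta>"
  using Delta_subgroup by (auto simp: subgroup_heis_iff)

lemma Delta_hact: "\<alpha> \<in> \<Delta> \<Longrightarrow> \<alpha> \<odot>\<^sub>h c \<in> \<Delta>"
  using form_par_submodule by (simp add: heis_submodule_def)

lemma Delta_tr [simp]: "(0, tr x) \<in> \<Delta>"
  using Delta_min_subset by (auto simp: Delta_min_def tr_def)

lemma Delta_DeltaMax: "\<alpha> \<in> \<Delta> \<Longrightarrow> \<alpha> \<in> Delta_max R"
  using form_par_subset by auto

lemma Delta_hplus_hneg_cancel:
  "\<alpha> \<oplus>\<^sub>h hneg \<beta> \<in> \<Delta> \<Longrightarrow> \<beta> \<in> \<Delta> \<Longrightarrow> \<alpha> \<in> \<Delta>"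
  using Delta_hplus[of "\<alpha> \<oplus>\<^sub>h hneg \<beta>" \<beta>] by (simp add: hplus_assoc)

lemma Delta_snd: "(x, y) \<in> \<Delta> \<Longrightarrow> L * cj y = - y - cj x * m * x"
  using Delta_DeltaMax[of "(x, y)"] by (simp add: Delta_max_iff algebra_simps eq_neg_iff_add_eq_0)

lemma Q_add: "Q (u + v) = Q u \<oplus>\<^sub>h Q v \<oplus>\<^sub>h (0, B u v + tr (bq v u))"
  by (simp add: Q_alt hplus_def B_bq tr_def algebra_simps)

lemma Q_zero [simp]: "Q 0 = (0, 0)"
  by (simp add: Q_alt)

lemma Q_ax [simp]: "i \<in> theta_hb \<Longrightarrow> Q (ax i) = (0, 0)"
  by (simp add: Q_alt theta_hb_iff bq_ax_ax minus_theta_neq)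

lemma Q_ax0 [simp]: "Q (ax ZeroI) = (1, 0)"
  by (simp add: Q_alt bq_ax_left)

text \<open>The value \<open>B u u\<close> measures how far \<open>Q u\<close> is from \<open>\<Delta>\<^sub>m\<^sub>a\<^sub>x\<close>.\<close>

lemma B_self: "B u u = cj (fst (Q u)) * m * fst (Q u) + snd (Q u) + cj (snd (Q u)) * L"
  by (simp add: B_bq Q_alt)

lemma B_self_eq_0: "Q u \<in> \<Delta> \<Longrightarrow> B u u = 0"
  using Delta_DeltaMax[of "Q u"] by (simp add: B_self Delta_max_iff)

end

section \<open>Transvections\<close>

context unitary
begin

lemma hneg_hplus_distrib: "hneg (\<alpha> \<oplus>\<^sub>h \<beta>) = hneg \<beta> \<oplus>\<^sub>h hneg \<alpha>"
  by (simp add: hplus_def hneg_def algebra_simps)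

abbreviation Ug :: "('a, 'n :: finite) tmat monoid" where "Ug \<equiv> unitary_group R"

lemma mult_Ug [simp]: "\<sigma> \<otimes>\<^bsub>Ug\<^esub> \<tau> = \<sigma> ** \<tau>"
  and one_Ug [simp]: "\<one>\<^bsub>Ug\<^esub> = mat 1"
  by (simp_all add: unitary_group_def)

lemma carrier_Ug: "\<sigma> \<in> carrier Ug \<longleftrightarrow> invertible \<sigma> \<and> (\<forall>u v. B (\<sigma> *v u) (\<sigma> *v v) = B u v)
    \<and> (\<forall>u. Q (\<sigma> *v u) \<oplus>\<^sub>h hneg (Q u) \<in> \<Delta>)"
  by (simp add: unitary_group_def heis_cong_def heis_minus_alt)

lemma Ug_B [simp]: "\<sigma> \<in> carrier Ug \<Longrightarrow> B (\<sigma> *v u) (\<sigma> *v v) = B u v"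
  and Ug_Q: "\<sigma> \<in> carrier Ug \<Longrightarrow> Q (\<sigma> *v u) \<oplus>\<^sub>h hneg (Q u) \<in> \<Delta>"
  by (auto simp: carrier_Ug)

lemma Ug_Q_Delta: "\<sigma> \<in> carrier Ug \<Longrightarrow> Q u \<in> \<Delta> \<Longrightarrow> Q (\<sigma> *v u) \<in> \<Delta>"
  using Ug_Q Delta_hplus_hneg_cancel by blast

lemma group_Ug: "group (Ug :: ('a, 'n :: finite) tmat monoid)"
proof (rule groupI)
  fix \<sigma> \<tau> :: "('a, 'n) tmat" assume st: "\<sigma> \<in> carrier Ug" "\<tau> \<in> carrier Ug"
  have "Q (\<sigma> *v (\<tau> *v u)) \<oplus>\<^sub>h hneg (Q u) \<in> \<Delta>" for u
    using Delta_hplus[OF Ug_Q[OF st(1), of "\<tau> *v u"] Ug_Q[OF st(2), of u]]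
    by (simp add: hplus_assoc)
  moreover have "invertible (\<sigma> ** \<tau>)"
    using st by (simp add: carrier_Ug invertible_mult)
  ultimately show "\<sigma> \<otimes>\<^bsub>Ug\<^esub> \<tau> \<in> carrier Ug"
    using st by (simp add: carrier_Ug matrix_vector_mul_assoc[symmetric])
next
  show "\<one>\<^bsub>Ug\<^esub> \<in> carrier (Ug :: ('a, 'n) tmat monoid)"
    by (auto simp: carrier_Ug invertible_def intro!: exI[of _ "mat 1"])
next
  fix \<sigma> :: "('a, 'n) tmat" assume s: "\<sigma> \<in> carrier Ug"
  then obtain \<tau> where t: "\<sigma> ** \<tau> = mat 1" "\<tau> ** \<sigma> = mat 1"
    by (auto simp: carrier_Ug invertible_def)
  have st: "\<sigma> *v (\<tau> *v u) = u" for u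
    by (simp add: matrix_vector_mul_assoc t)
  have "invertible \<tau>"
    using t by (auto simp: invertible_def)
  moreover have "B (\<tau> *v u) (\<tau> *v v) = B u v" for u v
    using Ug_B[OF s, of "\<tau> *v u" "\<tau> *v v"] by (simp add: st)
  moreover have "Q (\<tau> *v u) \<oplus>\<^sub>h hneg (Q u) \<in> \<Delta>" for u
    using Delta_hneg[OF Ug_Q[OF s, of "\<tau> *v u"]] by (simp add: st hneg_hplus_distrib)
  ultimately have "\<tau> \<in> carrier Ug"
    by (simp add: carrier_Ug)
  then show "\<exists>\<tau>\<in>carrier Ug. \<tau> \<otimes>\<^bsub>Ug\<^esub> \<sigma> = \<one>\<^bsub>Ug\<^esub>"
    using t by auto
qed (auto simp: matrix_mul_assoc)

interpretation Ug: group "Ug :: ('a, 'n :: finite) tmat monoid"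
  by (rule group_Ug)

lemma Ug_inv [simp]:
  assumes "\<sigma> \<in> carrier Ug"
  shows "\<sigma> *v (inv\<^bsub>Ug\<^esub> \<sigma> *v w) = w" "inv\<^bsub>Ug\<^esub> \<sigma> *v (\<sigma> *v w) = w"
  using Ug.r_inv[OF assms] Ug.l_inv[OF assms] by (simp_all add: matrix_vector_mul_assoc)

lemma Ug_inv_closed [simp]: "\<sigma> \<in> carrier Ug \<Longrightarrow> inv\<^bsub>Ug\<^esub> \<sigma> \<in> carrier Ug"
  by simp

lemma Ug_mult_closed [simp]: "\<sigma> \<in> carrier Ug \<Longrightarrow> \<tau> \<in> carrier Ug \<Longrightarrow> \<sigma> ** \<tau> \<in> carrier Ug"
  using Ug.m_closed by simp

lemma Ug_one_closed [simp]: "mat 1 \<in> carrier Ug"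
  using Ug.one_closed by simp

lemma Ug_B_inv: "\<sigma> \<in> carrier Ug \<Longrightarrow> B u (inv\<^bsub>Ug\<^esub> \<sigma> *v w) = B (\<sigma> *v u) w"
  by (metis Ug_B Ug_inv(1))

lemma mat_eqI: "(\<And>w. \<sigma> *v w = \<tau> *v w) \<Longrightarrow> \<sigma> = (\<tau> :: ('a, 'n :: finite) tmat)"
  by (simp add: matrix_eq)

text \<open>\<open>S v u y\<close> is the Eichler (or ESD) transvection along \<open>v\<close>. All elementary matrices are of
  this shape, and the shape is preserved by conjugation in the unitary group, so that every
  commutator needed later reduces to evaluating \<open>B\<close> on a few explicit vectors.\<close>

definition S :: "('a, 'n :: finite) tvec \<Rightarrow> ('a, 'n) tvec \<Rightarrow> 'a \<Rightarrow> ('a, 'n) tmat" where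
  "S v u y = (\<chi> i j. mat 1 $ i $ j + u $ i * B v (ax j) - v $ i * (cj L * B u (ax j))
      + v $ i * (y * B v (ax j)))"

lemma B_expand_right: "B v w = (\<Sum>j\<in>UNIV. w $ j * B v (ax j))"
  by (subst vec_expand[of w]) (simp add: B_sum_right)

lemma S_apply: "S v u y *v w = w + B v w *s u - (cj L * B u w) *s v + (y * B v w) *s v"
proof -
  have "(S v u y *v w) $ i = (w + B v w *s u - (cj L * B u w) *s v + (y * B v w) *s v) $ i" for i
  proof -
    have "(S v u y *v w) $ i = (\<Sum>j\<in>UNIV. mat 1 $ i $ j * w $ j) + u $ i * (\<Sum>j\<in>UNIV. w $ j * B v (ax j))
       - v $ i * (cj L * (\<Sum>j\<in>UNIV. w $ j * B u (ax j))) + v $ i * (y * (\<Sum>j\<in>UNIV. w $ j * B v (ax j)))"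
      by (simp add: matrix_vector_mult_def S_def algebra_simps sum.distrib sum_subtractf sum_distrib_left)
    also have "(\<Sum>j\<in>UNIV. mat 1 $ i $ j * w $ j) = (mat 1 *v w) $ i"
      by (simp add: matrix_vector_mult_def)
    finally show ?thesis
      by (simp add: B_expand_right[symmetric] mult_ac)
  qed
  then show ?thesis by (simp add: vec_eq_iff)
qed

lemma S_conj:
  assumes "\<sigma> \<in> carrier Ug"
  shows "\<sigma> ** S v u y ** inv\<^bsub>Ug\<^esub> \<sigma> = S (\<sigma> *v v) (\<sigma> *v u) y"
proof (rule mat_eqI)
  fix w
  show "\<sigma> ** S v u y ** inv\<^bsub>Ug\<^esub> \<sigma> *v w = S (\<sigma> *v v) (\<sigma> *v u) y *v w"
    using assms
    by (simp add: matrix_vector_mul_assoc[symmetric] S_apply matrix_vector_right_distrib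
        matrix_vector_mult_diff_distrib matrix_vector_smult Ug_B_inv)
qed

lemma S_comp:
  assumes "B v v = 0" "B v u = 0" "B v u' = 0"
  shows "S v u y ** S v u' y' = S v (u + u') (y + y' - cj L * B u u')"
proof (rule mat_eqI)
  fix w
  have *: "B u v = 0" "B u' v = 0"
    using assms by (simp_all add: B_eq_0_flip)
  show "S v u y ** S v u' y' *v w = S v (u + u') (y + y' - cj L * B u u') *v w"
    using assms *
    by (simp add: matrix_vector_mul_assoc[symmetric] S_apply vec_eq_iff algebra_simps)
qed

lemma S_zero: "S v 0 0 = mat 1"
  by (rule mat_eqI) (simp add: S_apply)

lemma S_uv: "S v (u + x *s v) y = S v u (y + x - cj L * cj x)"
  by (rule mat_eqI) (simp add: S_apply vec_eq_iff algebra_simps)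

lemma S_smult_left: "S (c *s v) u 0 = S v (cj c *s u) 0"
  by (rule mat_eqI) (simp add: S_apply vec_eq_iff algebra_simps)

lemma S_swap: "S v (x *s u) 0 = S u ((- (cj L * cj x)) *s v) 0"
  by (rule mat_eqI) (simp add: S_apply vec_eq_iff algebra_simps)

lemma S_add_left:
  assumes "B u u = 0" "B v v' = 0" "B v u = 0" "B v' u = 0"
  shows "S (v + v') u 0 = S v u 0 ** S v' u 0"
proof (rule mat_eqI)
  fix w
  have *: "B v' v = 0" "B u v = 0" "B u v' = 0"
    using assms by (simp_all add: B_eq_0_flip)
  show "S (v + v') u 0 *v w = S v u 0 ** S v' u 0 *v w"
    using assms *
    by (simp add: matrix_vector_mul_assoc[symmetric] S_apply vec_eq_iff algebra_simps)
qed

text \<open>\<open>Q\<close> changes by an element of \<open>\<Delta>\<close> as soon as \<open>Q v\<close> and \<open>Q u \<oplus> (0, \<lambda> y)\<close> lie in \<open>\<Delta>\<close>. The exact formula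
  is needed again later, where the error term \<open>tr\<close> has to be located in a given ideal.\<close>

lemma S_Q:
  fixes y :: 'a
  assumes "B v u = 0"
  defines "\<beta> \<equiv> \<lambda>w. B v w" and "\<gamma> \<equiv> \<lambda>w. cj L * B u w"
  defines "\<kappa> \<equiv> \<lambda>w. y * \<beta> w - \<gamma> w"
  shows "Q (S v u y *v w) = Q w \<oplus>\<^sub>h (Q u \<oplus>\<^sub>h (0, L * y)) \<odot>\<^sub>h \<beta> w \<oplus>\<^sub>h Q v \<odot>\<^sub>h \<kappa> w \<oplus>\<^sub>h
     (0, tr (bq (\<beta> w *s u + \<kappa> w *s v) w + cj (\<gamma> w) * \<beta> w + bq (\<kappa> w *s v) (\<beta> w *s u)))"
proof -
  have uv: "B u v = 0" using assms(1) by (rule B_eq_0_flip)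
  have 1: "S v u y *v w = w + (\<beta> w *s u + \<kappa> w *s v)"
    by (simp add: S_apply \<beta>_def \<gamma>_def \<kappa>_def vec_eq_iff algebra_simps)
  have wu: "B w u = cj (\<gamma> w)" by (simp add: \<gamma>_def B_flip[of w u] mult.commute)
  have wv: "B w v = cj (\<beta> w) * L" by (simp add: \<beta>_def B_flip[of w v])
  have Bw: "B w (\<beta> w *s u + \<kappa> w *s v) = cj (\<beta> w) * L * y * \<beta> w + tr (cj (\<gamma> w) * \<beta> w)"
    by (simp add: wu wv tr_def \<kappa>_def algebra_simps)
  show ?thesis
    unfolding 1 Q_add[of w] Q_add[of "\<beta> w *s u"] Bw Q_smult
    by (simp add: uv hplus_def heis_act_def tr_add algebra_simps)
qed

lemma S_inverse:
  assumes "B v v = 0" "B v u = 0"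
  shows "S v u y ** S v (- u) (- y - cj L * B u u) = mat 1"
    "S v (- u) (- y - cj L * B u u) ** S v u y = mat 1"
  using assms by (simp_all add: S_comp S_zero)

lemma S_closed:
  assumes vu: "B v u = 0" and v: "Q v \<in> \<Delta>" and u: "Q u \<oplus>\<^sub>h (0, L * y) \<in> \<Delta>"
  shows "S v u y \<in> carrier Ug"
proof -
  have vv: "B v v = 0" using v by (rule B_self_eq_0)
  have uv: "B u v = 0" using vu by (rule B_eq_0_flip)
  have uu: "B u u = - cj y - L * y"
  proof -
    have "cj (fst (Q u)) * m * fst (Q u) + (snd (Q u) + L * y) + cj (snd (Q u) + L * y) * L = 0"
      using Delta_DeltaMax[OF u] unfolding Delta_max_iff by (simp add: hplus_def)
    then show ?thesis
      by (simp add: B_self[of u] algebra_simps eq_neg_iff_add_eq_0)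
  qed
  have "invertible (S v u y)"
    using S_inverse[OF vv vu] by (auto simp: invertible_def)
  moreover have "B (S v u y *v w) (S v u y *v w') = B w w'" for w w'
  proof -
    have e: "B w u = cj (B u w) * L" "B w v = cj (B v w) * L" by (simp_all add: B_flip[of w])
    show ?thesis
      by (simp add: S_apply vv vu uv uu e algebra_simps)
  qed
  moreover have "Q (S v u y *v w) \<oplus>\<^sub>h hneg (Q w) \<in> \<Delta>" for w
  proof -
    define \<beta> where "\<beta> = B v w"
    define \<kappa> where "\<kappa> = y * B v w - cj L * B u w"
    obtain t where t: "Q (S v u y *v w) = Q w \<oplus>\<^sub>h (Q u \<oplus>\<^sub>h (0, L * y)) \<odot>\<^sub>h \<beta> \<oplus>\<^sub>h Q v \<odot>\<^sub>h \<kappa> \<oplus>\<^sub>h (0, tr t)"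
      using S_Q[OF vu, of y w] by (auto simp: \<beta>_def \<kappa>_def)
    define \<alpha> where "\<alpha> = (Q u \<oplus>\<^sub>h (0, L * y)) \<odot>\<^sub>h \<beta> \<oplus>\<^sub>h Q v \<odot>\<^sub>h \<kappa> \<oplus>\<^sub>h (0, tr t)"
    have a: "\<alpha> \<in> \<Delta>"
      unfolding \<alpha>_def by (intro Delta_hplus Delta_hact u v Delta_tr)
    define x where "x = cj (fst \<alpha>) * m * fst (Q w)"
    have "Q w \<oplus>\<^sub>h \<alpha> \<oplus>\<^sub>h hneg (Q w) = \<alpha> \<oplus>\<^sub>h (0, tr x)"
    proof -
      have "cj x * L = cj (fst (Q w)) * m * fst \<alpha>"
        by (simp add: x_def cj_m mult_ac)
      then show ?thesis
        by (simp add: hplus_def hneg_def tr_def x_def algebra_simps)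
    qed
    then have "Q w \<oplus>\<^sub>h \<alpha> \<oplus>\<^sub>h hneg (Q w) \<in> \<Delta>"
      using a by (simp add: Delta_hplus)
    then show ?thesis
      by (simp add: t \<alpha>_def hplus_assoc)
  qed
  ultimately show ?thesis by (simp add: carrier_Ug)
qed

subsection \<open>Elementary matrices\<close>

text \<open>The short root elements, in a normalisation that treats the two indices symmetrically: exchanging
  them only changes the parameter (\<open>ES_swap\<close>).\<close>

definition ES :: "'n :: finite theta \<Rightarrow> 'n theta \<Rightarrow> 'a \<Rightarrow> ('a, 'n) tmat" where
  "ES i j x = S (ax i) (x *s ax j) 0"

text \<open>The long root elements. Conjugating the second component of the parameter makes \<open>\<Delta>\<close> itself the
  parameter set for indices of both signs.\<close>

definition EL :: "'n :: finite theta \<Rightarrow> 'a \<times> 'a \<Rightarrow> ('a, 'n) tmat" where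
  "EL i \<alpha> = S (ax i) (fst \<alpha> *s ax ZeroI) (cj (snd \<alpha>))"

lemma ES_closed [simp]: "apart i j \<Longrightarrow> ES i j x \<in> carrier Ug"
  unfolding ES_def by (rule S_closed) (auto simp: Q_smult B_ax_ax apartD)

lemma Delta_conj_snd:
  assumes "\<alpha> \<in> \<Delta>"
  shows "(fst \<alpha>, L * cj (snd \<alpha>)) \<in> \<Delta>"
proof -
  have "(fst \<alpha>, L * cj (snd \<alpha>)) = hneg \<alpha> \<odot>\<^sub>h (- 1)"
    using Delta_snd[of "fst \<alpha>" "snd \<alpha>"] assms by (simp add: hneg_def heis_act_def)
  then show ?thesis using assms by (simp add: Delta_hneg Delta_hact)
qed

lemma EL_closed [simp]: "i \<in> theta_hb \<Longrightarrow> \<alpha> \<in> \<Delta> \<Longrightarrow> EL i \<alpha> \<in> carrier Ug"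
  unfolding EL_def
  by (rule S_closed) (auto simp: Q_smult heis_act_def hplus_def B_ax_ax theta_hb_iff Delta_conj_snd
      minus_theta_neq theta_minus_eq)

lemma EL_hplus:
  assumes "i \<in> theta_hb"
  shows "EL i \<alpha> ** EL i \<beta> = EL i (\<beta> \<oplus>\<^sub>h \<alpha>)"
proof -
  have "cj (cj (fst \<beta>) * m * fst \<alpha>) = cj L * (cj (fst \<alpha>) * fst \<beta> * m)"
    by (simp add: cj_m mult_ac)
  then show ?thesis
    using assms unfolding EL_def
    by (subst S_comp) (auto simp: B_ax_ax theta_hb_iff minus_theta_neq theta_minus_eq hplus_def
      vector_sadd_rdistrib[symmetric] mult_ac add.commute)
qed

lemma EL_zero [simp]: "EL i (0, 0) = mat 1"
  by (simp add: EL_def S_zero)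

lemma ES_add:
  assumes "apart i j"
  shows "ES i j x ** ES i j y = ES i j (x + y)"
  using apartD[OF assms] unfolding ES_def
  by (subst S_comp) (auto simp: B_ax_ax vector_sadd_rdistrib[symmetric])

lemma ES_zero [simp]: "ES i j 0 = mat 1"
  by (simp add: ES_def S_zero)

lemma ES_swap: "ES i j x = ES j i (- (cj L * cj x))"
  unfolding ES_def by (rule S_swap)

lemma be_cases: "i \<in> theta_hb \<Longrightarrow> be i = 1 \<or> be i = L"
  by (cases i) auto

lemma inv_ES: "apart i j \<Longrightarrow> inv\<^bsub>Ug\<^esub> (ES i j x) = ES i j (- x)"
  by (rule Ug.inv_equality) (auto simp: ES_add)

lemma inv_EL: "i \<in> theta_hb \<Longrightarrow> \<alpha> \<in> \<Delta> \<Longrightarrow> inv\<^bsub>Ug\<^esub> (EL i \<alpha>) = EL i (hneg \<alpha>)"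
  by (rule Ug.inv_equality) (auto simp: EL_hplus Delta_hneg)

lemma munit_apply: "munit x i j *v w = (x * w $ j) *s ax i"
  by (auto simp: vec_eq_iff munit_def matrix_vector_mult_def ax_nth if_distrib[of "\<lambda>z. z * _"] cong: if_cong)

lemma T_short_ES:
  assumes "i \<in> theta_hb" "j \<in> theta_hb"
  shows "T_short R i j x = ES (- j) i (x * cj (be (- j)))"
proof (rule mat_eqI)
  fix w
  have "lam_pow R ((eps j - 1) div 2) * cj x * lam_pow R ((1 - eps i) div 2)
      = cj L * cj (x * cj (be (- j))) * be i"
    using assms by (cases i; cases j) (auto simp: theta_hb_def lam_pow_def mult_ac)
  moreover have "be (- j) = 1 \<or> be (- j) = L"
    using assms by (intro be_cases) simp
  ultimately show "T_short R i j x *v w = ES (- j) i (x * cj (be (- j))) *v w"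
    by (elim disjE) (simp_all add: T_short_def ES_def S_apply matrix_vector_mult_add_rdistrib
        matrix_vector_mult_diff_rdistrib munit_apply B_ax_left vec_eq_iff algebra_simps)
qed

lemma T_long_EL:
  assumes "i \<in> theta_hb"
  shows "T_long R i (x, y) = EL i (x * cj (be i), cj y * be i)"
proof (rule mat_eqI)
  fix w
  have "lam_pow R (- (1 + eps i) div 2) = cj L * be i"
    using assms by (cases i) (auto simp: theta_hb_def lam_pow_def mult_ac)
  then show "T_long R i (x, y) *v w = EL i (x * cj (be i), cj y * be i) *v w"
    using be_cases[OF assms]
    by (elim disjE) (simp_all add: T_long_def EL_def S_apply matrix_vector_mult_add_rdistrib
        matrix_vector_mult_diff_rdistrib munit_apply B_ax_left vec_eq_iff algebra_simps)
qed

lemma par_pm_iff: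
  assumes "heis_submodule R \<Omega>" "\<Omega> \<subseteq> \<Delta>" "i \<in> theta_hb"
  shows "(x, y) \<in> par_pm R \<Omega> (- eps i) \<longleftrightarrow> (x * cj (be i), cj y * be i) \<in> \<Omega>"
proof (cases i)
  case (NegI k)
  have flip: "(a * cj L, cj b * L) \<in> \<Omega>" if "(a, b) \<in> \<Omega>" for a b
  proof -
    have "(a * cj L, cj b * L) = hneg (a, b) \<odot>\<^sub>h (- cj L)"
      using Delta_snd[of a b] that assms(2) by (auto simp: hneg_def heis_act_def mult_ac algebra_simps)
    then show ?thesis
      using assms(1) that unfolding heis_submodule_def subgroup_heis_iff by simp
  qed
  have "(x, y) \<in> \<Omega>" if h: "(x * cj L, cj y * L) \<in> \<Omega>"
  proof -
    have "(x * cj L, cj y * L) \<odot>\<^sub>h (L * L) \<in> \<Omega>"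
      using assms(1) h unfolding heis_submodule_def by blast
    then have "(x * L, cj y * L) \<in> \<Omega>"
      by (simp add: heis_act_def mult_ac)
    from flip[OF this] show ?thesis by (simp add: mult_ac)
  qed
  then show ?thesis using flip by (auto simp: par_pm_def NegI)
qed (use assms in \<open>auto simp: par_pm_def theta_hb_def\<close>)

lemma elem_gens_alt:
  assumes "heis_submodule R \<Omega>" "\<Omega> \<subseteq> \<Delta>" and I: "\<And>x r. x \<in> I \<Longrightarrow> x * r \<in> I"
  shows "elem_gens R I \<Omega> = {ES i j x |i j x. apart i j \<and> x \<in> I} \<union> {EL i \<alpha> |i \<alpha>. i \<in> theta_hb \<and> \<alpha> \<in> \<Omega>}"
  unfolding elem_gens_def
proof (rule arg_cong2[where f = "(\<union>)"])
  show "{T_short R i j x |i j x. i \<in> theta_hb \<and> j \<in> theta_hb \<and> i \<noteq> j \<and> i \<noteq> - j \<and> x \<in> I}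
      = {ES i j x |i j x. apart i j \<and> x \<in> I}" (is "?l = ?r")
  proof (intro equalityI subsetI)
    fix g assume "g \<in> ?l"
    then obtain i j x where "g = T_short R i j x" "apart i j" "x \<in> I"
      by (auto simp: apart_def)
    then have "g = ES (- j) i (x * cj (be (- j)))" "apart (- j) i" "x * cj (be (- j)) \<in> I"
      using I by (auto simp: T_short_ES apart_def theta_minus_eq)
    then show "g \<in> ?r" by blast
  next
    fix g assume "g \<in> ?r"
    then obtain i j x where g: "g = ES i j x" "apart i j" "x \<in> I" by blast
    then have "g = T_short R j (- i) (x * be i)"
      using be_cj_be[of i] by (simp add: T_short_ES apartD mult.assoc)
    moreover have "x * be i \<in> I" using g I by blast
    ultimately show "g \<in> ?l"
      using apartD[OF g(2)] by fastforce
  qed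
next
  show "{T_long R i \<alpha> |i \<alpha>. i \<in> theta_hb \<and> \<alpha> \<in> par_pm R \<Omega> (- eps i)}
      = {EL i \<alpha> |i \<alpha>. i \<in> theta_hb \<and> \<alpha> \<in> \<Omega>}" (is "?l = ?r")
  proof (intro equalityI subsetI)
    fix g assume "g \<in> ?l"
    then show "g \<in> ?r"
      using par_pm_iff[OF assms(1,2)] by (force simp: T_long_EL)
  next
    fix g assume "g \<in> ?r"
    then obtain i x y where g: "g = EL i (x, y)" "i \<in> theta_hb" "(x, y) \<in> \<Omega>" by auto
    define x' y' where "x' = x * be i" and "y' = cj y * be i"
    have 1: "x' * cj (be i) = x" "cj y' * be i = y"
      using be_cases[OF g(2)] by (auto simp: x'_def y'_def mult_ac)
    then have "(x', y') \<in> par_pm R \<Omega> (- eps i)" "g = T_long R i (x', y')"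
      using par_pm_iff[OF assms(1,2) g(2), of x' y'] g by (auto simp: T_long_EL)
    then show "g \<in> ?l" using g(2) by blast
  qed
qed

end

section \<open>Commutators modulo a subgroup, inside its normaliser\<close>

text \<open>The normaliser, with both inclusions spelled out because \<open>H\<close> may be infinite.\<close>

definition nmz :: "('g, 'm) monoid_scheme \<Rightarrow> 'g set \<Rightarrow> 'g set" where
  "nmz G H = {g \<in> carrier G. \<forall>h\<in>H. g \<otimes>\<^bsub>G\<^esub> h \<otimes>\<^bsub>G\<^esub> inv\<^bsub>G\<^esub> g \<in> H \<and> inv\<^bsub>G\<^esub> g \<otimes>\<^bsub>G\<^esub> h \<otimes>\<^bsub>G\<^esub> g \<in> H}"

definition com :: "('g, 'm) monoid_scheme \<Rightarrow> 'g \<Rightarrow> 'g \<Rightarrow> 'g" where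
  "com G x y = x \<otimes>\<^bsub>G\<^esub> y \<otimes>\<^bsub>G\<^esub> inv\<^bsub>G\<^esub> x \<otimes>\<^bsub>G\<^esub> inv\<^bsub>G\<^esub> y"

text \<open>Equality in the quotient of the normaliser of \<open>H\<close> by \<open>H\<close>.\<close>

definition cng :: "('g, 'm) monoid_scheme \<Rightarrow> 'g set \<Rightarrow> 'g \<Rightarrow> 'g \<Rightarrow> bool" where
  "cng G H x y \<longleftrightarrow> x \<in> nmz G H \<and> y \<in> nmz G H \<and> x \<otimes>\<^bsub>G\<^esub> inv\<^bsub>G\<^esub> y \<in> H"

context group
begin

lemma cancel_left [simp]:
  assumes "x \<in> carrier G" "y \<in> carrier G"
  shows "x \<otimes> (inv x \<otimes> y) = y" "inv x \<otimes> (x \<otimes> y) = y"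
  using assms by (simp_all add: m_assoc[symmetric])

lemma nmz_carrier: "g \<in> nmz G H \<Longrightarrow> g \<in> carrier G"
  by (simp add: nmz_def)

lemma nmz_conj: "g \<in> nmz G H \<Longrightarrow> h \<in> H \<Longrightarrow> g \<otimes> h \<otimes> inv g \<in> H"
  by (simp add: nmz_def)

lemma com_closed: "x \<in> carrier G \<Longrightarrow> y \<in> carrier G \<Longrightarrow> com G x y \<in> carrier G"
  by (simp add: com_def)

context
  fixes H assumes H: "subgroup H G"
begin

lemma H_carrier: "h \<in> H \<Longrightarrow> h \<in> carrier G"
  using H by (simp add: subgroup.mem_carrier)

lemma subgroup_nmz: "subgroup (nmz G H) G"
proof (rule subgroupI)
  show "nmz G H \<noteq> {}"
    using H_carrier by (auto simp: nmz_def intro!: exI[of _ \<one>])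
next
  fix a assume "a \<in> nmz G H"
  then show "inv a \<in> nmz G H" by (auto simp: nmz_def)
next
  fix a b assume a: "a \<in> nmz G H" and b: "b \<in> nmz G H"
  then have c: "a \<in> carrier G" "b \<in> carrier G" by (auto simp: nmz_def)
  show "a \<otimes> b \<in> nmz G H"
    unfolding nmz_def
  proof (intro CollectI conjI ballI)
    fix h assume h: "h \<in> H"
    then have "a \<otimes> (b \<otimes> h \<otimes> inv b) \<otimes> inv a \<in> H" "inv b \<otimes> (inv a \<otimes> h \<otimes> a) \<otimes> b \<in> H"
      using a b by (auto simp: nmz_def)
    then show "a \<otimes> b \<otimes> h \<otimes> inv (a \<otimes> b) \<in> H" "inv (a \<otimes> b) \<otimes> h \<otimes> (a \<otimes> b) \<in> H"
      using c H_carrier[OF h] by (simp_all add: inv_mult_group m_assoc)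
  qed (use c in auto)
qed (auto simp: nmz_def)

lemma H_nmz: "h \<in> H \<Longrightarrow> h \<in> nmz G H"
  using H H_carrier by (auto simp: nmz_def subgroup.m_closed subgroup.m_inv_closed)

lemma nmz_mult: "x \<in> nmz G H \<Longrightarrow> y \<in> nmz G H \<Longrightarrow> x \<otimes> y \<in> nmz G H"
  and nmz_inv: "x \<in> nmz G H \<Longrightarrow> inv x \<in> nmz G H"
  using subgroup_nmz by (auto simp: subgroup.m_closed subgroup.m_inv_closed)

lemma com_nmz: "x \<in> nmz G H \<Longrightarrow> y \<in> nmz G H \<Longrightarrow> com G x y \<in> nmz G H"
  by (simp add: com_def nmz_mult nmz_inv)

lemma com_H:
  assumes "g \<in> nmz G H" "h \<in> H"
  shows "com G g h \<in> H"
  unfolding com_def using assms H by (simp add: nmz_conj subgroup.m_closed subgroup.m_inv_closed)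

lemma com_H':
  assumes "g \<in> nmz G H" "h \<in> H"
  shows "com G h g \<in> H"
proof -
  have "com G h g = h \<otimes> (g \<otimes> inv h \<otimes> inv g)"
    using assms H_carrier nmz_carrier by (simp add: com_def m_assoc)
  then show ?thesis
    using assms H by (simp add: nmz_conj subgroup.m_closed subgroup.m_inv_closed)
qed

lemma cngD:
  assumes "cng G H x y"
  obtains h where "h \<in> H" "x = h \<otimes> y" "y \<in> nmz G H"
proof
  show "x \<otimes> inv y \<in> H" "y \<in> nmz G H" using assms by (auto simp: cng_def)
  show "x = x \<otimes> inv y \<otimes> y"
    using assms by (simp add: cng_def nmz_carrier[of _ H] m_assoc)
qed

lemma cngI:
  assumes "h \<in> H" "y \<in> nmz G H"
  shows "cng G H (h \<otimes> y) y"
  using assms H_carrier nmz_carrier by (simp add: cng_def m_assoc nmz_mult H_nmz)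

lemma cng_refl: "x \<in> nmz G H \<Longrightarrow> cng G H x x"
  using H by (simp add: cng_def nmz_carrier[of _ H] subgroup.one_closed)

lemma cng_sym:
  assumes "cng G H x y" shows "cng G H y x"
proof -
  have "inv (x \<otimes> inv y) \<in> H"
    using assms H by (simp add: cng_def subgroup.m_inv_closed)
  then show ?thesis
    using assms by (simp add: cng_def nmz_carrier[of _ H] inv_mult_group)
qed

lemma cng_trans:
  assumes "cng G H x y" "cng G H y z" shows "cng G H x z"
proof -
  have "(x \<otimes> inv y) \<otimes> (y \<otimes> inv z) \<in> H"
    using assms H by (simp add: cng_def subgroup.m_closed)
  then show ?thesis
    using assms by (simp add: cng_def nmz_carrier[of _ H] m_assoc)
qed

lemma cng_com:
  assumes xy: "cng G H x y" and s: "s \<in> nmz G H"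
  shows "cng G H (com G x s) (com G y s)"
proof -
  obtain h where h: "h \<in> H" "x = h \<otimes> y" "y \<in> nmz G H"
    using xy by (rule cngD)
  have c: "h \<in> carrier G" "y \<in> carrier G" "s \<in> carrier G"
    using h s H_carrier nmz_carrier by auto
  define c' where "c' = com G y s"
  have c': "c' \<in> nmz G H" "c' \<in> carrier G"
    unfolding c'_def using h s by (auto simp: com_nmz intro: nmz_carrier com_nmz)
  have "com G x s = (h \<otimes> (c' \<otimes> (s \<otimes> inv h \<otimes> inv s) \<otimes> inv c')) \<otimes> c'"
    using c c'(2) by (simp add: h(2) c'_def com_def m_assoc inv_mult_group)
  moreover have "h \<otimes> (c' \<otimes> (s \<otimes> inv h \<otimes> inv s) \<otimes> inv c') \<in> H"
    using h(1) c'(1) s H by (simp add: nmz_conj subgroup.m_closed subgroup.m_inv_closed)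
  ultimately show ?thesis
    using cngI c'(1) by (simp add: c'_def)
qed

lemma cng_H: "cng G H x y \<Longrightarrow> y \<in> H \<Longrightarrow> x \<in> H"
  using H by (metis cngD subgroup.m_closed)

lemma cng_conj:
  assumes "\<sigma> \<in> H" "\<tau> \<in> nmz G H"
  shows "cng G H (\<sigma> \<otimes> \<tau> \<otimes> inv \<sigma>) \<tau>"
proof -
  have "\<sigma> \<otimes> \<tau> \<otimes> inv \<sigma> = com G \<sigma> \<tau> \<otimes> \<tau>"
    using assms H_carrier nmz_carrier by (simp add: com_def m_assoc)
  then show ?thesis
    using cngI[OF com_H'[OF assms(2,1)] assms(2)] by simp
qed

lemma cng_mult_right:
  assumes "x \<in> nmz G H" "h \<in> H"
  shows "cng G H (x \<otimes> h) x"
proof -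
  have "x \<otimes> h = (x \<otimes> h \<otimes> inv x) \<otimes> x"
    using assms H_carrier nmz_carrier by (simp add: m_assoc)
  then show ?thesis
    using cngI[of "x \<otimes> h \<otimes> inv x" x] assms by (simp add: nmz_conj)
qed

text \<open>The engine of all extractions: a conjugate \<open>\<sigma> \<tau> \<sigma>\<^sup>-\<^sup>1\<close> agrees with \<open>\<tau>\<close> modulo \<open>H\<close>, so iterated
  commutators of the two agree modulo \<open>H\<close> as well. If those of the conjugate die for geometric
  reasons, those of \<open>\<tau>\<close> fall into \<open>H\<close>.\<close>

lemma extraction_principle:
  assumes "\<sigma> \<in> H" "\<tau> \<in> nmz G H" "t \<in> nmz G H" "s \<in> nmz G H" "D \<in> nmz G H"
    and triv: "com G (com G (com G (\<sigma> \<otimes> \<tau> \<otimes> inv \<sigma>) t) s) D = \<one>"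
    and x: "com G (com G \<tau> t) s = x \<otimes> h" "h \<in> H" "x \<in> nmz G H"
  shows "com G x D \<in> H"
proof -
  have "cng G H (com G (com G (\<sigma> \<otimes> \<tau> \<otimes> inv \<sigma>) t) s) (com G (com G \<tau> t) s)"
    by (intro cng_com cng_conj assms)
  moreover have "cng G H (com G (com G \<tau> t) s) x"
    unfolding x(1) by (rule cng_mult_right[OF x(3,2)])
  ultimately have "cng G H x (com G (com G (\<sigma> \<otimes> \<tau> \<otimes> inv \<sigma>) t) s)"
    by (rule cng_sym[OF cng_trans])
  from cng_com[OF this assms(5)] have "cng G H (com G x D) \<one>"
    by (simp add: triv)
  then show ?thesis
    using H cng_H subgroup.one_closed by blast
qed

end

end

section \<open>Ideals of the base ring and their powers\<close>

lemma ring_of_type_algebra_simps [simp]: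
  "carrier (ring_of_type_algebra :: 'a :: comm_ring_1 ring) = UNIV"
  "x \<otimes>\<^bsub>ring_of_type_algebra\<^esub> y = x * y"
  "x \<oplus>\<^bsub>ring_of_type_algebra\<^esub> y = x + y"
  "\<zero>\<^bsub>(ring_of_type_algebra :: 'a ring)\<^esub> = 0"
  "\<one>\<^bsub>(ring_of_type_algebra :: 'a ring)\<^esub> = 1"
  by (simp_all add: ring_of_type_algebra_def)

lemma ideal_type_iff:
  "ideal I (ring_of_type_algebra :: 'a :: comm_ring_1 ring)
    \<longleftrightarrow> 0 \<in> I \<and> (\<forall>x\<in>I. \<forall>y\<in>I. x + y \<in> I) \<and> (\<forall>x\<in>I. \<forall>r. x * r \<in> I)" (is "?l \<longleftrightarrow> ?r")
proof
  assume ?l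
  then interpret ideal I "ring_of_type_algebra :: 'a ring" .
  show ?r
    using additive_subgroup.zero_closed[OF is_additive_subgroup]
      additive_subgroup.a_closed[OF is_additive_subgroup] I_r_closed by force
next
  assume r: ?r
  interpret cring "ring_of_type_algebra :: 'a ring" by (rule cring_from_type_algebra)
  show ?l
  proof (rule idealI)
    show "ring (ring_of_type_algebra :: 'a ring)" by (rule ring_axioms)
    show "subgroup I (add_monoid (ring_of_type_algebra :: 'a ring))"
    proof (rule subgroup.intro)
      fix x assume x: "x \<in> I"
      then have "x * (- 1) \<in> I" using r by blast
      moreover have "inv\<^bsub>add_monoid (ring_of_type_algebra :: 'a ring)\<^esub> x = - x"
        using minus_equality[of "- x" x] by (simp add: a_inv_def)
      ultimately show "inv\<^bsub>add_monoid (ring_of_type_algebra :: 'a ring)\<^esub> x \<in> I" by simp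
    qed (use r in auto)
  qed (use r in \<open>auto simp: mult.commute\<close>)
qed

lemma ideal_type_minus:
  "ideal I (ring_of_type_algebra :: 'a :: comm_ring_1 ring) \<Longrightarrow> x \<in> I \<Longrightarrow> - x \<in> I"
  unfolding ideal_type_iff by (metis mult_minus1_right)

lemma ideal_type_diff:
  "ideal I (ring_of_type_algebra :: 'a :: comm_ring_1 ring) \<Longrightarrow> x \<in> I \<Longrightarrow> y \<in> I \<Longrightarrow> x - y \<in> I"
  using ideal_type_minus[of I y] unfolding ideal_type_iff by (metis diff_conv_add_uminus)

lemma ideal_prod_type:
  assumes "ideal I (ring_of_type_algebra :: 'a :: comm_ring_1 ring)" "ideal J ring_of_type_algebra"
  shows "ideal (ideal_prod ring_of_type_algebra I J) ring_of_type_algebra"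
  using ring.ideal_prod_is_ideal[OF ring_from_type_algebra] assms by blast

lemma ideal_prod_type_induct [consumes 1, case_names mult add]:
  assumes "z \<in> ideal_prod (ring_of_type_algebra :: 'a :: comm_ring_1 ring) I J"
    and "\<And>x y. x \<in> I \<Longrightarrow> y \<in> J \<Longrightarrow> P (x * y)"
    and "\<And>x y. P x \<Longrightarrow> P y \<Longrightarrow> P (x + y)"
  shows "P z"
  using assms by (induction z rule: ideal_prod.induct) auto

lemma ideal_pow_0 [simp]: "ideal_pow (I :: 'a :: comm_ring_1 set) 0 = UNIV"
  by (simp add: ideal_pow_def ideals_set_def nat_pow_def)

lemma ideal_pow_Suc:
  "ideal_pow (I :: 'a :: comm_ring_1 set) (Suc k) = ideal_prod ring_of_type_algebra (ideal_pow I k) I"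
  by (simp add: ideal_pow_def ideals_set_def nat_pow_def)

lemma ideal_ideal_pow:
  assumes "ideal I (ring_of_type_algebra :: 'a :: comm_ring_1 ring)"
  shows "ideal (ideal_pow I k) ring_of_type_algebra"
  by (induction k) (use assms in \<open>auto intro: ideal_prod_type simp: ideal_pow_Suc ideal_type_iff[of UNIV]\<close>)

lemma ideal_pow_mult:
  assumes "ideal I (ring_of_type_algebra :: 'a :: comm_ring_1 ring)" "x \<in> ideal_pow I k" "y \<in> ideal_pow I l"
  shows "x * y \<in> ideal_pow I (k + l)"
  using assms(3)
proof (induction l arbitrary: y)
  case 0
  then show ?case using ideal_ideal_pow[OF assms(1), of k] assms(2) by (simp add: ideal_type_iff)
next
  case (Suc l)
  from Suc.prems have "y \<in> ideal_prod ring_of_type_algebra (ideal_pow I l) I" by (simp add: ideal_pow_Suc)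
  then show ?case
  proof (induction rule: ideal_prod_type_induct)
    case (mult a b)
    have "(x * a) * b \<in> ideal_pow I (Suc (k + l))"
      using ideal_prod.prod[of "x * a" "ideal_pow I (k + l)" b I ring_of_type_algebra] Suc.IH[OF mult(1)] mult(2)
      by (simp add: ideal_pow_Suc)
    then show ?case by (simp add: mult.assoc)
  next
    case (add a b)
    then show ?case
      using ideal_ideal_pow[OF assms(1), of "k + Suc l"] by (simp add: ideal_type_iff distrib_left)
  qed
qed

lemma ideal_pow_mono:
  assumes "ideal I (ring_of_type_algebra :: 'a :: comm_ring_1 ring)" "k \<le> l"
  shows "ideal_pow I l \<subseteq> ideal_pow I k"
  using assms(2)
proof (induction rule: dec_induct)
  case (step l)
  have "z \<in> ideal_pow I l" if "z \<in> ideal_prod ring_of_type_algebra (ideal_pow I l) I" for z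
    using that ideal_ideal_pow[OF assms(1), of l]
    by (induction rule: ideal_prod_type_induct) (auto simp: ideal_type_iff)
  with step show ?case by (auto simp: ideal_pow_Suc)
qed simp

section \<open>Subgroups normalised by a relative elementary group\<close>

context unitary
begin

interpretation Ug: group "Ug :: ('a, 'n :: finite) tmat monoid"
  by (rule group_Ug)

lemma elem_gens_form_par:
  "elem_gens R UNIV \<Delta> = {ES i j x |i j x. apart i j} \<union> {EL i \<alpha> |i \<alpha>. i \<in> theta_hb \<and> \<alpha> \<in> \<Delta>}"
  using elem_gens_alt[OF form_par_submodule subset_refl, of UNIV] by simp

lemma subgroup_EU: "subgroup (EU R) (Ug :: ('a, 'n :: finite) tmat monoid)"
  unfolding EU_def by (rule Ug.generate_is_subgroup) (auto simp: elem_gens_form_par)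

lemma EU_closed [simp]: "\<epsilon> \<in> EU R \<Longrightarrow> \<epsilon> \<in> carrier Ug"
  by (rule subgroup.mem_carrier[OF subgroup_EU])

lemma EU_mult: "\<epsilon> \<in> EU R \<Longrightarrow> \<epsilon>' \<in> EU R \<Longrightarrow> \<epsilon> ** \<epsilon>' \<in> EU R"
  using subgroup.m_closed[OF subgroup_EU] by simp

lemma EU_inv: "\<epsilon> \<in> EU R \<Longrightarrow> inv\<^bsub>Ug\<^esub> \<epsilon> \<in> EU R"
  by (rule subgroup.m_inv_closed[OF subgroup_EU])

lemma inv_Ug_one [simp]: "inv\<^bsub>Ug\<^esub> (mat 1 :: ('a, 'n :: finite) tmat) = mat 1"
  using Ug.inv_one by simp

lemma EU_one: "mat 1 \<in> EU R"
  using subgroup.one_closed[OF subgroup_EU] by simp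

lemma ES_EU: "apart i j \<Longrightarrow> ES i j x \<in> EU R"
  unfolding EU_def elem_gens_form_par by (rule generate.incl) blast

lemma EL_EU: "i \<in> theta_hb \<Longrightarrow> \<alpha> \<in> \<Delta> \<Longrightarrow> EL i \<alpha> \<in> EU R"
  unfolding EU_def elem_gens_form_par by (rule generate.incl) blast

subsection \<open>Commutator formulas\<close>

lemma inv_S:
  assumes "S v u y \<in> carrier Ug" "B v v = 0" "B v u = 0"
  shows "inv\<^bsub>Ug\<^esub> (S v u y) = S v (- u) (- y - cj L * B u u)"
proof -
  define S' where "S' = S v (- u) (- y - cj L * B u u)"
  have "inv\<^bsub>Ug\<^esub> (S v u y) *v w = S' *v w" for w
  proof -
    have "S v u y *v (S' *v w) = w"
      using S_inverse(1)[OF assms(2,3), of y] by (simp add: S'_def matrix_vector_mul_assoc)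
    then show ?thesis by (metis Ug_inv(2)[OF assms(1)])
  qed
  then show ?thesis unfolding S'_def by (rule mat_eqI)
qed

lemma com_S:
  assumes g: "g \<in> carrier Ug" and S: "S v u y \<in> carrier Ug"
  shows "com Ug g (S v u y) = S (g *v v) (g *v u) y ** inv\<^bsub>Ug\<^esub> (S v u y)"
  using S_conj[OF g, of v u y] by (simp add: com_def)

text \<open>If \<open>g\<close> fixes \<open>v\<close>, the conjugate is again a transvection along \<open>v\<close>, and these form a group.\<close>

lemma com_S_fix:
  assumes g: "g \<in> carrier Ug" and S: "S v u y \<in> carrier Ug" and "B v v = 0" "B v u = 0"
    and fixd: "g *v v = v"
  shows "com Ug g (S v u y) = S v (g *v u - u) (cj L * B (g *v u - u) u)"
    "B v (g *v u - u) = 0"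
proof -
  have vgu: "B v (g *v u) = 0"
    using Ug_B[OF g, of v u] assms(4) by (simp add: fixd)
  show "B v (g *v u - u) = 0" using vgu assms(4) by simp
  show "com Ug g (S v u y) = S v (g *v u - u) (cj L * B (g *v u - u) u)"
    unfolding com_S[OF g S] inv_S[OF S assms(3,4)] fixd
    using S_comp[of v "g *v u" "- u" y "- y - cj L * B u u"] assms(3,4) vgu
    by (simp add: algebra_simps)
qed

lemma com_inverse:
  assumes "x \<in> carrier Ug" "y \<in> carrier Ug"
  shows "inv\<^bsub>Ug\<^esub> (com Ug x y) = com Ug y x"
  using assms unfolding com_def by (simp add: Ug.inv_mult_group Ug.m_assoc del: mult_Ug)

lemma ES_apply: "ES i j x *v w = w + (x * B (ax i) w) *s ax j - (cj L * cj x * B (ax j) w) *s ax i"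
  by (simp add: ES_def S_apply vec_eq_iff mult_ac)

lemma EL_apply: "EL i \<alpha> *v w = w + (fst \<alpha> * B (ax i) w) *s ax ZeroI
    - (cj L * cj (fst \<alpha>) * B (ax ZeroI) w) *s ax i + (cj (snd \<alpha>) * B (ax i) w) *s ax i"
  by (simp add: EL_def S_apply vec_eq_iff mult_ac)

text \<open>The Chevalley commutator formula for two short roots whose sum is short.\<close>

lemma com_ES:
  assumes "apart i j" "apart j k" "apart i k"
  shows "com Ug (ES (- j) k y) (ES i j x) = ES i k (be (- j) * y * x)"
proof -
  note d = apartD[OF assms(1)] apartD[OF assms(2)] apartD[OF assms(3)]
  let ?D = "ES (- j) k y"
  have D: "?D *v ax i = ax i" "?D *v (x *s ax j) = x *s ax j + (be (- j) * y * x) *s ax k"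
    using d by (simp_all add: ES_apply B_ax_ax vec_eq_iff mult_ac)
  have "com Ug ?D (S (ax i) (x *s ax j) 0)
      = S (ax i) (?D *v (x *s ax j) - x *s ax j) (cj L * B (?D *v (x *s ax j) - x *s ax j) (x *s ax j))"
  proof (rule com_S_fix(1))
    show "?D \<in> carrier Ug" using assms apart_sym[of i j] by simp
    show "S (ax i) (x *s ax j) 0 \<in> carrier Ug" using ES_closed[OF assms(1), of x] by (simp add: ES_def)
  qed (use d D in \<open>simp_all add: B_ax_ax\<close>)
  also have "\<dots> = S (ax i) ((be (- j) * y * x) *s ax k) 0"
    unfolding D using d by (simp add: B_ax_ax)
  finally show ?thesis by (simp add: ES_def[of i])
qed

lemma EL_tr: "EL i (0, tr (- (L * f))) = S (ax i) (f *s ax i) 0"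
  using S_uv[of "ax i" 0 f 0] by (simp add: EL_def tr_def mult_ac)

text \<open>Two short roots may add up to a long one, with a parameter in \<open>\<Delta>\<^sub>m\<^sub>i\<^sub>n\<close>.\<close>

lemma com_ES_long:
  assumes "apart i j"
  shows "com Ug (ES (- j) i y) (ES i j x) = EL i (0, tr (- (L * (be (- j) * y * x))))"
proof -
  note d = apartD[OF assms(1)]
  let ?D = "ES (- j) i y"
  have D: "?D *v ax i = ax i" "?D *v (x *s ax j) = x *s ax j + (be (- j) * y * x) *s ax i"
    using d by (simp_all add: ES_apply B_ax_ax vec_eq_iff mult_ac)
  have "com Ug ?D (S (ax i) (x *s ax j) 0)
      = S (ax i) (?D *v (x *s ax j) - x *s ax j) (cj L * B (?D *v (x *s ax j) - x *s ax j) (x *s ax j))"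
  proof (rule com_S_fix(1))
    show "?D \<in> carrier Ug" using assms apart_sym[of i j] by simp
    show "S (ax i) (x *s ax j) 0 \<in> carrier Ug" using ES_closed[OF assms(1), of x] by (simp add: ES_def)
  qed (use d D in \<open>simp_all add: B_ax_ax\<close>)
  also have "\<dots> = S (ax i) ((be (- j) * y * x) *s ax i) 0"
    unfolding D using d by (simp add: B_ax_ax)
  finally show ?thesis by (simp add: ES_def[of i j] EL_tr)
qed

text \<open>Inside a totally isotropic coordinate space every transvection along a basis vector splits into
  elementary matrices; the component along the vector itself becomes a long root element.\<close>

lemma S_ax_decomp:
  assumes "apart i j" "apart i k" "apart j k"
  shows "S (ax i) (f *s ax i + g *s ax j + h *s ax k) 0 = ES i j g ** ES i k h ** EL i (0, tr (- (L * f)))"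
proof -
  note d = apartD[OF assms(1)] apartD[OF assms(2)] apartD[OF assms(3)]
  have "ES i j g ** ES i k h = S (ax i) (g *s ax j + h *s ax k) 0"
    unfolding ES_def using d by (subst S_comp) (auto simp: B_ax_ax)
  moreover have "\<dots> ** EL i (0, tr (- (L * f))) = S (ax i) (g *s ax j + h *s ax k + f *s ax i) 0"
    unfolding EL_tr using d by (subst S_comp) (auto simp: B_ax_ax)
  ultimately show ?thesis by (simp add: add_ac)
qed

lemma S_plane:
  assumes "apart i j" "apart i k" "apart j k"
    and u: "u = f *s ax i + g *s ax j + h *s ax k"
  shows "S (p *s ax i + q *s ax k) u 0 = S (ax i) (cj p *s u) 0 ** S (ax k) (cj q *s u) 0"
proof -
  note d = apartD[OF assms(1)] apartD[OF assms(2)] apartD[OF assms(3)]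
  show ?thesis
    unfolding S_smult_left[symmetric] using d u by (subst S_add_left) (auto simp: B_ax_ax)
qed

subsection \<open>Base change in one coordinate\<close>

text \<open>\<open>trv c b x\<close> adds \<open>x\<close> times the basis vector \<open>b\<close> to the basis vector \<open>c\<close>; \<open>trl c (y, z)\<close> adds to
  \<open>c\<close> the multiple \<open>y\<close> of the basis vector \<open>0\<close> and a compensating multiple of the opposite vector.
  Conjugating by them moves the entries of a matrix into one another.\<close>

definition trv :: "'n :: finite theta \<Rightarrow> 'n theta \<Rightarrow> 'a \<Rightarrow> ('a, 'n) tmat" where
  "trv c b x = ES (- c) b (cj (be (- c)) * x)"

definition trl :: "'n :: finite theta \<Rightarrow> 'a \<times> 'a \<Rightarrow> ('a, 'n) tmat" where
  "trl c \<alpha> = EL (- c) (\<alpha> \<odot>\<^sub>h cj (be (- c)))"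

lemma trv_EU: "apart c b \<Longrightarrow> trv c b x \<in> EU R"
  by (simp add: trv_def ES_EU)

lemma trl_EU: "c \<in> theta_hb \<Longrightarrow> \<alpha> \<in> \<Delta> \<Longrightarrow> trl c \<alpha> \<in> EU R"
  by (simp add: trl_def EL_EU Delta_hact)

lemma trv_ax:
  assumes "apart c b"
  shows "trv c b x *v ax c = ax c + x *s ax b"
    "k \<noteq> c \<Longrightarrow> k \<noteq> - b \<Longrightarrow> trv c b x *v ax k = ax k"
    "trv c b x *v ax (- b) = ax (- b) - (cj L * be (- c) * be b * cj x) *s ax (- c)"
proof -
  note d = apartD[OF assms]
  have be: "be (- c) = 1 \<or> be (- c) = L" using d by (intro be_cases) simp
  show "trv c b x *v ax c = ax c + x *s ax b"
    using d be by (auto simp: trv_def ES_apply B_ax_ax mult_ac)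
  show "k \<noteq> c \<Longrightarrow> k \<noteq> - b \<Longrightarrow> trv c b x *v ax k = ax k"
    using d by (auto simp: trv_def ES_apply B_ax_ax theta_minus_eq)
  show "trv c b x *v ax (- b) = ax (- b) - (cj L * be (- c) * be b * cj x) *s ax (- c)"
    using d be by (auto simp: trv_def ES_apply B_ax_ax theta_minus_eq mult_ac)
qed

lemma trl_ax:
  assumes "c \<in> theta_hb"
  shows "trl c \<alpha> *v ax c = ax c + fst \<alpha> *s ax ZeroI + (be (- c) * cj (snd \<alpha>)) *s ax (- c)"
    "k \<noteq> c \<Longrightarrow> k \<noteq> ZeroI \<Longrightarrow> trl c \<alpha> *v ax k = ax k"
    "trl c \<alpha> *v ax ZeroI = ax ZeroI - (cj L * be (- c) * cj (fst \<alpha>) * m) *s ax (- c)"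
proof -
  have be: "be (- c) = 1 \<or> be (- c) = L" using assms by (intro be_cases) simp
  have c: "c \<noteq> ZeroI" "- c \<noteq> c" "c \<noteq> - c" using assms by (auto simp: theta_hb_iff minus_theta_neq theta_minus_eq)
  show "trl c \<alpha> *v ax c = ax c + fst \<alpha> *s ax ZeroI + (be (- c) * cj (snd \<alpha>)) *s ax (- c)"
    using c be by (auto simp: trl_def EL_apply B_ax_ax heis_act_def mult_ac)
  show "k \<noteq> c \<Longrightarrow> k \<noteq> ZeroI \<Longrightarrow> trl c \<alpha> *v ax k = ax k"
    using c by (auto simp: trl_def EL_apply B_ax_ax theta_minus_eq)
  show "trl c \<alpha> *v ax ZeroI = ax ZeroI - (cj L * be (- c) * cj (fst \<alpha>) * m) *s ax (- c)"
    using c be by (auto simp: trl_def EL_apply B_ax_ax heis_act_def mult_ac)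
qed

end

text \<open>The ideal \<open>K\<close> measures how much of the elementary group normalises the subgroups under
  consideration. Every commutator with an element of that part costs a factor from \<open>K\<close>, and the
  powers \<open>P k\<close> keep the account.\<close>

locale relative = unitary R
  for R :: "'a :: comm_ring_1 hermitian_form_ring" +
  fixes K :: "'a set"
  assumes K_ideal: "ideal K ring_of_type_algebra"
    and K_bar: "x \<in> K \<Longrightarrow> bar R x \<in> K"
begin

interpretation Ug: group "Ug :: ('a, 'n :: finite) tmat monoid"
  by (rule group_Ug)

abbreviation P :: "nat \<Rightarrow> 'a set" where "P k \<equiv> ideal_pow K k"

lemma K_simps: "0 \<in> K" "x \<in> K \<Longrightarrow> y \<in> K \<Longrightarrow> x + y \<in> K" "x \<in> K \<Longrightarrow> x * r \<in> K" "x \<in> K \<Longrightarrow> r * x \<in> K"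
    "x \<in> K \<Longrightarrow> - x \<in> K"
  using K_ideal ideal_type_minus[OF K_ideal] unfolding ideal_type_iff by (auto simp: mult.commute)

lemma P_ideal: "ideal (P k) ring_of_type_algebra"
  by (rule ideal_ideal_pow[OF K_ideal])

lemma P_simps: "0 \<in> P k" "x \<in> P k \<Longrightarrow> y \<in> P k \<Longrightarrow> x + y \<in> P k" "x \<in> P k \<Longrightarrow> x * r \<in> P k"
    "x \<in> P k \<Longrightarrow> r * x \<in> P k" "x \<in> P k \<Longrightarrow> - x \<in> P k"
  using P_ideal[of k] ideal_type_minus[OF P_ideal] unfolding ideal_type_iff by (auto simp: mult.commute)

lemma P_mult: "x \<in> P k \<Longrightarrow> y \<in> P l \<Longrightarrow> x * y \<in> P (k + l)"
  by (rule ideal_pow_mult[OF K_ideal])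

lemma P_1 [simp]: "P (Suc 0) = K"
proof
  show "P (Suc 0) \<subseteq> K"
  proof
    fix z assume "z \<in> P (Suc 0)"
    then have "z \<in> ideal_prod ring_of_type_algebra UNIV K" by (simp add: ideal_pow_Suc)
    then show "z \<in> K" by (induction rule: ideal_prod_type_induct) (auto simp: K_simps)
  qed
  show "K \<subseteq> P (Suc 0)"
    using ideal_prod.prod[of 1 "UNIV :: 'a set" _ K ring_of_type_algebra] by (auto simp: ideal_pow_Suc)
qed

lemma P_bar: "x \<in> P k \<Longrightarrow> cj x \<in> P k"
proof (induction k arbitrary: x)
  case (Suc k)
  from Suc.prems have "x \<in> ideal_prod ring_of_type_algebra (P k) K" by (simp add: ideal_pow_Suc)
  then show ?case
  proof (induction rule: ideal_prod_type_induct)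
    case (mult a b)
    then show ?case using P_mult[of "cj a" k "cj b" "Suc 0"] Suc.IH K_bar by simp
  next
    case (add a b)
    then show ?case using P_simps(2)[of "cj a" "Suc k"] by simp
  qed
qed simp

lemma P_mono: "k \<le> l \<Longrightarrow> z \<in> P l \<Longrightarrow> z \<in> P k"
  using ideal_pow_mono[OF K_ideal] by blast

lemma P_Suc_induct:
  assumes "z \<in> P (Suc k)" "\<And>x y. x \<in> P k \<Longrightarrow> y \<in> K \<Longrightarrow> q (x * y)" "\<And>x y. q x \<Longrightarrow> q y \<Longrightarrow> q (x + y)"
  shows "q z"
proof -
  from assms(1) have "z \<in> ideal_prod ring_of_type_algebra (P k) K" by (simp add: ideal_pow_Suc)
  then show ?thesis by (induction rule: ideal_prod_type_induct) (use assms in auto)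
qed

lemma P_add_induct:
  assumes "z \<in> P (k + l)" "\<And>x y. x \<in> P k \<Longrightarrow> y \<in> P l \<Longrightarrow> q (x * y)" "\<And>x y. q x \<Longrightarrow> q y \<Longrightarrow> q (x + y)"
  shows "q z"
  using assms
proof (induction l arbitrary: z q)
  case 0
  then show ?case using 0(2)[of z 1] by simp
next
  case (Suc l)
  from Suc.prems(1) have z: "z \<in> P (Suc (k + l))" by simp
  show ?case
  proof (rule P_Suc_induct[OF z])
    fix x y assume x: "x \<in> P (k + l)" and y: "y \<in> K"
    show "q (x * y)"
    proof (rule Suc.IH[OF x, of "\<lambda>x. q (x * y)"])
      fix a b assume "a \<in> P k" "b \<in> P l"
      then show "q (a * b * y)"
        using Suc.prems(2)[of a "b * y"] P_mult[of b l y "Suc 0"] y by (simp add: mult.assoc)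
    next
      fix a b assume "q (a * y)" "q (b * y)"
      then show "q ((a + b) * y)" using Suc.prems(3) by (simp add: distrib_right)
    qed
  qed (use Suc.prems in auto)
qed

subsection \<open>Normalised subgroups and their levels\<close>

text \<open>These elements generate the elementary subgroup of the odd form ideal \<open>(K, \<Omega>\<^sup>K\<^sub>m\<^sub>i\<^sub>n)\<close>.\<close>

definition rel_gens :: "('a, 'n :: finite) tmat set" where
  "rel_gens = {ES i j x |i j x. apart i j \<and> x \<in> K}
     \<union> {EL i (\<delta> \<odot>\<^sub>h c) |i \<delta> c. i \<in> theta_hb \<and> \<delta> \<in> \<Delta> \<and> c \<in> K}
     \<union> {EL i (0, tr x) |i x. i \<in> theta_hb \<and> x \<in> K}"

text \<open>Including all conjugates under the elementary group makes the condition pass from \<open>H\<close> to its own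
  conjugates (\<open>normalised_conj_group\<close>), so that what is extracted from \<open>\<sigma>\<close> can also be extracted from
  \<open>\<epsilon>\<^sup>-\<^sup>1 \<sigma> \<epsilon>\<close>.\<close>

definition normalised :: "('a, 'n :: finite) tmat set \<Rightarrow> bool" where
  "normalised H \<longleftrightarrow> subgroup H Ug \<and> (\<forall>\<epsilon>\<in>EU R. \<forall>g\<in>rel_gens. \<epsilon> ** g ** inv\<^bsub>Ug\<^esub> \<epsilon> \<in> nmz Ug H)"

lemma normalised_subgroup: "normalised H \<Longrightarrow> subgroup H Ug"
  by (simp add: normalised_def)

lemma normalised_closed: "normalised H \<Longrightarrow> h \<in> H \<Longrightarrow> h \<in> carrier Ug"
  by (rule subgroup.mem_carrier[OF normalised_subgroup])

lemma normalised_mult: "normalised H \<Longrightarrow> h \<in> H \<Longrightarrow> h' \<in> H \<Longrightarrow> h ** h' \<in> H"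
  using subgroup.m_closed[OF normalised_subgroup] by simp

lemma normalised_inv: "normalised H \<Longrightarrow> h \<in> H \<Longrightarrow> inv\<^bsub>Ug\<^esub> h \<in> H"
  by (rule subgroup.m_inv_closed[OF normalised_subgroup])

lemma normalised_one: "normalised H \<Longrightarrow> mat 1 \<in> H"
  using subgroup.one_closed[OF normalised_subgroup] by simp

lemma normalised_gens: "normalised H \<Longrightarrow> g \<in> rel_gens \<Longrightarrow> g \<in> nmz Ug H"
proof -
  assume "normalised H" "g \<in> rel_gens"
  then have "mat 1 ** g ** inv\<^bsub>Ug\<^esub> (mat 1) \<in> nmz Ug H"
    unfolding normalised_def using EU_one by blast
  then show ?thesis by simp
qed

lemma normalised_ES: "normalised H \<Longrightarrow> apart i j \<Longrightarrow> x \<in> K \<Longrightarrow> ES i j x \<in> nmz Ug H"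
  by (rule normalised_gens) (auto simp: rel_gens_def)

lemma normalised_EL:
  assumes "normalised H" "i \<in> theta_hb" "\<delta> \<in> \<Delta>" "c \<in> K"
  shows "EL i (\<delta> \<odot>\<^sub>h c) \<in> nmz Ug H"
proof (rule normalised_gens[OF assms(1)])
  show "EL i (\<delta> \<odot>\<^sub>h c) \<in> rel_gens"
    unfolding rel_gens_def by (rule UnI1, rule UnI2, rule CollectI, rule exI[of _ i], rule exI[of _ \<delta>], rule exI[of _ c])
      (simp add: assms)
qed

lemma normalised_EL_tr: "normalised H \<Longrightarrow> i \<in> theta_hb \<Longrightarrow> x \<in> K \<Longrightarrow> EL i (0, tr x) \<in> nmz Ug H"
  by (rule normalised_gens) (auto simp: rel_gens_def)

lemma nmz_mult: "normalised H \<Longrightarrow> x \<in> nmz Ug H \<Longrightarrow> y \<in> nmz Ug H \<Longrightarrow> x ** y \<in> nmz Ug H"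
  using Ug.nmz_mult[OF normalised_subgroup] by simp

definition conj_group :: "('a, 'n :: finite) tmat \<Rightarrow> ('a, 'n) tmat set \<Rightarrow> ('a, 'n) tmat set" where
  "conj_group \<epsilon> H = {h \<in> carrier Ug. \<epsilon> ** h ** inv\<^bsub>Ug\<^esub> \<epsilon> \<in> H}"

lemma conj_group_mem: "\<epsilon> \<in> EU R \<Longrightarrow> normalised H \<Longrightarrow> \<sigma> \<in> H \<Longrightarrow> inv\<^bsub>Ug\<^esub> \<epsilon> ** \<sigma> ** \<epsilon> \<in> conj_group \<epsilon> H"
proof -
  assume a: "\<epsilon> \<in> EU R" "normalised H" "\<sigma> \<in> H"
  have c: "\<sigma> \<in> carrier Ug" "\<epsilon> \<in> carrier Ug" using normalised_closed a by auto
  have "\<epsilon> ** (inv\<^bsub>Ug\<^esub> \<epsilon> ** \<sigma> ** \<epsilon>) ** inv\<^bsub>Ug\<^esub> \<epsilon> = \<sigma>"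
    using c by (intro mat_eqI) (simp add: matrix_vector_mul_assoc[symmetric])
  then show ?thesis using a c by (simp add: conj_group_def)
qed

lemma normalised_conj_group:
  assumes e: "\<epsilon> \<in> EU R" and H: "normalised H"
  shows "normalised (conj_group \<epsilon> H)"
proof -
  have ec: "\<epsilon> \<in> carrier Ug" "inv\<^bsub>Ug\<^esub> \<epsilon> \<in> carrier Ug" using e by simp_all
  have Hs: "subgroup H Ug" using H by (rule normalised_subgroup)
  have hom: "\<epsilon> \<otimes>\<^bsub>Ug\<^esub> (a \<otimes>\<^bsub>Ug\<^esub> b) \<otimes>\<^bsub>Ug\<^esub> inv\<^bsub>Ug\<^esub> \<epsilon>
      = (\<epsilon> \<otimes>\<^bsub>Ug\<^esub> a \<otimes>\<^bsub>Ug\<^esub> inv\<^bsub>Ug\<^esub> \<epsilon>) \<otimes>\<^bsub>Ug\<^esub> (\<epsilon> \<otimes>\<^bsub>Ug\<^esub> b \<otimes>\<^bsub>Ug\<^esub> inv\<^bsub>Ug\<^esub> \<epsilon>)"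
    if "a \<in> carrier Ug" "b \<in> carrier Ug" for a b
    using that ec by (simp add: Ug.m_assoc del: mult_Ug)
  have homi: "\<epsilon> \<otimes>\<^bsub>Ug\<^esub> inv\<^bsub>Ug\<^esub> a \<otimes>\<^bsub>Ug\<^esub> inv\<^bsub>Ug\<^esub> \<epsilon> = inv\<^bsub>Ug\<^esub> (\<epsilon> \<otimes>\<^bsub>Ug\<^esub> a \<otimes>\<^bsub>Ug\<^esub> inv\<^bsub>Ug\<^esub> \<epsilon>)"
    if "a \<in> carrier Ug" for a
    using that ec by (simp add: Ug.m_assoc Ug.inv_mult_group del: mult_Ug)
  have mem: "h \<in> conj_group \<epsilon> H \<longleftrightarrow> h \<in> carrier Ug \<and> \<epsilon> \<otimes>\<^bsub>Ug\<^esub> h \<otimes>\<^bsub>Ug\<^esub> inv\<^bsub>Ug\<^esub> \<epsilon> \<in> H" for h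
    by (simp add: conj_group_def)
  have sub: "subgroup (conj_group \<epsilon> H) Ug"
  proof (rule Ug.subgroupI)
    show "conj_group \<epsilon> H \<noteq> {}"
      using ec subgroup.one_closed[OF Hs] mem[of "\<one>\<^bsub>Ug\<^esub>"] Ug.r_inv[OF ec(1)]
      by (auto simp: matrix_mul_assoc)
  qed (use Hs in \<open>auto simp: mem hom homi subgroup.m_closed subgroup.m_inv_closed simp del: mult_Ug\<close>)
  have "\<epsilon>' \<otimes>\<^bsub>Ug\<^esub> g \<otimes>\<^bsub>Ug\<^esub> inv\<^bsub>Ug\<^esub> \<epsilon>' \<in> nmz Ug (conj_group \<epsilon> H)" if e': "\<epsilon>' \<in> EU R" and g: "g \<in> rel_gens" for \<epsilon>' g
  proof -
    have e'c: "\<epsilon>' \<in> carrier Ug" using e' by simp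
    have gc: "g \<in> carrier Ug" using normalised_gens[OF H g] by (rule Ug.nmz_carrier)
    define x where "x = \<epsilon>' \<otimes>\<^bsub>Ug\<^esub> g \<otimes>\<^bsub>Ug\<^esub> inv\<^bsub>Ug\<^esub> \<epsilon>'"
    have xc: "x \<in> carrier Ug" using e'c gc by (simp add: x_def)
    have "(\<epsilon> ** \<epsilon>') ** g ** inv\<^bsub>Ug\<^esub> (\<epsilon> ** \<epsilon>') \<in> nmz Ug H"
      using H EU_mult[OF e e'] g unfolding normalised_def by blast
    moreover have "(\<epsilon> \<otimes>\<^bsub>Ug\<^esub> \<epsilon>') \<otimes>\<^bsub>Ug\<^esub> g \<otimes>\<^bsub>Ug\<^esub> inv\<^bsub>Ug\<^esub> (\<epsilon> \<otimes>\<^bsub>Ug\<^esub> \<epsilon>') = \<epsilon> \<otimes>\<^bsub>Ug\<^esub> x \<otimes>\<^bsub>Ug\<^esub> inv\<^bsub>Ug\<^esub> \<epsilon>"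
      using ec e'c gc unfolding x_def by (simp add: Ug.m_assoc Ug.inv_mult_group del: mult_Ug)
    ultimately have n: "\<epsilon> \<otimes>\<^bsub>Ug\<^esub> x \<otimes>\<^bsub>Ug\<^esub> inv\<^bsub>Ug\<^esub> \<epsilon> \<in> nmz Ug H" by simp
    show ?thesis
      unfolding x_def[symmetric] nmz_def
    proof (intro CollectI conjI ballI xc)
      fix h assume h: "h \<in> conj_group \<epsilon> H"
      then have hc: "h \<in> carrier Ug" by (simp add: mem)
      show "x \<otimes>\<^bsub>Ug\<^esub> h \<otimes>\<^bsub>Ug\<^esub> inv\<^bsub>Ug\<^esub> x \<in> conj_group \<epsilon> H" "inv\<^bsub>Ug\<^esub> x \<otimes>\<^bsub>Ug\<^esub> h \<otimes>\<^bsub>Ug\<^esub> x \<in> conj_group \<epsilon> H"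
        using n h hc xc unfolding nmz_def mem
        by (simp_all add: hom homi del: mult_Ug)
    qed
  qed
  then show ?thesis using sub by (simp add: normalised_def)
qed

text \<open>Quantifying over the multiples by the \<open>k\<close>-th power of the ideal makes this an ideal of \<open>R\<close>; the
  exponent \<open>k\<close> counts the commutators spent so far.\<close>

definition root_level :: "nat \<Rightarrow> 'n :: finite theta \<Rightarrow> 'n theta \<Rightarrow> ('a, 'n) tmat set \<Rightarrow> 'a set" where
  "root_level k i j H = {x. \<forall>z\<in>P k. ES i j (x * z) \<in> H}"

lemma root_level_add:
  assumes "normalised H" "apart i j" "x \<in> root_level k i j H" "y \<in> root_level k i j H"
  shows "x + y \<in> root_level k i j H"
  using assms normalised_mult[OF assms(1)] unfolding root_level_def
  by (auto simp: distrib_right ES_add[symmetric])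

lemma root_level_mult: "x \<in> root_level k i j H \<Longrightarrow> x * r \<in> root_level k i j H" "x \<in> root_level k i j H \<Longrightarrow> r * x \<in> root_level k i j H"
  unfolding root_level_def using P_simps(4)[of _ k r] by (auto simp: mult.assoc mult.left_commute[of r])

lemma root_level_minus: "x \<in> root_level k i j H \<Longrightarrow> - x \<in> root_level k i j H"
  using root_level_mult(1)[of x k i j H "- 1"] by simp

lemma root_level_diff: "normalised H \<Longrightarrow> apart i j \<Longrightarrow> x \<in> root_level k i j H \<Longrightarrow> y \<in> root_level k i j H \<Longrightarrow> x - y \<in> root_level k i j H"
  using root_level_add[OF _ _ _ root_level_minus, of H i j x k y] by simp

lemma root_level_zero: "normalised H \<Longrightarrow> 0 \<in> root_level k i j H"
  by (simp add: root_level_def normalised_one)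

lemma root_level_mono: "k \<le> l \<Longrightarrow> x \<in> root_level k i j H \<Longrightarrow> x \<in> root_level l i j H"
  using P_mono unfolding root_level_def by blast

lemma root_level_flip:
  assumes x: "x \<in> root_level k i j H"
  shows "cj x \<in> root_level k j i H"
  unfolding root_level_def
proof (intro CollectI ballI)
  fix z assume "z \<in> P k"
  then have "- (cj L) * cj z \<in> P k" using P_bar P_simps(4) by blast
  then have "ES i j (x * (- (cj L) * cj z)) \<in> H" using x by (simp only: root_level_def mem_Collect_eq)
  also have "ES i j (x * (- (cj L) * cj z)) = ES j i (cj x * z)"
    by (subst ES_swap) (simp add: mult_ac)
  finally show "ES j i (cj x * z) \<in> H" .
qed

lemma root_level_unit: "x * u \<in> root_level k i j H \<Longrightarrow> u * u' = 1 \<Longrightarrow> x \<in> root_level k i j H"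
  using root_level_mult(1)[of "x * u" k i j H u'] by (simp add: mult.assoc)

text \<open>Moving one end of the root takes one commutator with an element of \<open>rel_gens\<close>, hence one further
  power of the ideal.\<close>

lemma root_level_right:
  assumes H: "normalised H" and ap: "apart i j" "apart i k" "apart j k" and x: "x \<in> root_level n i j H"
  shows "x \<in> root_level (Suc n) i k H"
  unfolding root_level_def
proof (intro CollectI ballI)
  fix z assume "z \<in> P (Suc n)"
  then show "ES i k (x * z) \<in> H"
  proof (rule P_Suc_induct)
    fix a b assume a: "a \<in> P n" and b: "b \<in> K"
    have bb: "be (- j) * cj (be (- j)) = 1" using ap by (intro be_cj_be) (simp add: apartD)
    have "com Ug (ES (- j) k (cj (be (- j)) * b)) (ES i j (x * a)) \<in> H"
      using ap a b x by (intro Ug.com_H normalised_subgroup H normalised_ES) (auto simp: K_simps root_level_def)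
    also have "com Ug (ES (- j) k (cj (be (- j)) * b)) (ES i j (x * a)) = ES i k ((be (- j) * cj (be (- j))) * (x * (a * b)))"
      using ap by (subst com_ES) (auto simp: mult_ac)
    finally show "ES i k (x * (a * b)) \<in> H" by (simp add: bb)
  next
    fix a b assume "ES i k (x * a) \<in> H" "ES i k (x * b) \<in> H"
    then show "ES i k (x * (a + b)) \<in> H"
      using normalised_mult[OF H] ap by (metis distrib_left ES_add)
  qed
qed

lemma root_level_left:
  assumes H: "normalised H" and ap: "apart i j" "apart k j" "apart i k" and x: "x \<in> root_level n i j H"
  shows "x \<in> root_level (Suc n) k j H"
  using root_level_flip[OF root_level_right[OF H _ _ _ root_level_flip[OF x], of k]] ap apart_sym by auto

text \<open>If the conjugating element fixes the two basis vectors, then conjugation does not move the root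
  element, and a membership obtained in the conjugate subgroup holds in the subgroup itself.\<close>

lemma root_level_conj_group:
  assumes e: "\<epsilon> \<in> EU R" and fixd: "\<epsilon> *v ax i = ax i" "\<epsilon> *v ax j = ax j" and x: "x \<in> root_level k i j (conj_group \<epsilon> H)"
  shows "x \<in> root_level k i j H"
proof -
  have "\<epsilon> ** ES i j y ** inv\<^bsub>Ug\<^esub> \<epsilon> = ES i j y" for y
    unfolding ES_def using S_conj[of \<epsilon> "ax i" "y *s ax j" 0] e fixd by (simp add: matrix_vector_smult)
  then show ?thesis using x by (simp add: root_level_def conj_group_def)
qed

lemma B_conj_group:
  assumes "\<epsilon> \<in> EU R"
  shows "B u ((inv\<^bsub>Ug\<^esub> \<epsilon> ** \<sigma> ** \<epsilon>) *v w) = B (\<epsilon> *v u) (\<sigma> *v (\<epsilon> *v w))"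
  using assms by (simp add: matrix_vector_mul_assoc[symmetric] Ug_B_inv)

end

section \<open>Extracting matrix entries\<close>

context unitary
begin

definition norm_one :: "'a \<Rightarrow> bool" where "norm_one u \<longleftrightarrow> u * cj u = 1"

lemma norm_one_mult: "norm_one u \<Longrightarrow> norm_one v \<Longrightarrow> norm_one (u * v)"
  unfolding norm_one_def by (metis cj_mult mult.assoc mult.left_commute mult_1_right)
lemma norm_one_L: "norm_one L" by (simp add: norm_one_def)
lemma norm_one_be: "i \<in> theta_hb \<Longrightarrow> norm_one (be i)" by (simp add: norm_one_def be_cj_be)
lemma norm_one_cj: "norm_one u \<Longrightarrow> norm_one (cj u)" by (simp add: norm_one_def mult.commute)
lemma norm_one_minus: "norm_one u \<Longrightarrow> norm_one (- u)" by (simp add: norm_one_def)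
lemmas norm_one_intros = norm_one_mult norm_one_L norm_one_be norm_one_cj norm_one_minus

end

context relative
begin

interpretation Ug: group "Ug :: ('a, 'n :: finite) tmat monoid"
  by (rule group_Ug)

lemma P_4_induct:
  assumes "z \<in> P 4" "\<And>x1 x2 x3 x4. x1 \<in> K \<Longrightarrow> x2 \<in> K \<Longrightarrow> x3 \<in> K \<Longrightarrow> x4 \<in> K \<Longrightarrow> q (x1 * x2 * x3 * x4)"
    "\<And>x y. q x \<Longrightarrow> q y \<Longrightarrow> q (x + y)"
  shows "q z"
proof -
  have 4: "P 4 = P (Suc (Suc (Suc (Suc 0))))" by (simp add: numeral_eq_Suc)
  have 1: "q (x * y * y' * y'')" if "x \<in> P (Suc 0)" "y \<in> K" "y' \<in> K" "y'' \<in> K" for x y y' y''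
    using assms(2) that by simp
  have 2: "q (x * y * y')" if "x \<in> P (Suc (Suc 0))" "y \<in> K" "y' \<in> K" for x y y'
    by (rule P_Suc_induct[OF that(1), of "\<lambda>x. q (x * y * y')"])
      (use 1 that assms(3) in \<open>auto simp: distrib_right\<close>)
  have 3: "q (x * y)" if "x \<in> P (Suc (Suc (Suc 0)))" "y \<in> K" for x y
    by (rule P_Suc_induct[OF that(1), of "\<lambda>x. q (x * y)"])
      (use 2 that assms(3) in \<open>auto simp: distrib_right\<close>)
  show ?thesis
    using assms(1) unfolding 4 by (rule P_Suc_induct) (use 3 assms(3) in auto)
qed

lemma ES_H_add: "normalised H \<Longrightarrow> apart i j \<Longrightarrow> ES i j x \<in> H \<Longrightarrow> ES i j y \<in> H \<Longrightarrow> ES i j (x + y) \<in> H"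
  using normalised_mult ES_add by metis

lemma S_plane_nmz:
  assumes H: "normalised H" and ap: "apart i j" "apart i k" "apart j k"
    and u: "u = f *s ax i + g *s ax j + h *s ax k" and fgh: "f \<in> K" "g \<in> K" "h \<in> K"
  shows "S (p *s ax i + q *s ax k) u 0 \<in> nmz Ug H"
proof -
  have "S (ax i) (cj p *s u) 0 = ES i j (cj p * g) ** ES i k (cj p * h) ** EL i (0, tr (- (L * (cj p * f))))"
    using S_ax_decomp[OF ap, of "cj p * f" "cj p * g" "cj p * h"] by (simp add: u vector_add_ldistrib vector_smult_assoc)
  moreover have "S (ax k) (cj q *s u) 0 = ES k i (cj q * f) ** ES k j (cj q * g) ** EL k (0, tr (- (L * (cj q * h))))"
    using S_ax_decomp[of k i j "cj q * h" "cj q * f" "cj q * g"] ap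
    by (simp add: u vector_add_ldistrib vector_smult_assoc apart_sym add_ac)
  moreover have "norm_one L" by (rule norm_one_L)
  ultimately show ?thesis
    unfolding S_plane[OF ap u] using ap fgh apartD(1,2)[OF ap(2)]
    by (auto intro!: nmz_mult[OF H] normalised_ES[OF H] normalised_EL_tr[OF H] simp: K_simps apart_sym)
qed

text \<open>If \<open>v\<close> and \<open>u\<close> are orthogonal to row \<open>a\<close> of \<open>\<sigma>\<close>, the conjugate of the transvection by \<open>\<sigma>\<close> fixes
  the isotropic vector \<open>ax a\<close>. Its commutators with the unipotent radical of the stabiliser of that vector stay
  in the radical; the second of them lies in the centre of the radical, with which \<open>D\<close> commutes.\<close>

lemma extract_line:
  assumes H: "normalised H" and s: "\<sigma> \<in> H" and a: "a \<in> theta_hb"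
    and \<tau>: "S v u 0 \<in> nmz Ug H"
    and ker: "B (ax a) (\<sigma> *v v) = 0" "B (ax a) (\<sigma> *v u) = 0"
    and t: "S (ax a) ut 0 \<in> nmz Ug H" "B (ax a) ut = 0"
    and s': "S (ax a) us 0 \<in> nmz Ug H" "B (ax a) us = 0"
    and D: "D \<in> nmz Ug H" "D *v ax a = ax a"
    and x: "com Ug (com Ug (S v u 0) (S (ax a) ut 0)) (S (ax a) us 0) = x ** h" "h \<in> H" "x \<in> nmz Ug H"
  shows "com Ug D x \<in> H"
proof -
  note c = Ug.nmz_carrier
  have sc: "\<sigma> \<in> carrier Ug" using s normalised_closed[OF H] by blast
  have aa: "B (ax a) (ax a) = 0" using a by (simp add: B_ax_ax minus_theta_neq)
  define E where "E = \<sigma> ** S v u 0 ** inv\<^bsub>Ug\<^esub> \<sigma>"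
  have Ec: "E \<in> carrier Ug" unfolding E_def using sc c[OF \<tau>] by simp
  have Ea: "E *v ax a = ax a"
    unfolding E_def S_conj[OF sc] using ker by (simp add: S_apply B_eq_0_flip)
  obtain w y where C1: "com Ug E (S (ax a) ut 0) = S (ax a) w y" and w: "B (ax a) w = 0"
    using com_S_fix[OF Ec c[OF t(1)] aa t(2) Ea] by metis
  have C1c: "S (ax a) w y \<in> carrier Ug"
    unfolding C1[symmetric] using Ug.com_closed[OF Ec c[OF t(1)]] .
  have C1a: "S (ax a) w y *v ax a = ax a"
    using w aa by (simp add: S_apply B_eq_0_flip)
  have "S (ax a) w y *v us - us = (- (cj L * B w us)) *s ax a"
    using s'(2) by (simp add: S_apply vec_eq_iff)
  then obtain \<kappa> y' where C2: "com Ug (S (ax a) w y) (S (ax a) us 0) = S (ax a) (\<kappa> *s ax a) y'"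
    using com_S_fix(1)[OF C1c c[OF s'(1)] aa s'(2) C1a] by metis
  define C where "C = S (ax a) (\<kappa> *s ax a) y'"
  have Cc: "C \<in> carrier Ug"
    unfolding C_def C2[symmetric] using Ug.com_closed[OF C1c c[OF s'(1)]] .
  have "com Ug D C = mat 1"
    using com_S[OF c[OF D(1)], of "ax a" "\<kappa> *s ax a" y'] Cc D(2) Ug.r_inv[OF Cc]
    by (simp add: C_def matrix_vector_smult)
  then have "com Ug C D = mat 1"
    using com_inverse[OF c[OF D(1)] Cc] by simp
  then have "com Ug x D \<in> H"
    using Ug.extraction_principle[OF normalised_subgroup[OF H] s \<tau> t(1) s'(1) D(1), of x h] x
    by (simp add: E_def[symmetric] C1 C2 C_def)
  then show ?thesis
    using normalised_inv[OF H] com_inverse[OF c[OF x(3)] c[OF D(1)]] by metis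
qed

lemma B_row:
  assumes "\<sigma> \<in> carrier Ug"
  shows "B (ax a) (\<sigma> *v (x *s v - y *s w)) = x * B (ax a) (\<sigma> *v v) - y * B (ax a) (\<sigma> *v w)"
  by (simp add: matrix_vector_mult_diff_distrib matrix_vector_smult)

text \<open>The transvection lives in the totally isotropic coordinate space spanned by \<open>-a, b, c\<close>, with both
  vectors chosen orthogonal to the row. For columns apart from the row and from each other the iterated
  commutator is then a single root element, whose parameter is the product of the two entries up to
  units and factors from the ideal.\<close>

lemma extract_product:
  fixes \<sigma> :: "('a, 'n :: finite) tmat"
  assumes H: "normalised H" and s: "\<sigma> \<in> H" and ap: "apart a b" "apart a c" "apart b c" and d: "d = b \<or> d = - b"
  defines "r \<equiv> \<lambda>k. B (ax a) (\<sigma> *v ax k)"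
  shows "r b * cj (r c) \<in> root_level 4 a d H"
proof -
  note ds = apartD[OF ap(1)] apartD[OF ap(2)] apartD[OF ap(3)]
  have sc: "\<sigma> \<in> carrier Ug" using s normalised_closed[OF H] by blast
  have apd: "apart c d" "apart a d" using d ap apart_sym by auto
  note dd = apartD[OF apd(1)] apartD[OF apd(2)]
  define U where "U = be (- c) * cj L * be b * cj (be (- a))"
  have U: "norm_one U" unfolding U_def using ds by (intro norm_one_intros) auto
  have main: "ES a d (r b * cj (r c) * U * (k1 * k2 * k3 * k4)) \<in> H"
    if k: "k1 \<in> K" "k2 \<in> K" "k3 \<in> K" "k4 \<in> K" for k1 k2 k3 k4
  proof -
    define x1 x2 where "x1 = cj k1" and "x2 = cj k2"
    have x12: "x1 \<in> K" "x2 \<in> K" using k K_bar by (auto simp: x1_def x2_def)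
    define v where "v = r (- a) *s ax b - r b *s (ax (- a) :: ('a, 'n) tvec)"
    define u where "u = (x1 * r c) *s ax b - (x1 * r b) *s (ax c :: ('a, 'n) tvec)"
    define \<tau> where "\<tau> = S v u 0"
    have \<tau>n: "\<tau> \<in> nmz Ug H"
      unfolding \<tau>_def using S_plane_nmz[OF H, of b c "- a" u "x1 * r c" "- (x1 * r b)" 0 "r (- a)" "- r b"] ap x12
      by (simp add: u_def v_def apart_sym K_simps vector_minus_smult[symmetric])
    have \<tau>c: "\<tau> \<in> carrier Ug" using \<tau>n by (rule Ug.nmz_carrier)
    have \<tau>a: "\<tau> *v ax a = ax a - (cj (r b) * be (- a)) *s u"
      using ds by (simp add: \<tau>_def S_apply u_def v_def B_ax_ax vec_eq_iff algebra_simps)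
    have \<tau>c': "\<tau> *v ax c = ax c"
      using ds by (simp add: \<tau>_def S_apply u_def v_def B_ax_ax)
    define w where "w = (- (x2 * cj (r b) * be (- a))) *s u"
    have g: "com Ug \<tau> (ES c a x2) = S (ax c) w (cj L * B w (x2 *s ax a))" and gw: "B (ax c) w = 0"
    proof -
      have dif: "\<tau> *v (x2 *s ax a) - x2 *s ax a = w"
        by (simp add: matrix_vector_smult \<tau>a w_def vec_eq_iff algebra_simps)
      have ec: "S (ax c) (x2 *s ax a) 0 \<in> carrier Ug"
        using ES_closed[of c a x2] apart_sym[of c a] ap(2) by (simp add: ES_def)
      have 0: "B (ax c) (ax c) = 0" "B (ax c) (x2 *s ax a) = 0" using ds by (simp_all add: B_ax_ax)
      show "com Ug \<tau> (ES c a x2) = S (ax c) w (cj L * B w (x2 *s ax a))" "B (ax c) w = 0"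
        using com_S_fix[OF \<tau>c ec 0 \<tau>c'] by (simp_all add: dif ES_def)
    qed
    define g where "g = S (ax c) w (cj L * B w (x2 *s ax a))"
    have gc: "g \<in> carrier Ug"
      unfolding g_def g[symmetric] using \<tau>c ap(2) apart_sym[of c a] by (intro Ug.com_closed) auto
    define \<xi> where "\<xi> = k3 * cj L * be b * cj x2 * r b * cj (be (- a)) * cj x1 * cj (r c)"
    have gs: "com Ug g (ES a (- b) k3) = ES a c \<xi>"
    proof -
      have ga: "g *v ax a = ax a"
        using ds by (simp add: g_def S_apply w_def u_def B_ax_ax)
      have dif: "g *v (k3 *s ax (- b)) - k3 *s ax (- b) = \<xi> *s ax c"
        using ds by (simp add: g_def S_apply w_def u_def B_ax_ax \<xi>_def vec_eq_iff algebra_simps)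
      have ec: "S (ax a) (k3 *s ax (- b)) 0 \<in> carrier Ug"
        using ES_closed[of a "- b" k3] ap by (simp add: ES_def)
      have 0: "B (ax a) (ax a) = 0" "B (ax a) (k3 *s ax (- b)) = 0" using ds by (simp_all add: B_ax_ax)
      have 1: "cj L * B (\<xi> *s ax c) (k3 *s ax (- b)) = 0" using ds by (simp add: B_ax_ax)
      show ?thesis
        using com_S_fix(1)[OF gc ec 0 ga] unfolding dif 1 by (simp add: ES_def)
    qed
    have \<xi>K: "\<xi> \<in> K" unfolding \<xi>_def using k by (simp add: K_simps mult_ac)
    have "com Ug (ES (- c) d k4) (ES a c \<xi>) \<in> H"
    proof (rule extract_line[OF H s, of a v u "(- (cj L * cj x2)) *s ax c" "k3 *s ax (- b)"])
      show "a \<in> theta_hb" using ds by simp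
      show "S v u 0 \<in> nmz Ug H" using \<tau>n by (simp add: \<tau>_def)
      show "B (ax a) (\<sigma> *v v) = 0" "B (ax a) (\<sigma> *v u) = 0"
        unfolding v_def u_def B_row[OF sc] r_def by (simp_all add: mult_ac)
      have t: "S (ax a) ((- (cj L * cj x2)) *s ax c) 0 = ES c a x2"
        unfolding ES_def S_swap[of "ax c" x2] ..
      show "S (ax a) ((- (cj L * cj x2)) *s ax c) 0 \<in> nmz Ug H"
        unfolding t using ap x12 apart_sym by (intro normalised_ES[OF H]) auto
      have s1: "S (ax a) (k3 *s ax (- b)) 0 = ES a (- b) k3" by (simp add: ES_def)
      show "S (ax a) (k3 *s ax (- b)) 0 \<in> nmz Ug H"
        unfolding s1 using ap k by (intro normalised_ES[OF H]) auto
      show "ES (- c) d k4 \<in> nmz Ug H" using apd k by (intro normalised_ES[OF H]) auto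
      show "ES (- c) d k4 *v ax a = ax a" using ds dd by (simp add: ES_apply B_ax_ax)
      show "com Ug (com Ug (S v u 0) (S (ax a) ((- (cj L * cj x2)) *s ax c) 0)) (S (ax a) (k3 *s ax (- b)) 0)
          = ES a c \<xi> ** mat 1"
        unfolding t s1 \<tau>_def[symmetric] g g_def[symmetric] gs by simp
      show "mat 1 \<in> H" by (rule normalised_one[OF H])
      show "ES a c \<xi> \<in> nmz Ug H" by (rule normalised_ES[OF H ap(2) \<xi>K])
      show "B (ax a) ((- (cj L * cj x2)) *s ax c) = 0" "B (ax a) (k3 *s ax (- b)) = 0"
        using ds by (simp_all add: B_ax_ax)
    qed
    moreover have "com Ug (ES (- c) d k4) (ES a c \<xi>) = ES a d (be (- c) * k4 * \<xi>)"
      using ap apd by (intro com_ES)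
    ultimately show ?thesis
      by (simp add: \<xi>_def U_def x1_def x2_def mult_ac)
  qed
  have "r b * cj (r c) * U \<in> root_level 4 a d H"
    unfolding root_level_def
  proof (intro CollectI ballI)
    fix z assume "z \<in> P 4"
    then show "ES a d (r b * cj (r c) * U * z) \<in> H"
      by (rule P_4_induct) (use main ES_H_add[OF H apd(2)] in \<open>auto simp: distrib_left\<close>)
  qed
  then show ?thesis using U unfolding norm_one_def by (rule root_level_unit)
qed

text \<open>The product of an entry with the diagonal entry. The commutator now carries a second factor, at a
  root spanned by \<open>b\<close> and \<open>-c\<close>; its coefficient is a combination of the products handled by
  the previous lemma, so it can be absorbed into \<open>H\<close> at the price of a higher power of the ideal.\<close>

lemma extract_product_diag:
  fixes \<sigma> :: "('a, 'n :: finite) tmat"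
  assumes H: "normalised H" and s: "\<sigma> \<in> H" and ap: "apart a b" "apart a c" "apart b c" and d: "d = c \<or> d = - c"
  defines "r \<equiv> \<lambda>k. B (ax a) (\<sigma> *v ax k)"
  shows "r b * cj (r (- a)) \<in> root_level 7 a d H"
proof -
  note ds = apartD[OF ap(1)] apartD[OF ap(2)] apartD[OF ap(3)]
  have sc: "\<sigma> \<in> carrier Ug" using s normalised_closed[OF H] by blast
  have ap': "apart b a" "apart c a" "apart c b" using ap apart_sym by blast+
  have apd: "apart b d" "apart a d" using d ap by auto
  note dd = apartD[OF apd(1)] apartD[OF apd(2)]
  have rr: "cj (r c) * r b \<in> root_level 6 b (- c) H" "cj (r b) * r c \<in> root_level 6 b (- c) H"
  proof -
    have "r b * cj (r c) \<in> root_level 4 a b H"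
      unfolding r_def by (rule extract_product[OF H s ap]) simp
    then have "r b * cj (r c) \<in> root_level (Suc 4) a (- c) H"
      by (rule root_level_right[OF H, rotated 3]) (use ap in auto)
    then have "r b * cj (r c) \<in> root_level (Suc (Suc 4)) b (- c) H"
      by (rule root_level_left[OF H, rotated 3]) (use ap in auto)
    then show "cj (r c) * r b \<in> root_level 6 b (- c) H" by (simp add: mult.commute)
    have "r c * cj (r b) \<in> root_level 4 a (- c) H"
      unfolding r_def by (rule extract_product[OF H s ap(2,1) ap'(3)]) simp
    then have "r c * cj (r b) \<in> root_level (Suc 4) b (- c) H"
      by (rule root_level_left[OF H, rotated 3]) (use ap in auto)
    then have "r c * cj (r b) \<in> root_level 6 b (- c) H"
      by (rule root_level_mono[rotated]) simp
    then show "cj (r b) * r c \<in> root_level 6 b (- c) H" by (simp add: mult.commute)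
  qed
  define U where "U = - (be (- b) * (cj L * be c * L * cj (be (- a))))"
  have U: "norm_one U" unfolding U_def using ds by (intro norm_one_intros) auto
  have main: "ES a d (r b * cj (r (- a)) * U * (k3 * (k1 * k2 * k4))) \<in> H"
    if k: "k1 \<in> K" "k2 \<in> K" "k3 \<in> P 4" "k4 \<in> K" for k1 k2 k3 k4
  proof -
    define x1 x2 where "x1 = k1" and "x2 = cj k2"
    have x12: "x1 \<in> K" "x2 \<in> K" using k K_bar by (auto simp: x1_def x2_def)
    have k3: "k3 \<in> K" using P_mono[of "Suc 0" 4 k3] k by simp
    define v where "v = r c *s ax (- a) - r (- a) *s (ax c :: ('a, 'n) tvec)"
    define u where "u = (x1 * r b) *s ax (- a) - (x1 * r (- a)) *s (ax b :: ('a, 'n) tvec)"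
    define \<tau> where "\<tau> = S v u 0"
    have \<tau>n: "\<tau> \<in> nmz Ug H"
      unfolding \<tau>_def using S_plane_nmz[OF H, of "- a" b c u "x1 * r b" "- (x1 * r (- a))" 0 "r c" "- r (- a)"] ap x12
      by (simp add: u_def v_def K_simps vector_minus_smult[symmetric])
    have \<tau>c: "\<tau> \<in> carrier Ug" using \<tau>n by (rule Ug.nmz_carrier)
    have \<tau>a: "\<tau> *v ax a = ax a + (cj (r c) * be (- a)) *s u - (cj L * cj x1 * cj (r b) * be (- a)) *s v"
      using ds by (simp add: \<tau>_def S_apply u_def v_def B_ax_ax vec_eq_iff algebra_simps)
    have \<tau>b: "\<tau> *v ax b = ax b"
      using ds by (simp add: \<tau>_def S_apply u_def v_def B_ax_ax)
    define Y where "Y = x2 * be (- a) * (cj (r c) * x1 * r b - cj L * cj x1 * cj (r b) * r c)"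
    define W where "W = x2 * cj L * cj x1 * cj (r b) * be (- a) * r (- a)"
    define Z where "Z = - (x2 * cj (r c) * be (- a) * x1 * r (- a))"
    define w where "w = Y *s ax (- a) + W *s ax c + Z *s (ax b :: ('a, 'n) tvec)"
    define g where "g = S (ax b) w (cj L * B w (x2 *s ax a))"
    have g: "com Ug \<tau> (ES b a x2) = g" and gw: "B (ax b) w = 0"
    proof -
      have dif: "\<tau> *v (x2 *s ax a) - x2 *s ax a = w"
        by (simp add: matrix_vector_smult \<tau>a w_def u_def v_def W_def Y_def Z_def vec_eq_iff algebra_simps)
      have ec: "S (ax b) (x2 *s ax a) 0 \<in> carrier Ug"
        using ES_closed[of b a x2] ap' by (simp add: ES_def)
      have 0: "B (ax b) (ax b) = 0" "B (ax b) (x2 *s ax a) = 0" using ds by (simp_all add: B_ax_ax)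
      show "com Ug \<tau> (ES b a x2) = g" "B (ax b) w = 0"
        using com_S_fix[OF \<tau>c ec 0 \<tau>b] by (simp_all add: dif ES_def g_def)
    qed
    have gc: "g \<in> carrier Ug"
      unfolding g[symmetric] using \<tau>c ap' by (intro Ug.com_closed) auto
    define y1 where "y1 = - (cj L * cj Y * be (- a))"
    define z1 where "z1 = - (cj L * cj W * be c)"
    have z1K: "z1 \<in> K" unfolding z1_def W_def using x12 k by (simp add: K_simps x2_def mult_ac)
    define s where "s = ES a (- c) k3"
    have sn: "s \<in> nmz Ug H" unfolding s_def using ap k3 by (intro normalised_ES[OF H]) auto
    have scc: "s \<in> carrier Ug" using sn by (rule Ug.nmz_carrier)
    define x where "x = ES a b (k3 * z1)"
    have xn: "x \<in> nmz Ug H" unfolding x_def using ap k3 by (intro normalised_ES[OF H]) (auto simp: K_simps)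
    have xc: "x \<in> carrier Ug" using xn by (rule Ug.nmz_carrier)
    define h where "h = ES b (- c) (cj y1 * k3) ** EL b (0, tr (- (L * (cj y1 * k3 * z1))))"
    have gs: "g ** s ** inv\<^bsub>Ug\<^esub> g = x ** s ** h"
    proof -
      have ga: "g *v ax a = ax a + y1 *s ax b"
        using ds by (simp add: g_def S_apply w_def B_ax_ax y1_def vec_eq_iff algebra_simps)
      have gcc: "g *v (k3 *s ax (- c)) = k3 *s ax (- c) + (k3 * z1) *s ax b"
        using ds by (simp add: g_def S_apply w_def B_ax_ax z1_def vec_eq_iff algebra_simps)
      have "g ** s ** inv\<^bsub>Ug\<^esub> g = S (ax a + y1 *s ax b) (k3 *s ax (- c) + (k3 * z1) *s ax b) 0"
        unfolding s_def ES_def S_conj[OF gc] ga gcc ..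
      also have "\<dots> = S (ax a) (k3 *s ax (- c) + (k3 * z1) *s ax b) 0
          ** S (y1 *s ax b) (k3 *s ax (- c) + (k3 * z1) *s ax b) 0"
        using ds by (intro S_add_left) (simp_all add: B_ax_ax)
      also have "S (ax a) (k3 *s ax (- c) + (k3 * z1) *s ax b) 0 = x ** s"
        unfolding x_def s_def ES_def using ds by (subst S_comp) (simp_all add: B_ax_ax add.commute)
      also have "S (y1 *s ax b) (k3 *s ax (- c) + (k3 * z1) *s ax b) 0
          = S (ax b) ((cj y1 * k3) *s ax (- c) + (cj y1 * k3 * z1) *s ax b) 0"
        unfolding S_smult_left by (simp add: vector_add_ldistrib vector_smult_assoc mult_ac)
      also have "\<dots> = h"
        unfolding h_def ES_def EL_tr using ds by (subst S_comp) (simp_all add: B_ax_ax)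
      finally show ?thesis .
    qed
    have hH: "h \<in> H"
    proof -
      have yk: "ES b (- c) (cj y1 * k3) \<in> H"
      proof -
        define q where "q = - (L * cj (be (- a)))"
        have e: "cj y1 * k3 = cj (r c) * r b * (q * (k3 * (x2 * be (- a) * x1))) +
             cj (r b) * r c * (q * (k3 * (- (x2 * be (- a) * cj L * cj x1))))"
          by (simp add: y1_def Y_def q_def algebra_simps)
        have "k3 * (y * x) \<in> P 6" if "y \<in> K" "x \<in> K" for y x
        proof -
          have "y * x \<in> P (Suc 0 + Suc 0)" using that by (intro P_mult) simp_all
          from P_mult[OF k(3) this] show ?thesis by simp
        qed
        note kP = this
        have "q * (k3 * (x2 * be (- a) * x1)) \<in> P 6" "q * (k3 * (- (x2 * be (- a) * cj L * cj x1))) \<in> P 6"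
          using kP[of "x2 * be (- a)" x1, THEN P_simps(4), of q]
            kP[of "- (x2 * be (- a) * cj L)" "cj x1", THEN P_simps(4), of q] x12 K_bar
          by (simp_all add: K_simps)
        then have "ES b (- c) (cj (r c) * r b * (q * (k3 * (x2 * be (- a) * x1)))) \<in> H"
          "ES b (- c) (cj (r b) * r c * (q * (k3 * (- (x2 * be (- a) * cj L * cj x1))))) \<in> H"
          using rr unfolding root_level_def by blast+
        then show ?thesis unfolding e using ap by (intro ES_H_add[OF H]) auto
      qed
      have "com Ug (ES (- (- c)) b (cj (be c) * z1)) (ES b (- c) (cj y1 * k3))
          = EL b (0, tr (- (L * (be (- (- c)) * (cj (be c) * z1) * (cj y1 * k3)))))"
        using ap by (intro com_ES_long) auto
      moreover have "be (- (- c)) * (cj (be c) * z1) * (cj y1 * k3) = cj y1 * k3 * z1"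
        using be_cases[of c] ds by (auto simp: mult_ac)
      moreover have "com Ug (ES (- (- c)) b (cj (be c) * z1)) (ES b (- c) (cj y1 * k3)) \<in> H"
        using yk z1K ap' by (intro Ug.com_H[OF normalised_subgroup[OF H]] normalised_ES[OF H]) (auto simp: K_simps)
      ultimately have "EL b (0, tr (- (L * (cj y1 * k3 * z1)))) \<in> H" by simp
      then show ?thesis unfolding h_def using yk normalised_mult[OF H] by blast
    qed
    have hc: "h \<in> carrier Ug" using hH normalised_closed[OF H] by blast
    have "com Ug (ES (- b) d k4) x \<in> H"
    proof (rule extract_line[OF H \<open>\<sigma> \<in> H\<close>, of a v u "(- (cj L * cj x2)) *s ax b" "k3 *s ax (- c)"])
      show "a \<in> theta_hb" using ds by simp
      show "S v u 0 \<in> nmz Ug H" using \<tau>n by (simp add: \<tau>_def)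
      show "B (ax a) (\<sigma> *v v) = 0" "B (ax a) (\<sigma> *v u) = 0"
        unfolding v_def u_def B_row[OF sc] r_def by (simp_all add: mult_ac)
      have t: "S (ax a) ((- (cj L * cj x2)) *s ax b) 0 = ES b a x2"
        unfolding ES_def S_swap[of "ax b" x2] ..
      show "S (ax a) ((- (cj L * cj x2)) *s ax b) 0 \<in> nmz Ug H"
        unfolding t using ap' x12 by (intro normalised_ES[OF H]) auto
      have s1: "S (ax a) (k3 *s ax (- c)) 0 = s" by (simp add: ES_def s_def)
      show "S (ax a) (k3 *s ax (- c)) 0 \<in> nmz Ug H" unfolding s1 by (rule sn)
      show "ES (- b) d k4 \<in> nmz Ug H" using apd k by (intro normalised_ES[OF H]) auto
      show "ES (- b) d k4 *v ax a = ax a" using ds dd by (simp add: ES_apply B_ax_ax)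
      show "com Ug (com Ug (S v u 0) (S (ax a) ((- (cj L * cj x2)) *s ax b) 0)) (S (ax a) (k3 *s ax (- c)) 0)
          = x ** (s ** h ** inv\<^bsub>Ug\<^esub> s)"
        unfolding t s1 \<tau>_def[symmetric] g using gs by (simp add: com_def matrix_mul_assoc)
      show "s ** h ** inv\<^bsub>Ug\<^esub> s \<in> H" using Ug.nmz_conj[OF sn hH] by simp
      show "x \<in> nmz Ug H" by (rule xn)
      show "B (ax a) ((- (cj L * cj x2)) *s ax b) = 0" "B (ax a) (k3 *s ax (- c)) = 0"
        using ds by (simp_all add: B_ax_ax)
    qed
    moreover have "com Ug (ES (- b) d k4) x = ES a d (be (- b) * k4 * (k3 * z1))"
      unfolding x_def using ap apd by (intro com_ES)
    ultimately show ?thesis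
      by (simp add: U_def z1_def W_def x1_def x2_def mult_ac)
  qed
  have "r b * cj (r (- a)) * U \<in> root_level 7 a d H"
    unfolding root_level_def
  proof (intro CollectI ballI)
    fix z assume "z \<in> P 7"
    then have "z \<in> P (4 + (Suc (Suc (Suc 0))))" by simp
    then show "ES a d (r b * cj (r (- a)) * U * z) \<in> H"
    proof (rule P_add_induct)
      fix x y assume x: "x \<in> P 4" and y: "y \<in> P (Suc (Suc (Suc 0)))"
      show "ES a d (r b * cj (r (- a)) * U * (x * y)) \<in> H"
      proof (rule P_Suc_induct[OF y])
        fix y' k4 assume y': "y' \<in> P (Suc (Suc 0))" and k4: "k4 \<in> K"
        show "ES a d (r b * cj (r (- a)) * U * (x * (y' * k4))) \<in> H"
          by (rule P_Suc_induct[OF y']) (use main x k4 ES_H_add[OF H apd(2)] in \<open>auto simp: distrib_left distrib_right\<close>)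
      qed (use ES_H_add[OF H apd(2)] in \<open>auto simp: distrib_left distrib_right\<close>)
    qed (use ES_H_add[OF H apd(2)] in \<open>auto simp: distrib_left distrib_right\<close>)
  qed
  then show ?thesis using U unfolding norm_one_def by (rule root_level_unit)
qed

end

lemma not_apart: "a \<in> theta_hb \<Longrightarrow> d \<in> theta_hb \<Longrightarrow> \<not> apart a d \<longleftrightarrow> d = a \<or> d = - a"
  by (auto simp: apart_def)

context relative
begin

interpretation Ug: group "Ug :: ('a, 'n :: finite) tmat monoid"
  by (rule group_Ug)

lemma root_level_sum:
  assumes "normalised H" "apart i j" "\<And>k. k \<in> T \<Longrightarrow> f k \<in> root_level n i j H"
  shows "sum f T \<in> root_level n i j H"
  using assms(3) by (induction T rule: infinite_finite_induct) (auto intro: root_level_add assms(1,2) root_level_zero)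

lemma root_level_add_cancel: "normalised H \<Longrightarrow> apart i j \<Longrightarrow> x + y \<in> root_level k i j H \<Longrightarrow> x \<in> root_level k i j H \<Longrightarrow> y \<in> root_level k i j H"
  using root_level_diff[of H i j "x + y" k x] by simp

text \<open>Rows of invertible matrices are unimodular, so an element is in a level as soon as all its
  multiples by the entries of a row are. The entry in column \<open>0\<close> only matters up to \<open>J(\<Delta>)\<close>.\<close>

lemma row_unimodular:
  fixes \<sigma> :: "('a, 'n :: finite) tmat"
  assumes H: "normalised H" and ap: "apart i j" and s: "\<sigma> \<in> carrier Ug" and a: "a \<in> theta_hb"
    and hb: "\<And>k. k \<in> theta_hb \<Longrightarrow> x * cj (B (ax a) (\<sigma> *v ax k)) \<in> root_level n i j H"
    and zero: "\<And>y. y \<in> J_par R \<Longrightarrow> x * cj (B (ax a) (\<sigma> *v ax ZeroI) * y) \<in> root_level n i j H"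
  shows "x \<in> root_level n i j H"
proof -
  define w where "w = inv\<^bsub>Ug\<^esub> \<sigma> *v ax (- a)"
  have "Q w \<in> \<Delta>"
    unfolding w_def using s a by (intro Ug_Q_Delta) auto
  then have w0: "w $ ZeroI \<in> J_par R" by (auto simp: Q_alt J_par_def)
  have "be a = B (ax a) (\<sigma> *v w)" using s by (simp add: w_def B_ax_ax)
  also have "\<dots> = (\<Sum>k\<in>UNIV. B (ax a) (\<sigma> *v ax k) * w $ k)"
    by (subst vec_expand[of w]) (simp add: matrix_vector_sum B_sum_right matrix_vector_smult mult_ac)
  finally have "x * cj (be a) = (\<Sum>k\<in>UNIV. x * cj (B (ax a) (\<sigma> *v ax k) * w $ k))"
    by (simp add: cj_sum sum_distrib_left)
  also have "\<dots> \<in> root_level n i j H"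
  proof (rule root_level_sum[OF H ap])
    fix k :: "'n theta"
    show "x * cj (B (ax a) (\<sigma> *v ax k) * w $ k) \<in> root_level n i j H"
    proof (cases "k = ZeroI")
      case False
      then show ?thesis
        using root_level_mult(1)[OF hb[of k], of "cj (w $ k)"] by (simp add: theta_hb_iff mult_ac)
    qed (use zero[OF w0] in simp)
  qed
  finally show ?thesis
    using be_cj_be[OF a] by (intro root_level_unit[of x "cj (be a)" n i j H "be a"]) (simp_all add: mult.commute)
qed

lemma extract_product_conj_group:
  fixes \<sigma> :: "('a, 'n :: finite) tmat"
  assumes H: "normalised H" and s: "\<sigma> \<in> H" and ap: "apart a b" "apart a c" "apart b c" and d: "d = b \<or> d = - b"
    and e: "\<epsilon> \<in> EU R" "\<epsilon> *v ax a = ax a" "\<epsilon> *v ax d = ax d"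
  shows "B (ax a) (\<sigma> *v (\<epsilon> *v ax b)) * cj (B (ax a) (\<sigma> *v (\<epsilon> *v ax c))) \<in> root_level 4 a d H"
  using extract_product[OF normalised_conj_group[OF e(1) H] conj_group_mem[OF e(1) H s] ap d]
  unfolding B_conj_group[OF e(1)] e(2) by (rule root_level_conj_group[OF e])

text \<open>By unimodularity of the row it suffices to multiply the entry \<open>b\<close> by every entry of its row. The
  products not yet available appear as summands after conjugating with elementary matrices that fix the
  basis vector of the row. The product with the opposite entry \<open>-b\<close> is reached only together with the
  product of the entries \<open>c\<close> and \<open>-c\<close>; one more multiplication by an entry of the row removes that
  companion, and then unimodularity is used twice.\<close>

lemma extract_entry:
  fixes \<sigma> :: "('a, 'n :: finite) tmat"
  assumes H: "normalised H" and s: "\<sigma> \<in> H" and ap: "apart a b" "apart a c" "apart b c"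
  shows "B (ax a) (\<sigma> *v ax b) \<in> root_level 7 a c H"
proof -
  note ds = apartD[OF ap(1)] apartD[OF ap(2)] apartD[OF ap(3)]
  have sc: "\<sigma> \<in> carrier Ug" using s normalised_closed[OF H] by blast
  have ap': "apart b a" "apart c a" "apart c b" using ap apart_sym by blast+
  define r where "r = (\<lambda>k. B (ax a) (\<sigma> *v ax k))"
  have rlin: "B (ax a) (\<sigma> *v (u + v)) = B (ax a) (\<sigma> *v u) + B (ax a) (\<sigma> *v v)"
     "B (ax a) (\<sigma> *v (u - v)) = B (ax a) (\<sigma> *v u) - B (ax a) (\<sigma> *v v)"
     "B (ax a) (\<sigma> *v (x *s u)) = x * B (ax a) (\<sigma> *v u)" for u v x
    by (simp_all add: matrix_vector_right_distrib matrix_vector_mult_diff_distrib matrix_vector_smult)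
  have up: "x \<in> root_level 7 a c H" if "x \<in> root_level k a b H \<or> x \<in> root_level k a (- b) H" "k < 7" for x k
  proof -
    have "x \<in> root_level (Suc k) a c H"
      using that ap root_level_right[OF H, of a b c x k] root_level_right[OF H, of a "- b" c x k] by auto
    then show ?thesis by (rule root_level_mono[rotated]) (use that in simp)
  qed
  have up': "x \<in> root_level 7 a c H" if "x \<in> root_level 4 a c H" for x
    using that by (rule root_level_mono[rotated]) simp
  have third: "r b * cj (r k) \<in> root_level 4 a b H" if "apart a k" "apart b k" for k
    unfolding r_def using that by (intro extract_product[OF H s ap(1)]) auto
  have via: "r b * cj (B (ax a) (\<sigma> *v (\<epsilon> *v ax c))) \<in> root_level 4 a b H"
    if "\<epsilon> \<in> EU R" "\<epsilon> *v ax a = ax a" "\<epsilon> *v ax b = ax b" for \<epsilon>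
    using extract_product_conj_group[OF H s ap, of b \<epsilon>] that by (simp add: r_def)
  have ra: "r b * cj (r a) \<in> root_level 4 a b H"
  proof -
    have "r b * cj (r c) + r b * cj (r a) \<in> root_level 4 a b H"
      using via[of "trv c a 1"] ds ap' by (simp add: trv_EU trv_ax rlin r_def algebra_simps)
    then show ?thesis using third[OF ap(2,3)] by (rule root_level_add_cancel[OF H ap(1)])
  qed
  have rb: "r b * cj (r b) \<in> root_level 4 a b H"
  proof -
    have "r b * cj (r c) + r b * cj (r b) \<in> root_level 4 a b H"
      using via[of "trv c b 1"] ds ap' by (simp add: trv_EU trv_ax rlin r_def algebra_simps)
    then show ?thesis using third[OF ap(2,3)] by (rule root_level_add_cancel[OF H ap(1)])
  qed
  have r0: "r b * cj (r ZeroI * y) \<in> root_level 4 a b H" if y: "y \<in> J_par R" for y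
  proof -
    obtain z where yz: "(y, z) \<in> \<Delta>" using y by (auto simp: J_par_def)
    have "(r b * cj (r c) + (r b * cj (r (- c))) * cj (be (- c) * cj z)) + r b * cj (r ZeroI * y) \<in> root_level 4 a b H"
      using via[of "trl c (y, z)"] ds yz by (simp add: trl_EU trl_ax rlin r_def algebra_simps)
    moreover have "r b * cj (r c) + (r b * cj (r (- c))) * cj (be (- c) * cj z) \<in> root_level 4 a b H"
      using third[of c] third[of "- c"] ap by (intro root_level_add[OF H ap(1) _ root_level_mult(1)]) auto
    ultimately show ?thesis by (rule root_level_add_cancel[OF H ap(1)])
  qed
  have rc: "r (- c) * cj (r k) \<in> root_level 4 a c H" if "k = b \<or> k = - b" for k
    unfolding r_def using that ap ap' by (intro extract_product[OF H s, of a "- c" k c]) auto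
  define \<kappa> where "\<kappa> = cj L * be (- c) * be (- b)"
  have opp: "r b * cj (r (- b)) - \<kappa> * r (- c) * cj (r c) \<in> root_level 7 a c H"
  proof -
    have ap3: "apart c (- b)" using ap' by simp
    have fb: "trv c (- b) 1 *v ax b = ax b - \<kappa> *s ax (- c)"
      using trv_ax(3)[OF ap3, of 1] by (simp add: \<kappa>_def)
    have "B (ax a) (\<sigma> *v (trv c (- b) 1 *v ax b)) * cj (B (ax a) (\<sigma> *v (trv c (- b) 1 *v ax c))) \<in> root_level 4 a (- b) H"
      using ds ap3 by (intro extract_product_conj_group[OF H s ap]) (auto simp: trv_EU trv_ax)
    then have "(r b - \<kappa> * r (- c)) * cj (r c + r (- b)) \<in> root_level 7 a c H"
      using up[of _ 4] unfolding fb trv_ax(1)[OF ap3] by (simp add: rlin r_def)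
    moreover have "(r b - \<kappa> * r (- c)) * cj (r c + r (- b))
       = (r b * cj (r c) - \<kappa> * (r (- c) * cj (r (- b)))) + (r b * cj (r (- b)) - \<kappa> * r (- c) * cj (r c))"
      by (simp add: algebra_simps)
    moreover have "r b * cj (r c) - \<kappa> * (r (- c) * cj (r (- b))) \<in> root_level 7 a c H"
      using up[OF disjI1[OF third[OF ap(2,3)]]] up'[OF rc] by (intro root_level_diff[OF H ap(2) _ root_level_mult(2)]) auto
    ultimately show ?thesis using root_level_add_cancel[OF H ap(2)] by metis
  qed
  have diag: "r b * cj (r (- a)) \<in> root_level 7 a c H"
    unfolding r_def by (intro extract_product_diag[OF H s ap]) simp
  have most: "r b * cj (r k) \<in> root_level 7 a c H" if hk: "k \<in> theta_hb" "k \<noteq> - b" for k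
  proof -
    consider "k = a" | "k = - a" | "k = b" | "apart a k" "apart b k"
      using hk ds not_apart[of a k] not_apart[of b k] by blast
    then show ?thesis
      using up[OF disjI1[OF ra]] up[OF disjI1[OF rb]] diag up[OF disjI1[OF third]] by cases auto
  qed
  have zero: "r b * cj (r ZeroI * y) \<in> root_level 7 a c H" if "y \<in> J_par R" for y
    using up[OF disjI1[OF r0[OF that]]] by simp
  have "r b * cj (r (- b)) \<in> root_level 7 a c H"
  proof (rule row_unimodular[OF H ap(2) sc, of a])
    fix k :: "'n theta" assume k: "k \<in> theta_hb"
    show "r b * cj (r (- b)) * cj (B (ax a) (\<sigma> *v ax k)) \<in> root_level 7 a c H"
    proof (cases "k = - b")
      case True
      have "r b * cj (r (- b)) * cj (r (- b)) = (r b * cj (r (- b)) - \<kappa> * r (- c) * cj (r c)) * cj (r (- b))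
          + (r (- c) * cj (r (- b))) * (\<kappa> * cj (r c))"
        by (simp add: algebra_simps)
      also have "\<dots> \<in> root_level 7 a c H"
        by (intro root_level_add[OF H ap(2)] root_level_mult(1)[OF opp] root_level_mult(1)[OF up'[OF rc]]) simp
      finally show ?thesis using True by (simp add: r_def)
    next
      case False
      then show ?thesis
        using root_level_mult(1)[OF most[OF k], of "cj (r (- b))"] by (simp add: r_def mult_ac)
    qed
  next
    fix y assume "y \<in> J_par R"
    then show "r b * cj (r (- b)) * cj (B (ax a) (\<sigma> *v ax ZeroI) * y) \<in> root_level 7 a c H"
      using root_level_mult(1)[OF zero, of y "cj (r (- b))"] by (simp add: r_def mult_ac)
  qed (use ds in simp)
  then have all: "r b * cj (r k) \<in> root_level 7 a c H" if "k \<in> theta_hb" for k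
    using most that by blast
  have "r b \<in> root_level 7 a c H"
    by (rule row_unimodular[OF H ap(2) sc, of a]) (use all zero ds in \<open>auto simp: r_def\<close>)
  then show ?thesis by (simp add: r_def)
qed

subsection \<open>From one root to all roots\<close>

text \<open>What \<open>H\<close> shows at every short root, up to the \<open>k\<close>-th power of the ideal.\<close>

definition all_levels :: "nat \<Rightarrow> ('a, 'n :: finite) tmat set \<Rightarrow> 'a set" where
  "all_levels k H = {x. \<forall>i j. apart i j \<longrightarrow> x \<in> root_level k i j H}"

lemma all_levelsI: "(\<And>i j. apart i j \<Longrightarrow> x \<in> root_level k i j H) \<Longrightarrow> l = k \<Longrightarrow> x \<in> all_levels l H"
  by (simp add: all_levels_def)

lemma all_levelsD: "x \<in> all_levels k H \<Longrightarrow> apart i j \<Longrightarrow> x \<in> root_level k i j H"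
  by (simp add: all_levels_def)

end

text \<open>The only consequence of \<open>n \<ge> 3\<close> that is ever used.\<close>

lemma third_index:
  fixes a b :: "'n :: finite theta"
  assumes "3 \<le> CARD('n)" "a \<in> theta_hb" "b \<in> theta_hb"
  obtains c where "apart a c" "apart b c"
proof -
  define f :: "'n theta \<Rightarrow> 'n" where "f = (\<lambda>t. case t of PosI i \<Rightarrow> i | NegI i \<Rightarrow> i | ZeroI \<Rightarrow> undefined)"
  have "card {f a, f b} \<le> 2" by (simp add: card_insert_if)
  then have "{f a, f b} \<noteq> UNIV" using assms(1) by auto
  then obtain i where i: "i \<noteq> f a" "i \<noteq> f b" by auto
  have "apart t (PosI i)" if "t \<in> theta_hb" "i \<noteq> f t" for t
    using that by (cases t) (auto simp: apart_def theta_hb_iff f_def)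
  then show thesis using that assms i by blast
qed

context relative
begin

context
  fixes H :: "('a, 'n :: finite) tmat set"
  assumes H: "normalised H" and n: "3 \<le> CARD('n)"
begin

lemma root_level_Suc: "x \<in> root_level k i j H \<Longrightarrow> x \<in> root_level (Suc k) i j H"
  by (rule root_level_mono[of k]) simp_all

lemma all_levels_mono: "k \<le> l \<Longrightarrow> x \<in> all_levels k H \<Longrightarrow> x \<in> all_levels l H"
  unfolding all_levels_def using root_level_mono by blast

text \<open>Every short root is at most three moves away from \<open>(a, b)\<close> and \<open>(a, -b)\<close>.\<close>

lemma spread3:
  assumes ap: "apart a b" and x: "x \<in> root_level k a b H" "x \<in> root_level k a (- b) H"
  shows "x \<in> all_levels (k + 3) H"
proof -
  have b: "x \<in> root_level k a b' H" if "b' = b \<or> b' = - b" for b' using that x by auto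
  have b1: "x \<in> root_level (Suc k) c b' H" if "b' = b \<or> b' = - b" "apart a c" "apart b c" for b' c
    by (rule root_level_left[OF H _ _ _ b[OF that(1)]]) (use that ap in \<open>auto simp: apart_sym[of c]\<close>)
  have d1: "x \<in> root_level (Suc k) a d H" if "apart a d" "apart b d" for d
    by (rule root_level_right[OF H ap _ _ x(1)]) (use that in auto)
  have "x \<in> root_level (Suc (Suc (Suc k))) c d H" if cd: "apart c d" for c d
  proof -
    note D = apartD[OF cd] apartD[OF ap]
    consider "d = b \<or> d = - b" | "d = a \<or> d = - a" | "apart a d" "apart b d"
      using D not_apart[of a d] not_apart[of b d] by blast
    then show ?thesis
    proof cases
      case 1
      note q = 1
      consider "c = a" | "c = - a" | "apart a c" using D not_apart[of a c] by blast
      then show ?thesis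
      proof cases
        case 1
        then show ?thesis using b[OF q] by (simp add: root_level_Suc)
      next
        case 2
        obtain c' where c': "apart a c'" "apart b c'" using third_index[OF n D(1,2)] n D third_index by blast
        have "x \<in> root_level (Suc (Suc k)) c d H"
          by (rule root_level_left[OF H _ _ _ b1[OF q c']]) (use 2 q ap c' in \<open>auto simp: apart_sym[of c']\<close>)
        then show ?thesis by (rule root_level_Suc)
      next
        case 3
        have "apart b c" using cd q apart_sym by auto
        then have "x \<in> root_level (Suc k) c d H" using b1[OF q 3] by blast
        then show ?thesis by (simp add: root_level_Suc)
      qed
    next
      case 2
      have ac: "apart a c" using cd 2 apart_sym by auto
      show ?thesis
      proof (cases "apart b c")
        case True
        have "x \<in> root_level (Suc (Suc k)) c d H"
          by (rule root_level_right[OF H _ _ _ b1[OF _ ac True, of b]]) (use cd True 2 ap apart_sym in auto)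
        then show ?thesis by (rule root_level_Suc)
      next
        case False
        obtain c' where c': "apart a c'" "apart b c'" using third_index[OF n] D by metis
        have cb: "c = b \<or> c = - b" using False D not_apart[of b c] by blast
        have "x \<in> root_level (Suc (Suc k)) c' d H"
          by (rule root_level_right[OF H _ _ _ b1[OF _ c', of b]]) (use c' 2 ap apart_sym in auto)
        then show ?thesis
          by (rule root_level_left[OF H, rotated 3]) (use cb 2 ap c' apart_sym in auto)
      qed
    next
      case 3
      note q = 3
      consider "c = a" | "c = - a" | "apart a c" using D not_apart[of a c] by blast
      then show ?thesis
      proof cases
        case 1
        then show ?thesis using d1[OF q] by (simp add: root_level_Suc)
      next
        case 2
        have "x \<in> root_level (Suc (Suc k)) b d H"
          by (rule root_level_left[OF H _ _ _ d1[OF q]]) (use q ap in auto)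
        then show ?thesis
          by (rule root_level_left[OF H, rotated 3]) (use q 2 ap apart_sym in auto)
      next
        case 3
        have "x \<in> root_level (Suc (Suc k)) c d H"
          by (rule root_level_left[OF H _ _ _ d1[OF q]]) (use q 3 cd in auto)
        then show ?thesis by (rule root_level_Suc)
      qed
    qed
  qed
  note main = this
  show ?thesis
  proof (rule all_levelsI[OF _ refl])
    fix i j :: "'n theta" assume "apart i j"
    from main[OF this] show "x \<in> root_level (k + 3) i j H" by (simp add: numeral_eq_Suc)
  qed
qed

text \<open>From the four roots that join \<open>a\<close> and \<open>a'\<close> to \<open>b\<close> and \<open>-b\<close>, two moves reach every root.\<close>

lemma spread2:
  assumes ap: "apart a b" "apart a' b" "apart a a'"
    and x: "\<And>a'' b'. a'' \<in> {a, a'} \<Longrightarrow> b' \<in> {b, - b} \<Longrightarrow> x \<in> root_level k a'' b' H"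
  shows "x \<in> all_levels (k + 2) H"
proof -
  have *: "x \<in> root_level (Suc (Suc k)) c d H"
    if cd: "apart c d" and ap: "apart a b" "apart a' b" "apart a a'"
    and x: "\<And>a'' b'. a'' \<in> {a, a'} \<Longrightarrow> b' \<in> {b, - b} \<Longrightarrow> x \<in> root_level k a'' b' H"
    and q: "d = b \<or> d = - b \<or> (apart a d \<and> apart b d)" for c d a a'
  proof -
    note D = apartD[OF cd] apartD[OF ap(1)] apartD[OF ap(2)] apartD[OF ap(3)]
    show ?thesis
    proof (cases "d = b \<or> d = - b")
      case True
      consider "c = a" | "apart a c" | "apart a' c"
        using D not_apart[of a c] ap(3) by (auto simp: apart_sym[of a'])
      then show ?thesis
      proof cases
        case 1
        then show ?thesis using x True by (simp add: root_level_Suc)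
      next
        case 2
        have "x \<in> root_level (Suc k) c d H"
          by (rule root_level_left[OF H _ _ _ x[of a d]]) (use cd True ap 2 in auto)
        then show ?thesis by (rule root_level_Suc)
      next
        case 3
        have "x \<in> root_level (Suc k) c d H"
          by (rule root_level_left[OF H _ _ _ x[of a' d]]) (use cd True ap 3 in auto)
        then show ?thesis by (rule root_level_Suc)
      qed
    next
      case False
      then have d: "apart a d" "apart b d" using q by auto
      have d1: "x \<in> root_level (Suc k) a d H"
        by (rule root_level_right[OF H ap(1) d x]) auto
      consider "c = a" | "c = - a" "apart a' d" | "c = - a" "d = a' \<or> d = - a'" | "apart a c"
        using D not_apart[of a c] not_apart[of a' d] by blast
      then show ?thesis
      proof cases
        case 1
        then show ?thesis using d1 by (simp add: root_level_Suc)
      next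
        case 2
        have "x \<in> root_level (Suc k) a' d H"
          by (rule root_level_right[OF H ap(2) 2(2) d(2) x]) auto
        then show ?thesis
          by (rule root_level_left[OF H, rotated 3]) (use 2 cd ap apart_sym in auto)
      next
        case 3
        have "x \<in> root_level (Suc k) c b H"
          by (rule root_level_left[OF H _ _ _ x[of a' b]]) (use 3 ap apart_sym in auto)
        then show ?thesis
          by (rule root_level_right[OF H, rotated 3]) (use 3 ap cd d in auto)
      next
        case 4
        show ?thesis by (rule root_level_left[OF H _ _ _ d1]) (use 4 d cd in auto)
      qed
    qed
  qed
  have "x \<in> root_level (Suc (Suc k)) c d H" if cd: "apart c d" for c d
  proof (cases "d = b \<or> d = - b \<or> (apart a d \<and> apart b d)")
    case True
    then show ?thesis using *[OF cd ap x] by blast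
  next
    case False
    have "apart a' d \<and> apart b d"
      using False apartD(2)[OF cd] apartD(1,2)[OF ap(1)] ap(3) not_apart[of b d] not_apart[of a d]
      by (auto simp: apart_sym[of a'])
    moreover have "apart a' a" using ap(3) apart_sym by blast
    ultimately show ?thesis using *[OF cd ap(2,1), of] x by blast
  qed
  note main = this
  show ?thesis
  proof (rule all_levelsI[OF _ refl])
    fix i j :: "'n theta" assume "apart i j"
    from main[OF this] show "x \<in> root_level (k + 2) i j H" by (simp add: numeral_eq_Suc)
  qed
qed

text \<open>Two moves also suffice when all roots avoiding the coordinate \<open>j\<close> are available.\<close>

lemma spread_off:
  assumes j: "j \<in> theta_hb" and x: "\<And>c d. apart c d \<Longrightarrow> apart j c \<Longrightarrow> apart j d \<Longrightarrow> x \<in> root_level k c d H"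
  shows "x \<in> all_levels (k + 2) H"
proof -
  have "x \<in> root_level (Suc k) c d H" if cd: "apart c d" for c d
  proof -
    consider "apart j c" "apart j d" | "c = j \<or> c = - j" "apart j d" | "d = j \<or> d = - j" "apart j c"
      using cd j apartD(1,2)[OF cd] not_apart[of j c] not_apart[of j d] by (auto simp: apart_def)
    then show ?thesis
    proof cases
      case 1
      then show ?thesis using x cd by (simp add: root_level_Suc)
    next
      case 2
      obtain e where e: "apart j e" "apart d e" using third_index[OF n j apartD(2)[OF cd]] .
      show ?thesis
        by (rule root_level_left[OF H _ _ _ x[of e d]]) (use e 2 cd apart_sym in auto)
    next
      case 3
      obtain e where e: "apart j e" "apart c e" using third_index[OF n j apartD(1)[OF cd]] .
      show ?thesis
        by (rule root_level_right[OF H _ _ _ x[of c e]]) (use e 3 cd apart_sym in auto)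
    qed
  qed
  then have "x \<in> all_levels (Suc k) H" by (rule all_levelsI[OF _ refl])
  then show ?thesis by (rule all_levels_mono[rotated]) simp
qed

lemma all_levels_add: "x \<in> all_levels k H \<Longrightarrow> y \<in> all_levels k H \<Longrightarrow> x + y \<in> all_levels k H"
  unfolding all_levels_def using root_level_add[OF H] by blast

lemma all_levels_mult: "x \<in> all_levels k H \<Longrightarrow> x * r \<in> all_levels k H"
  unfolding all_levels_def using root_level_mult by blast

lemma all_levels_cj: "x \<in> all_levels k H \<Longrightarrow> cj x \<in> all_levels k H"
  unfolding all_levels_def using root_level_flip apart_sym by blast

lemma ideal_All: "ideal (all_levels k H) ring_of_type_algebra"
  unfolding ideal_type_iff using all_levels_add all_levels_mult by (auto simp: all_levels_def root_level_zero[OF H])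

end

end

section \<open>all_levels generators of the upper level ideal\<close>

context unitary
begin

lemma upper_Y_cases:
  fixes H :: "('a, 'n :: finite) tmat set"
  assumes "x \<in> upper_Y R H"
  obtains \<sigma> :: "('a, 'n) tmat" and i j where "\<sigma> \<in> H" "i \<in> theta_hb" "j \<in> theta_hb" "i \<noteq> j"
    "x = \<sigma> $ i $ j \<or> x = \<sigma> $ i $ i - \<sigma> $ j $ j \<or> (\<exists>a\<in>J_par R. x = \<sigma> $ i $ ZeroI * a)
      \<or> (\<exists>a\<in>J_par R. x = cj a * m * \<sigma> $ ZeroI $ j)
      \<or> (\<exists>a\<in>J_par R. \<exists>b\<in>J_par R. x = cj a * m * (\<sigma> $ ZeroI $ ZeroI - \<sigma> $ j $ j) * b)"
proof -
  define Yij where "Yij = (\<lambda>(\<sigma> :: ('a, 'n) tmat) i j. {\<sigma> $ i $ j, \<sigma> $ i $ i - \<sigma> $ j $ j}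
     \<union> {\<sigma> $ i $ ZeroI * a |a. a \<in> J_par R}
     \<union> {cj a * m * \<sigma> $ ZeroI $ j |a. a \<in> J_par R}
     \<union> {cj a * m * (\<sigma> $ ZeroI $ ZeroI - \<sigma> $ j $ j) * b |a b. a \<in> J_par R \<and> b \<in> J_par R})"
  have "x \<in> (\<Union>\<sigma>\<in>H. \<Union>i\<in>theta_hb. \<Union>j\<in>theta_hb - {i}. Yij \<sigma> i j)"
    using assms unfolding upper_Y_def Yij_def .
  then obtain \<sigma> i j where s: "\<sigma> \<in> H" "i \<in> theta_hb" "j \<in> theta_hb - {i}" and x: "x \<in> Yij \<sigma> i j"
    by blast
  show thesis
  proof (rule that[of \<sigma> i j])
    show "x = \<sigma> $ i $ j \<or> x = \<sigma> $ i $ i - \<sigma> $ j $ j \<or> (\<exists>a\<in>J_par R. x = \<sigma> $ i $ ZeroI * a)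
      \<or> (\<exists>a\<in>J_par R. x = cj a * m * \<sigma> $ ZeroI $ j)
      \<or> (\<exists>a\<in>J_par R. \<exists>b\<in>J_par R. x = cj a * m * (\<sigma> $ ZeroI $ ZeroI - \<sigma> $ j $ j) * b)"
      using x unfolding Yij_def by blast
  qed (use s in auto)
qed

end

context relative
begin

interpretation Ug: group "Ug :: ('a, 'n :: finite) tmat monoid"
  by (rule group_Ug)

lemma mat_lin:
  fixes \<sigma> :: "('a, 'n :: finite) tmat"
  shows "\<sigma> *v (u + v) = \<sigma> *v u + \<sigma> *v v" "\<sigma> *v (u - v) = \<sigma> *v u - \<sigma> *v v" "\<sigma> *v (x *s u) = x *s (\<sigma> *v u)"
  by (simp_all add: matrix_vector_right_distrib matrix_vector_mult_diff_distrib matrix_vector_smult)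

text \<open>The entries of the inverse are the conjugated entries reflected in the antidiagonal, so that
  statements about columns turn into statements about rows.\<close>

lemma entry_inverse:
  assumes "\<sigma> \<in> carrier Ug"
  shows "B u (\<sigma> *v w) = cj (B w (inv\<^bsub>Ug\<^esub> \<sigma> *v u)) * L"
  using Ug_B_inv[OF assms, of w u] by (simp add: B_flip[of u])

lemma extract_entry':
  fixes \<sigma> :: "('a, 'n :: finite) tmat"
  assumes H: "normalised H" and s: "\<sigma> \<in> H" and ap: "apart a b" "apart a c" "apart b c"
  shows "B (ax a) (\<sigma> *v ax b) \<in> root_level 7 c b H"
proof -
  have "B (ax b) (inv\<^bsub>Ug\<^esub> \<sigma> *v ax a) \<in> root_level 7 b c H"
    using ap apart_sym by (intro extract_entry[OF H normalised_inv[OF H s]]) blast+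
  from root_level_mult(1)[OF root_level_flip[OF this], of L] show ?thesis
    unfolding entry_inverse[OF normalised_closed[OF H s]] .
qed

context
  assumes n: "3 \<le> CARD('n :: finite)"
begin

text \<open>Adding the column \<open>a\<close> to a column already dealt with turns the wanted entry into a summand of an
  entry of the previous kind. The following lemmas use the same device.\<close>

lemma extract_opposite:
  fixes \<sigma> :: "('a, 'n) tmat"
  assumes H: "normalised H" and s: "\<sigma> \<in> H" and ap: "apart a c"
  shows "B (ax a) (\<sigma> *v ax a) \<in> root_level 7 a c H"
proof -
  obtain b where b: "apart a b" "apart c b" using third_index[OF n] apartD[OF ap] by metis
  have b': "apart b a" "apart b c" using b apart_sym by blast+
  note ds = apartD[OF ap] apartD[OF b(1)] apartD[OF b(2)]
  have e: "trv b a 1 \<in> EU R" by (rule trv_EU[OF b'(1)])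
  have f: "trv b a 1 *v ax a = ax a" "trv b a 1 *v ax c = ax c"
    using ds b' by (simp_all add: trv_ax)
  have "B (ax a) ((inv\<^bsub>Ug\<^esub> (trv b a 1) ** \<sigma> ** trv b a 1) *v ax b) \<in> root_level 7 a c H"
    by (rule root_level_conj_group[OF e f extract_entry[OF normalised_conj_group[OF e H] conj_group_mem[OF e H s] b(1) ap b'(2)]])
  then have "B (ax a) (\<sigma> *v ax b) + B (ax a) (\<sigma> *v ax a) \<in> root_level 7 a c H"
    unfolding B_conj_group[OF e] f trv_ax(1)[OF b'(1)] by (simp add: mat_lin)
  moreover have "B (ax a) (\<sigma> *v ax b) \<in> root_level 7 a c H"
    by (intro extract_entry[OF H s] b ap b')
  ultimately show ?thesis by (rule root_level_add_cancel[OF H ap])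
qed

lemma extract_column0:
  fixes \<sigma> :: "('a, 'n) tmat"
  assumes H: "normalised H" and s: "\<sigma> \<in> H" and ap: "apart a c" and y: "y \<in> J_par R"
  shows "B (ax a) (\<sigma> *v (y *s ax ZeroI)) \<in> root_level 7 a c H"
proof -
  obtain b where b: "apart a b" "apart c b" using third_index[OF n] apartD[OF ap] by metis
  have b': "apart b a" "apart b c" using b apart_sym by blast+
  note ds = apartD[OF ap] apartD[OF b(1)] apartD[OF b(2)]
  obtain z where z: "(y, z) \<in> \<Delta>" using y by (auto simp: J_par_def)
  define \<epsilon> :: "('a, 'n) tmat" where "\<epsilon> = trl b (y, z)"
  have e: "\<epsilon> \<in> EU R" unfolding \<epsilon>_def using ds z by (intro trl_EU)
  have f: "\<epsilon> *v ax a = ax a" "\<epsilon> *v ax c = ax c"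
    unfolding \<epsilon>_def using ds by (simp_all add: trl_ax)
  have fb: "\<epsilon> *v ax b = ax b + y *s ax ZeroI + (be (- b) * cj z) *s ax (- b)"
    unfolding \<epsilon>_def using ds by (simp add: trl_ax)
  have "B (ax a) ((inv\<^bsub>Ug\<^esub> \<epsilon> ** \<sigma> ** \<epsilon>) *v ax b) \<in> root_level 7 a c H"
    by (rule root_level_conj_group[OF e f extract_entry[OF normalised_conj_group[OF e H] conj_group_mem[OF e H s] b(1) ap b'(2)]])
  then have "(B (ax a) (\<sigma> *v ax b) + B (ax a) (\<sigma> *v ax (- b)) * (be (- b) * cj z)) + B (ax a) (\<sigma> *v (y *s ax ZeroI)) \<in> root_level 7 a c H"
    unfolding B_conj_group[OF e] f fb by (simp add: mat_lin algebra_simps)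
  moreover have "B (ax a) (\<sigma> *v ax b) + B (ax a) (\<sigma> *v ax (- b)) * (be (- b) * cj z) \<in> root_level 7 a c H"
    using b b' ap by (intro root_level_add[OF H ap] extract_entry[OF H s] root_level_mult(1)[OF extract_entry[OF H s]]) auto
  ultimately show ?thesis by (rule root_level_add_cancel[OF H ap])
qed

lemma extract_row0:
  fixes \<sigma> :: "('a, 'n) tmat"
  assumes H: "normalised H" and s: "\<sigma> \<in> H" and ap: "apart b c" and y: "y \<in> J_par R"
  shows "B (y *s ax ZeroI) (\<sigma> *v ax b) \<in> root_level 7 c b H"
proof -
  have "B (ax b) (inv\<^bsub>Ug\<^esub> \<sigma> *v (y *s ax ZeroI)) \<in> root_level 7 b c H"
    by (rule extract_column0[OF H normalised_inv[OF H s] ap y])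
  from root_level_mult(1)[OF root_level_flip[OF this], of L] show ?thesis
    unfolding entry_inverse[OF normalised_closed[OF H s]] .
qed

text \<open>Conjugating by an elementary matrix moves the difference of two diagonal entries to an
  off-diagonal position.\<close>

lemma extract_diagonal:
  fixes \<sigma> :: "('a, 'n) tmat"
  assumes H: "normalised H" and s: "\<sigma> \<in> H" and ap: "apart k l" "apart k j" "apart l j"
  shows "\<sigma> $ k $ k - \<sigma> $ l $ l \<in> root_level 8 (- l) j H"
proof -
  have ap': "apart l k" "apart j k" "apart j l" using ap apart_sym by blast+
  note ds = apartD[OF ap(1)] apartD[OF ap(2)] apartD[OF ap(3)]
  define \<epsilon> :: "('a, 'n) tmat" where "\<epsilon> = trv l k 1"
  define \<kappa> where "\<kappa> = cj L * be (- l) * be k"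
  have e: "\<epsilon> \<in> EU R" unfolding \<epsilon>_def by (rule trv_EU[OF ap'(1)])
  have f: "\<epsilon> *v ax (- l) = ax (- l)" "\<epsilon> *v ax j = ax j" "\<epsilon> *v ax l = ax l + ax k"
    "\<epsilon> *v ax (- k) = ax (- k) - \<kappa> *s ax (- l)"
    unfolding \<epsilon>_def \<kappa>_def using ds ap'(1) by (simp_all add: trv_ax)
  let ?E = "\<lambda>a b. B (ax a) (\<sigma> *v ax b)"
  have "B (ax (- k)) ((inv\<^bsub>Ug\<^esub> \<epsilon> ** \<sigma> ** \<epsilon>) *v ax l) \<in> root_level 7 (- k) j (conj_group \<epsilon> H)"
    by (rule extract_entry[OF normalised_conj_group[OF e H] conj_group_mem[OF e H s]]) (use ap in auto)
  then have "B (ax (- k)) ((inv\<^bsub>Ug\<^esub> \<epsilon> ** \<sigma> ** \<epsilon>) *v ax l) \<in> root_level (Suc 7) (- l) j (conj_group \<epsilon> H)"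
    by (rule root_level_left[OF normalised_conj_group[OF e H], rotated 3]) (use ap in auto)
  then have "B (ax (- k)) ((inv\<^bsub>Ug\<^esub> \<epsilon> ** \<sigma> ** \<epsilon>) *v ax l) \<in> root_level 8 (- l) j H"
    using root_level_conj_group[OF e f(1,2)] by simp
  then have "(?E (- k) l - cj \<kappa> * ?E (- l) k) + (?E (- k) k - cj \<kappa> * ?E (- l) l) \<in> root_level 8 (- l) j H"
    unfolding B_conj_group[OF e] f by (simp add: mat_lin algebra_simps)
  moreover have "?E (- k) l - cj \<kappa> * ?E (- l) k \<in> root_level 8 (- l) j H"
  proof (intro root_level_diff[OF H] root_level_mult(2))
    have "?E (- k) l \<in> root_level 7 (- k) j H" using ap by (intro extract_entry[OF H s]) auto
    then have "?E (- k) l \<in> root_level (Suc 7) (- l) j H"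
      by (rule root_level_left[OF H, rotated 3]) (use ap in auto)
    then show "?E (- k) l \<in> root_level 8 (- l) j H" by simp
    have "?E (- l) k \<in> root_level 7 (- l) j H" using ap ap' by (intro extract_entry[OF H s]) auto
    then show "?E (- l) k \<in> root_level 8 (- l) j H" by (rule root_level_mono[rotated]) simp
  qed (use ap in auto)
  ultimately have "?E (- k) k - cj \<kappa> * ?E (- l) l \<in> root_level 8 (- l) j H"
    by (rule root_level_add_cancel[OF H, rotated]) (use ap in auto)
  moreover have "?E (- k) k - cj \<kappa> * ?E (- l) l = (\<sigma> $ k $ k - \<sigma> $ l $ l) * be (- k)"
  proof -
    have "cj \<kappa> * be (- l) = be (- k)"
      using be_cases[of "- l"] ds by (auto simp: \<kappa>_def be_minus[of k, symmetric] mult_ac)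
    then have "cj \<kappa> * (be (- l) * \<sigma> $ l $ l) = be (- k) * \<sigma> $ l $ l"
      by (simp only: mult.assoc[symmetric])
    then show ?thesis
      by (simp add: B_ax_left mat_ax_nth algebra_simps)
  qed
  ultimately show ?thesis
    using be_cj_be[of "- k"] ds by (auto intro: root_level_unit)
qed

lemma extract_diagonal0:
  fixes \<sigma> :: "('a, 'n) tmat"
  assumes H: "normalised H" and s: "\<sigma> \<in> H" and ap: "apart j k" "apart j l" "apart k l"
    and y: "y \<in> J_par R" "y' \<in> J_par R"
  shows "cj y * m * (\<sigma> $ ZeroI $ ZeroI - \<sigma> $ j $ j) * y' \<in> root_level 8 k l H"
proof -
  have ap': "apart k j" "apart l j" "apart l k" using ap apart_sym by blast+
  note ds = apartD[OF ap(1)] apartD[OF ap(2)] apartD[OF ap(3)]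
  obtain z' where z': "(y', z') \<in> \<Delta>" using y by (auto simp: J_par_def)
  define \<epsilon> :: "('a, 'n) tmat" where "\<epsilon> = trl j (y', z')"
  define t where "t = be (- j) * cj z'"
  define \<kappa> where "\<kappa> = cj L * be (- j) * cj y' * m"
  have e: "\<epsilon> \<in> EU R" unfolding \<epsilon>_def using ds z' by (intro trl_EU)
  have f: "\<epsilon> *v ax k = ax k" "\<epsilon> *v ax l = ax l" "\<epsilon> *v ax j = ax j + y' *s ax ZeroI + t *s ax (- j)"
    "\<epsilon> *v ax ZeroI = ax ZeroI - \<kappa> *s ax (- j)"
    unfolding \<epsilon>_def t_def \<kappa>_def using ds by (simp_all add: trl_ax)
  let ?E = "\<lambda>u b. B u (\<sigma> *v b)" let ?z0 = "ax ZeroI :: ('a, 'n) tvec"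
  let ?J = "ax j :: ('a, 'n) tvec" let ?J' = "ax (- j) :: ('a, 'n) tvec"
  have row: "x \<in> root_level 8 k l H'" if "x \<in> root_level 7 k j' H'" "j' = j \<or> j' = - j" "normalised H'" for x H' j'
  proof -
    have "x \<in> root_level (Suc 7) k l H'"
      by (rule root_level_right[OF that(3) _ _ _ that(1)]) (use that ap ap' in auto)
    then show ?thesis by simp
  qed
  have col: "x \<in> root_level 8 k l H" if "x \<in> root_level 7 (- j) l H" for x
  proof -
    have "x \<in> root_level (Suc 7) k l H"
      by (rule root_level_left[OF H _ _ _ that(1)]) (use ap ap' in auto)
    then show ?thesis by simp
  qed
  have "B (y *s ax ZeroI) ((inv\<^bsub>Ug\<^esub> \<epsilon> ** \<sigma> ** \<epsilon>) *v ax j) \<in> root_level 7 k j (conj_group \<epsilon> H)"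
    by (rule extract_row0[OF normalised_conj_group[OF e H] conj_group_mem[OF e H s] ap(1) y(1)])
  then have "B (y *s ax ZeroI) ((inv\<^bsub>Ug\<^esub> \<epsilon> ** \<sigma> ** \<epsilon>) *v ax j) \<in> root_level 8 k l H"
    using root_level_conj_group[OF e f(1,2)] row normalised_conj_group[OF e H] by blast
  moreover have "B (y *s ax ZeroI) ((inv\<^bsub>Ug\<^esub> \<epsilon> ** \<sigma> ** \<epsilon>) *v ax j)
     = ((?E (y *s ?z0) ?J + t * ?E (y *s ?z0) ?J') - cj y * cj \<kappa> * (?E ?J' (y' *s ?z0) + t * ?E ?J' ?J'))
      + (cj y * y' * ?E ?z0 ?z0 - cj y * cj \<kappa> * ?E ?J' ?J)"
    unfolding B_conj_group[OF e] mat_lin f by (simp add: algebra_simps)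
  moreover have "(?E (y *s ?z0) ?J + t * ?E (y *s ?z0) ?J') - cj y * cj \<kappa> * (?E ?J' (y' *s ?z0) + t * ?E ?J' ?J') \<in> root_level 8 k l H"
  proof (intro root_level_diff[OF H ap(3)] root_level_add[OF H ap(3)] root_level_mult(2))
    have "?E (y *s ?z0) ?J \<in> root_level 7 k j H" "?E (y *s ?z0) ?J' \<in> root_level 7 k (- j) H"
      using extract_row0[OF H s _ y(1), of j k] extract_row0[OF H s _ y(1), of "- j" k] ap by (simp_all del: B_smult_left)
    then show "?E (y *s ?z0) ?J \<in> root_level 8 k l H" "?E (y *s ?z0) ?J' \<in> root_level 8 k l H"
      using row H by blast+
    have "?E ?J' (y' *s ?z0) \<in> root_level 7 (- j) l H" "?E ?J' ?J' \<in> root_level 7 (- j) l H"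
      using extract_column0[OF H s _ y(2), of "- j" l] extract_opposite[OF H s, of "- j" l] ap by (simp_all add: mat_lin)
    then show "?E ?J' (y' *s ?z0) \<in> root_level 8 k l H" "?E ?J' ?J' \<in> root_level 8 k l H"
      using col by blast+
  qed
  ultimately have "cj y * y' * ?E ?z0 ?z0 - cj y * cj \<kappa> * ?E ?J' ?J \<in> root_level 8 k l H"
    using root_level_add_cancel[OF H ap(3)] by metis
  moreover have "cj y * y' * ?E ?z0 ?z0 - cj y * cj \<kappa> * ?E ?J' ?J = cj y * m * (\<sigma> $ ZeroI $ ZeroI - \<sigma> $ j $ j) * y'"
    using be_cases[of "- j"] ds by (auto simp: B_ax_left mat_ax_nth \<kappa>_def cj_m algebra_simps)
  ultimately show ?thesis by simp
qed

lemma entry_All: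
  fixes \<sigma> :: "('a, 'n) tmat"
  assumes H: "normalised H" and s: "\<sigma> \<in> H" and i: "i \<in> theta_hb" "j \<in> theta_hb" "i \<noteq> j"
  shows "\<sigma> $ i $ j \<in> all_levels 10 H"
proof -
  have "B (ax (- i)) (\<sigma> *v ax j) \<in> all_levels 10 H"
  proof (cases "j = - i")
    case True
    obtain c where c: "apart i c" using third_index[OF n i(1) i(1)] by blast
    have "B (ax (- i)) (\<sigma> *v ax j) \<in> all_levels (7 + 3) H"
      unfolding True using c by (intro spread3[OF H n, of "- i" c] extract_opposite[OF H s]) auto
    then show ?thesis by simp
  next
    case False
    then have ij: "apart i j" using i by (auto simp: apart_def theta_minus_eq)
    obtain c where c: "apart i c" "apart j c" using third_index[OF n i(1,2)] by blast
    have "B (ax (- i)) (\<sigma> *v ax j) \<in> all_levels (7 + 3) H"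
      using c ij by (intro spread3[OF H n, of "- i" c] extract_entry[OF H s]) auto
    then show ?thesis by simp
  qed
  then have "B (ax (- i)) (\<sigma> *v ax j) * cj (be (- i)) \<in> all_levels 10 H"
    by (rule all_levels_mult[OF H n])
  then show ?thesis
    using nth_eq_B[OF i(1), of "\<sigma> *v ax j"] by (simp add: mat_ax_nth mult.commute)
qed

lemma diagonal_All:
  fixes \<sigma> :: "('a, 'n) tmat"
  assumes H: "normalised H" and s: "\<sigma> \<in> H" and i: "i \<in> theta_hb" "j \<in> theta_hb" "i \<noteq> j"
  shows "\<sigma> $ i $ i - \<sigma> $ j $ j \<in> all_levels 10 H"
proof -
  have *: "\<sigma> $ k $ k - \<sigma> $ l $ l \<in> all_levels 10 H" if ap: "apart k l" for k l
  proof -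
    have ap': "apart l k" using ap apart_sym by blast
    obtain j where j: "apart k j" "apart l j" using third_index[OF n] apartD[OF ap] by metis
    have 1: "\<sigma> $ k $ k - \<sigma> $ l $ l \<in> root_level 8 (- l) b H" if "b \<in> {j, - j}" for b
      using that j ap by (auto intro!: extract_diagonal[OF H s])
    have 2: "\<sigma> $ k $ k - \<sigma> $ l $ l \<in> root_level 8 (- k) b H" if "b \<in> {j, - j}" for b
    proof -
      have "\<sigma> $ l $ l - \<sigma> $ k $ k \<in> root_level 8 (- k) b H"
        using that j ap' by (auto intro!: extract_diagonal[OF H s])
      from root_level_minus[OF this] show ?thesis by simp
    qed
    have "\<sigma> $ k $ k - \<sigma> $ l $ l \<in> all_levels (8 + 2) H"
      using 1 2 j ap' by (intro spread2[OF H n, of "- l" j "- k"]) auto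
    then show ?thesis by simp
  qed
  show ?thesis
  proof (cases "apart i j")
    case False
    then have j: "j = - i" using i not_apart by blast
    obtain c where c: "apart i c" using third_index[OF n i(1) i(1)] by blast
    then have "(\<sigma> $ i $ i - \<sigma> $ c $ c) + (\<sigma> $ c $ c - \<sigma> $ j $ j) \<in> all_levels 10 H"
      using j apart_sym[of c] by (intro all_levels_add[OF H n] *) auto
    then show ?thesis by simp
  qed (rule *)
qed

text \<open>The generators are available at some short roots after seven or eight powers of the ideal. Carrying
  them to all short roots takes three or two further moves, so that ten powers suffice in every case.\<close>

lemma upper_Y_All:
  fixes H :: "('a, 'n) tmat set"
  assumes H: "normalised H" and x: "x \<in> upper_Y R H"
  shows "x \<in> all_levels 10 H"
proof -
  from x obtain \<sigma> i j where s: "\<sigma> \<in> H" and i: "i \<in> theta_hb" "j \<in> theta_hb" "i \<noteq> j"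
    and x': "x = \<sigma> $ i $ j \<or> x = \<sigma> $ i $ i - \<sigma> $ j $ j \<or> (\<exists>a\<in>J_par R. x = \<sigma> $ i $ ZeroI * a)
      \<or> (\<exists>a\<in>J_par R. x = cj a * m * \<sigma> $ ZeroI $ j)
      \<or> (\<exists>a\<in>J_par R. \<exists>b\<in>J_par R. x = cj a * m * (\<sigma> $ ZeroI $ ZeroI - \<sigma> $ j $ j) * b)"
    by (rule upper_Y_cases)
  obtain c where c: "apart i c" using third_index[OF n i(1) i(1)] by blast
  obtain d where d: "apart j d" using third_index[OF n i(2) i(2)] by blast
  have col: "\<sigma> $ i $ ZeroI * a \<in> all_levels 10 H" if a: "a \<in> J_par R" for a
  proof -
    have "B (ax (- i)) (\<sigma> *v (a *s ax ZeroI)) \<in> all_levels (7 + 3) H"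
      using c by (intro spread3[OF H n, of "- i" c] extract_column0[OF H s _ a]) auto
    then have "B (ax (- i)) (\<sigma> *v (a *s ax ZeroI)) * cj (be (- i)) \<in> all_levels 10 H"
      using all_levels_mult[OF H n] by simp
    moreover have "\<sigma> $ i $ ZeroI * a = B (ax (- i)) (\<sigma> *v (a *s ax ZeroI)) * cj (be (- i))"
      using nth_eq_B[OF i(1), of "\<sigma> *v (a *s ax ZeroI)"] by (simp add: mat_lin mat_ax_nth mult_ac)
    ultimately show ?thesis by simp
  qed
  have row: "cj a * m * \<sigma> $ ZeroI $ j \<in> all_levels 10 H" if a: "a \<in> J_par R" for a
  proof -
    let ?r = "B (a *s ax ZeroI) (\<sigma> *v ax j)"
    have "cj ?r \<in> root_level 7 j c' H" if "c' = d \<or> c' = - d" for c'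
      using that d by (intro root_level_flip extract_row0[OF H s _ a]) auto
    then have "cj ?r \<in> all_levels (7 + 3) H"
      using d by (intro spread3[OF H n, of j d]) auto
    then have "?r \<in> all_levels 10 H" using all_levels_cj[OF H n, of "cj ?r"] by simp
    then show ?thesis by (simp add: B_ax_left mat_ax_nth mult_ac)
  qed
  have diag0: "cj a * m * (\<sigma> $ ZeroI $ ZeroI - \<sigma> $ j $ j) * b \<in> all_levels 10 H" if "a \<in> J_par R" "b \<in> J_par R" for a b
  proof -
    have "cj a * m * (\<sigma> $ ZeroI $ ZeroI - \<sigma> $ j $ j) * b \<in> all_levels (8 + 2) H"
      using that by (intro spread_off[OF H n i(2)] extract_diagonal0[OF H s])
    then show ?thesis by simp
  qed
  show ?thesis
    using x' entry_All[OF H s i] diagonal_All[OF H s i] col row diag0 by blast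
qed

end

end

section \<open>Odd form ideals and congruence of vectors\<close>

context unitary
begin

interpretation Ug: group "Ug :: ('a, 'n :: finite) tmat monoid"
  by (rule group_Ug)

interpretation heis: group "heis R"
  by (rule group_heis)

lemma tilde_iff: "x \<in> ideal_tilde R J \<longleftrightarrow> (\<forall>a\<in>J_par R. cj a * m * x \<in> J)"
  by (simp add: ideal_tilde_def)

lemma J_par_iff: "y \<in> J_par R \<longleftrightarrow> (\<exists>z. (y, z) \<in> \<Delta>)"
  by (simp add: J_par_def)

lemma Delta_fst: "\<alpha> \<in> \<Delta> \<Longrightarrow> fst \<alpha> \<in> J_par R"
  by (cases \<alpha>) (auto simp: J_par_iff)

lemma J_par_simps: "0 \<in> J_par R" "x \<in> J_par R \<Longrightarrow> x * c \<in> J_par R" "x \<in> J_par R \<Longrightarrow> c * x \<in> J_par R"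
  using Delta_fst[OF Delta_zero] Delta_fst[OF Delta_hact, of "(x, _)" c]
  by (auto simp: J_par_iff heis_act_def mult.commute)

text \<open>The value \<open>Q u\<close> with a hyperbolic part \<open>s\<close> split off. For \<open>u\<close> with zeroth coordinate in \<open>J(\<Delta>)\<close> some
  \<open>s\<close> makes it an element of \<open>\<Delta>\<close>.\<close>

definition D :: "'a \<Rightarrow> ('a, 'n :: finite) tvec \<Rightarrow> 'a \<times> 'a" where
  "D s u = Q u \<oplus>\<^sub>h (0, - s)"

lemma D_fst [simp]: "fst (D s u) = u $ ZeroI"
  by (simp add: D_def Q_alt hplus_def)

lemma D_Delta_J_par: "D s u \<in> \<Delta> \<Longrightarrow> u $ ZeroI \<in> J_par R"
  using Delta_fst[of "D s u"] by simp

lemma D_ex: "u $ ZeroI \<in> J_par R \<Longrightarrow> \<exists>s. D s u \<in> \<Delta>"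
proof -
  assume "u $ ZeroI \<in> J_par R"
  then obtain z where "(u $ ZeroI, z) \<in> \<Delta>" by (auto simp: J_par_iff)
  then have "D (bq u u - z) u \<in> \<Delta>" by (simp add: D_def Q_alt hplus_def)
  then show ?thesis by blast
qed

lemma D_hneg: "D s v \<oplus>\<^sub>h hneg (D s u) = Q v \<oplus>\<^sub>h hneg (Q u)"
  by (simp add: D_def hplus_def hneg_def algebra_simps)

lemma D_Ug: "\<sigma> \<in> carrier Ug \<Longrightarrow> D s u \<in> \<Delta> \<Longrightarrow> D s (\<sigma> *v u) \<in> \<Delta>"
  using Ug_Q[of \<sigma> u] Delta_hplus_hneg_cancel[of "D s (\<sigma> *v u)" "D s u"] by (simp add: D_hneg)

lemma D_add: "D (s + s' + B u v) (u + v) = D s u \<oplus>\<^sub>h D s' v \<oplus>\<^sub>h (0, tr (bq v u))"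
  by (simp add: D_def Q_add hplus_def algebra_simps)

lemma heis_conj: "\<alpha> \<oplus>\<^sub>h \<omega> \<oplus>\<^sub>h hneg \<alpha> = \<omega> \<oplus>\<^sub>h (0, tr (- (cj (fst \<alpha>) * m * fst \<omega>)))"
  by (simp add: hplus_def hneg_def tr_def cj_m algebra_simps)

lemma hact_tr: "(0, tr x) \<odot>\<^sub>h c = (0, tr (cj c * c * x))"
  by (simp add: heis_act_def tr_def algebra_simps)

end

locale form_ideal = unitary R
  for R :: "'a :: comm_ring_1 hermitian_form_ring" +
  fixes J :: "'a set" and \<Sigma> :: "('a \<times> 'a) set"
  assumes ofi: "odd_form_ideal R (J, \<Sigma>)"
begin

interpretation Ug: group "Ug :: ('a, 'n :: finite) tmat monoid"
  by (rule group_Ug)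

interpretation heis: group "heis R"
  by (rule group_heis)

lemma J_ideal: "ideal J ring_of_type_algebra"
  and J_cj: "x \<in> J \<Longrightarrow> cj x \<in> J"
  using ofi by (auto simp: odd_form_ideal_def bar_invariant_def)

lemma J_simps: "0 \<in> J" "x \<in> J \<Longrightarrow> y \<in> J \<Longrightarrow> x + y \<in> J" "x \<in> J \<Longrightarrow> x * r \<in> J" "x \<in> J \<Longrightarrow> r * x \<in> J"
    "x \<in> J \<Longrightarrow> - x \<in> J" "x \<in> J \<Longrightarrow> y \<in> J \<Longrightarrow> x - y \<in> J"
  using J_ideal ideal_type_minus[OF J_ideal] ideal_type_diff[OF J_ideal] unfolding ideal_type_iff
  by (auto simp: mult.commute)

lemma J_sum: "(\<And>k. k \<in> T \<Longrightarrow> f k \<in> J) \<Longrightarrow> sum f T \<in> J"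
  by (induction T rule: infinite_finite_induct) (auto intro: J_simps)

lemma Sg_zero: "(0, 0) \<in> \<Sigma>"
  and Sg_hplus: "\<alpha> \<in> \<Sigma> \<Longrightarrow> \<beta> \<in> \<Sigma> \<Longrightarrow> \<alpha> \<oplus>\<^sub>h \<beta> \<in> \<Sigma>"
  and Sg_hneg: "\<alpha> \<in> \<Sigma> \<Longrightarrow> hneg \<alpha> \<in> \<Sigma>"
  and Sg_act: "\<alpha> \<in> \<Sigma> \<Longrightarrow> \<alpha> \<odot>\<^sub>h c \<in> \<Sigma>"
  using ofi by (auto simp: odd_form_ideal_def heis_submodule_def subgroup_heis_iff)

lemma Sg_Delta: "\<alpha> \<in> \<Sigma> \<Longrightarrow> \<alpha> \<in> \<Delta>"
  and Sg_fst: "\<alpha> \<in> \<Sigma> \<Longrightarrow> fst \<alpha> \<in> ideal_tilde R J"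
  using ofi by (auto simp: odd_form_ideal_def Omega_max_def)

lemma Sg_tr: "x \<in> J \<Longrightarrow> (0, tr x) \<in> \<Sigma>"
proof -
  assume x: "x \<in> J"
  have "(0, tr x) \<otimes>\<^bsub>heis R\<^esub> \<one>\<^bsub>heis R\<^esub> \<in> Omega_min R J"
    unfolding Omega_min_def set_mult_def heis_set_act_def tr_def using x by (blast intro: generate.one)
  then show ?thesis using ofi by (auto simp: odd_form_ideal_def mult_heis one_heis)
qed

lemma Sg_hact: "\<delta> \<in> \<Delta> \<Longrightarrow> x \<in> J \<Longrightarrow> \<delta> \<odot>\<^sub>h x \<in> \<Sigma>"
proof -
  assume x: "\<delta> \<in> \<Delta>" "x \<in> J"
  have "(0, tr 0) \<otimes>\<^bsub>heis R\<^esub> (\<delta> \<odot>\<^sub>h x) \<in> Omega_min R J"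
    unfolding Omega_min_def set_mult_def heis_set_act_def tr_def using x J_simps(1) by (blast intro: generate.incl)
  then show ?thesis using ofi by (auto simp: odd_form_ideal_def mult_heis one_heis)
qed

lemma tilde_J: "a \<in> J_par R \<Longrightarrow> x \<in> ideal_tilde R J \<Longrightarrow> cj a * m * x \<in> J"
  by (simp add: tilde_iff)

lemma tilde_J': "a \<in> J_par R \<Longrightarrow> x \<in> ideal_tilde R J \<Longrightarrow> cj x * m * a \<in> J"
proof -
  assume "a \<in> J_par R" "x \<in> ideal_tilde R J"
  then have "cj (cj a * m * x) * L \<in> J" by (intro J_simps J_cj tilde_J)
  then show ?thesis by (simp add: cj_m mult_ac)
qed

text \<open>Congruence modulo \<open>\<Sigma>\<close> inside \<open>\<Delta>\<close>; it is compatible with the group structure because \<open>\<Sigma>\<close> is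
  normalised by \<open>\<Delta>\<close>, the commutators being of the form \<open>(0, tr x)\<close> with \<open>x\<close> in the ideal.\<close>

definition heq :: "'a \<times> 'a \<Rightarrow> 'a \<times> 'a \<Rightarrow> bool" where
  "heq \<alpha> \<beta> \<longleftrightarrow> \<alpha> \<oplus>\<^sub>h hneg \<beta> \<in> \<Sigma>"

lemma Sg_conj: "\<alpha> \<in> \<Delta> \<Longrightarrow> \<omega> \<in> \<Sigma> \<Longrightarrow> \<alpha> \<oplus>\<^sub>h \<omega> \<oplus>\<^sub>h hneg \<alpha> \<in> \<Sigma>"
  unfolding heis_conj by (intro Sg_hplus Sg_tr J_simps tilde_J Sg_fst Delta_fst)

lemma heq_refl: "heq \<alpha> \<alpha>"
  by (simp add: heq_def Sg_zero)

lemma heq_sym: "heq \<alpha> \<beta> \<Longrightarrow> heq \<beta> \<alpha>"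
  using Sg_hneg[of "\<alpha> \<oplus>\<^sub>h hneg \<beta>"] by (simp add: heq_def hneg_hplus_distrib)

lemma heq_trans: "heq \<alpha> \<beta> \<Longrightarrow> heq \<beta> \<gamma> \<Longrightarrow> heq \<alpha> \<gamma>"
  using Sg_hplus[of "\<alpha> \<oplus>\<^sub>h hneg \<beta>" "\<beta> \<oplus>\<^sub>h hneg \<gamma>"] by (simp add: heq_def hplus_assoc)

lemma heq_hplus:
  assumes "heq \<alpha> \<alpha>'" "heq \<beta> \<beta>'" "\<alpha>' \<in> \<Delta>"
  shows "heq (\<alpha> \<oplus>\<^sub>h \<beta>) (\<alpha>' \<oplus>\<^sub>h \<beta>')"
proof -
  have "(\<alpha> \<oplus>\<^sub>h hneg \<alpha>') \<oplus>\<^sub>h (\<alpha>' \<oplus>\<^sub>h (\<beta> \<oplus>\<^sub>h hneg \<beta>') \<oplus>\<^sub>h hneg \<alpha>') \<in> \<Sigma>"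
    by (rule Sg_hplus[OF _ Sg_conj]) (use assms in \<open>auto simp: heq_def\<close>)
  then show ?thesis by (simp add: heq_def hplus_assoc hneg_hplus_distrib)
qed

lemma heq_hact: "heq \<alpha> \<beta> \<Longrightarrow> heq (\<alpha> \<odot>\<^sub>h c) (\<beta> \<odot>\<^sub>h c)"
  using Sg_act[of "\<alpha> \<oplus>\<^sub>h hneg \<beta>" c] by (simp add: heq_def hact_hplus hact_hneg)

lemma heq_tr: "x - y \<in> J \<Longrightarrow> heq (0, tr x) (0, tr y)"
  using Sg_tr[of "x - y"] by (simp add: heq_def tr_diff)

lemma heq_hact_J:
  assumes "\<alpha> \<in> \<Delta>" "x - y \<in> J"
  shows "heq (\<alpha> \<odot>\<^sub>h x) (\<alpha> \<odot>\<^sub>h y)"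
proof -
  have "\<alpha> \<odot>\<^sub>h x = \<alpha> \<odot>\<^sub>h (x - y + y)" by simp
  also have "\<dots> = (\<alpha> \<odot>\<^sub>h (x - y) \<oplus>\<^sub>h (0, tr (cj y * snd \<alpha> * (x - y)))) \<oplus>\<^sub>h \<alpha> \<odot>\<^sub>h y"
    using hact_add[OF Delta_DeltaMax[OF assms(1)], of "x - y" y] by (simp add: hplus_assoc hplus_zero_pair)
  finally show ?thesis
    using assms by (simp add: heq_def hplus_assoc Sg_hplus Sg_hact Sg_tr J_simps)
qed

lemma heq_zero: "heq \<alpha> (0, 0) \<longleftrightarrow> \<alpha> \<in> \<Sigma>"
  by (simp add: heq_def)

text \<open>A unitary matrix preserves the hyperbolic value \<open>s\<close> of a vector exactly, while a scalar \<open>c\<close>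
  multiplies it by \<open>cj c * c\<close>. Splitting \<open>s\<close> off, so that only an element of \<open>\<Delta>\<close> remains, makes
  it meaningful to say that \<open>v\<close> is \<open>u\<close> times the scalar \<open>c\<close> modulo the odd form ideal.\<close>

definition rel :: "'a \<Rightarrow> 'a \<Rightarrow> ('a, 'n :: finite) tvec \<Rightarrow> ('a, 'n) tvec \<Rightarrow> bool" where
  "rel c s v u \<longleftrightarrow> D s u \<in> \<Delta> \<and> (\<forall>k\<in>theta_hb. v $ k - u $ k * c \<in> J) \<and> heq (D s v) (D s u \<odot>\<^sub>h c)"

lemma rel_Delta: "rel c s v u \<Longrightarrow> D s u \<in> \<Delta>"
  by (simp add: rel_def)

lemma rel_Delta': "rel c s v u \<Longrightarrow> D s v \<in> \<Delta>"
  unfolding rel_def heq_def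
  using Delta_hplus_hneg_cancel Sg_Delta Delta_hact by blast

lemma rel_nth: "rel c s v u \<Longrightarrow> k \<in> theta_hb \<Longrightarrow> v $ k - u $ k * c \<in> J"
  by (simp add: rel_def)

lemma rel_fst: "rel c s v u \<Longrightarrow> v $ ZeroI - u $ ZeroI * c \<in> ideal_tilde R J"
  unfolding rel_def heq_def using Sg_fst[of "D s v \<oplus>\<^sub>h hneg (D s u \<odot>\<^sub>h c)"]
  by (simp add: hplus_def hneg_def heis_act_def)

lemma rel_refl: "D s u \<in> \<Delta> \<Longrightarrow> rel 1 s u u"
  by (simp add: rel_def J_simps heq_refl)

lemma rel_comp:
  assumes "rel c s v u" "rel c' s w v"
  shows "rel (c * c') s w u"
  unfolding rel_def
proof (intro conjI ballI)
  fix k :: "'b theta" assume k: "k \<in> theta_hb"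
  from J_simps(2)[OF rel_nth[OF assms(2) k] J_simps(3)[OF rel_nth[OF assms(1) k], of c']] show "w $ k - u $ k * (c * c') \<in> J" by (simp add: algebra_simps)
next
  have "heq (D s w) (D s v \<odot>\<^sub>h c')" "heq (D s v \<odot>\<^sub>h c') (D s u \<odot>\<^sub>h c \<odot>\<^sub>h c')"
    using assms heq_hact by (auto simp: rel_def)
  then show "heq (D s w) (D s u \<odot>\<^sub>h (c * c'))" unfolding hact_hact by (rule heq_trans)
qed (use assms rel_Delta in blast)

lemma rel_cancel:
  assumes "rel c s v u" "rel c s w u"
  shows "rel 1 s v w"
  unfolding rel_def
proof (intro conjI ballI)
  fix k :: "'b theta" assume k: "k \<in> theta_hb"
  from J_simps(6)[OF rel_nth[OF assms(1) k] rel_nth[OF assms(2) k]] show "v $ k - w $ k * 1 \<in> J" by simp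
next
  have a: "heq (D s v) (D s u \<odot>\<^sub>h c)" and b: "heq (D s w) (D s u \<odot>\<^sub>h c)"
    using assms by (simp_all add: rel_def)
  from heq_trans[OF a heq_sym[OF b]] show "heq (D s v) (D s w \<odot>\<^sub>h 1)" by simp
qed (use rel_Delta'[OF assms(2)] in auto)

lemma cong_mult:
  assumes "x - x' * c \<in> J" "y - y' * c \<in> J"
  shows "cj x * y - cj c * c * (cj x' * y') \<in> J"
proof -
  from J_simps(2)[OF J_simps(3)[OF J_cj[OF assms(1)], of y] J_simps(4)[OF assms(2), of "cj x' * cj c"]] show ?thesis by (simp add: algebra_simps)
qed

lemma cong_bq:
  assumes "\<And>k. k \<in> theta_hb \<Longrightarrow> z $ k - z' $ k * c \<in> J" "\<And>k. k \<in> theta_hb \<Longrightarrow> v $ k - w $ k * c \<in> J"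
  shows "bq z v - cj c * c * bq z' w \<in> J"
  unfolding bq_def sum_distrib_left sum_subtractf[symmetric]
  by (intro J_sum cong_mult assms) (auto simp: theta_hb_iff)

lemma rel_B:
  assumes "rel c s v w" "u $ ZeroI \<in> J_par R"
  shows "B u v - B u w * c \<in> J"
proof -
  have "B u v - B u w * c = (\<Sum>k\<in>UNIV. cj (u $ k) * be k * (v $ (- k) - w $ (- k) * c))"
    by (simp add: B_alt sum_distrib_left sum_subtractf[symmetric] algebra_simps)
  also have "\<dots> \<in> J"
  proof (rule J_sum)
    fix k
    show "cj (u $ k) * be k * (v $ (- k) - w $ (- k) * c) \<in> J"
    proof (cases "k = ZeroI")
      case True
      then show ?thesis using tilde_J[OF assms(2) rel_fst[OF assms(1)]] by simp
    next
      case False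
      then have "- k \<in> theta_hb" by (simp add: theta_hb_iff)
      from J_simps(4)[OF rel_nth[OF assms(1) this]] show ?thesis .
    qed
  qed
  finally show ?thesis .
qed

text \<open>Additivity is what reduces statements about all vectors to basis vectors. The hypothesis on \<open>B\<close>
  holds for images under a unitary matrix; without it the values \<open>s\<close> would not match.\<close>

lemma rel_add:
  assumes r: "rel c s v u" "rel c s' v' u'" and e: "B v v' = B u u'"
  shows "rel c (s + s' + B u u') (v + v') (u + u')"
  unfolding rel_def
proof (intro conjI ballI)
  fix k :: "'b theta" assume k: "k \<in> theta_hb"
  from J_simps(2)[OF rel_nth[OF r(1) k] rel_nth[OF r(2) k]] show "(v + v') $ k - (u + u') $ k * c \<in> J" by (simp add: algebra_simps)
next
  have "heq (D s v \<oplus>\<^sub>h D s' v' \<oplus>\<^sub>h (0, tr (bq v' v)))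
      (D s u \<odot>\<^sub>h c \<oplus>\<^sub>h D s' u' \<odot>\<^sub>h c \<oplus>\<^sub>h (0, tr (cj c * c * bq u' u)))"
    using r by (intro heq_hplus heq_tr cong_bq Delta_hplus Delta_hact) (auto simp: rel_def)
  then show "heq (D (s + s' + B u u') (v + v')) (D (s + s' + B u u') (u + u') \<odot>\<^sub>h c)"
    unfolding D_add[of s s' u u'] unfolding e[symmetric] D_add hact_hplus hact_tr .
next
  show "D (s + s' + B u u') (u + u') \<in> \<Delta>"
    unfolding D_add using r by (intro Delta_hplus Delta_tr) (auto simp: rel_def)
qed

text \<open>A transvection along a basis vector changes \<open>D s w\<close> by the fixed element of \<open>\<Delta>\<close> acted on by
  \<open>B (ax i) w\<close> and by a term \<open>tr t\<close> with \<open>t\<close> quadratic in \<open>w\<close>. Both respect congruence.\<close>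

lemma rel_S:
  fixes u :: "('a, 'n :: finite) tvec"
  assumes i: "i \<in> theta_hb" and u: "u $ (- i) = 0" "u $ ZeroI \<in> J_par R"
    and \<alpha>: "Q u \<oplus>\<^sub>h (0, L * y) \<in> \<Delta>" and S: "S (ax i) u y \<in> carrier Ug" and r: "rel c s v w"
  shows "rel c s (S (ax i) u y *v v) (S (ax i) u y *v w)"
proof -
  define \<beta> where "\<beta> = (\<lambda>w. B (ax i) w)"
  define \<gamma> where "\<gamma> = (\<lambda>w. cj L * B u w)"
  define \<kappa> where "\<kappa> = (\<lambda>w. y * \<beta> w - \<gamma> w)"
  define z where "z = (\<lambda>w. \<beta> w *s u + \<kappa> w *s (ax i :: ('a, 'n) tvec))"
  define t where "t = (\<lambda>w. bq (z w) w + cj (\<gamma> w) * \<beta> w + bq (\<kappa> w *s ax i) (\<beta> w *s u))"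
  define \<alpha>0 where "\<alpha>0 = Q u \<oplus>\<^sub>h (0, L * y)"
  have \<alpha>0: "\<alpha>0 \<in> \<Delta>" using \<alpha> by (simp add: \<alpha>0_def)
  have iu: "B (ax i) u = 0" using u(1) by (simp add: B_ax_left)
  have Dg: "D s (S (ax i) u y *v w) = D s w \<oplus>\<^sub>h \<alpha>0 \<odot>\<^sub>h \<beta> w \<oplus>\<^sub>h (0, tr (t w))" for w
  proof -
    have "Q (S (ax i) u y *v w) = Q w \<oplus>\<^sub>h \<alpha>0 \<odot>\<^sub>h \<beta> w \<oplus>\<^sub>h (0, tr (t w))"
      using S_Q[OF iu, of y w] i by (simp add: \<beta>_def \<gamma>_def \<kappa>_def t_def z_def \<alpha>0_def)
    then show ?thesis by (simp add: D_def hplus_def algebra_simps)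
  qed
  have b: "\<beta> v - \<beta> w * c \<in> J"
    unfolding \<beta>_def using i by (intro rel_B[OF r]) (simp add: theta_hb_iff J_par_simps)
  from J_simps(4)[OF rel_B[OF r u(2)], of "cj L"] have g: "\<gamma> v - \<gamma> w * c \<in> J" by (simp add: \<gamma>_def algebra_simps)
  from J_simps(6)[OF J_simps(4)[OF b, of y] g] have k: "\<kappa> v - \<kappa> w * c \<in> J" by (simp add: \<kappa>_def algebra_simps)
  have negligible: "(\<beta> v *s x) $ l - (\<beta> w *s x) $ l * c \<in> J" "(\<kappa> v *s x) $ l - (\<kappa> w *s x) $ l * c \<in> J"
    for x :: "('a, 'n) tvec" and l
  proof -
    from J_simps(4)[OF b, of "x $ l"] J_simps(4)[OF k, of "x $ l"] show "(\<beta> v *s x) $ l - (\<beta> w *s x) $ l * c \<in> J" "(\<kappa> v *s x) $ l - (\<kappa> w *s x) $ l * c \<in> J"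
      by (simp_all add: algebra_simps)
  qed
  have z: "z v $ l - z w $ l * c \<in> J" for l
  proof -
    from J_simps(2)[OF negligible(1)[of u l] negligible(2)[of "ax i" l]] show ?thesis by (simp add: z_def algebra_simps)
  qed
  have vw: "v $ l - w $ l * c \<in> J" if "l \<in> theta_hb" for l
    using r that by (simp add: rel_def)
  have "(bq (z v) v - cj c * c * bq (z w) w) + (cj (\<gamma> v) * \<beta> v - cj c * c * (cj (\<gamma> w) * \<beta> w))
     + (bq (\<kappa> v *s ax i) (\<beta> v *s u) - cj c * c * bq (\<kappa> w *s ax i) (\<beta> w *s u)) \<in> J"
    by (intro J_simps(2) cong_bq cong_mult z vw negligible b g)
  then have t: "t v - cj c * c * t w \<in> J" unfolding t_def by (simp only: algebra_simps)
  show ?thesis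
    unfolding rel_def
  proof (intro conjI ballI)
    fix l :: "'n theta" assume l: "l \<in> theta_hb"
    have e: "S (ax i) u y *v x = x + z x" for x
      by (simp add: S_apply z_def \<beta>_def \<gamma>_def \<kappa>_def vec_eq_iff algebra_simps)
    from J_simps(2)[OF vw[OF l] z[of l]] show "(S (ax i) u y *v v) $ l - (S (ax i) u y *v w) $ l * c \<in> J"
      by (simp add: e algebra_simps)
  next
    have "heq (\<alpha>0 \<odot>\<^sub>h \<beta> v) (\<alpha>0 \<odot>\<^sub>h (\<beta> w * c))"
      by (intro heq_hact_J \<alpha>0 b)
    then show "heq (D s (S (ax i) u y *v v)) (D s (S (ax i) u y *v w) \<odot>\<^sub>h c)"
      unfolding Dg hact_hplus hact_hact hact_tr
      using r by (intro heq_hplus heq_tr t Delta_hplus Delta_hact \<alpha>0) (auto simp: rel_def)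
  next
    show "D s (S (ax i) u y *v w) \<in> \<Delta>" using D_Ug[OF S rel_Delta[OF r]] .
  qed
qed

lemma rel_EU:
  assumes "\<epsilon> \<in> EU R"
  shows "rel c s v w \<Longrightarrow> rel c s (\<epsilon> *v v) (\<epsilon> *v w)"
proof -
  have es: "rel c s (ES i j x *v v) (ES i j x *v w)" if ap: "apart i j" and r: "rel c s v w"
    for i j :: "'b theta" and x c s and v w :: "('a, 'b) tvec"
  proof -
    have "S (ax i) (x *s ax j) 0 \<in> carrier Ug" using ES_closed[OF ap, of x] by (simp add: ES_def)
    then show ?thesis
      unfolding ES_def using apartD[OF ap] r
      by (intro rel_S) (auto simp: Q_smult J_par_simps)
  qed
  have el: "rel c s (EL i \<alpha> *v v) (EL i \<alpha> *v w)" if i: "i \<in> theta_hb" and a: "\<alpha> \<in> \<Delta>" and r: "rel c s v w"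
    for i :: "'b theta" and \<alpha> c s and v w :: "('a, 'b) tvec"
  proof -
    have "S (ax i) (fst \<alpha> *s ax ZeroI) (cj (snd \<alpha>)) \<in> carrier Ug" using EL_closed[OF i a] by (simp add: EL_def)
    then show ?thesis
      unfolding EL_def using i r a
      by (intro rel_S) (auto simp: Q_smult theta_hb_iff Delta_fst Delta_conj_snd hplus_def heis_act_def)
  qed
  from assms show "rel c s v w \<Longrightarrow> rel c s (\<epsilon> *v v) (\<epsilon> *v w)"
    unfolding EU_def elem_gens_form_par
  proof (induction \<epsilon> arbitrary: v w rule: generate.induct)
    case (inv h)
    from inv(1) show ?case
    proof (elim UnE CollectE exE conjE)
      fix i j x assume "h = ES i j x" "apart i j"
      then show ?thesis using es inv(2) by (simp add: inv_ES)
    next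
      fix i \<alpha> assume "h = EL i \<alpha>" "i \<in> theta_hb" "\<alpha> \<in> \<Delta>"
      then show ?thesis using el inv(2) by (simp add: inv_EL Delta_hneg)
    qed
  next
    case (eng h1 h2)
    then show ?case by (simp add: matrix_vector_mul_assoc[symmetric])
  qed (use es el in auto)
qed

end

section \<open>Matrices that are scalar modulo an odd form ideal\<close>

context unitary
begin

lemma upper_Y_entry:
  fixes H :: "('a, 'n :: finite) tmat set" and \<sigma> :: "('a, 'n) tmat"
  assumes "\<sigma> \<in> H" "i \<in> theta_hb" "j \<in> theta_hb" "i \<noteq> j"
  shows "\<sigma> $ i $ j \<in> upper_Y R H" "\<sigma> $ i $ i - \<sigma> $ j $ j \<in> upper_Y R H"
  unfolding upper_Y_def by (rule UN_I[OF assms(1)], rule UN_I[OF assms(2)], rule UN_I[of j], use assms in auto)+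

lemma upper_Y_zero:
  fixes H :: "('a, 'n :: finite) tmat set" and \<sigma> :: "('a, 'n) tmat"
  assumes "\<sigma> \<in> H" "i \<in> theta_hb"
  shows "a \<in> J_par R \<Longrightarrow> \<sigma> $ i $ ZeroI * a \<in> upper_Y R H"
    "a \<in> J_par R \<Longrightarrow> cj a * m * \<sigma> $ ZeroI $ i \<in> upper_Y R H"
    "a \<in> J_par R \<Longrightarrow> b \<in> J_par R \<Longrightarrow> cj a * m * (\<sigma> $ ZeroI $ ZeroI - \<sigma> $ i $ i) * b \<in> upper_Y R H"
  unfolding upper_Y_def
    apply (rule UN_I[OF assms(1)], rule UN_I[OF assms(2)], rule UN_I[of "- i"], use assms minus_theta_neq[of i] in auto)[1]
   apply (rule UN_I[OF assms(1)], rule UN_I[of "- i"], use assms in simp, rule UN_I[of i], use assms minus_theta_neq[of i] in auto)[1]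
  apply (rule UN_I[OF assms(1)], rule UN_I[of "- i"], use assms in simp, rule UN_I[of i], use assms minus_theta_neq[of i] in auto)[1]
  done

text \<open>Pulling \<open>y\<close> into the vector exhibits the generator as the difference of two values that the relation
  \<open>rel\<close> compares.\<close>

lemma upper_Z_second:
  fixes \<sigma> :: "('a, 'n :: finite) tmat"
  shows "heis_minus R (heis_act R (heis_minus R (Q (column ZeroI \<sigma>)) (1, 0)) y \<otimes>\<^bsub>heis R\<^esub> (y, z)) (heis_act R (y, z) c)
    = Q (\<sigma> *v (y *s ax ZeroI)) \<oplus>\<^sub>h (0, z) \<oplus>\<^sub>h hneg ((y, z) \<odot>\<^sub>h c)"
proof -
  have "(\<alpha> \<oplus>\<^sub>h hneg (1, 0)) \<odot>\<^sub>h y \<oplus>\<^sub>h (y, z) = \<alpha> \<odot>\<^sub>h y \<oplus>\<^sub>h (0, z)" for \<alpha>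
    by (simp add: hplus_def hneg_def heis_act_def algebra_simps)
  then show ?thesis
    by (simp add: heis_minus_alt mult_heis matrix_vector_smult Q_smult mat_ax)
qed

lemma upper_Z_iff:
  fixes H :: "('a, 'n :: finite) tmat set"
  shows "\<zeta> \<in> upper_Z R H \<longleftrightarrow> (\<exists>\<sigma>\<in>H. \<exists>i\<in>theta_hb. \<zeta> = Q (\<sigma> *v ax i) \<or>
     (\<exists>y z. (y, z) \<in> \<Delta> \<and> \<zeta> = Q (\<sigma> *v (y *s ax ZeroI)) \<oplus>\<^sub>h (0, z) \<oplus>\<^sub>h hneg ((y, z) \<odot>\<^sub>h \<sigma> $ i $ i)))"
  unfolding upper_Z_def upper_Z_second mat_ax by blast

end

context form_ideal
begin

interpretation Ug: group "Ug :: ('a, 'n :: finite) tmat monoid"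
  by (rule group_Ug)

text \<open>\<open>\<sigma>\<close> acts on all vectors as the scalar \<open>c\<close> modulo the odd form ideal.\<close>

definition scalar_mod :: "'a \<Rightarrow> ('a, 'n :: finite) tmat \<Rightarrow> bool" where
  "scalar_mod c \<sigma> \<longleftrightarrow> \<sigma> \<in> carrier Ug \<and> (\<forall>u s. D s u \<in> \<Delta> \<longrightarrow> rel c s (\<sigma> *v u) u)"

lemma scalar_mod_closed: "scalar_mod c \<sigma> \<Longrightarrow> \<sigma> \<in> carrier Ug"
  and scalar_mod_rel: "scalar_mod c \<sigma> \<Longrightarrow> D s u \<in> \<Delta> \<Longrightarrow> rel c s (\<sigma> *v u) u"
  by (auto simp: scalar_mod_def)

lemma scalar_mod_conj:
  assumes e: "\<epsilon> \<in> EU R" and c: "scalar_mod c \<sigma>"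
  shows "scalar_mod c (inv\<^bsub>Ug\<^esub> \<epsilon> ** \<sigma> ** \<epsilon>)"
  unfolding scalar_mod_def
proof (intro conjI allI impI)
  show "inv\<^bsub>Ug\<^esub> \<epsilon> ** \<sigma> ** \<epsilon> \<in> carrier Ug"
    using e scalar_mod_closed[OF c] by simp
  fix u :: "('a, 'b) tvec" and s assume "D s u \<in> \<Delta>"
  then have "rel c s (\<sigma> *v (\<epsilon> *v u)) (\<epsilon> *v u)"
    using e by (intro scalar_mod_rel[OF c] D_Ug) auto
  from rel_EU[OF EU_inv[OF e] this] show "rel c s (inv\<^bsub>Ug\<^esub> \<epsilon> ** \<sigma> ** \<epsilon> *v u) u"
    using e by (simp add: matrix_vector_mul_assoc[symmetric])
qed

lemma D_ax: "i \<in> theta_hb \<Longrightarrow> D 0 (x *s ax i) = (0, 0)"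
  by (simp add: D_def Q_smult)

lemma D_ax0: "D (- z) (y *s ax ZeroI) = (y, z)"
  by (simp add: D_def Q_smult hplus_def heis_act_def)

lemma D_minus: "D (- z) u = Q u \<oplus>\<^sub>h (0, z)" and D_0: "D 0 u = Q u"
  by (simp_all add: D_def)

lemma scalar_mod_column: "scalar_mod c \<sigma> \<Longrightarrow> i \<in> theta_hb \<Longrightarrow> Q (\<sigma> *v ax i) \<in> \<Sigma>"
  using scalar_mod_rel[of c \<sigma> 0 "ax i"] D_ax[of i 1] by (simp add: rel_def heq_zero D_0)

lemma scalar_mod_entry:
  fixes \<sigma> :: "('a, 'n :: finite) tmat"
  assumes "scalar_mod c \<sigma>" "i \<in> theta_hb" "j \<in> theta_hb"
  shows "\<sigma> $ i $ j - (if i = j then c else 0) \<in> J"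
  using scalar_mod_rel[OF assms(1), of 0 "ax j"] D_ax[OF assms(3), of 1] rel_nth[of c 0 "\<sigma> *v ax j" "ax j" i] assms(2)
  by (cases "i = j") (simp_all add: mat_ax_nth ax_nth)

text \<open>The generators of the upper level are the obstructions to acting as a scalar on basis vectors.\<close>

lemma scalar_mod_upper:
  fixes H :: "('a, 'n :: finite) tmat set"
  assumes c: "\<And>\<sigma>. \<sigma> \<in> H \<Longrightarrow> \<exists>c. scalar_mod c \<sigma>"
  shows "upper_Y R H \<subseteq> J" "upper_Z R H \<subseteq> \<Sigma>"
proof -
  have dd: "\<sigma> $ i $ i - c \<in> J" if "scalar_mod c \<sigma>" "i \<in> theta_hb" for \<sigma> :: "('a, 'n) tmat" and i c
    using scalar_mod_entry[OF that(1,2,2)] by simp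
  show "upper_Y R H \<subseteq> J"
  proof
    fix x assume "x \<in> upper_Y R H"
    then show "x \<in> J"
    proof (cases rule: upper_Y_cases)
      case (1 \<sigma> i j)
      obtain c where c: "scalar_mod c \<sigma>" using assms 1 by blast
      have A: "\<sigma> $ i $ j \<in> J" using scalar_mod_entry[OF c 1(2,3)] 1(4) by simp
      have B: "\<sigma> $ i $ i - \<sigma> $ j $ j \<in> J"
        using J_simps(6)[OF dd[OF c 1(2)] dd[OF c 1(3)]] by simp
      have C: "\<sigma> $ i $ ZeroI * a \<in> J" if "a \<in> J_par R" for a
      proof -
        obtain z where "(a, z) \<in> \<Delta>" using \<open>a \<in> J_par R\<close> by (auto simp: J_par_iff)
        then have "rel c (- z) (\<sigma> *v (a *s ax ZeroI)) (a *s ax ZeroI)"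
          by (intro scalar_mod_rel[OF c]) (simp add: D_ax0)
        from rel_nth[OF this 1(2)] show ?thesis
          using 1(2) by (simp add: matrix_vector_smult mat_ax_nth theta_hb_iff mult.commute)
      qed
      have E: "cj a * m * \<sigma> $ ZeroI $ j \<in> J" if "a \<in> J_par R" for a
        using tilde_J[OF that Sg_fst[OF scalar_mod_column[OF c 1(3)]]] by (simp add: Q_alt mat_ax_nth)
      have F: "cj a * m * (\<sigma> $ ZeroI $ ZeroI - \<sigma> $ j $ j) * b \<in> J" if ab: "a \<in> J_par R" "b \<in> J_par R" for a b
      proof -
        obtain z where "(b, z) \<in> \<Delta>" using ab(2) by (auto simp: J_par_iff)
        then have "rel c (- z) (\<sigma> *v (b *s ax ZeroI)) (b *s ax ZeroI)"
          by (intro scalar_mod_rel[OF c]) (simp add: D_ax0)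
        from tilde_J[OF ab(1) rel_fst[OF this]]
        have "cj a * m * (b * (\<sigma> $ ZeroI $ ZeroI) - b * c) \<in> J"
          by (simp add: matrix_vector_smult mat_ax_nth)
        from J_simps(6)[OF this J_simps(4)[OF dd[OF c 1(3)], of "cj a * m * b"]] show ?thesis
          by (simp add: algebra_simps)
      qed
      show ?thesis using 1(5) A B C E F by blast
    qed
  qed
  show "upper_Z R H \<subseteq> \<Sigma>"
  proof
    fix \<zeta> assume "\<zeta> \<in> upper_Z R H"
    then obtain \<sigma> i where s: "\<sigma> \<in> H" and i: "i \<in> theta_hb" and z: "\<zeta> = Q (\<sigma> *v ax i) \<or>
     (\<exists>y z. (y, z) \<in> \<Delta> \<and> \<zeta> = Q (\<sigma> *v (y *s ax ZeroI)) \<oplus>\<^sub>h (0, z) \<oplus>\<^sub>h hneg ((y, z) \<odot>\<^sub>h \<sigma> $ i $ i))"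
      unfolding upper_Z_iff by blast
    obtain c where c: "scalar_mod c \<sigma>" using assms s by blast
    from z show "\<zeta> \<in> \<Sigma>"
    proof (elim disjE exE conjE)
      fix y z assume yz: "(y, z) \<in> \<Delta>"
        and \<zeta>: "\<zeta> = Q (\<sigma> *v (y *s ax ZeroI)) \<oplus>\<^sub>h (0, z) \<oplus>\<^sub>h hneg ((y, z) \<odot>\<^sub>h \<sigma> $ i $ i)"
      have "rel c (- z) (\<sigma> *v (y *s ax ZeroI)) (y *s ax ZeroI)"
        using yz by (intro scalar_mod_rel[OF c]) (simp add: D_ax0)
      then have "heq (D (- z) (\<sigma> *v (y *s ax ZeroI))) ((y, z) \<odot>\<^sub>h c)"
        by (simp add: rel_def D_ax0)
      moreover have "heq ((y, z) \<odot>\<^sub>h c) ((y, z) \<odot>\<^sub>h \<sigma> $ i $ i)"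
        using heq_sym[OF heq_hact_J[OF yz dd[OF c i]]] .
      ultimately have "heq (D (- z) (\<sigma> *v (y *s ax ZeroI))) ((y, z) \<odot>\<^sub>h \<sigma> $ i $ i)" by (rule heq_trans)
      then show "\<zeta> \<in> \<Sigma>" by (simp add: \<zeta> heq_def D_minus)
    qed (use scalar_mod_column[OF c i] in simp)
  qed
qed

text \<open>Conversely, a matrix whose contributions to the upper level lie in the odd form ideal acts as a
  scalar on all basis vectors, hence on all vectors by additivity.\<close>

lemma upper_scalar_mod:
  fixes H :: "('a, 'n :: finite) tmat set"
  assumes Y: "upper_Y R H \<subseteq> J" and Z: "upper_Z R H \<subseteq> \<Sigma>" and s: "\<sigma> \<in> H" and sc: "\<sigma> \<in> carrier Ug"
  shows "\<exists>c. scalar_mod c \<sigma>"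
proof -
  obtain i0 :: "'n theta" where i0: "i0 \<in> theta_hb" by (metis theta.distinct(1) theta_hb_iff)
  define c where "c = \<sigma> $ i0 $ i0"
  have ent: "\<sigma> $ k $ j - (if k = j then c else 0) \<in> J" if "k \<in> theta_hb" "j \<in> theta_hb" for k j
  proof (cases "k = j")
    case True
    then show ?thesis
      using upper_Y_entry(2)[OF s that(2) i0] Y J_simps(1) by (cases "j = i0") (auto simp: c_def)
  next
    case False
    then show ?thesis using upper_Y_entry(1)[OF s that False] Y by auto
  qed
  have zsec: "heq (Q (\<sigma> *v (y *s ax ZeroI)) \<oplus>\<^sub>h (0, z)) ((y, z) \<odot>\<^sub>h c)" if yz: "(y, z) \<in> \<Delta>" for y z
  proof -
    have "Q (\<sigma> *v (y *s ax ZeroI)) \<oplus>\<^sub>h (0, z) \<oplus>\<^sub>h hneg ((y, z) \<odot>\<^sub>h c) \<in> upper_Z R H"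
      unfolding upper_Z_iff c_def using s i0 yz by blast
    then show ?thesis using Z by (auto simp: heq_def)
  qed
  have base: "\<exists>s. rel c s (\<sigma> *v (x *s ax j)) (x *s ax j)" if x: "j = ZeroI \<Longrightarrow> x \<in> J_par R" for j :: "'n theta" and x
  proof (cases "j = ZeroI")
    case False
    then have j: "j \<in> theta_hb" by (simp add: theta_hb_iff)
    have "rel c 0 (\<sigma> *v (x *s ax j)) (x *s ax j)"
      unfolding rel_def
    proof (intro conjI ballI)
      show "D 0 (x *s ax j :: ('a, 'n) tvec) \<in> \<Delta>" by (simp add: D_ax j)
      fix k :: "'n theta" assume "k \<in> theta_hb"
      from J_simps(4)[OF ent[OF this j], of x] show "(\<sigma> *v (x *s ax j)) $ k - (x *s ax j) $ k * c \<in> J"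
        by (auto simp: matrix_vector_smult mat_ax_nth ax_nth algebra_simps)
    next
      have "Q (\<sigma> *v ax j) \<in> upper_Z R H" unfolding upper_Z_iff using s j by blast
      then have "Q (\<sigma> *v ax j) \<odot>\<^sub>h x \<in> \<Sigma>" using Z Sg_act by blast
      then show "heq (D 0 (\<sigma> *v (x *s ax j))) (D 0 (x *s ax j) \<odot>\<^sub>h c)"
        by (simp add: D_ax j heq_zero D_0 matrix_vector_smult Q_smult)
    qed
    then show ?thesis ..
  next
    case True
    obtain z where z: "(x, z) \<in> \<Delta>" using x[OF True] by (auto simp: J_par_iff)
    have "rel c (- z) (\<sigma> *v (x *s ax ZeroI)) (x *s ax ZeroI)"
      unfolding rel_def
    proof (intro conjI ballI)
      show "D (- z) (x *s ax ZeroI :: ('a, 'n) tvec) \<in> \<Delta>" using z by (simp add: D_ax0)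
      fix k :: "'n theta" assume k: "k \<in> theta_hb"
      then show "(\<sigma> *v (x *s ax ZeroI)) $ k - (x *s ax ZeroI) $ k * c \<in> J"
        using upper_Y_zero(1)[OF s k x[OF True]] Y
        by (auto simp: matrix_vector_smult mat_ax_nth theta_hb_iff mult.commute)
    next
      show "heq (D (- z) (\<sigma> *v (x *s ax ZeroI))) (D (- z) (x *s ax ZeroI) \<odot>\<^sub>h c)"
        using zsec[OF z] unfolding D_ax0 unfolding D_minus .
    qed
    then show ?thesis using True by blast
  qed
  have some: "\<exists>s. rel c s (\<sigma> *v u) u" if u: "u $ ZeroI \<in> J_par R" for u
  proof -
    have "\<exists>s. rel c s (\<sigma> *v (\<Sum>k\<in>T. u $ k *s ax k)) (\<Sum>k\<in>T. u $ k *s ax k)" if "finite T" for T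
      using that
    proof (induction T rule: finite_induct)
      case empty
      have "\<exists>s. rel c s (\<sigma> *v (0 *s ax ZeroI)) (0 *s ax ZeroI)"
        by (rule base) (simp add: J_par_simps)
      then show ?case by simp
    next
      case (insert k T)
      obtain s1 where s1: "rel c s1 (\<sigma> *v (u $ k *s ax k)) (u $ k *s ax k)"
        using base[of k "u $ k"] u by blast
      obtain s2 where s2: "rel c s2 (\<sigma> *v (\<Sum>k\<in>T. u $ k *s ax k)) (\<Sum>k\<in>T. u $ k *s ax k)"
        using insert by blast
      from rel_add[OF s1 s2 Ug_B[OF sc]] insert(1,2) show ?case
        by (auto simp: matrix_vector_right_distrib)
    qed
    from this[of UNIV] show ?thesis by (simp add: vec_expand[symmetric])
  qed
  have "rel c s (\<sigma> *v u) u" if su: "D s u \<in> \<Delta>" for s u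
  proof -
    obtain s0 where s0: "rel c s0 (\<sigma> *v u) u" using some D_Delta_J_par[OF su] by blast
    define t where "t = s0 - s"
    have e: "D s v = D s0 v \<oplus>\<^sub>h (0, t)" for v
      by (simp add: D_def t_def hplus_assoc)
    have "(0, t) = hneg (D s0 u) \<oplus>\<^sub>h D s u" by (simp add: e)
    then have t: "(0, t) \<in> \<Delta>" using Delta_hplus[OF Delta_hneg[OF rel_Delta[OF s0]] su] by simp
    have "heq (0, t) ((0, t) \<odot>\<^sub>h c)" using zsec[OF t] by simp
    then have "heq (D s (\<sigma> *v u)) (D s u \<odot>\<^sub>h c)"
      unfolding e hact_hplus using s0 by (intro heq_hplus Delta_hact) (auto simp: rel_def)
    then show ?thesis using s0 su by (simp add: rel_def)
  qed
  then show ?thesis using sc by (auto simp: scalar_mod_def)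
qed

subsection \<open>Congruence subgroups\<close>

lemma U_rel_iff: "\<sigma> \<in> U_rel R (J, \<Sigma>) \<longleftrightarrow> scalar_mod 1 \<sigma>"
proof
  assume c: "scalar_mod 1 \<sigma>"
  have "heis_cong R \<Sigma> (Q (\<sigma> *v u)) (Q u)" if "u \<in> M_par R" for u
  proof -
    obtain s where "D s u \<in> \<Delta>" using D_ex[of u] \<open>u \<in> M_par R\<close> by (auto simp: M_par_def)
    from scalar_mod_rel[OF c this] show ?thesis
      by (simp add: rel_def heq_def D_hneg heis_cong_def heis_minus_alt)
  qed
  then show "\<sigma> \<in> U_rel R (J, \<Sigma>)"
    using scalar_mod_closed[OF c] scalar_mod_entry[OF c] by (auto simp: U_rel_def mat_def)
next
  assume s: "\<sigma> \<in> U_rel R (J, \<Sigma>)"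
  then have sc: "\<sigma> \<in> carrier Ug" and ent: "\<And>i j. i \<in> theta_hb \<Longrightarrow> j \<in> theta_hb \<Longrightarrow> \<sigma> $ i $ j - mat 1 $ i $ j \<in> J"
    and q: "\<And>u. u $ ZeroI \<in> J_par R \<Longrightarrow> Q (\<sigma> *v u) \<oplus>\<^sub>h hneg (Q u) \<in> \<Sigma>"
    by (auto simp: U_rel_def M_par_def heis_cong_def heis_minus_alt)
  have "rel 1 s (\<sigma> *v u) u" if u: "D s u \<in> \<Delta>" for s u
    unfolding rel_def
  proof (intro conjI ballI u)
    have u0: "u $ ZeroI \<in> J_par R" using u by (rule D_Delta_J_par)
    show "heq (D s (\<sigma> *v u)) (D s u \<odot>\<^sub>h 1)"
      using q[OF u0] by (simp add: heq_def D_hneg)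
    have su0: "(\<sigma> *v u) $ ZeroI \<in> J_par R" using D_Delta_J_par[OF D_Ug[OF sc u]] .
    fix i :: "'b theta" assume i: "i \<in> theta_hb"
    define w where "w = \<sigma> *v ax (- i)"
    have "Q w \<in> \<Sigma>" using q[of "ax (- i)"] i by (simp add: w_def J_par_simps theta_hb_iff)
    then have w0: "w $ ZeroI \<in> ideal_tilde R J" using Sg_fst by (fastforce simp: Q_alt)
    have w: "w $ k - ax (- i) $ k \<in> J" if "k \<in> theta_hb" for k
      using ent[of k "- i"] that i by (simp add: w_def mat_ax_nth mat_def ax_nth)
    have "B (ax (- i)) (\<sigma> *v u) - B (ax (- i)) u = B (ax (- i) - w) (\<sigma> *v u)"
      using sc by (simp add: w_def)
    also have "\<dots> = (\<Sum>k\<in>UNIV. cj ((ax (- i) - w) $ k) * be k * (\<sigma> *v u) $ (- k))"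
      by (rule B_alt)
    also have "\<dots> \<in> J"
    proof (rule J_sum)
      fix k
      show "cj ((ax (- i) - w) $ k) * be k * (\<sigma> *v u) $ (- k) \<in> J"
      proof (cases "k = ZeroI")
        case True
        then show ?thesis
          using J_simps(5)[OF tilde_J'[OF su0 w0]] i by (simp add: theta_hb_iff)
      next
        case False
        then have "cj (- (w $ k - ax (- i) $ k)) \<in> J"
          using w by (intro J_cj J_simps(5)) (simp add: theta_hb_iff)
        from J_simps(3)[OF this, of "be k * (\<sigma> *v u) $ (- k)"] show ?thesis
          by (simp add: mult.assoc)
      qed
    qed
    finally have "be (- i) * ((\<sigma> *v u) $ i - u $ i) \<in> J"
      by (simp add: B_ax_left algebra_simps)
    from J_simps(4)[OF this, of "cj (be (- i))"] show "(\<sigma> *v u) $ i - u $ i * 1 \<in> J"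
      using be_cases[of "- i"] i by (auto simp: algebra_simps)
  qed
  then show "scalar_mod 1 \<sigma>" using sc by (simp add: scalar_mod_def)
qed

lemma scalar_mod_one_inv:
  assumes "scalar_mod 1 \<sigma>"
  shows "scalar_mod 1 (inv\<^bsub>Ug\<^esub> \<sigma>)"
  unfolding scalar_mod_def
proof (intro conjI allI impI)
  have sc: "\<sigma> \<in> carrier Ug" using assms by (rule scalar_mod_closed)
  then show "inv\<^bsub>Ug\<^esub> \<sigma> \<in> carrier Ug" by simp
  fix u :: "('a, 'b) tvec" and s assume u: "D s u \<in> \<Delta>"
  have "rel 1 s u (inv\<^bsub>Ug\<^esub> \<sigma> *v u)"
    using scalar_mod_rel[OF assms D_Ug[OF Ug_inv_closed[OF sc] u]] sc by simp
  from rel_cancel[OF rel_refl[OF rel_Delta[OF this]] this] show "rel 1 s (inv\<^bsub>Ug\<^esub> \<sigma> *v u) u" .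
qed

lemma scalar_mod_mult: "scalar_mod c \<sigma> \<Longrightarrow> scalar_mod c' \<tau> \<Longrightarrow> scalar_mod (c' * c) (\<sigma> ** \<tau>)"
  unfolding scalar_mod_def
proof (intro conjI allI impI; elim conjE)
  fix u :: "('a, 'b) tvec" and s assume a: "\<sigma> \<in> carrier Ug" "\<tau> \<in> carrier Ug" "\<forall>u s. D s u \<in> \<Delta> \<longrightarrow> rel c s (\<sigma> *v u) u"
    "\<forall>u s. D s u \<in> \<Delta> \<longrightarrow> rel c' s (\<tau> *v u) u" "D s u \<in> \<Delta>"
  then have "rel c' s (\<tau> *v u) u" "rel c s (\<sigma> *v (\<tau> *v u)) (\<tau> *v u)"
    using D_Ug by blast+
  from rel_comp[OF this] show "rel (c' * c) s (\<sigma> ** \<tau> *v u) u"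
    by (simp add: matrix_vector_mul_assoc)
qed simp

lemma U_rel_subgroup: "subgroup (U_rel R (J, \<Sigma>)) Ug"
proof (rule Ug.subgroupI)
  have "scalar_mod 1 (mat 1)" by (simp add: scalar_mod_def rel_refl)
  then show "U_rel R (J, \<Sigma>) \<noteq> {}" using U_rel_iff by blast
qed (auto simp: U_rel_iff scalar_mod_closed scalar_mod_one_inv dest: scalar_mod_mult)

lemma U_rel_conj:
  assumes c: "scalar_mod c \<sigma>" and \<rho>: "\<rho> \<in> U_rel R (J, \<Sigma>)"
  shows "\<sigma> ** \<rho> ** inv\<^bsub>Ug\<^esub> \<sigma> \<in> U_rel R (J, \<Sigma>)"
  unfolding U_rel_iff scalar_mod_def
proof (intro conjI allI impI)
  have sc: "\<sigma> \<in> carrier Ug" using c by (rule scalar_mod_closed)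
  have r: "scalar_mod 1 \<rho>" using \<rho> by (simp add: U_rel_iff)
  then have rc: "\<rho> \<in> carrier Ug" by (rule scalar_mod_closed)
  show "\<sigma> ** \<rho> ** inv\<^bsub>Ug\<^esub> \<sigma> \<in> carrier Ug" using sc rc by simp
  fix u :: "('a, 'b) tvec" and s assume u: "D s u \<in> \<Delta>"
  define w where "w = inv\<^bsub>Ug\<^esub> \<sigma> *v u"
  have w: "D s w \<in> \<Delta>" unfolding w_def using sc u by (intro D_Ug) auto
  have "rel (1 * c) s (\<sigma> *v (\<rho> *v w)) w"
    by (rule rel_comp[OF scalar_mod_rel[OF r w] scalar_mod_rel[OF c D_Ug[OF rc w]]])
  moreover have "rel c s u w"
    using scalar_mod_rel[OF c w] sc by (simp add: w_def)
  ultimately have "rel 1 s (\<sigma> *v (\<rho> *v w)) u"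
    by (intro rel_cancel[of c s _ w]) simp_all
  then show "rel 1 s (\<sigma> ** \<rho> ** inv\<^bsub>Ug\<^esub> \<sigma> *v u) u"
    by (simp add: w_def matrix_vector_mul_assoc[symmetric])
qed

text \<open>A scalar commutes with \<open>\<tau>\<close>, and \<open>\<tau>\<close> respects the congruence.\<close>

lemma scalar_mod_commutator:
  assumes c: "scalar_mod c \<sigma>" "scalar_mod c' (inv\<^bsub>Ug\<^esub> \<sigma>)" and \<tau>: "\<tau> \<in> EU R"
  shows "\<sigma> ** \<tau> ** inv\<^bsub>Ug\<^esub> \<sigma> ** inv\<^bsub>Ug\<^esub> \<tau> \<in> U_rel R (J, \<Sigma>)"
  unfolding U_rel_iff scalar_mod_def
proof (intro conjI allI impI)
  have sc: "\<sigma> \<in> carrier Ug" using c(1) by (rule scalar_mod_closed)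
  have tc: "\<tau> \<in> carrier Ug" using \<tau> by simp
  show "\<sigma> ** \<tau> ** inv\<^bsub>Ug\<^esub> \<sigma> ** inv\<^bsub>Ug\<^esub> \<tau> \<in> carrier Ug" using sc tc by simp
  fix u :: "('a, 'b) tvec" and s assume u: "D s u \<in> \<Delta>"
  define w where "w = inv\<^bsub>Ug\<^esub> \<tau> *v u"
  have w: "D s w \<in> \<Delta>" unfolding w_def using tc u by (intro D_Ug) auto
  have r1: "rel c' s (\<tau> *v (inv\<^bsub>Ug\<^esub> \<sigma> *v w)) u"
    using rel_EU[OF \<tau> scalar_mod_rel[OF c(2) w]] tc by (simp add: w_def)
  have r2: "rel (c' * c) s (\<sigma> *v (\<tau> *v (inv\<^bsub>Ug\<^esub> \<sigma> *v w))) u"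
    by (rule rel_comp[OF r1 scalar_mod_rel[OF c(1) rel_Delta'[OF r1]]])
  have r3: "rel (c' * c) s u u"
    using scalar_mod_rel[OF scalar_mod_mult[OF c] u] Ug.r_inv[OF sc] by simp
  from rel_cancel[OF r2 r3] show "rel 1 s (\<sigma> ** \<tau> ** inv\<^bsub>Ug\<^esub> \<sigma> ** inv\<^bsub>Ug\<^esub> \<tau> *v u) u"
    by (simp add: w_def matrix_vector_mul_assoc[symmetric])
qed

lemma scalar_mod_CU:
  fixes \<sigma> :: "('a, 'n :: finite) tmat"
  assumes c: "scalar_mod c \<sigma>" "scalar_mod c' (inv\<^bsub>Ug\<^esub> \<sigma>)"
  shows "\<sigma> \<in> CU_rel R (J, \<Sigma>)"
proof -
  define N :: "('a, 'n) tmat set" where "N = U_rel R (J, \<Sigma>)"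
  have N: "subgroup N Ug" unfolding N_def by (rule U_rel_subgroup)
  have sc: "\<sigma> \<in> carrier Ug" using c(1) by (rule scalar_mod_closed)
  have Nc: "N \<subseteq> carrier Ug" using N by (rule subgroup.subset)
  have "\<sigma> <#\<^bsub>Ug\<^esub> N #>\<^bsub>Ug\<^esub> inv\<^bsub>Ug\<^esub> \<sigma> = {\<sigma> ** \<rho> ** inv\<^bsub>Ug\<^esub> \<sigma> |\<rho>. \<rho> \<in> N}"
    by (auto simp: l_coset_def r_coset_def)
  also have "\<dots> = N"
  proof (intro equalityI subsetI)
    fix x assume "x \<in> {\<sigma> ** \<rho> ** inv\<^bsub>Ug\<^esub> \<sigma> |\<rho>. \<rho> \<in> N}"
    then show "x \<in> N" using U_rel_conj[OF c(1)] by (auto simp: N_def)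
  next
    fix x assume x: "x \<in> N"
    then have "inv\<^bsub>Ug\<^esub> \<sigma> ** x ** inv\<^bsub>Ug\<^esub> (inv\<^bsub>Ug\<^esub> \<sigma>) \<in> N"
      using U_rel_conj[OF c(2)] by (simp add: N_def)
    then have "inv\<^bsub>Ug\<^esub> \<sigma> ** x ** \<sigma> \<in> N" using Ug.inv_inv[OF sc] by simp
    moreover have "x = \<sigma> ** (inv\<^bsub>Ug\<^esub> \<sigma> ** x ** \<sigma>) ** inv\<^bsub>Ug\<^esub> \<sigma>"
      using sc by (intro mat_eqI) (simp add: matrix_vector_mul_assoc[symmetric])
    ultimately show "x \<in> {\<sigma> ** \<rho> ** inv\<^bsub>Ug\<^esub> \<sigma> |\<rho>. \<rho> \<in> N}" by blast
  qed
  finally have "\<sigma> \<in> NU_rel R (J, \<Sigma>)"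
    using sc Nc by (simp add: NU_rel_def normalizer_def stabilizer_def N_def)
  moreover have "generate Ug {\<sigma> \<otimes>\<^bsub>Ug\<^esub> \<tau> \<otimes>\<^bsub>Ug\<^esub> inv\<^bsub>Ug\<^esub> \<sigma> \<otimes>\<^bsub>Ug\<^esub> inv\<^bsub>Ug\<^esub> \<tau> |\<tau>. \<tau> \<in> EU R} \<subseteq> N"
    using scalar_mod_commutator[OF c] by (intro Ug.generate_subgroup_incl N) (auto simp: N_def)
  ultimately show ?thesis by (simp add: CU_rel_def N_def)
qed

end

section \<open>The upper level is an odd form ideal\<close>

context unitary
begin

interpretation Ug: group "Ug :: ('a, 'n :: finite) tmat monoid"
  by (rule group_Ug)

interpretation heis: group "heis R"
  by (rule group_heis)

text \<open>The Heisenberg group is not commutative, so a product of subgroups needs one of them to be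
  normalised by the other.\<close>

lemma subgroup_set_mult_heis:
  assumes A: "subgroup A (heis R)" and C: "subgroup C (heis R)"
    and conj: "\<And>a c. a \<in> A \<Longrightarrow> c \<in> C \<Longrightarrow> c \<oplus>\<^sub>h a \<oplus>\<^sub>h hneg c \<in> A"
  shows "subgroup (A <#>\<^bsub>heis R\<^esub> C) (heis R)"
proof -
  note A = A[unfolded subgroup_heis_iff] and C = C[unfolded subgroup_heis_iff]
  have mem: "x \<in> A <#>\<^bsub>heis R\<^esub> C \<longleftrightarrow> (\<exists>a\<in>A. \<exists>c\<in>C. x = a \<oplus>\<^sub>h c)" for x
    by (auto simp: set_mult_def mult_heis)
  show ?thesis
    unfolding subgroup_heis_iff
  proof (intro conjI ballI)
    show "(0, 0) \<in> A <#>\<^bsub>heis R\<^esub> C"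
      unfolding mem using A C hplus_zero(1) by metis
  next
    fix x y assume "x \<in> A <#>\<^bsub>heis R\<^esub> C" "y \<in> A <#>\<^bsub>heis R\<^esub> C"
    then obtain a c a' c' where x: "x = a \<oplus>\<^sub>h c" "y = a' \<oplus>\<^sub>h c'" and m: "a \<in> A" "c \<in> C" "a' \<in> A" "c' \<in> C"
      unfolding mem by blast
    have "x \<oplus>\<^sub>h y = (a \<oplus>\<^sub>h (c \<oplus>\<^sub>h a' \<oplus>\<^sub>h hneg c)) \<oplus>\<^sub>h (c \<oplus>\<^sub>h c')"
      by (simp add: x hplus_assoc)
    moreover have "a \<oplus>\<^sub>h (c \<oplus>\<^sub>h a' \<oplus>\<^sub>h hneg c) \<in> A" "c \<oplus>\<^sub>h c' \<in> C"
      using A C m conj by simp_all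
    ultimately show "x \<oplus>\<^sub>h y \<in> A <#>\<^bsub>heis R\<^esub> C" unfolding mem by blast
  next
    fix x assume "x \<in> A <#>\<^bsub>heis R\<^esub> C"
    then obtain a c where x: "x = a \<oplus>\<^sub>h c" and m: "a \<in> A" "c \<in> C"
      unfolding mem by blast
    have "hneg x = (hneg c \<oplus>\<^sub>h hneg a \<oplus>\<^sub>h hneg (hneg c)) \<oplus>\<^sub>h hneg c"
      by (simp add: x hneg_hplus_distrib hplus_assoc)
    moreover have "hneg c \<oplus>\<^sub>h hneg a \<oplus>\<^sub>h hneg (hneg c) \<in> A" "hneg c \<in> C"
      using A C m conj by blast+
    ultimately show "hneg x \<in> A <#>\<^bsub>heis R\<^esub> C" unfolding mem by blast
  qed
qed

lemma heis_set_act_subgroup: "subgroup (heis_set_act R A C) (heis R)"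
  unfolding heis_set_act_def by (rule heis.generate_is_subgroup) simp

lemma heis_set_act_incl: "\<alpha> \<in> A \<Longrightarrow> c \<in> C \<Longrightarrow> \<alpha> \<odot>\<^sub>h c \<in> heis_set_act R A C"
  unfolding heis_set_act_def by (rule generate.incl) blast

lemma heis_set_act_least:
  assumes "subgroup N (heis R)" "\<And>\<alpha> c. \<alpha> \<in> A \<Longrightarrow> c \<in> C \<Longrightarrow> \<alpha> \<odot>\<^sub>h c \<in> N"
  shows "heis_set_act R A C \<subseteq> N"
  unfolding heis_set_act_def using assms by (intro heis.generate_subgroup_incl) auto

lemma heis_set_act_hact:
  assumes "x \<in> heis_set_act R A C" "\<And>c. c \<in> C \<Longrightarrow> c * r \<in> C"
  shows "x \<odot>\<^sub>h r \<in> heis_set_act R A C"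
  using assms(1) unfolding heis_set_act_def
proof (induction rule: generate.induct)
  case one
  then show ?case by (simp add: one_heis generate.one[of "heis R", unfolded one_heis])
next
  case (incl h)
  then obtain \<alpha> c where h: "h = \<alpha> \<odot>\<^sub>h c" "\<alpha> \<in> A" "c \<in> C" by blast
  have "\<alpha> \<odot>\<^sub>h (c * r) \<in> generate (heis R) {\<alpha> \<odot>\<^sub>h b |\<alpha> b. \<alpha> \<in> A \<and> b \<in> C}"
    using h assms(2) by (intro generate.incl) blast
  then show ?case by (simp add: h hact_hact)
next
  case (inv h)
  then obtain \<alpha> c where h: "h = \<alpha> \<odot>\<^sub>h c" "\<alpha> \<in> A" "c \<in> C" by blast
  have "inv\<^bsub>heis R\<^esub> h \<odot>\<^sub>h r = inv\<^bsub>heis R\<^esub> (\<alpha> \<odot>\<^sub>h (c * r))"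
    by (simp add: h inv_heis hact_hneg hact_hact)
  moreover have "inv\<^bsub>heis R\<^esub> (\<alpha> \<odot>\<^sub>h (c * r)) \<in> generate (heis R) {\<alpha> \<odot>\<^sub>h b |\<alpha> b. \<alpha> \<in> A \<and> b \<in> C}"
    using h assms(2) by (intro generate.inv) blast
  ultimately show ?case by simp
next
  case (eng h1 h2)
  then show ?case using generate.eng by (fastforce simp: mult_heis hact_hplus)
qed

lemma set_mult_heis_least:
  assumes "subgroup N (heis R)" "A \<subseteq> N" "C \<subseteq> N"
  shows "A <#>\<^bsub>heis R\<^esub> C \<subseteq> N"
proof
  fix x assume "x \<in> A <#>\<^bsub>heis R\<^esub> C"
  then obtain a c where "a \<in> A" "c \<in> C" "x = a \<oplus>\<^sub>h c" unfolding set_mult_def mult_heis by blast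
  then show "x \<in> N" using assms unfolding subgroup_heis_iff by blast
qed

lemma set_mult_heis_hact:
  assumes "\<And>x. x \<in> A \<Longrightarrow> x \<odot>\<^sub>h r \<in> A" "\<And>x. x \<in> C \<Longrightarrow> x \<odot>\<^sub>h r \<in> C" "x \<in> A <#>\<^bsub>heis R\<^esub> C"
  shows "x \<odot>\<^sub>h r \<in> A <#>\<^bsub>heis R\<^esub> C"
proof -
  obtain a c where ac: "a \<in> A" "c \<in> C" "x = a \<oplus>\<^sub>h c"
    using assms(3) unfolding set_mult_def mult_heis by blast
  have "x \<odot>\<^sub>h r = a \<odot>\<^sub>h r \<oplus>\<^sub>h c \<odot>\<^sub>h r" by (simp add: ac(3) hact_hplus)
  then show ?thesis
    using assms(1)[OF ac(1)] assms(2)[OF ac(2)] unfolding set_mult_def mult_heis by blast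
qed

lemma set_mult_heis_left: "subgroup C (heis R) \<Longrightarrow> a \<in> A \<Longrightarrow> a \<in> A <#>\<^bsub>heis R\<^esub> C"
  unfolding set_mult_def mult_heis subgroup_heis_iff by (metis (no_types, lifting) UN_I hplus_zero(2) insertI1)

lemma set_mult_heis_right: "subgroup A (heis R) \<Longrightarrow> c \<in> C \<Longrightarrow> c \<in> A <#>\<^bsub>heis R\<^esub> C"
  unfolding set_mult_def mult_heis subgroup_heis_iff by (metis (no_types, lifting) UN_I hplus_zero(1) insertI1)

definition trset :: "'a set \<Rightarrow> ('a \<times> 'a) set" where
  "trset J = (\<lambda>x. (0, tr x)) ` J"

lemma Omega_min_alt: "Omega_min R J = trset J <#>\<^bsub>heis R\<^esub> heis_set_act R \<Delta> J"
  unfolding Omega_min_def trset_def tr_def by (simp add: image_def Bex_def conj_commute)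

context
  fixes J :: "'a set"
  assumes J: "ideal J ring_of_type_algebra" and Jcj: "\<And>x. x \<in> J \<Longrightarrow> cj x \<in> J"
begin

lemma Jc: "0 \<in> J" "x \<in> J \<Longrightarrow> y \<in> J \<Longrightarrow> x + y \<in> J" "x \<in> J \<Longrightarrow> x * r \<in> J" "x \<in> J \<Longrightarrow> r * x \<in> J"
    "x \<in> J \<Longrightarrow> - x \<in> J" "x \<in> J \<Longrightarrow> y \<in> J \<Longrightarrow> x - y \<in> J"
  using J ideal_type_minus[OF J] ideal_type_diff[OF J] unfolding ideal_type_iff
  by (auto simp: mult.commute)

lemma Jc_sum: "(\<And>k. k \<in> T \<Longrightarrow> f k \<in> J) \<Longrightarrow> sum f T \<in> J"
  by (induction T rule: infinite_finite_induct) (auto intro: Jc)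

lemma Omega_max_submodule: "heis_submodule R (Omega_max R J)"
  unfolding heis_submodule_def subgroup_heis_iff
proof (intro conjI ballI allI)
  show "(0, 0) \<in> Omega_max R J" by (simp add: Omega_max_def tilde_iff Jc)
next
  fix \<alpha> \<beta> assume a: "\<alpha> \<in> Omega_max R J" "\<beta> \<in> Omega_max R J"
  have "fst \<alpha> + fst \<beta> \<in> ideal_tilde R J"
    using a by (auto simp: Omega_max_def tilde_iff distrib_left intro: Jc)
  moreover have "cj (fst \<alpha>) * m * fst \<beta> \<in> J"
    using a Delta_fst by (auto simp: Omega_max_def tilde_iff)
  ultimately show "\<alpha> \<oplus>\<^sub>h \<beta> \<in> Omega_max R J"
    using a Delta_hplus[of \<alpha> \<beta>] by (auto simp: Omega_max_def hplus_def intro!: Jc(6) intro: Jc(2))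
next
  fix \<alpha> assume a: "\<alpha> \<in> Omega_max R J"
  have "- fst \<alpha> \<in> ideal_tilde R J"
    using a by (auto simp: Omega_max_def tilde_iff intro: Jc)
  moreover have "cj (fst \<alpha>) * m * fst \<alpha> \<in> J"
    using a Delta_fst by (auto simp: Omega_max_def tilde_iff)
  ultimately show "hneg \<alpha> \<in> Omega_max R J"
    using a Delta_hneg[of \<alpha>] by (auto simp: Omega_max_def hneg_def intro!: Jc(5,6))
next
  fix \<alpha> c assume a: "\<alpha> \<in> Omega_max R J"
  have "fst \<alpha> * c \<in> ideal_tilde R J"
    using a by (auto simp: Omega_max_def tilde_iff mult.assoc[symmetric] intro: Jc)
  moreover have "cj c * snd \<alpha> * c \<in> J"
    using a by (intro Jc(3) Jc(4)) (auto simp: Omega_max_def)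
  ultimately show "\<alpha> \<odot>\<^sub>h c \<in> Omega_max R J"
    using a Delta_hact[of \<alpha> c] by (auto simp: Omega_max_def heis_act_def)
qed

lemma Omega_max_subgroup: "subgroup (Omega_max R J) (heis R)"
  using Omega_max_submodule by (simp add: heis_submodule_def)

lemma tr_subgroup: "subgroup (trset J) (heis R)"
  unfolding subgroup_heis_iff
proof (intro conjI ballI)
  show "(0, 0) \<in> trset J" using Jc(1) tr_zero by (force simp: trset_def)
next
  fix \<alpha> \<beta> assume "\<alpha> \<in> trset J" "\<beta> \<in> trset J"
  then show "\<alpha> \<oplus>\<^sub>h \<beta> \<in> trset J"
    by (auto simp: trset_def tr_add[symmetric] intro!: Jc)
next
  fix \<alpha> assume "\<alpha> \<in> trset J"
  then show "hneg \<alpha> \<in> trset J"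
    by (auto simp: trset_def tr_minus[symmetric] intro!: Jc)
qed

lemma Omega_min_tr: "x \<in> J \<Longrightarrow> (0, tr x) \<in> Omega_min R J"
  unfolding Omega_min_alt by (rule set_mult_heis_left[OF heis_set_act_subgroup]) (simp add: trset_def)

lemma Omega_min_submodule: "heis_submodule R (Omega_min R J)"
  unfolding heis_submodule_def
proof (intro conjI ballI allI)
  show "subgroup (Omega_min R J) (heis R)"
    unfolding Omega_min_alt
  proof (rule subgroup_set_mult_heis[OF tr_subgroup heis_set_act_subgroup])
    fix a c assume "a \<in> trset J"
    then show "c \<oplus>\<^sub>h a \<oplus>\<^sub>h hneg c \<in> trset J"
      by (auto simp: trset_def heis_conj)
  qed
next
  fix \<alpha> r assume "\<alpha> \<in> Omega_min R J"
  then show "\<alpha> \<odot>\<^sub>h r \<in> Omega_min R J"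
    unfolding Omega_min_alt
  proof (rule set_mult_heis_hact[rotated 2])
    fix x assume "x \<in> heis_set_act R \<Delta> J"
    then show "x \<odot>\<^sub>h r \<in> heis_set_act R \<Delta> J" by (rule heis_set_act_hact) (rule Jc(3))
  qed (auto simp: trset_def hact_tr intro: Jc(4))
qed

lemma Omega_min_subset_max: "Omega_min R J \<subseteq> Omega_max R J"
  unfolding Omega_min_alt
proof (intro set_mult_heis_least heis_set_act_least Omega_max_subgroup)
  show "trset J \<subseteq> Omega_max R J"
    using Jcj by (auto simp: trset_def Omega_max_def tilde_iff Jc) (simp add: tr_def Jc)
  fix \<alpha> c assume "\<alpha> \<in> \<Delta>" "c \<in> J"
  then show "\<alpha> \<odot>\<^sub>h c \<in> Omega_max R J"
    using Delta_hact[of \<alpha> c] by (auto simp: Omega_max_def tilde_iff heis_act_def intro!: Jc)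
qed

text \<open>Modulo the ideal only one summand of \<open>B (\<sigma> e\<^sub>i) (\<sigma> e\<^sub>-\<^sub>i) = B e\<^sub>i e\<^sub>-\<^sub>i\<close> survives, and the two diagonal entries in
  it agree.\<close>

lemma diagonal_norm:
  fixes H :: "('a, 'n :: finite) tmat set"
  assumes Y: "upper_Y R H \<subseteq> J" and Hc: "H \<subseteq> carrier Ug" and s: "\<sigma> \<in> H" and i: "i \<in> theta_hb"
  shows "1 - cj (\<sigma> $ i $ i) * \<sigma> $ i $ i \<in> J"
proof -
  define c where "c = \<sigma> $ i $ i"
  have sc: "\<sigma> \<in> carrier Ug" using s Hc by blast
  have off: "\<sigma> $ k $ j \<in> J" if "k \<in> theta_hb" "j \<in> theta_hb" "k \<noteq> j" for k j
    using upper_Y_entry(1)[OF s that] Y by blast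
  have row: "cj a * m * \<sigma> $ ZeroI $ j \<in> J" if "a \<in> J_par R" "j \<in> theta_hb" for a j
    using upper_Y_zero(2)[OF s that(2,1)] Y by blast
  define f where "f = (\<lambda>k. cj (\<sigma> $ k $ i) * be k * \<sigma> $ (- k) $ (- i))"
  have "be i = sum f UNIV"
  proof -
    have "B (\<sigma> *v ax i) (\<sigma> *v ax (- i)) = be i" using sc by (simp add: Ug_B B_ax_ax)
    then show ?thesis by (simp add: B_alt mat_ax_nth f_def)
  qed
  also have "\<dots> = f i + sum f (UNIV - {i})" by (rule sum.remove) auto
  finally have "be i - f i = sum f (UNIV - {i})" by simp
  also have "\<dots> \<in> J"
  proof (rule Jc_sum)
    fix k assume k: "k \<in> UNIV - {i}"
    show "f k \<in> J"
    proof (cases "k = ZeroI")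
      case True
      have "Q (\<sigma> *v ax i) \<in> \<Delta>" using i by (intro Ug_Q_Delta sc) simp
      then have "\<sigma> $ ZeroI $ i \<in> J_par R" using Delta_fst by (fastforce simp: Q_alt mat_ax_nth)
      then show ?thesis using row[of _ "- i"] i True by (simp add: f_def)
    next
      case False
      then have "\<sigma> $ k $ i \<in> J" using off[of k i] k i by (auto simp: theta_hb_iff)
      then show ?thesis unfolding f_def by (intro Jc(3) Jcj)
    qed
  qed
  finally have a: "be i - f i \<in> J" .
  have b: "\<sigma> $ (- i) $ (- i) - c \<in> J"
    using upper_Y_entry(2)[OF s, of "- i" i] i Y minus_theta_neq[OF i] by (auto simp: c_def)
  have "(be i - f i) + cj c * be i * (\<sigma> $ (- i) $ (- i) - c) \<in> J"
    by (intro Jc(2) Jc(4) a b)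
  then have "be i * (1 - cj c * c) \<in> J" by (simp add: f_def c_def algebra_simps)
  from Jc(4)[OF this, of "cj (be i)"] show ?thesis
    using be_cases[OF i] by (auto simp: c_def)
qed

text \<open>For generators of the second kind the norm condition on the diagonal is what puts the second
  component into the ideal.\<close>

lemma upper_Z_subset_max:
  fixes H :: "('a, 'n :: finite) tmat set"
  assumes Y: "upper_Y R H \<subseteq> J" and Hc: "H \<subseteq> carrier Ug"
  shows "upper_Z R H \<subseteq> Omega_max R J"
proof
  fix \<zeta> assume "\<zeta> \<in> upper_Z R H"
  then obtain \<sigma> i where s: "\<sigma> \<in> H" and i: "i \<in> theta_hb" and z: "\<zeta> = Q (\<sigma> *v ax i) \<or>
     (\<exists>y z. (y, z) \<in> \<Delta> \<and> \<zeta> = Q (\<sigma> *v (y *s ax ZeroI)) \<oplus>\<^sub>h (0, z) \<oplus>\<^sub>h hneg ((y, z) \<odot>\<^sub>h \<sigma> $ i $ i))"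
    unfolding upper_Z_iff by blast
  have sc: "\<sigma> \<in> carrier Ug" using s Hc by blast
  have off: "\<sigma> $ k $ j \<in> J" if "k \<in> theta_hb" "j \<in> theta_hb" "k \<noteq> j" for k j
    using upper_Y_entry(1)[OF s that] Y by blast
  have row: "cj a * m * \<sigma> $ ZeroI $ j \<in> J" if "a \<in> J_par R" "j \<in> theta_hb" for a j
    using upper_Y_zero(2)[OF s that(2,1)] Y by blast
  from z show "\<zeta> \<in> Omega_max R J"
  proof (elim disjE exE conjE)
    assume \<zeta>: "\<zeta> = Q (\<sigma> *v ax i)"
    have "\<zeta> \<in> \<Delta>" unfolding \<zeta> using i by (intro Ug_Q_Delta sc) simp
    moreover have "fst \<zeta> \<in> ideal_tilde R J"
      using row i by (simp add: \<zeta> Q_alt mat_ax_nth tilde_iff)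
    moreover have "snd \<zeta> \<in> J"
    proof -
      have "bq (\<sigma> *v ax i) (\<sigma> *v ax i) \<in> J"
        unfolding bq_def
      proof (rule Jc_sum)
        fix k :: "'n theta" assume "k \<in> range PosI"
        then have k: "k \<in> theta_hb" by (auto simp: theta_hb_iff)
        have "\<sigma> $ (- k) $ i \<in> J \<or> \<sigma> $ k $ i \<in> J"
          using off[of k i] off[of "- k" i] k i minus_theta_neq[OF i] by (cases "k = i") auto
        then show "cj ((\<sigma> *v ax i) $ k) * (\<sigma> *v ax i) $ (- k) \<in> J"
          unfolding mat_ax_nth by (auto intro: Jc Jcj)
      qed
      then show ?thesis by (simp add: \<zeta> Q_alt)
    qed
    ultimately show ?thesis by (cases \<zeta>) (simp add: Omega_max_def)
  next
    fix y z assume yz: "(y, z) \<in> \<Delta>"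
      and \<zeta>: "\<zeta> = Q (\<sigma> *v (y *s ax ZeroI)) \<oplus>\<^sub>h (0, z) \<oplus>\<^sub>h hneg ((y, z) \<odot>\<^sub>h \<sigma> $ i $ i)"
    define c where "c = \<sigma> $ i $ i"
    define w where "w = \<sigma> *v (y *s ax ZeroI)"
    have y: "y \<in> J_par R" using Delta_fst[OF yz] by simp
    have "D (- z) w \<in> \<Delta>"
      unfolding w_def using yz by (intro D_Ug sc) (simp add: D_def Q_smult hplus_def heis_act_def)
    then have "\<zeta> \<in> \<Delta>"
      unfolding \<zeta> w_def[symmetric] by (intro Delta_hplus[OF _ Delta_hneg[OF Delta_hact[OF yz]]]) (simp add: D_def)
    moreover have "fst \<zeta> \<in> ideal_tilde R J"
      using upper_Y_zero(3)[OF s i _ y] Y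
      by (auto simp: \<zeta> hplus_def hneg_def Q_alt heis_act_def tilde_iff matrix_vector_smult mat_ax_nth algebra_simps)
    moreover have "snd \<zeta> \<in> J"
    proof -
      have w: "w $ k \<in> J" if "k \<in> theta_hb" for k
        using upper_Y_zero(1)[OF s that y] Y by (auto simp: w_def matrix_vector_smult mat_ax_nth mult.commute)
      have 1: "bq w w \<in> J"
        unfolding bq_def by (intro Jc_sum Jc(4) w) (auto simp: theta_hb_iff)
      have 2: "1 - cj c * c \<in> J"
        unfolding c_def by (rule diagonal_norm[OF Y Hc s i])
      have 3: "cj (\<sigma> $ ZeroI $ ZeroI - c) * (cj y * m * y) \<in> J"
      proof -
        have "cj y * m * (\<sigma> $ ZeroI $ ZeroI - c) * y \<in> J"
          using upper_Y_zero(3)[OF s i y y] Y by (auto simp: c_def)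
        from Jc(4)[OF Jcj[OF this], of L] show ?thesis
          by (simp add: cj_m algebra_simps)
      qed
      have "snd \<zeta> = bq w w + (1 - cj c * c) * z + cj (\<sigma> $ ZeroI $ ZeroI - c) * (cj y * m * y) * c"
        by (simp add: \<zeta> w_def[symmetric] c_def[symmetric] Q_alt hplus_def hneg_def heis_act_def algebra_simps)
          (simp add: w_def matrix_vector_smult mat_ax_nth algebra_simps)
      then show ?thesis using Jc(2)[OF Jc(2)[OF 1 Jc(3)[OF 2]] Jc(3)[OF 3]] by simp
    qed
    ultimately show ?thesis by (cases \<zeta>) (simp add: Omega_max_def)
  qed
qed

end

lemma genideal_type:
  fixes T :: "'a set"
  shows "ideal (genideal ring_of_type_algebra T) ring_of_type_algebra" "T \<subseteq> genideal ring_of_type_algebra T"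
    "ideal I ring_of_type_algebra \<Longrightarrow> T \<subseteq> I \<Longrightarrow> genideal ring_of_type_algebra T \<subseteq> I"
proof -
  interpret r: ring "ring_of_type_algebra :: 'a ring" by (rule ring_from_type_algebra)
  show "ideal (genideal ring_of_type_algebra T) ring_of_type_algebra" by (rule r.genideal_ideal) simp
  show "T \<subseteq> genideal ring_of_type_algebra T" by (rule r.genideal_self) simp
  show "ideal I ring_of_type_algebra \<Longrightarrow> T \<subseteq> I \<Longrightarrow> genideal ring_of_type_algebra T \<subseteq> I" by (rule r.genideal_minimal)
qed

lemma upper_level_alt:
  fixes H :: "('a, 'n :: finite) tmat set"
  assumes "upper_level R H = (J, \<Sigma>)"
  shows "J = genideal ring_of_type_algebra (upper_Y R H \<union> cj ` upper_Y R H)"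
    "\<Sigma> = Omega_min R J <#>\<^bsub>heis R\<^esub> heis_set_act R (upper_Z R H) UNIV"
  using assms by (auto simp: upper_level_def Let_def)

lemma upper_level_odd_form_ideal:
  fixes H :: "('a, 'n :: finite) tmat set"
  assumes Hc: "H \<subseteq> carrier Ug" and ul: "upper_level R H = (J, \<Sigma>)"
  shows "odd_form_ideal R (J, \<Sigma>)" "upper_Y R H \<subseteq> J" "upper_Z R H \<subseteq> \<Sigma>"
proof -
  let ?Y = "upper_Y R H"
  note al = upper_level_alt[OF ul]
  have J: "ideal J ring_of_type_algebra" and Y: "?Y \<subseteq> J" and Y': "cj ` ?Y \<subseteq> J"
    unfolding al(1) using genideal_type(1,2)[of "?Y \<union> cj ` ?Y"] by auto
  show "?Y \<subseteq> J" by (rule Y)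
  have Jcj: "cj x \<in> J" if "x \<in> J" for x
  proof -
    have "ideal {x. cj x \<in> J} ring_of_type_algebra"
      using J unfolding ideal_type_iff by auto
    moreover have "?Y \<union> cj ` ?Y \<subseteq> {x. cj x \<in> J}" using Y Y' by auto
    ultimately show ?thesis using genideal_type(3)[of "{x. cj x \<in> J}" "?Y \<union> cj ` ?Y"] that al(1) by auto
  qed
  note sub = Omega_min_submodule[OF J Jcj]
  have sub1: "subgroup (Omega_min R J) (heis R)" using sub by (simp add: heis_submodule_def)
  have Z: "upper_Z R H \<subseteq> Omega_max R J" by (rule upper_Z_subset_max[OF J Jcj Y Hc])
  have ZR: "heis_set_act R (upper_Z R H) UNIV \<subseteq> Omega_max R J"
    using Z Omega_max_submodule[OF J Jcj] Omega_max_subgroup[OF J Jcj]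
    by (intro heis_set_act_least) (auto simp: heis_submodule_def)
  have Sg: "subgroup \<Sigma> (heis R)"
    unfolding al(2)
  proof (rule subgroup_set_mult_heis[OF sub1 heis_set_act_subgroup])
    fix a c assume a: "a \<in> Omega_min R J" and c: "c \<in> heis_set_act R (upper_Z R H) UNIV"
    have "c \<in> \<Delta>" using c ZR by (auto simp: Omega_max_def)
    then have "fst c \<in> J_par R" by (rule Delta_fst)
    moreover have "fst a \<in> ideal_tilde R J" using a Omega_min_subset_max[OF J Jcj] by (auto simp: Omega_max_def)
    ultimately have "- (cj (fst c) * m * fst a) \<in> J" using J ideal_type_minus by (auto simp: tilde_iff)
    then show "c \<oplus>\<^sub>h a \<oplus>\<^sub>h hneg c \<in> Omega_min R J"
      unfolding heis_conj using a sub1 Omega_min_tr[OF J Jcj] by (auto simp: subgroup_heis_iff)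
  qed
  moreover have "\<alpha> \<odot>\<^sub>h r \<in> \<Sigma>" if "\<alpha> \<in> \<Sigma>" for \<alpha> r
    using that unfolding al(2)
    by (rule set_mult_heis_hact[rotated 2]) (use sub in \<open>auto simp: heis_submodule_def intro!: heis_set_act_hact\<close>)
  moreover have "Omega_min R J \<subseteq> \<Sigma>"
    unfolding al(2) using set_mult_heis_left[OF heis_set_act_subgroup] by blast
  moreover have "\<Sigma> \<subseteq> Omega_max R J"
    unfolding al(2)
    by (intro set_mult_heis_least ZR Omega_max_subgroup[OF J Jcj] Omega_min_subset_max[OF J Jcj])
  ultimately show "odd_form_ideal R (J, \<Sigma>)"
    using J Jcj by (auto simp: odd_form_ideal_def bar_invariant_def heis_submodule_def)
  show "upper_Z R H \<subseteq> \<Sigma>"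
  proof
    fix \<zeta> assume "\<zeta> \<in> upper_Z R H"
    then have "\<zeta> \<odot>\<^sub>h 1 \<in> heis_set_act R (upper_Z R H) UNIV" by (intro heis_set_act_incl) auto
    then show "\<zeta> \<in> \<Sigma>" unfolding al(2) using set_mult_heis_right[OF sub1] by simp
  qed
qed

text \<open>Together with the previous lemma: the upper level is the least odd form ideal modulo which all
  elements of \<open>H\<close> act as scalars.\<close>

lemma upper_level_least:
  fixes H :: "('a, 'n :: finite) tmat set"
  assumes ul: "upper_level R H = (J, \<Sigma>)" and o: "odd_form_ideal R (J', \<Sigma>')"
    and Y: "upper_Y R H \<subseteq> J'" and Z: "upper_Z R H \<subseteq> \<Sigma>'"
  shows "J \<subseteq> J'" "\<Sigma> \<subseteq> \<Sigma>'"
proof -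
  interpret f: form_ideal R J' \<Sigma>' by unfold_locales (rule o)
  note al = upper_level_alt[OF ul]
  have "cj ` upper_Y R H \<subseteq> J'" using Y f.J_cj by auto
  then show JJ: "J \<subseteq> J'"
    unfolding al(1) using Y by (intro genideal_type(3) f.J_ideal) auto
  have S: "subgroup \<Sigma>' (heis R)"
    unfolding subgroup_heis_iff using f.Sg_zero f.Sg_hplus f.Sg_hneg by blast
  show "\<Sigma> \<subseteq> \<Sigma>'"
    unfolding al(2) Omega_min_def tr_def[symmetric]
    using JJ Z f.Sg_tr f.Sg_hact f.Sg_act
    by (intro set_mult_heis_least heis_set_act_least S) auto
qed

text \<open>Acting as a scalar is invariant under conjugation by elementary matrices.\<close>

lemma upper_level_conj:
  fixes H :: "('a, 'n :: finite) tmat set"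
  assumes Hc: "H \<subseteq> carrier Ug" and e: "\<epsilon> \<in> EU R" and ul: "upper_level R H = (J, \<Sigma>)"
    and H': "\<And>\<tau>. \<tau> \<in> H' \<Longrightarrow> \<exists>\<sigma>\<in>H. \<tau> = inv\<^bsub>Ug\<^esub> \<epsilon> ** \<sigma> ** \<epsilon>" and ul': "upper_level R H' = (J', \<Sigma>')"
  shows "J' \<subseteq> J" "\<Sigma>' \<subseteq> \<Sigma>"
proof -
  note o = upper_level_odd_form_ideal[OF Hc ul]
  interpret f: form_ideal R J \<Sigma> by unfold_locales (rule o(1))
  have "\<exists>c. f.scalar_mod c \<tau>" if "\<tau> \<in> H'" for \<tau>
    using H'[OF that] f.upper_scalar_mod[OF o(2,3)] f.scalar_mod_conj[OF e] Hc by blast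
  from f.scalar_mod_upper[OF this] show "J' \<subseteq> J" "\<Sigma>' \<subseteq> \<Sigma>"
    using upper_level_least[OF ul' o(1)] by blast+
qed

theorem subgroup_le_CU:
  fixes H :: "('a, 'n :: finite) tmat set"
  assumes H: "subgroup H Ug"
  shows "H \<subseteq> CU_rel R (upper_level R H)"
proof -
  obtain J \<Sigma> where ul: "upper_level R H = (J, \<Sigma>)" by (cases "upper_level R H")
  note o = upper_level_odd_form_ideal[OF subgroup.subset[OF H] ul]
  interpret f: form_ideal R J \<Sigma> by unfold_locales (rule o(1))
  show ?thesis
  proof
    fix \<sigma> assume s: "\<sigma> \<in> H"
    then have "inv\<^bsub>Ug\<^esub> \<sigma> \<in> H" by (rule subgroup.m_inv_closed[OF H])
    then show "\<sigma> \<in> CU_rel R (upper_level R H)"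
      unfolding ul using f.upper_scalar_mod[OF o(2,3)] s subgroup.mem_carrier[OF H] f.scalar_mod_CU by metis
  qed
qed

end

section \<open>Long root elements\<close>

context unitary
begin

text \<open>For \<open>y = 0\<close> and isotropic \<open>u\<close> transvections are additive in the vector along which they move. In
  general a short correction term appears.\<close>

lemma S_add_left_long:
  assumes "B v u = 0" "B v' u = 0" "B v v = 0" "B v' v' = 0" "B v v' = 0" and u: "cj L * B u u = - y - cj L * cj y"
  shows "S (v + v') u y = S v u y ** (S v' u y ** S v (y *s v') 0)"
proof (rule mat_eqI)
  fix w
  have *: "B v' v = 0" "B u v = 0" "B u v' = 0"
    using assms by (simp_all add: B_eq_0_flip)
  show "S (v + v') u y *v w = S v u y ** (S v' u y ** S v (y *s v') 0) *v w"
    using assms(1-5) *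
  proof (simp add: matrix_vector_mul_assoc[symmetric] S_apply vec_eq_iff algebra_simps, intro allI)
    fix i
    have "(y + cj y * cj L + B u u * cj L) * (v $ i * B v' w) = 0" using u by (simp add: algebra_simps)
    then show "y * (v $ i * B v' w) + (cj y * (v $ i * (B v' w * cj L)) + v $ i * (B u u * (B v' w * cj L))) = 0"
      by (simp add: algebra_simps)
  qed
qed

lemma S_smult_left_long: "S (t *s v) u y = S v (cj t *s u) (cj t * t * y)"
  by (rule mat_eqI) (simp add: S_apply vec_eq_iff mult_ac)

text \<open>Conjugating a long root element by a short one spreads it to a second index.\<close>

lemma conj_ES_EL:
  fixes t :: 'a and k i :: "'n :: finite theta"
  assumes ap: "apart k i" and b: "\<beta> \<in> \<Delta>"
  defines "g \<equiv> ES (- k) i (cj (be (- k)) * t)"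
  shows "g ** EL k \<beta> ** inv\<^bsub>Ug\<^esub> g = EL k \<beta> ** (EL i (\<beta> \<odot>\<^sub>h cj t) ** ES k i (cj (snd \<beta>) * t))"
proof -
  note d = apartD[OF ap]
  have bb: "be (- k) * cj (be (- k)) = 1" using d by (intro be_cj_be) simp
  have g: "g *v ax k = ax k + t *s ax i" "g *v ax ZeroI = ax ZeroI"
    using d bb by (simp_all add: g_def ES_apply B_ax_ax vec_eq_iff mult_ac)
  have gc: "g \<in> carrier Ug" using ap by (simp add: g_def)
  have u: "cj L * B (fst \<beta> *s ax ZeroI) (fst \<beta> *s ax ZeroI) = - cj (snd \<beta>) - cj L * cj (cj (snd \<beta>))"
  proof -
    have e: "fst \<beta> * (cj (fst \<beta>) * m) = - snd \<beta> - L * cj (snd \<beta>)"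
      using Delta_snd[of "fst \<beta>" "snd \<beta>"] b by (simp add: mult_ac)
    have "cj L * B (fst \<beta> *s ax ZeroI) (fst \<beta> *s ax ZeroI) = cj L * (fst \<beta> * (cj (fst \<beta>) * m))"
      by (simp add: B_ax_ax mult_ac)
    also have "\<dots> = cj L * (- snd \<beta> - L * cj (snd \<beta>))" by (simp only: e)
    also have "\<dots> = - cj (snd \<beta>) - cj L * cj (cj (snd \<beta>))" by (simp add: algebra_simps)
    finally show ?thesis .
  qed
  show ?thesis
    unfolding EL_def S_conj[OF gc]
    using d S_add_left_long[OF _ _ _ _ _ u, of "ax k" "t *s ax i"]
    by (simp add: g matrix_vector_smult B_ax_ax S_smult_left_long ES_def heis_act_def mult_ac vector_smult_assoc)
qed

end

context relative
begin

interpretation Ug: group "Ug :: ('a, 'n :: finite) tmat monoid"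
  by (rule group_Ug)

lemma EL_H_hplus: "normalised H \<Longrightarrow> i \<in> theta_hb \<Longrightarrow> EL i \<alpha> \<in> H \<Longrightarrow> EL i \<beta> \<in> H \<Longrightarrow> EL i (\<alpha> \<oplus>\<^sub>h \<beta>) \<in> H"
  using normalised_mult[of H "EL i \<beta>" "EL i \<alpha>"] by (simp add: EL_hplus)

lemma EL_H_hneg: "normalised H \<Longrightarrow> i \<in> theta_hb \<Longrightarrow> \<alpha> \<in> \<Delta> \<Longrightarrow> EL i \<alpha> \<in> H \<Longrightarrow> EL i (hneg \<alpha>) \<in> H"
  using normalised_inv[of H "EL i \<alpha>"] by (simp add: inv_EL)

lemma long_tr:
  assumes H: "normalised H" and ap: "apart i j" and x: "x \<in> root_level n i j H" and z: "z \<in> P (Suc n)"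
  shows "EL i (0, tr (x * z)) \<in> H"
  using z
proof (rule P_Suc_induct)
  note d = apartD[OF ap]
  fix a b assume a: "a \<in> P n" and b: "b \<in> K"
  define y where "y = - (cj L * cj (be (- j)) * b)"
  have bb: "be (- j) * cj (be (- j)) = 1" using d by (intro be_cj_be) simp
  have "com Ug (ES (- j) i y) (ES i j (x * a)) \<in> H"
  proof (rule Ug.com_H[OF normalised_subgroup[OF H]])
    show "ES (- j) i y \<in> nmz Ug H"
      using ap apart_sym[of i j] b by (intro normalised_ES[OF H]) (auto simp: y_def K_simps)
    show "ES i j (x * a) \<in> H" using x a by (simp add: root_level_def)
  qed
  also have "com Ug (ES (- j) i y) (ES i j (x * a)) = EL i (0, tr ((be (- j) * cj (be (- j))) * (x * (a * b))))"
    unfolding com_ES_long[OF ap] y_def by (simp add: mult_ac)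
  finally show "EL i (0, tr (x * (a * b))) \<in> H" by (simp add: bb)
next
  fix a b assume "EL i (0, tr (x * a)) \<in> H" "EL i (0, tr (x * b)) \<in> H"
  from EL_H_hplus[OF H _ this] show "EL i (0, tr (x * (a + b))) \<in> H"
    using apartD[OF ap] by (simp add: distrib_left tr_add)
qed

text \<open>Here the short root element lies in \<open>H\<close> and the long one normalises it, so that their commutator
  lies in \<open>H\<close>; it consists of the long root element at the new index and a short one.\<close>

lemma long_spread_nmz:
  assumes H: "normalised H" and ap: "apart k i" and b: "\<beta> \<in> \<Delta>" "EL k \<beta> \<in> nmz Ug H"
    and g: "ES (- k) i (cj (be (- k)) * t) \<in> H" and s: "ES k i (cj (snd \<beta>) * t) \<in> H"
  shows "EL i (\<beta> \<odot>\<^sub>h cj t) \<in> H"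
proof -
  note d = apartD[OF ap]
  let ?g = "ES (- k) i (cj (be (- k)) * t)"
  let ?x = "EL i (\<beta> \<odot>\<^sub>h cj t)" and ?s = "ES k i (cj (snd \<beta>) * t)"
  have c: "?g \<in> carrier Ug" "EL k \<beta> \<in> carrier Ug" "?x \<in> carrier Ug" "?s \<in> carrier Ug"
    using ap b d by (simp_all add: Delta_hact)
  have "inv\<^bsub>Ug\<^esub> (EL k \<beta>) ** ?g ** EL k \<beta> \<in> H"
    using b(2) g by (simp add: nmz_def)
  then have "inv\<^bsub>Ug\<^esub> (EL k \<beta>) ** ?g ** EL k \<beta> ** inv\<^bsub>Ug\<^esub> ?g \<in> H"
    by (rule normalised_mult[OF H _ normalised_inv[OF H g]])
  also have "inv\<^bsub>Ug\<^esub> (EL k \<beta>) ** ?g ** EL k \<beta> ** inv\<^bsub>Ug\<^esub> ?g = inv\<^bsub>Ug\<^esub> (EL k \<beta>) ** (?g ** EL k \<beta> ** inv\<^bsub>Ug\<^esub> ?g)"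
    by (simp add: matrix_mul_assoc)
  also have "\<dots> = ?x ** ?s"
    unfolding conj_ES_EL[OF ap b(1)] using c by (intro mat_eqI) (simp add: matrix_vector_mul_assoc[symmetric])
  finally have "?x ** ?s ** inv\<^bsub>Ug\<^esub> ?s \<in> H" by (rule normalised_mult[OF H _ normalised_inv[OF H s]])
  also have "?x ** ?s ** inv\<^bsub>Ug\<^esub> ?s = ?x"
    using c by (intro mat_eqI) (simp add: matrix_vector_mul_assoc[symmetric])
  finally show ?thesis .
qed

text \<open>The same commutator with the roles exchanged: the long root element lies in \<open>H\<close>.\<close>

lemma long_spread_H:
  assumes H: "normalised H" and ap: "apart k i" and b: "\<beta> \<in> \<Delta>" "EL k \<beta> \<in> H" and t: "t \<in> K"
    and s: "ES k i (cj (snd \<beta>) * t) \<in> H"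
  shows "EL i (\<beta> \<odot>\<^sub>h cj t) \<in> H"
proof -
  note d = apartD[OF ap]
  let ?g = "ES (- k) i (cj (be (- k)) * t)"
  let ?x = "EL i (\<beta> \<odot>\<^sub>h cj t)" and ?s = "ES k i (cj (snd \<beta>) * t)"
  have c: "?g \<in> carrier Ug" "EL k \<beta> \<in> carrier Ug" "?x \<in> carrier Ug" "?s \<in> carrier Ug"
    using ap b d by (simp_all add: Delta_hact)
  have "?g \<in> nmz Ug H" using ap t by (intro normalised_ES[OF H]) (auto simp: K_simps)
  then have "?g ** EL k \<beta> ** inv\<^bsub>Ug\<^esub> ?g \<in> H" using b(2) by (simp add: nmz_def)
  then have "inv\<^bsub>Ug\<^esub> (EL k \<beta>) ** (EL k \<beta> ** (?x ** ?s)) ** inv\<^bsub>Ug\<^esub> ?s \<in> H"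
    unfolding conj_ES_EL[OF ap b(1)]
    by (rule normalised_mult[OF H normalised_mult[OF H normalised_inv[OF H b(2)]] normalised_inv[OF H s]])
  also have "inv\<^bsub>Ug\<^esub> (EL k \<beta>) ** (EL k \<beta> ** (?x ** ?s)) ** inv\<^bsub>Ug\<^esub> ?s = ?x"
    using c by (intro mat_eqI) (simp add: matrix_vector_mul_assoc[symmetric])
  finally show ?thesis .
qed

text \<open>The parameters that are in \<open>H\<close> at every root, with all their multiples.\<close>

definition negligible_half :: "('a, 'n :: finite) tmat set \<Rightarrow> 'a set" where
  "negligible_half H = {x. \<forall>r. (\<forall>i j. apart i j \<longrightarrow> ES i j (x * r) \<in> H) \<and>
     (\<forall>i\<in>theta_hb. EL i (0, tr (x * r)) \<in> H \<and> (\<forall>\<delta>\<in>\<Delta>. EL i (\<delta> \<odot>\<^sub>h (x * r)) \<in> H))}"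

text \<open>Closure under the involution makes this the ideal of an odd form ideal with smallest possible form
  part. All its elementary matrices lie in \<open>H\<close>, so that calculations with \<open>Q\<close> may be carried out
  modulo it.\<close>

definition negligible :: "('a, 'n :: finite) tmat set \<Rightarrow> 'a set" where
  "negligible H = {x. x \<in> negligible_half H \<and> cj x \<in> negligible_half H}"

lemma negligible_half_ideal:
  fixes H :: "('a, 'n :: finite) tmat set"
  assumes H: "normalised H"
  shows "ideal (negligible_half H) ring_of_type_algebra"
  unfolding ideal_type_iff
proof (intro conjI ballI allI)
  show "0 \<in> negligible_half H" using normalised_one[OF H] by (simp add: negligible_half_def)
next
  fix x r assume "x \<in> negligible_half H"
  then show "x * r \<in> negligible_half H" by (simp add: negligible_half_def mult.assoc)
next
  fix x y assume x: "x \<in> negligible_half H" and y: "y \<in> negligible_half H"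
  show "x + y \<in> negligible_half H"
    unfolding negligible_half_def
  proof (intro CollectI allI conjI ballI impI)
    fix r and i j :: "'n theta" assume "apart i j"
    then show "ES i j ((x + y) * r) \<in> H"
      unfolding distrib_right using x y by (intro ES_H_add[OF H]) (auto simp: negligible_half_def)
  next
    fix r and i :: "'n theta" assume i: "i \<in> theta_hb"
    have "EL i ((0, tr (x * r)) \<oplus>\<^sub>h (0, tr (y * r))) \<in> H"
      using x y i by (intro EL_H_hplus[OF H]) (auto simp: negligible_half_def)
    then show "EL i (0, tr ((x + y) * r)) \<in> H" by (simp add: tr_add distrib_right)
    fix \<delta> assume de: "\<delta> \<in> \<Delta>"
    have "EL i (0, tr (x * (r * (cj (y * r) * snd \<delta>)))) \<in> H" using x i by (simp add: negligible_half_def)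
    then have "EL i (\<delta> \<odot>\<^sub>h (x * r) \<oplus>\<^sub>h \<delta> \<odot>\<^sub>h (y * r) \<oplus>\<^sub>h (0, tr (cj (y * r) * snd \<delta> * (x * r)))) \<in> H"
      using x y i de by (intro EL_H_hplus[OF H]) (auto simp: negligible_half_def mult_ac)
    then show "EL i (\<delta> \<odot>\<^sub>h ((x + y) * r)) \<in> H"
      unfolding distrib_right hact_add[OF Delta_DeltaMax[OF de]] .
  qed
qed

lemma negligible_ideal: "normalised H \<Longrightarrow> ideal (negligible H) ring_of_type_algebra"
  using negligible_half_ideal[of H] unfolding ideal_type_iff negligible_def by auto

lemma negligible_cj: "x \<in> negligible H \<Longrightarrow> cj x \<in> negligible H"
  by (simp add: negligible_def)

lemma negligible_D:
  assumes "x \<in> negligible H"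
  shows "apart i j \<Longrightarrow> ES i j (x * r) \<in> H" "i \<in> theta_hb \<Longrightarrow> EL i (0, tr (x * r)) \<in> H"
    "i \<in> theta_hb \<Longrightarrow> \<delta> \<in> \<Delta> \<Longrightarrow> EL i (\<delta> \<odot>\<^sub>h (x * r)) \<in> H"
  using assms by (auto simp: negligible_def negligible_half_def)

lemma form_ideal_negligible: "normalised H \<Longrightarrow> form_ideal R (negligible H) (Omega_min R (negligible H))"
proof unfold_locales
  assume H: "normalised H"
  note s = negligible_ideal[OF H] negligible_cj
  show "odd_form_ideal R (negligible H, Omega_min R (negligible H))"
    using Omega_min_submodule[OF s] Omega_min_subset_max[OF s] s
    by (auto simp: odd_form_ideal_def bar_invariant_def)
qed

lemma EL_Omega_min:
  assumes H: "normalised H" and i: "i \<in> theta_hb" and w: "\<omega> \<in> Omega_min R (negligible H)"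
  shows "EL i \<omega> \<in> H"
proof -
  have sg: "subgroup {\<omega> \<in> \<Delta>. EL i \<omega> \<in> H} (heis R)"
    unfolding subgroup_heis_iff
    using EL_H_hplus[OF H i] EL_H_hneg[OF H i] normalised_one[OF H] by (auto simp: Delta_hplus Delta_hneg)
  have eq: "Omega_min R (negligible H) = trset (negligible H) <#>\<^bsub>heis R\<^esub> heis_set_act R \<Delta> (negligible H)"
    by (rule Omega_min_alt)
  have "Omega_min R (negligible H) \<subseteq> {\<omega> \<in> \<Delta>. EL i \<omega> \<in> H}"
    unfolding eq
  proof (intro set_mult_heis_least heis_set_act_least)
    show "trset (negligible H) \<subseteq> {\<omega> \<in> \<Delta>. EL i \<omega> \<in> H}"
      using negligible_D(2)[OF _ i, where r = 1] by (auto simp: trset_def)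
    show "\<alpha> \<odot>\<^sub>h c \<in> {\<omega> \<in> \<Delta>. EL i \<omega> \<in> H}" if "\<alpha> \<in> \<Delta>" "c \<in> negligible H" for \<alpha> c
      using negligible_D(3)[OF that(2) i that(1), of 1] Delta_hact[OF that(1)] by simp
  qed (rule sg)+
  then show ?thesis using w by blast
qed

text \<open>The factor \<open>- cj L * bq w w\<close> is the value for which the transvection is a product of short root
  elements at \<open>a\<close> and an element \<open>EL a (0, tr e)\<close> with negligible \<open>e\<close>.\<close>

lemma strip_hyperbolic:
  fixes H :: "('a, 'n :: finite) tmat set"
  assumes H: "normalised H" and a: "a \<in> theta_hb" and T: "T \<subseteq> theta_hb - {- a}"
    and u: "\<And>k. k \<in> T \<Longrightarrow> f k \<in> negligible H"
  defines "w \<equiv> \<Sum>k\<in>T. f k *s ax k"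
  shows "S (ax a) w (- (cj L * bq w w)) \<in> H"
proof -
  have fin: "finite T" by (rule finite_subset[OF subset_UNIV finite_theta])
  note sim = ideal_type_iff[THEN iffD1, OF negligible_ideal[OF H]]
  show ?thesis
    using fin T u unfolding w_def
  proof (induction T rule: finite_induct)
    case empty
    then show ?case using normalised_one[OF H] by (simp add: S_zero)
  next
    case (insert k T)
    define w where "w = (\<Sum>k\<in>T. f k *s (ax k :: ('a, 'n) tvec))"
    define w' where "w' = f k *s (ax k :: ('a, 'n) tvec)"
    have k: "k \<in> theta_hb" "k \<noteq> - a" and fk: "f k \<in> negligible H" using insert.prems by auto
    have IH: "S (ax a) w (- (cj L * bq w w)) \<in> H"
      unfolding w_def by (rule insert.IH) (use insert.prems in auto)
    have w0: "w $ ZeroI = 0" unfolding w_def using insert.prems by (auto simp: ax_nth theta_hb_iff intro!: sum.neutral)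
    have aw: "B (ax a) w = 0" unfolding w_def B_sum_right using insert.prems a
      by (auto simp: B_ax_ax intro!: sum.neutral)
    have aw': "B (ax a) w' = 0" unfolding w'_def using k by (simp add: B_ax_ax)
    have aa: "B (ax a) (ax a) = 0" using minus_theta_neq[OF a] by (simp add: B_ax_ax)
    have "S (ax a) w' 0 \<in> H"
    proof (cases "k = a")
      case True
      then show ?thesis using negligible_D(2)[OF fk a, of "- L"] EL_tr[of a "f k"] by (simp add: w'_def mult.commute)
    next
      case False
      then have "apart a k" using a k theta_minus_eq by (auto simp: apart_def)
      from negligible_D(1)[OF fk this, of 1] show ?thesis by (simp add: w'_def ES_def)
    qed
    define e where "e = bq w' w"
    have e: "EL a (0, tr e) \<in> H"
      using negligible_D(2)[OF negligible_cj[OF fk] a, of "bq (ax k) w"] by (simp add: e_def w'_def)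
    have B: "B w w' = bq w w' + cj e * L"
      using w0 by (simp add: B_bq e_def)
    have ww: "bq w' w' = 0" using k minus_theta_neq[OF k(1)] by (simp add: w'_def bq_ax_ax)
    have "S (ax a) w (- (cj L * bq w w)) ** S (ax a) w' 0 ** EL a (0, tr e) \<in> H"
      by (intro normalised_mult[OF H] IH e) fact
    also have "S (ax a) w (- (cj L * bq w w)) ** S (ax a) w' 0 ** EL a (0, tr e)
        = S (ax a) (w' + w) (- (cj L * bq (w' + w) (w' + w)))"
      unfolding EL_def using aa aw aw'
      by (simp add: S_comp B ww e_def[symmetric] tr_def algebra_simps)
    finally show ?case using insert.hyps by (simp add: w_def w'_def)
  qed
qed

text \<open>If the hyperbolic coordinates of \<open>u\<close> are negligible, a transvection along \<open>ax a\<close> is modulo \<open>H\<close> a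
  long root element, and its parameter is the invariant \<open>Q u \<oplus> (0, \<lambda> y)\<close>. The sign is due to
  the chosen parametrisation of the long root elements.\<close>

lemma strip:
  fixes H :: "('a, 'n :: finite) tmat set" and u :: "('a, 'n) tvec"
  assumes H: "normalised H" and a: "a \<in> theta_hb" and S: "S (ax a) u y \<in> H" and D: "Q u \<oplus>\<^sub>h (0, L * y) \<in> \<Delta>"
    and u: "\<And>k. k \<in> theta_hb \<Longrightarrow> u $ k \<in> negligible H" "u $ (- a) = 0"
  shows "EL a ((Q u \<oplus>\<^sub>h (0, L * y)) \<odot>\<^sub>h (- 1)) \<in> H"
proof -
  define w where "w = (\<Sum>k\<in>theta_hb - {- a}. u $ k *s (ax k :: ('a, 'n) tvec))"
  define v where "v = u $ ZeroI *s (ax ZeroI :: ('a, 'n) tvec)"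
  have "theta_hb = (UNIV :: 'n theta set) - {ZeroI}" by (auto simp: theta_hb_def)
  have uvw: "u = w + v"
  proof -
    have "u = (\<Sum>k\<in>UNIV. u $ k *s ax k)" by (rule vec_expand)
    also have "\<dots> = (\<Sum>k\<in>insert ZeroI (theta_hb - {- a}). u $ k *s ax k)"
      using u(2) by (intro sum.mono_neutral_right) (auto simp: theta_hb_iff)
    also have "\<dots> = v + w"
      unfolding v_def w_def by (subst sum.insert) (auto intro: finite_subset[OF subset_UNIV finite_theta])
    finally show ?thesis by simp
  qed
  have w0: "w $ ZeroI = 0" unfolding w_def by (auto simp: ax_nth theta_hb_iff intro!: sum.neutral)
  have w: "S (ax a) w (- (cj L * bq w w)) \<in> H"
    unfolding w_def by (rule strip_hyperbolic[OF H a]) (use u in auto)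
  have au: "B (ax a) u = 0" using u(2) by (simp add: B_ax_left)
  have av: "B (ax a) v = 0" using a by (simp add: v_def B_ax_ax theta_hb_iff)
  have aw: "B (ax a) w = 0" using au av by (simp add: uvw)
  have aa: "B (ax a) (ax a) = 0" using minus_theta_neq[OF a] by (simp add: B_ax_ax)
  have wv: "B w v = 0" using w0 by (simp add: v_def B_ax_right)
  have "bq v t = 0" "bq t v = 0" for t by (auto simp: v_def bq_def ax_nth intro!: sum.neutral)
  then have bq: "bq u u = bq w w" by (simp add: uvw)
  define y1 where "y1 = y + cj L * bq u u"
  have "S (ax a) u y = S (ax a) w (- (cj L * bq w w)) ** S (ax a) v y1"
    using aa aw av by (simp add: S_comp wv uvw[symmetric] y1_def bq)
  then have "inv\<^bsub>Ug\<^esub> (S (ax a) w (- (cj L * bq w w))) ** (S (ax a) w (- (cj L * bq w w)) ** S (ax a) v y1) \<in> H"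
    using S normalised_mult[OF H normalised_inv[OF H w]] by simp
  also have "inv\<^bsub>Ug\<^esub> (S (ax a) w (- (cj L * bq w w))) ** (S (ax a) w (- (cj L * bq w w)) ** S (ax a) v y1) = S (ax a) v y1"
    using normalised_closed[OF H w] by (intro mat_eqI) (simp add: matrix_vector_mul_assoc[symmetric])
  finally have v1: "S (ax a) v y1 \<in> H" .
  define \<alpha> where "\<alpha> = Q u \<oplus>\<^sub>h (0, L * y)"
  have \<alpha>: "\<alpha> = (u $ ZeroI, L * y1)"
    by (simp add: \<alpha>_def Q_alt hplus_def y1_def distrib_left)
  have "\<alpha> \<in> \<Delta>" using D by (simp add: \<alpha>_def)
  from Delta_hneg[OF this] have hn: "hneg \<alpha> \<in> \<Delta>" .
  have cy: "cj y1 = - (L * y1) - cj (u $ ZeroI) * m * u $ ZeroI"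
    using Delta_snd[of "u $ ZeroI" "L * y1"] \<open>\<alpha> \<in> \<Delta>\<close> \<alpha> by simp
  have e: "- (u $ ZeroI * cj m * cj (u $ ZeroI)) - cj L * cj y1 = y1"
  proof -
    have "cj (cj y1) = cj (- (L * y1) - cj (u $ ZeroI) * m * u $ ZeroI)" by (rule arg_cong[OF cy])
    then have "y1 = - (cj L * cj y1) - u $ ZeroI * cj m * cj (u $ ZeroI)" by simp
    then show ?thesis using minus_diff_commute by metis
  qed
  have "EL a (hneg \<alpha> \<odot>\<^sub>h (- 1)) = S (ax a) v y1"
    by (simp add: EL_def \<alpha> v_def hneg_def heis_act_def e)
  then have "EL a (hneg (\<alpha> \<odot>\<^sub>h (- 1))) \<in> H" using v1 by (simp add: hact_hneg)
  from EL_H_hneg[OF H a _ this] show ?thesis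
    using \<open>\<alpha> \<in> \<Delta>\<close> by (simp add: \<alpha>_def[symmetric] Delta_hneg Delta_hact)
qed

end

context relative
begin

interpretation Ug: group "Ug :: ('a, 'n :: finite) tmat monoid"
  by (rule group_Ug)

context
  fixes H :: "('a, 'n :: finite) tmat set"
  assumes n: "3 \<le> CARD('n)" and H: "normalised H"
begin

lemma all_levels_long:
  assumes x: "x \<in> all_levels k H" and i: "i \<in> theta_hb" and z: "z \<in> P (Suc k)"
  shows "EL i (0, tr (x * z)) \<in> H"
proof -
  obtain j where "apart i j" using third_index[OF n i i] by blast
  then show ?thesis using long_tr[OF H _ _ z] all_levelsD[OF x] by blast
qed

lemma all_levels_long_Delta:
  assumes x: "x \<in> all_levels k H" and i: "i \<in> theta_hb" and z: "z \<in> P (Suc k)" and de: "\<delta> \<in> \<Delta>"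
  shows "EL i (\<delta> \<odot>\<^sub>h (x * z)) \<in> H"
proof -
  obtain j where "apart i j" using third_index[OF n i i] by blast
  then have ji: "apart j i" using apart_sym by blast
  have "z \<in> P (Suc k) \<and> EL i (\<delta> \<odot>\<^sub>h (x * z)) \<in> H"
    using z
  proof (rule P_Suc_induct)
    fix a b assume a: "a \<in> P k" and b: "b \<in> K"
    have ab: "a * b \<in> P (Suc k)" using P_mult[of a k b "Suc 0"] a b by simp
    have ca: "cj a * r \<in> P k" "r * cj a \<in> P k" for r using P_bar[OF a] P_simps by auto
    have cx: "cj x \<in> root_level k l m H" if "apart l m" for l m
      using all_levelsD[OF all_levels_cj[OF H n x] that] .
    have "EL i (\<delta> \<odot>\<^sub>h b \<odot>\<^sub>h cj (cj (x * a))) \<in> H"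
    proof (rule long_spread_nmz[OF H ji Delta_hact[OF de] normalised_EL[OF H _ de b]])
      have "ES (- j) i (cj x * (cj a * cj (be (- j)))) \<in> H"
        using cx[of "- j" i] ca ji by (simp add: root_level_def)
      then show "ES (- j) i (cj (be (- j)) * cj (x * a)) \<in> H" by (simp add: mult_ac)
      have "ES j i (cj x * (cj a * cj (snd (\<delta> \<odot>\<^sub>h b)))) \<in> H"
        using cx[of j i] ca ji by (simp add: root_level_def)
      then show "ES j i (cj (snd (\<delta> \<odot>\<^sub>h b)) * cj (x * a)) \<in> H" by (simp add: mult_ac)
    qed (use ji in \<open>simp add: apart_def\<close>)
    then show "a * b \<in> P (Suc k) \<and> EL i (\<delta> \<odot>\<^sub>h (x * (a * b))) \<in> H"
      using ab by (simp add: hact_hact mult_ac)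
  next
    fix a b assume ab: "a \<in> P (Suc k) \<and> EL i (\<delta> \<odot>\<^sub>h (x * a)) \<in> H" "b \<in> P (Suc k) \<and> EL i (\<delta> \<odot>\<^sub>h (x * b)) \<in> H"
    have "EL i (0, tr (x * (a * (cj (x * b) * snd \<delta>)))) \<in> H"
      using ab by (intro all_levels_long[OF x i] P_simps) auto
    then have "EL i (\<delta> \<odot>\<^sub>h (x * a) \<oplus>\<^sub>h \<delta> \<odot>\<^sub>h (x * b) \<oplus>\<^sub>h (0, tr (cj (x * b) * snd \<delta> * (x * a)))) \<in> H"
      using ab by (intro EL_H_hplus[OF H i]) (auto simp: mult_ac)
    then show "a + b \<in> P (Suc k) \<and> EL i (\<delta> \<odot>\<^sub>h (x * (a + b))) \<in> H"
      using ab by (simp add: distrib_left hact_add[OF Delta_DeltaMax[OF de]] P_simps)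
  qed
  then show ?thesis by blast
qed

text \<open>Long root elements arise as commutators of short ones, or of a long and a short one, and therefore
  need one more power of the ideal than short root elements.\<close>

lemma all_levels_negligible_half:
  assumes x: "x \<in> all_levels k H" and z: "z \<in> P (Suc k)"
  shows "x * z \<in> negligible_half H"
  unfolding negligible_half_def
proof (intro CollectI allI conjI impI ballI)
  fix r and i j :: "'n theta"
  have zr: "z * r \<in> P (Suc k)" using z by (rule P_simps)
  show "ES i j (x * z * r) \<in> H" if "apart i j"
    using all_levelsD[OF x that] P_mono[OF _ zr, of k] by (simp add: root_level_def mult.assoc)
  assume i: "i \<in> theta_hb"
  show "EL i (0, tr (x * z * r)) \<in> H"
    using all_levels_long[OF x i zr] by (simp add: mult.assoc)
  show "EL i (\<delta> \<odot>\<^sub>h (x * z * r)) \<in> H" if "\<delta> \<in> \<Delta>" for \<delta>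
    using all_levels_long_Delta[OF x i zr that] by (simp add: mult.assoc)
qed

lemma all_levels_negligible: "x \<in> all_levels k H \<Longrightarrow> z \<in> P (Suc k) \<Longrightarrow> x * z \<in> negligible H"
  using all_levels_negligible_half[of x k z] all_levels_negligible_half[of "cj x" k "cj z"] all_levels_cj[OF H n] P_bar by (simp add: negligible_def)

lemma level_all_levels:
  assumes "upper_level R H = (J, \<Sigma>)"
  shows "J \<subseteq> all_levels 10 H"
proof -
  have "upper_Y R H \<union> cj ` upper_Y R H \<subseteq> all_levels 10 H"
    using upper_Y_All[OF n H] all_levels_cj[OF H n] by auto
  from genideal_type(3)[OF ideal_All[OF H n] this] show ?thesis
    using upper_level_alt(1)[OF assms] by simp
qed

lemma heq_EL:
  assumes a: "a \<in> theta_hb" and e: "form_ideal.heq R (Omega_min R (negligible H)) \<alpha> \<beta>" and EL: "EL a \<beta> \<in> H"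
  shows "EL a \<alpha> \<in> H"
proof -
  interpret s: form_ideal R "negligible H" "Omega_min R (negligible H)" by (rule form_ideal_negligible[OF H])
  have "EL a (\<alpha> \<oplus>\<^sub>h hneg \<beta>) \<in> H" using e by (intro EL_Omega_min[OF H a]) (simp add: s.heq_def)
  from EL_H_hplus[OF H a this EL] show ?thesis by (simp add: hplus_assoc)
qed

text \<open>Both vectors of the transvection \<open>\<tau>\<close> are orthogonal to row \<open>a\<close> of \<open>\<sigma>\<close>, so its conjugate \<open>E\<close> fixes
  \<open>ax a\<close>, while modulo \<open>H\<close> it is the single root element \<open>ES c b \<rho>\<close>. Comparing the commutators of the two
  with \<open>t\<close> exhibits in \<open>H\<close> a transvection along \<open>ax a\<close> with vector \<open>u0 = E w - w - \<theta> e\<^sub>b\<close>. The hyperbolic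
  coordinates of \<open>u0\<close> are negligible, so a long root element is left. Modulo negligible terms its
  parameter is \<open>Q (E w)\<close>, which in turn is \<open>Q (\<sigma> e\<^sub>b)\<close> acted on by \<open>a1 * b1\<close>.\<close>

lemma column_long_product:
  assumes s: "\<sigma> \<in> H" and ap: "apart a b" and a1: "a1 \<in> P 10" and b1: "b1 \<in> K"
  shows "EL a (Q (\<sigma> *v ax b) \<odot>\<^sub>h (- (a1 * b1))) \<in> H"
proof -
  obtain c where apc: "apart a c" "apart b c" using third_index[OF n] apartD[OF ap] by metis
  note ds = apartD[OF ap] apartD[OF apc(1)] apartD[OF apc(2)]
  have ap': "apart c a" "apart c b" "apart b a" using ap apc apart_sym by blast+
  have sc: "\<sigma> \<in> carrier Ug" using s normalised_closed[OF H] by blast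
  obtain J \<Sigma> where ul: "upper_level R H = (J, \<Sigma>)" by (cases "upper_level R H")
  have Hc: "H \<subseteq> carrier Ug" using normalised_closed[OF H] by blast
  note o = upper_level_odd_form_ideal[OF Hc ul]
  interpret f: form_ideal R J \<Sigma> by unfold_locales (rule o(1))
  interpret s: form_ideal R "negligible H" "Omega_min R (negligible H)" by (rule form_ideal_negligible[OF H])
  define r where "r = (\<lambda>k. B (ax a) (\<sigma> *v ax k))"
  \<comment> \<open>The factor \<open>\<sigma> $ c $ c * cj (be c)\<close> makes the final coefficient exactly \<open>a1 * b1\<close>, the diagonal
      entries having norm one modulo the ideal.\<close>
  define x1 where "x1 = a1 * (\<sigma> $ c $ c * cj (be c))"
  have x1: "x1 \<in> P 10" "x1 \<in> K"
    using P_simps(3)[OF a1] P_mono[of "Suc 0" 10] by (auto simp: x1_def)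
  have bcc: "be c * cj (be c) = 1" by (rule be_cj_be) (simp add: ds)
  have ent: "\<sigma> $ k $ l \<in> J" if "k \<in> theta_hb" "l \<in> theta_hb" "k \<noteq> l" for k l
    using upper_Y_entry(1)[OF s that] o(2) by blast
  have rJ: "r k \<in> J" if "k \<in> theta_hb" "k \<noteq> - a" for k
    using ent[of "- a" k] that ds by (auto simp: r_def B_ax_left mat_ax_nth intro: f.J_simps)
  have JA: "x \<in> all_levels 10 H" if "x \<in> J" for x using level_all_levels[OF ul] that by blast
  have JES: "ES i j (x * z) \<in> H" if "x \<in> J" "z \<in> P 10" "apart i j" for x z i j
    using all_levelsD[OF JA[OF that(1)] that(3)] that(2) by (simp add: root_level_def)
  have Jsm: "x * (p * q * t) \<in> negligible H" if "x \<in> J" "p \<in> P 10" "q \<in> K" for x p q t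
    using all_levels_negligible[OF JA[OF that(1)], of "p * q * t"] P_mult[of p 10 q "Suc 0"] that P_simps(3)[of "p * q" 11 t] by simp
  have norm: "1 - cj (\<sigma> $ k $ k) * \<sigma> $ k $ k \<in> J" if "k \<in> theta_hb" for k
    by (rule diagonal_norm[OF f.J_ideal f.J_cj o(2) Hc s that])
  define v where "v = r c *s ax (- a) + (- r (- a)) *s (ax c :: ('a, 'n) tvec)"
  define u where "u = (x1 * r b) *s ax (- a) + (- (x1 * r (- a))) *s (ax b :: ('a, 'n) tvec)"
  define \<rho> where "\<rho> = cj (r (- a)) * x1 * r (- a)"
  have \<rho>: "\<rho> \<in> K" using x1 by (simp add: \<rho>_def K_simps)
  define \<tau> where "\<tau> = S v u 0"
  \<comment> \<open>Modulo \<open>H\<close> only one root element of \<open>\<tau>\<close> survives.\<close>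
  define h where "h = ES (- a) b (- (cj (r c) * (x1 * r (- a)))) ** EL (- a) (0, tr (- (L * (cj (r c) * (x1 * r b)))))
      ** ES c (- a) (- (cj (r (- a)) * (x1 * r b)))"
  have hH: "h \<in> H"
    unfolding h_def
  proof (intro normalised_mult[OF H])
    have "cj (r c) \<in> J" using ds by (intro f.J_cj rJ) auto
    from JES[OF this, of "x1 * (- r (- a))" "- a" b] show "ES (- a) b (- (cj (r c) * (x1 * r (- a)))) \<in> H"
      using x1 ap P_simps(3)[of x1 10 "- r (- a)"] by simp
    have "r b \<in> J" using ds by (intro rJ) auto
    from JES[OF this, of "x1 * (- cj (r (- a)))" c "- a"] show "ES c (- a) (- (cj (r (- a)) * (x1 * r b))) \<in> H"
      using x1 ap' P_simps(3)[of x1 10 "- cj (r (- a))"] by (simp add: mult_ac)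
    \<comment> \<open>A long root element costs one power more, but the entry \<open>b\<close> is known at level nine already.\<close>
    have "r b \<in> root_level 7 c b H" unfolding r_def by (rule extract_entry'[OF H s ap apc])
    then have "r b \<in> root_level (Suc 7) (- a) b H" by (rule root_level_left[OF H, rotated 3]) (use ap ap' in auto)
    then have rb: "r b \<in> root_level 9 (- a) b H" by (rule root_level_mono[rotated]) simp
    have "x1 * (- (L * cj (r c))) \<in> P (Suc 9)" using P_simps(3)[OF x1(1), of "- (L * cj (r c))"] by simp
    from long_tr[OF H _ rb this] show "EL (- a) (0, tr (- (L * (cj (r c) * (x1 * r b))))) \<in> H"
      using ap by (simp add: mult_ac)
  qed
  have \<tau>h: "\<tau> = h ** ES c b \<rho>"
  proof -
    have "\<tau> = S (ax (- a)) (cj (r c) *s u) 0 ** S (ax c) (cj (- r (- a)) *s u) 0"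
      unfolding \<tau>_def v_def
      by (rule S_plane[of _ b _ _ "x1 * r b" "- (x1 * r (- a))" 0]) (use ap apc in \<open>auto simp: u_def\<close>)
    also have "S (ax (- a)) (cj (r c) *s u) 0 = ES (- a) b (- (cj (r c) * (x1 * r (- a))))
        ** EL (- a) (0, tr (- (L * (cj (r c) * (x1 * r b)))))"
      using S_ax_decomp[of "- a" b c "cj (r c) * (x1 * r b)" "- (cj (r c) * (x1 * r (- a)))" 0] ap apc
      by (simp add: u_def vector_add_ldistrib vector_smult_assoc)
    also have "S (ax c) (cj (- r (- a)) *s u) 0 = ES c (- a) (- (cj (r (- a)) * (x1 * r b))) ** ES c b \<rho>"
      using S_ax_decomp[of c "- a" b 0 "- (cj (r (- a)) * (x1 * r b))" \<rho>] ap ap'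
      by (simp add: u_def \<rho>_def vector_add_ldistrib vector_smult_assoc mult_ac)
    finally show ?thesis by (simp add: h_def matrix_mul_assoc)
  qed
  have rn: "ES c b \<rho> \<in> nmz Ug H" by (rule normalised_ES[OF H ap'(2) \<rho>])
  note sub = normalised_subgroup[OF H]
  have c1: "cng Ug H \<tau> (ES c b \<rho>)" using Ug.cngI[OF sub hH rn] by (simp add: \<tau>h)
  then have \<tau>n: "\<tau> \<in> nmz Ug H" by (simp add: cng_def)
  define E where "E = \<sigma> ** \<tau> ** inv\<^bsub>Ug\<^esub> \<sigma>"
  define t where "t = ES a (- c) b1"
  have tn: "t \<in> nmz Ug H" unfolding t_def using apc b1 by (intro normalised_ES[OF H]) auto
  have c2: "cng Ug H E (ES c b \<rho>)"
    using Ug.cng_trans[OF sub _ c1] Ug.cng_conj[OF sub s \<tau>n] by (simp add: E_def)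
  have En: "E \<in> nmz Ug H" using c2 by (simp add: cng_def)
  have Ec: "E \<in> carrier Ug" using En by (rule Ug.nmz_carrier)
  define \<theta> where "\<theta> = be c * \<rho> * b1"
  have "com Ug (ES c b \<rho>) t = ES a b \<theta>"
    using com_ES[of a "- c" b \<rho> b1] ap apc ap' by (simp add: t_def \<theta>_def)
  then have "cng Ug H (com Ug E t) (ES a b \<theta>)" using Ug.cng_com[OF sub c2 tn] by simp
  then have cE: "com Ug E t ** ES a b (- \<theta>) \<in> H" using ap by (simp add: cng_def inv_ES)
  define V U where "V = \<sigma> *v v" and "U = \<sigma> *v u"
  have ES: "E = S V U 0" unfolding E_def \<tau>_def S_conj[OF sc] V_def U_def ..
  have "B (ax a) V = 0" "B (ax a) U = 0"
    by (simp_all add: V_def U_def v_def u_def mat_lin r_def mult_ac)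
  then have "B V (ax a) = 0" "B U (ax a) = 0" by (simp_all add: B_eq_0_flip)
  then have Ea: "E *v ax a = ax a" by (simp add: ES S_apply)
  define w where "w = b1 *s (ax (- c) :: ('a, 'n) tvec)"
  define \<beta> \<gamma> where "\<beta> = B V w" and "\<gamma> = cj L * B U w"
  define w' where "w' = E *v w - w"
  have w': "w' = \<beta> *s U - \<gamma> *s V" by (simp add: w'_def ES S_apply \<beta>_def \<gamma>_def)
  define u0 where "u0 = w' + (- \<theta>) *s (ax b :: ('a, 'n) tvec)"
  define y0 where "y0 = cj L * B w' w + cj L * (\<theta> * B w' (ax b))"
  have tS: "t = S (ax a) w 0" by (simp add: t_def w_def ES_def)
  have aa: "B (ax a) (ax a) = 0" "B (ax a) w = 0" "B (ax a) (ax b) = 0" using ds by (simp_all add: w_def B_ax_ax)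
  have tc: "S (ax a) w 0 \<in> carrier Ug" using tn Ug.nmz_carrier by (simp add: tS)
  note fx = com_S_fix[OF Ec tc aa(1,2) Ea, folded w'_def tS]
  have au0: "B (ax a) u0 = 0" using fx(2) aa by (simp add: u0_def)
  have "com Ug E t ** ES a b (- \<theta>) = S (ax a) u0 y0"
    unfolding fx(1) ES_def using fx(2) aa by (simp add: S_comp u0_def y0_def mult_ac)
  with cE have S0: "S (ax a) u0 y0 \<in> H" by simp
  have u0a: "u0 $ (- a) = 0" using nth_eq_B[of "- a" u0] au0 ds by simp
  have Vk: "V $ k = r c * \<sigma> $ k $ (- a) - r (- a) * \<sigma> $ k $ c" for k
    by (simp add: V_def v_def mat_lin mat_ax_nth)
  have Uk: "U $ k = x1 * (r b * \<sigma> $ k $ (- a) - r (- a) * \<sigma> $ k $ b)" for k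
    by (simp add: U_def u_def mat_lin mat_ax_nth algebra_simps)
  have \<beta>: "\<beta> = b1 * (cj (V $ c) * be c)" by (simp add: \<beta>_def w_def B_ax_right)
  have rbJ: "r b \<in> J" and rcJ: "r c \<in> J" using ds by (auto intro!: rJ)
  have \<gamma>: "\<gamma> \<in> negligible H"
  proof -
    define j1 where "j1 = r b * \<sigma> $ c $ (- a) - r (- a) * \<sigma> $ c $ b"
    have "j1 \<in> J" unfolding j1_def using ds by (intro f.J_simps(6) f.J_simps(3)[OF rbJ] f.J_simps(4)[OF ent]) auto
    from Jsm[OF f.J_cj[OF this] P_bar[OF x1(1)] b1, of "cj L * be c"] show ?thesis
      by (simp add: \<gamma>_def w_def B_ax_right Uk j1_def[symmetric] mult_ac)
  qed
  \<comment> \<open>Only the coordinate \<open>b\<close> of \<open>w'\<close> need not be negligible, and there \<open>\<theta>\<close> cancels the main term.\<close>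
  have u0k: "u0 $ k \<in> negligible H" if k: "k \<in> theta_hb" for k
  proof -
    have "\<beta> * U $ k - \<theta> * (if k = b then 1 else 0) \<in> negligible H"
    proof (cases "k = b")
      case False
      define j1 where "j1 = r b * \<sigma> $ k $ (- a) - r (- a) * \<sigma> $ k $ b"
      have "j1 \<in> J" unfolding j1_def using ds k False by (intro f.J_simps(6) f.J_simps(3)[OF rbJ] f.J_simps(4)[OF ent]) auto
      from Jsm[OF this x1(1) b1, of "cj (V $ c) * be c"] show ?thesis
        using False by (simp add: \<beta> Uk j1_def[symmetric] mult_ac)
    next
      case True
      define j2 where "j2 = cj (r c) * (cj (\<sigma> $ c $ (- a)) * \<sigma> $ b $ b)
        - cj (r (- a)) * (cj (\<sigma> $ c $ c) * (\<sigma> $ b $ b - \<sigma> $ c $ c) - (1 - cj (\<sigma> $ c $ c) * \<sigma> $ c $ c))"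
      have bc: "\<sigma> $ b $ b - \<sigma> $ c $ c \<in> J" using upper_Y_entry(2)[OF s, of b c] ds o(2) by auto
      have "j2 \<in> J" unfolding j2_def
        by (rule f.J_simps(6)[OF f.J_simps(3)[OF f.J_cj[OF rcJ]] f.J_simps(4)[OF f.J_simps(6)[OF f.J_simps(4)[OF bc] norm]]])
          (simp add: ds)
      then have "r b * (cj (V $ c) * \<sigma> $ b $ (- a)) - j2 * r (- a) \<in> J"
        by (rule f.J_simps(6)[OF f.J_simps(3)[OF rbJ] f.J_simps(3)])
      from Jsm[OF this x1(1) b1, of "be c"] show ?thesis
        using True by (simp add: \<beta> Uk \<theta>_def \<rho>_def j2_def Vk algebra_simps)
    qed
    from s.J_simps(6)[OF this s.J_simps(3)[OF \<gamma>, of "V $ k"]] show ?thesis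
      by (simp add: u0_def w' ax_nth algebra_simps)
  qed
  have w'k: "w' $ k \<in> negligible H" if "k \<in> theta_hb" "k \<noteq> b" for k
    using u0k[OF that(1)] that by (simp add: u0_def)
  have bqs: "bq x (ax i) \<in> negligible H" "bq (ax i) x \<in> negligible H" if "x $ (- i) \<in> negligible H" for x :: "('a, 'n) tvec" and i
  proof -
    have "cj (x $ k) * ax i $ (- k) \<in> negligible H" "cj (ax i $ k) * x $ (- k) \<in> negligible H" for k
      using that s.J_cj[OF that] s.J_simps(1) by (cases "k = - i"; cases "k = i"; auto simp: ax_nth theta_minus_eq)+
    then show "bq x (ax i) \<in> negligible H" "bq (ax i) x \<in> negligible H" unfolding bq_def by (auto intro: s.J_sum)
  qed
  define q where "q = Q (\<sigma> *v ax b)"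
  define \<alpha> where "\<alpha> = Q u0 \<oplus>\<^sub>h (0, L * y0)"
  define e0 where "e0 = - bq w w' - cj \<theta> * bq (ax b) w'"
  have "bq w w' \<in> negligible H" "bq w' w \<in> negligible H" unfolding w_def using w'k[of c] ds bqs[of w' "- c"] by (auto intro!: s.J_simps)
  moreover have "bq (ax b) w' \<in> negligible H" using w'k[of "- b"] ds bqs(2) by auto
  ultimately have e0: "e0 \<in> negligible H" and ww: "bq w' w \<in> negligible H"
    unfolding e0_def by (auto intro!: s.J_simps)
  have Qw: "Q w = (0, 0)" using ds by (simp add: w_def Q_smult)
  have \<alpha>: "\<alpha> = Q (E *v w) \<oplus>\<^sub>h (0, tr e0)"
  proof -
    have "E *v w = w' + w" by (simp add: w'_def)
    then have "Q (E *v w) = Q w' \<oplus>\<^sub>h (0, B w' w + tr (bq w w'))" using Q_add[of w' w] Qw by simp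
    moreover have "\<alpha> = Q w' \<oplus>\<^sub>h (0, B w' w + tr (- (cj \<theta> * bq (ax b) w')))"
      unfolding \<alpha>_def u0_def y0_def Q_add
      using ds by (simp add: Q_smult hplus_assoc distrib_left add.commute)
    ultimately show ?thesis by (simp add: e0_def hplus_assoc tr_diff tr_minus)
  qed
  have QE: "Q (E *v w) \<in> \<Delta>" using Ug_Q_Delta[OF Ec, of w] Qw by simp
  then have \<alpha>D: "\<alpha> \<in> \<Delta>" unfolding \<alpha> by (simp add: Delta_hplus)
  from strip[OF H _ S0 _ u0k u0a, folded \<alpha>_def] \<alpha>D have EL\<alpha>: "EL a (\<alpha> \<odot>\<^sub>h (- 1)) \<in> H" using ds by simp
  have "s.heq \<alpha> (Q (E *v w))"
    unfolding \<alpha> s.heq_def hplus_zero_pair[symmetric] hplus_assoc using s.Sg_tr[OF e0] by simp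
  \<comment> \<open>The contribution of \<open>V\<close> carries the negligible factor \<open>\<gamma>\<close>.\<close>
  moreover have "s.heq (Q (E *v w)) (Q U \<odot>\<^sub>h \<beta>)"
  proof -
    have "B v u = 0" using ds by (simp add: v_def u_def B_ax_ax)
    then have VU: "B V U = 0" using sc by (simp add: V_def U_def)
    define t0 where "t0 = bq w' w + cj \<gamma> * \<beta> + bq ((- \<gamma>) *s V) (\<beta> *s U)"
    have "bq ((- \<gamma>) *s V) (\<beta> *s U) \<in> negligible H"
      using s.J_simps(3)[OF s.J_cj[OF \<gamma>], of "- (\<beta> * bq V U)"] by (simp add: mult_ac)
    then have t0: "t0 \<in> negligible H"
      unfolding t0_def by (rule s.J_simps(2)[OF s.J_simps(2)[OF ww s.J_simps(3)[OF s.J_cj[OF \<gamma>]]]])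
    have "Q v = (0, 0)" unfolding v_def Q_add using ds by (simp add: Q_smult B_ax_ax bq_ax_ax)
    then have QV: "Q V \<in> \<Delta>" unfolding V_def using Ug_Q_Delta[OF sc] by simp
    have "Q u = (0, 0)" unfolding u_def Q_add using ds by (simp add: Q_smult B_ax_ax bq_ax_ax)
    then have QU: "Q U \<in> \<Delta>" unfolding U_def using Ug_Q_Delta[OF sc] by simp
    have "Q (E *v w) = Q U \<odot>\<^sub>h \<beta> \<oplus>\<^sub>h (Q V \<odot>\<^sub>h (- \<gamma>) \<oplus>\<^sub>h (0, tr t0))"
      unfolding ES S_Q[OF VU, of 0 w] Qw \<beta>_def[symmetric] \<gamma>_def[symmetric]
      by (simp add: t0_def w' hplus_assoc)
    also have "s.heq \<dots> (Q U \<odot>\<^sub>h \<beta> \<oplus>\<^sub>h (0, 0))"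
      using QU QV \<gamma> t0
      by (intro s.heq_hplus s.heq_refl) (auto simp: s.heq_zero Delta_hact intro!: s.Sg_hplus s.Sg_hact s.Sg_tr s.J_simps)
    finally show ?thesis by simp
  qed
  moreover have qD: "q \<in> \<Delta>" unfolding q_def using ds by (intro Ug_Q_Delta sc) simp
  have "s.heq (Q U \<odot>\<^sub>h \<beta>) (q \<odot>\<^sub>h (- (x1 * r (- a)) * \<beta>))"
  proof -
    define q' where "q' = Q (\<sigma> *v ax (- a))"
    have q'D: "q' \<in> \<Delta>" unfolding q'_def using ds by (intro Ug_Q_Delta sc) simp
    define e1 where "e1 = cj \<beta> * \<beta> * bq ((- (x1 * r (- a))) *s (\<sigma> *v ax b)) ((x1 * r b) *s (\<sigma> *v ax (- a)))"
    have negligible_half: "x1 * r b * \<beta> \<in> negligible H"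
      using Jsm[OF rbJ x1(1) b1, of "cj (V $ c) * be c"] by (simp add: \<beta> mult_ac)
    have "e1 \<in> negligible H"
      using s.J_simps(3)[OF negligible_half, of "cj \<beta> * bq ((- (x1 * r (- a))) *s (\<sigma> *v ax b)) (\<sigma> *v ax (- a))"]
      by (simp add: e1_def mult_ac)
    have B0: "B (\<sigma> *v ax (- a)) (\<sigma> *v ax b) = 0" using sc ds by (simp add: B_ax_ax)
    have "Q U \<odot>\<^sub>h \<beta> = q' \<odot>\<^sub>h (x1 * r b * \<beta>) \<oplus>\<^sub>h (q \<odot>\<^sub>h (- (x1 * r (- a)) * \<beta>) \<oplus>\<^sub>h (0, tr e1))"
      unfolding U_def u_def mat_lin Q_add
      by (simp add: Q_smult hact_hplus hact_hact hact_tr B0 q_def q'_def e1_def hplus_assoc)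
    also have "s.heq \<dots> ((0, 0) \<oplus>\<^sub>h (q \<odot>\<^sub>h (- (x1 * r (- a)) * \<beta>) \<oplus>\<^sub>h (0, 0)))"
      using qD q'D negligible_half \<open>e1 \<in> negligible H\<close>
      by (intro s.heq_hplus s.heq_refl) (auto simp: s.heq_zero Delta_hact intro!: s.Sg_hact s.Sg_tr)
    finally show ?thesis by simp
  qed
  moreover have "s.heq (q \<odot>\<^sub>h (- (x1 * r (- a)) * \<beta>)) (q \<odot>\<^sub>h (a1 * b1))"
  proof (rule s.heq_hact_J[OF qD])
    define d where "d = \<sigma> $ (- a) $ (- a)"
    have ra: "r (- a) = be a * d" by (simp add: r_def B_ax_left mat_ax_nth d_def)
    have baa: "be a * cj (be a) = 1" using ds by (intro be_cj_be) simp
    define j3 where "j3 = \<sigma> $ c $ c * (r (- a) * (cj (r c) * cj (\<sigma> $ c $ (- a)))) + (1 - cj (\<sigma> $ c $ c) * \<sigma> $ c $ c)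
      + cj (\<sigma> $ c $ c) * \<sigma> $ c $ c * (1 - cj d * d)"
    have "j3 \<in> J" unfolding j3_def
      by (rule f.J_simps(2)[OF f.J_simps(2)[OF f.J_simps(4)[OF f.J_simps(4)[OF f.J_simps(3)[OF f.J_cj[OF rcJ]]]] norm]
            f.J_simps(4)[OF norm[of "- a", folded d_def]]])
        (simp_all add: ds)
    from Jsm[OF this a1 b1, of "- 1"] have "j3 * (a1 * b1 * - 1) \<in> negligible H" .
    also have "j3 * (a1 * b1 * - 1) = - (x1 * r (- a)) * \<beta> - a1 * b1"
    proof -
      have rr: "cj (r (- a)) * r (- a) = cj d * d"
      proof -
        have "cj (r (- a)) * r (- a) = (be a * cj (be a)) * (cj d * d)" by (simp add: ra mult_ac)
        then show ?thesis by (simp add: baa)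
      qed
      have "x1 * be c = a1 * \<sigma> $ c $ c * (be c * cj (be c))" by (simp add: x1_def mult_ac)
      then have xb: "x1 * be c = a1 * \<sigma> $ c $ c" by (simp add: bcc)
      have "- (x1 * r (- a)) * \<beta> = - (x1 * be c) * b1 * (r (- a) * cj (V $ c))"
        by (simp add: \<beta> mult_ac)
      also have "\<dots> = - (a1 * \<sigma> $ c $ c) * b1 * (r (- a) * (cj (r c) * cj (\<sigma> $ c $ (- a))) - (cj (r (- a)) * r (- a)) * cj (\<sigma> $ c $ c))"
        unfolding xb by (simp add: Vk algebra_simps)
      also have "\<dots> - a1 * b1 = j3 * (a1 * b1 * - 1)"
        unfolding rr j3_def by (simp add: algebra_simps)
      finally show ?thesis by simp
    qed
    finally show "- (x1 * r (- a)) * \<beta> - a1 * b1 \<in> negligible H" .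
  qed
  ultimately have "s.heq \<alpha> (q \<odot>\<^sub>h (a1 * b1))" using s.heq_trans by blast
  from s.heq_hact[OF s.heq_sym[OF this], of "- 1"] have "s.heq (q \<odot>\<^sub>h (- (a1 * b1))) (\<alpha> \<odot>\<^sub>h (- 1))"
    by (simp add: hact_hact)
  from heq_EL[OF _ this EL\<alpha>] show ?thesis using ds by (simp add: q_def)
qed

end

end

context relative
begin

interpretation Ug: group "Ug :: ('a, 'n :: finite) tmat monoid"
  by (rule group_Ug)

text \<open>Restricting the indices to \<open>M\<close> is needed for the second kind of generators, which are reached
  with \<open>M\<close> depending on an auxiliary index.\<close>

definition long_level :: "'a set \<Rightarrow> 'n :: finite theta set \<Rightarrow> ('a, 'n) tmat set \<Rightarrow> ('a \<times> 'a) set" where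
  "long_level J M H = {\<omega> \<in> Omega_max R J. \<forall>m\<in>M. \<forall>r\<in>P 12. EL m (\<omega> \<odot>\<^sub>h r) \<in> H}"

context
  assumes n: "3 \<le> CARD('n :: finite)"
begin

context
  fixes H :: "('a, 'n) tmat set" and J \<Sigma>
  assumes H: "normalised H" and ul: "upper_level R H = (J, \<Sigma>)"
begin

lemma Hc: "H \<subseteq> carrier Ug"
  using normalised_closed[OF H] by blast

lemmas ofi = upper_level_odd_form_ideal[OF Hc ul]

interpretation f: form_ideal R J \<Sigma>
  by unfold_locales (rule ofi(1))

lemma level_short: "x \<in> J \<Longrightarrow> z \<in> P 10 \<Longrightarrow> apart i j \<Longrightarrow> ES i j (x * z) \<in> H"
  using all_levelsD[of x 10 H i j] level_all_levels[OF n H ul] by (auto simp: root_level_def)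

lemma level_negligible: "x \<in> J \<Longrightarrow> z \<in> P 11 \<Longrightarrow> x * z \<in> negligible H"
  using all_levels_negligible[OF n H, of x 10 z] level_all_levels[OF n H ul] by auto

lemma column_mem:
  assumes "\<sigma> \<in> H" "b \<in> theta_hb"
  shows "Q (\<sigma> *v ax b) \<in> \<Sigma>"
  using assms ofi(3) unfolding subset_iff upper_Z_iff by blast

lemma Sg_snd: "\<omega> \<in> \<Sigma> \<Longrightarrow> snd \<omega> \<in> J" and Sg_max: "\<omega> \<in> \<Sigma> \<Longrightarrow> \<omega> \<in> Omega_max R J"
  using ofi(1) by (auto simp: odd_form_ideal_def Omega_max_def)

lemma long_add:
  assumes i: "i \<in> theta_hb" and w: "\<omega> \<in> \<Sigma>" and z: "z \<in> P 11" "EL i (\<omega> \<odot>\<^sub>h z) \<in> H" "EL i (\<omega> \<odot>\<^sub>h z') \<in> H"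
  shows "EL i (\<omega> \<odot>\<^sub>h (z + z')) \<in> H"
proof -
  have "EL i (0, tr (snd \<omega> * z * cj z')) \<in> H"
    by (rule negligible_D(2)[OF level_negligible[OF Sg_snd[OF w] z(1)] i])
  then have "EL i (\<omega> \<odot>\<^sub>h z \<oplus>\<^sub>h \<omega> \<odot>\<^sub>h z' \<oplus>\<^sub>h (0, tr (cj z' * snd \<omega> * z))) \<in> H"
    using z by (intro EL_H_hplus[OF H i]) (auto simp: mult_ac)
  then show ?thesis by (simp add: hact_add[OF Delta_DeltaMax[OF f.Sg_Delta[OF w]]])
qed

lemma column_long:
  assumes s: "\<sigma> \<in> H" and ap: "apart a b" and z: "z \<in> P 11"
  shows "EL a (Q (\<sigma> *v ax b) \<odot>\<^sub>h z) \<in> H"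
proof -
  let ?q = "Q (\<sigma> *v ax b)"
  note ds = apartD[OF ap]
  have q: "?q \<in> \<Sigma>" by (rule column_mem[OF s ds(2)])
  have "z \<in> P (Suc 10)" using z by simp
  then have "z \<in> P 11 \<and> EL a (?q \<odot>\<^sub>h z) \<in> H"
  proof (rule P_Suc_induct)
    fix a1 b1 assume a: "a1 \<in> P 10" "b1 \<in> K"
    show "a1 * b1 \<in> P 11 \<and> EL a (?q \<odot>\<^sub>h (a1 * b1)) \<in> H"
      using column_long_product[OF n H s ap P_simps(5)[OF a(1)] a(2)] P_mult[of a1 10 b1 "Suc 0"] a by simp
  next
    fix x y assume "x \<in> P 11 \<and> EL a (?q \<odot>\<^sub>h x) \<in> H" "y \<in> P 11 \<and> EL a (?q \<odot>\<^sub>h y) \<in> H"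
    then show "x + y \<in> P 11 \<and> EL a (?q \<odot>\<^sub>h (x + y)) \<in> H"
      using long_add[OF ds(1) q] P_simps(2) by blast
  qed
  then show ?thesis by blast
qed

text \<open>At the indices \<open>b\<close> and \<open>-b\<close> themselves the long root element has to be moved from another index,
  which raises the power of the ideal from eleven to twelve.\<close>

lemma column_long_all:
  assumes s: "\<sigma> \<in> H" and b: "b \<in> theta_hb" and i: "i \<in> theta_hb" and z: "z \<in> P 12"
  shows "EL i (Q (\<sigma> *v ax b) \<odot>\<^sub>h z) \<in> H"
proof (cases "apart i b")
  case True
  then show ?thesis using column_long[OF s] P_mono[OF _ z, of 11] by simp
next
  case False
  let ?q = "Q (\<sigma> *v ax b)"
  obtain k where "apart b k" using third_index[OF n b b] by blast
  then have kb: "apart k b" using apart_sym by blast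
  moreover have "i = b \<or> i = - b" using False not_apart[OF i b] theta_minus_eq by auto
  ultimately have ki: "apart k i" by auto
  have q: "?q \<in> \<Sigma>" by (rule column_mem[OF s b])
  have "z \<in> P (Suc 11)" using z by simp
  then have "z \<in> P 11 \<and> EL i (?q \<odot>\<^sub>h z) \<in> H"
  proof (rule P_Suc_induct)
    fix x y assume x: "x \<in> P 11" and y: "y \<in> K"
    have "EL i (?q \<odot>\<^sub>h x \<odot>\<^sub>h cj (cj y)) \<in> H"
    proof (rule long_spread_H[OF H ki _ column_long[OF s kb x] K_bar[OF y]])
      show "?q \<odot>\<^sub>h x \<in> \<Delta>" using f.Sg_Delta[OF q] by (rule Delta_hact)
      have "x * (cj x * cj y) \<in> P 10" using P_mono[OF _ x, of 10] P_simps(3) by simp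
      from level_short[OF f.J_cj[OF Sg_snd[OF q]] this ki]
      show "ES k i (cj (snd (?q \<odot>\<^sub>h x)) * cj y) \<in> H" by (simp add: heis_act_def mult_ac)
    qed
    then show "x * y \<in> P 11 \<and> EL i (?q \<odot>\<^sub>h (x * y)) \<in> H" using P_simps(3)[OF x] by (simp add: hact_hact)
  next
    fix x y assume "x \<in> P 11 \<and> EL i (?q \<odot>\<^sub>h x) \<in> H" "y \<in> P 11 \<and> EL i (?q \<odot>\<^sub>h y) \<in> H"
    then show "x + y \<in> P 11 \<and> EL i (?q \<odot>\<^sub>h (x + y)) \<in> H"
      using long_add[OF i q] P_simps(2) by blast
  qed
  then show ?thesis by blast
qed

lemma long_level_odd_form_ideal:
  assumes M: "M \<subseteq> theta_hb"
  shows "odd_form_ideal R (J, long_level J M H)"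
proof -
  note J = f.J_ideal f.J_cj
  have mx: "(0, 0) \<in> Omega_max R J" "\<And>\<alpha> \<beta>. \<alpha> \<in> Omega_max R J \<Longrightarrow> \<beta> \<in> Omega_max R J \<Longrightarrow> \<alpha> \<oplus>\<^sub>h \<beta> \<in> Omega_max R J"
    "\<And>\<alpha>. \<alpha> \<in> Omega_max R J \<Longrightarrow> hneg \<alpha> \<in> Omega_max R J"
    "\<And>\<alpha> c. \<alpha> \<in> Omega_max R J \<Longrightarrow> \<alpha> \<odot>\<^sub>h c \<in> Omega_max R J"
    using Omega_max_submodule[OF J] by (auto simp: heis_submodule_def subgroup_heis_iff)
  have sg: "subgroup (long_level J M H) (heis R)"
    unfolding subgroup_heis_iff
  proof (intro conjI ballI)
    show "(0, 0) \<in> long_level J M H" using mx(1) normalised_one[OF H] by (simp add: long_level_def)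
    fix \<alpha> assume a: "\<alpha> \<in> long_level J M H"
    then have "\<alpha> \<in> \<Delta>" by (simp add: long_level_def Omega_max_def)
    then have "EL k (hneg (\<alpha> \<odot>\<^sub>h r)) \<in> H" if "k \<in> M" "r \<in> P 12" for k r
      using that a M by (intro EL_H_hneg[OF H] Delta_hact) (auto simp: long_level_def)
    then show "hneg \<alpha> \<in> long_level J M H"
      using a mx(3) by (auto simp: long_level_def hact_hneg)
    fix \<beta> assume b: "\<beta> \<in> long_level J M H"
    then have "EL k (\<alpha> \<odot>\<^sub>h r \<oplus>\<^sub>h \<beta> \<odot>\<^sub>h r) \<in> H" if "k \<in> M" "r \<in> P 12" for k r
      using that a M by (intro EL_H_hplus[OF H]) (auto simp: long_level_def)
    then show "\<alpha> \<oplus>\<^sub>h \<beta> \<in> long_level J M H"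
      using a b mx(2) by (auto simp: long_level_def hact_hplus)
  qed
  have act: "\<alpha> \<odot>\<^sub>h c \<in> long_level J M H" if "\<alpha> \<in> long_level J M H" for \<alpha> c
    using that mx(4) P_simps(4) by (auto simp: long_level_def hact_hact)
  have "Omega_min R J = trset J <#>\<^bsub>heis R\<^esub> heis_set_act R \<Delta> J" by (rule Omega_min_alt)
  also have "\<dots> \<subseteq> long_level J M H"
  proof (intro set_mult_heis_least heis_set_act_least)
    note mn = Omega_min_subset_max[OF J]
    have P11: "r \<in> P 11" if "r \<in> P 12" for r using P_mono[OF _ that, of 11] by simp
    show "trset J \<subseteq> long_level J M H"
    proof
      fix \<omega> assume "\<omega> \<in> trset J"
      then obtain x where x: "x \<in> J" "\<omega> = (0, tr x)" by (auto simp: trset_def)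
      have "EL m (\<omega> \<odot>\<^sub>h r) \<in> H" if "m \<in> M" "r \<in> P 12" for m r
        using negligible_D(2)[OF level_negligible[OF x(1) P11[OF that(2)]], of m "cj r"] M that
        by (auto simp: x(2) hact_tr mult_ac)
      then show "\<omega> \<in> long_level J M H" using Omega_min_tr[OF J x(1)] mn x(2) by (auto simp: long_level_def)
    qed
    fix \<delta> x assume d: "\<delta> \<in> \<Delta>" and x: "x \<in> J"
    have "EL m (\<delta> \<odot>\<^sub>h x \<odot>\<^sub>h r) \<in> H" if "m \<in> M" "r \<in> P 12" for m r
      using negligible_D(3)[OF level_negligible[OF x P11[OF that(2)]], of m \<delta> 1] M that d by (auto simp: hact_hact)
    moreover have "\<delta> \<odot>\<^sub>h x \<in> Omega_max R J" by (rule Sg_max[OF f.Sg_hact[OF d x]])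
    ultimately show "\<delta> \<odot>\<^sub>h x \<in> long_level J M H" by (simp add: long_level_def)
  qed (rule sg)+
  finally show ?thesis
    using sg act J by (auto simp: odd_form_ideal_def heis_submodule_def bar_invariant_def long_level_def)
qed

end

text \<open>The element in question is the defect of \<open>\<sigma>\<close> from acting as a scalar on \<open>y e\<^sub>0\<close>. The elementary
  matrix \<open>\<epsilon>\<close> maps \<open>e\<^sub>j\<close> to \<open>e\<^sub>j + y e\<^sub>0 + t e\<^sub>-\<^sub>j\<close>, and the columns \<open>j\<close> of \<open>\<epsilon>\<^sup>-\<^sup>1 \<sigma> \<epsilon>\<close> and \<open>\<plusminus>j\<close> of \<open>\<sigma>\<close>
  are generators of the first kind. Additivity of the congruence then gives the claim for \<open>y e\<^sub>0\<close>.
  Returning from the conjugate of \<open>H\<close> to \<open>H\<close> works for long root elements at indices apart from \<open>j\<close>,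
  as \<open>\<epsilon>\<close> moves these by negligible short root elements only.\<close>

lemma column0_long:
  fixes H :: "('a, 'n) tmat set"
  assumes H: "normalised H" and ul: "upper_level R H = (J, \<Sigma>)" and s: "\<sigma> \<in> H"
    and yz: "(y, z) \<in> \<Delta>" and i: "i \<in> theta_hb" and j: "j \<in> theta_hb"
  shows "Q (\<sigma> *v (y *s ax ZeroI)) \<oplus>\<^sub>h (0, z) \<oplus>\<^sub>h hneg ((y, z) \<odot>\<^sub>h \<sigma> $ i $ i) \<in> long_level J {m. apart m j} H"
proof -
  let ?T = "long_level J {m. apart m j} H"
  have M: "{m. apart m j} \<subseteq> theta_hb" by (auto simp: apart_def)
  have sc: "\<sigma> \<in> carrier Ug" using s normalised_closed[OF H] by blast
  note o = ofi[OF H ul]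
  interpret f: form_ideal R J \<Sigma> by unfold_locales (rule o(1))
  interpret T: form_ideal R J ?T by unfold_locales (rule long_level_odd_form_ideal[OF H ul M])
  obtain c where c: "f.scalar_mod c \<sigma>" using f.upper_scalar_mod[OF o(2,3) s sc] by blast
  define \<epsilon> :: "('a, 'n) tmat" where "\<epsilon> = trl j (y, z)"
  have e: "\<epsilon> \<in> EU R" unfolding \<epsilon>_def by (rule trl_EU[OF j yz])
  then have ec: "\<epsilon> \<in> carrier Ug" by simp
  define \<sigma>' where "\<sigma>' = inv\<^bsub>Ug\<^esub> \<epsilon> ** \<sigma> ** \<epsilon>"
  have c': "f.scalar_mod c \<sigma>'" unfolding \<sigma>'_def by (rule f.scalar_mod_conj[OF e c])
  have H': "normalised (conj_group \<epsilon> H)" by (rule normalised_conj_group[OF e H])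
  have s': "\<sigma>' \<in> conj_group \<epsilon> H" unfolding \<sigma>'_def by (rule conj_group_mem[OF e H s])
  have rel: "T.rel c 0 (\<tau> *v (x *s ax k)) (x *s ax k)"
    if "f.scalar_mod c \<tau>" "k \<in> theta_hb" "Q (\<tau> *v ax k) \<in> ?T" for \<tau> :: "('a, 'n) tmat" and x k
    unfolding T.rel_def
  proof (intro conjI ballI)
    have D: "D 0 (x *s ax k :: ('a, 'n) tvec) = (0, 0)" by (rule f.D_ax[OF that(2)])
    then show "D 0 (x *s ax k :: ('a, 'n) tvec) \<in> \<Delta>" by simp
    show "(\<tau> *v (x *s ax k)) $ l - (x *s ax k) $ l * c \<in> J" if "l \<in> theta_hb" for l
      using f.rel_nth[OF f.scalar_mod_rel[OF \<open>f.scalar_mod c \<tau>\<close>, of 0 "x *s ax k"] that] D by simp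
    show "T.heq (D 0 (\<tau> *v (x *s ax k))) (D 0 (x *s ax k) \<odot>\<^sub>h c)"
      using T.Sg_act[OF that(3), of x] that(2) by (simp add: D T.heq_zero f.D_0 mat_lin Q_smult)
  qed
  have col: "Q (\<sigma> *v ax k) \<in> ?T" if "k \<in> theta_hb" for k
    using Sg_max[OF H ul f.scalar_mod_column[OF c that]] column_long_all[OF H ul s that] M by (auto simp: long_level_def)
  define q' where "q' = Q (\<sigma>' *v ax j)"
  have q'S: "q' \<in> \<Sigma>" unfolding q'_def by (rule f.scalar_mod_column[OF c' j])
  have col': "q' \<in> ?T"
  proof -
    have "EL k (q' \<odot>\<^sub>h r) \<in> H" if k: "apart k j" and r: "r \<in> P 12" for k r
    proof -
      note ds = apartD[OF k]
      define \<alpha> where "\<alpha> = q' \<odot>\<^sub>h r"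
      obtain J' \<Sigma>' where ul': "upper_level R (conj_group \<epsilon> H) = (J', \<Sigma>')"
        by (cases "upper_level R (conj_group \<epsilon> H)")
      have "EL k \<alpha> \<in> conj_group \<epsilon> H"
        unfolding \<alpha>_def q'_def by (rule column_long_all[OF H' ul' s' j ds(1) r])
      then have a: "\<epsilon> ** EL k \<alpha> ** inv\<^bsub>Ug\<^esub> \<epsilon> \<in> H" by (simp add: conj_group_def)
      define \<kappa> where "\<kappa> = - (fst \<alpha> * (cj L * be (- j) * cj y * m))"
      have ek: "\<epsilon> *v ax k = ax k" "\<epsilon> *v ax ZeroI = ax ZeroI - (cj L * be (- j) * cj y * m) *s ax (- j)"
        unfolding \<epsilon>_def using trl_ax(2)[OF j, of k] trl_ax(3)[OF j, of "(y, z)"] ds by simp_all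
      have "\<epsilon> ** EL k \<alpha> ** inv\<^bsub>Ug\<^esub> \<epsilon> = S (ax k) (fst \<alpha> *s ax ZeroI + \<kappa> *s ax (- j)) (cj (snd \<alpha>))"
        unfolding EL_def S_conj[OF ec] by (simp add: mat_lin ek \<kappa>_def vec_eq_iff algebra_simps S_def)
      also have "\<dots> = EL k \<alpha> ** ES k (- j) \<kappa>"
        unfolding EL_def ES_def using ds by (simp add: S_comp B_ax_ax)
      finally have b: "EL k \<alpha> ** ES k (- j) \<kappa> \<in> H" using a by simp
      have "y \<in> J_par R" using Delta_fst[OF yz] by simp
      then have "cj y * m * fst q' \<in> J" by (rule f.tilde_J[OF _ f.Sg_fst[OF q'S]])
      then have "ES k (- j) ((cj y * m * fst q') * (r * (cj L * be (- j)))) \<in> H"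
        using P_mono[OF _ r, of 10] k by (intro level_short[OF H ul] P_simps) auto
      also have "(cj y * m * fst q') * (r * (cj L * be (- j))) = - \<kappa>"
        by (simp add: \<kappa>_def \<alpha>_def heis_act_def mult_ac)
      finally have "EL k \<alpha> ** ES k (- j) \<kappa> ** ES k (- j) (- \<kappa>) \<in> H" by (rule normalised_mult[OF H b])
      also have "EL k \<alpha> ** ES k (- j) \<kappa> ** ES k (- j) (- \<kappa>) = EL k \<alpha>"
        using k by (simp add: matrix_mul_assoc[symmetric] ES_add)
      finally show ?thesis by (simp add: \<alpha>_def)
    qed
    then show ?thesis using Sg_max[OF H ul q'S] by (simp add: long_level_def)
  qed
  define t where "t = be (- j) * cj z"
  have ej: "\<epsilon> *v ax j = ax j + y *s ax ZeroI + t *s ax (- j)"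
    unfolding \<epsilon>_def using trl_ax(1)[OF j, of "(y, z)"] by (simp add: t_def)
  have "T.rel c 0 (\<epsilon> *v (\<sigma>' *v ax j)) (\<epsilon> *v ax j)"
    using T.rel_EU[OF e rel[OF c' j, of 1]] col' by (simp add: q'_def)
  also have "\<epsilon> *v (\<sigma>' *v ax j) = \<sigma> *v (\<epsilon> *v ax j)"
    using ec by (simp add: \<sigma>'_def matrix_vector_mul_assoc[symmetric])
  finally have r1: "T.rel c 0 (\<sigma> *v (\<epsilon> *v ax j)) (\<epsilon> *v ax j)" .
  have r2: "T.rel c (0 + 0 + B (\<epsilon> *v ax j) ((- 1) *s ax j)) (\<sigma> *v (\<epsilon> *v ax j) + \<sigma> *v ((- 1) *s ax j)) (\<epsilon> *v ax j + (- 1) *s ax j)"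
    using sc by (intro T.rel_add[OF r1] rel[OF c j col[OF j]]) simp
  have mj: "- j \<in> theta_hb" using j by simp
  have r3: "T.rel c (0 + 0 + B (\<epsilon> *v ax j) ((- 1) *s ax j) + 0 + B (\<epsilon> *v ax j + (- 1) *s ax j) ((- t) *s ax (- j)))
      (\<sigma> *v (\<epsilon> *v ax j) + \<sigma> *v ((- 1) *s ax j) + \<sigma> *v ((- t) *s ax (- j))) (\<epsilon> *v ax j + (- 1) *s ax j + (- t) *s ax (- j))"
    using sc by (intro T.rel_add[OF r2] rel[OF c mj col[OF mj]]) (simp add: mat_lin(1)[symmetric])
  have bb: "be (- j) * cj (be (- j)) = 1" by (rule be_cj_be[OF mj])
  have sum: "\<epsilon> *v ax j + (- 1) *s ax j + (- t) *s ax (- j) = y *s ax ZeroI"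
    by (simp add: ej vec_eq_iff algebra_simps)
  have "B (\<epsilon> *v ax j) ((- 1) *s ax j) + B (\<epsilon> *v ax j + (- 1) *s ax j) ((- t) *s ax (- j)) = - ((be (- j) * cj (be (- j))) * z)"
    unfolding ej using j minus_theta_neq[OF j] by (simp add: B_ax_ax t_def theta_hb_iff mult_ac)
  then have r4: "T.rel c (- z) (\<sigma> *v (y *s ax ZeroI)) (y *s ax ZeroI)"
    using r3 unfolding mat_lin(1)[symmetric] sum by (simp add: bb)
  then have "T.heq (D (- z) (\<sigma> *v (y *s ax ZeroI))) ((y, z) \<odot>\<^sub>h c)"
    by (simp add: T.rel_def f.D_ax0)
  moreover have "T.heq ((y, z) \<odot>\<^sub>h c) ((y, z) \<odot>\<^sub>h \<sigma> $ i $ i)"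
    using f.scalar_mod_entry[OF c i i] by (intro T.heq_sym[OF T.heq_hact_J[OF yz]]) simp
  ultimately have "T.heq (D (- z) (\<sigma> *v (y *s ax ZeroI))) ((y, z) \<odot>\<^sub>h \<sigma> $ i $ i)"
    by (rule T.heq_trans)
  then show ?thesis unfolding T.heq_def f.D_minus .
qed

text \<open>Every index is apart from some \<open>j\<close>, so the restriction in the previous lemma disappears.\<close>

lemma level_long:
  fixes H :: "('a, 'n) tmat set"
  assumes H: "normalised H" and ul: "upper_level R H = (J, \<Sigma>)"
  shows "\<Sigma> \<subseteq> long_level J theta_hb H"
proof (rule upper_level_least(2)[OF ul long_level_odd_form_ideal[OF H ul subset_refl]])
  show "upper_Y R H \<subseteq> J" by (rule ofi(2)[OF H ul])
  show "upper_Z R H \<subseteq> long_level J theta_hb H"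
  proof
    fix \<zeta> assume \<zeta>: "\<zeta> \<in> upper_Z R H"
    then have mx: "\<zeta> \<in> Omega_max R J" using ofi(3)[OF H ul] Sg_max[OF H ul] by blast
    have "EL k (\<zeta> \<odot>\<^sub>h r) \<in> H" if k: "k \<in> theta_hb" and r: "r \<in> P 12" for k r
    proof -
      obtain j where j: "apart k j" using third_index[OF n k k] by blast
      from \<zeta> obtain \<sigma> i where s: "\<sigma> \<in> H" and i: "i \<in> theta_hb" and z: "\<zeta> = Q (\<sigma> *v ax i) \<or>
         (\<exists>y z. (y, z) \<in> \<Delta> \<and> \<zeta> = Q (\<sigma> *v (y *s ax ZeroI)) \<oplus>\<^sub>h (0, z) \<oplus>\<^sub>h hneg ((y, z) \<odot>\<^sub>h \<sigma> $ i $ i))"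
        unfolding upper_Z_iff by blast
      from z show ?thesis
      proof (elim disjE exE conjE)
        assume "\<zeta> = Q (\<sigma> *v ax i)"
        then show ?thesis using column_long_all[OF H ul s i k r] by simp
      next
        fix y z assume yz: "(y, z) \<in> \<Delta>"
          and "\<zeta> = Q (\<sigma> *v (y *s ax ZeroI)) \<oplus>\<^sub>h (0, z) \<oplus>\<^sub>h hneg ((y, z) \<odot>\<^sub>h \<sigma> $ i $ i)"
        then have "\<zeta> \<in> long_level J {l. apart l j} H" using column0_long[OF H ul s yz i apartD(2)[OF j]] by simp
        then show ?thesis using j r by (auto simp: long_level_def)
      qed
    qed
    then show "\<zeta> \<in> long_level J theta_hb H" using mx by (auto simp: long_level_def)
  qed
qed

end

end

section \<open>From one normalised subgroup to subnormal chains\<close>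

lemma ideal_pow_ideal_pow:
  assumes "ideal I (ring_of_type_algebra :: 'a :: comm_ring_1 ring)"
  shows "ideal_pow (ideal_pow I s) k = ideal_pow I (s * k)"
proof -
  interpret comm_monoid "ideals_set (ring_of_type_algebra :: 'a ring)"
    by (rule cring.ideals_set_is_comm_monoid[OF cring_from_type_algebra])
  have "I \<in> carrier (ideals_set ring_of_type_algebra)" using assms by (simp add: ideals_set_def)
  then show ?thesis unfolding ideal_pow_def by (rule nat_pow_pow)
qed

lemma ideal_pow_subset:
  assumes "I \<subseteq> I'"
  shows "ideal_pow I k \<subseteq> ideal_pow (I' :: 'a :: comm_ring_1 set) k"
proof (induction k)
  case (Suc k)
  have "x \<in> ideal_prod ring_of_type_algebra (ideal_pow I' k) I'"
    if "x \<in> ideal_prod ring_of_type_algebra (ideal_pow I k) I" for x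
    using that
  proof (induction rule: ideal_prod.induct)
    case (prod i j)
    then show ?case using Suc.IH assms by (intro ideal_prod.prod) auto
  next
    case (sum s1 s2)
    then show ?case by (intro ideal_prod.sum)
  qed
  then show ?case unfolding ideal_pow_Suc by blast
qed simp

context relative
begin

interpretation Ug: group "Ug :: ('a, 'n :: finite) tmat monoid"
  by (rule group_Ug)

context
  assumes n: "3 \<le> CARD('n :: finite)"
begin

lemma product_negligible:
  fixes H :: "('a, 'n) tmat set"
  assumes H: "normalised H" and ul: "upper_level R H = (J, \<Sigma>)" and x: "x \<in> ideal_prod ring_of_type_algebra J (P 12)"
  shows "x \<in> negligible H"
  using x
proof (induction rule: ideal_prod_type_induct)
  case (mult x y)
  then show ?case using level_negligible[OF n H ul mult(1)] P_mono[of 11 12 y] by simp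
next
  case (add x y)
  then show ?case using negligible_ideal[OF H] by (simp add: ideal_type_iff)
qed

lemma upper_level_conj_group:
  fixes H :: "('a, 'n) tmat set"
  assumes e: "\<epsilon> \<in> EU R" and H: "normalised H"
  shows "upper_level R (conj_group \<epsilon> H) = upper_level R H"
proof -
  have ec: "\<epsilon> \<in> carrier Ug" using e by simp
  obtain J \<Sigma> where ul: "upper_level R H = (J, \<Sigma>)" by (cases "upper_level R H")
  obtain J' \<Sigma>' where ul': "upper_level R (conj_group \<epsilon> H) = (J', \<Sigma>')" by (cases "upper_level R (conj_group \<epsilon> H)")
  have Hc: "H \<subseteq> carrier Ug" "conj_group \<epsilon> H \<subseteq> carrier Ug" using normalised_closed[OF H] by (auto simp: conj_group_def)
  have 1: "\<exists>\<sigma>\<in>H. \<tau> = inv\<^bsub>Ug\<^esub> \<epsilon> ** \<sigma> ** \<epsilon>" if "\<tau> \<in> conj_group \<epsilon> H" for \<tau>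
  proof (rule bexI)
    show "\<epsilon> ** \<tau> ** inv\<^bsub>Ug\<^esub> \<epsilon> \<in> H" using that by (simp add: conj_group_def)
    show "\<tau> = inv\<^bsub>Ug\<^esub> \<epsilon> ** (\<epsilon> ** \<tau> ** inv\<^bsub>Ug\<^esub> \<epsilon>) ** \<epsilon>"
      using ec that by (intro mat_eqI) (simp add: matrix_vector_mul_assoc[symmetric] conj_group_def)
  qed
  have ei: "inv\<^bsub>Ug\<^esub> (inv\<^bsub>Ug\<^esub> \<epsilon>) = \<epsilon>" using ec by (rule Ug.inv_inv)
  have 2: "\<exists>\<sigma>\<in>conj_group \<epsilon> H. \<tau> = inv\<^bsub>Ug\<^esub> (inv\<^bsub>Ug\<^esub> \<epsilon>) ** \<sigma> ** inv\<^bsub>Ug\<^esub> \<epsilon>" if "\<tau> \<in> H" for \<tau>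
  proof (rule bexI)
    show "inv\<^bsub>Ug\<^esub> \<epsilon> ** \<tau> ** \<epsilon> \<in> conj_group \<epsilon> H" by (rule conj_group_mem[OF e H that])
    show "\<tau> = inv\<^bsub>Ug\<^esub> (inv\<^bsub>Ug\<^esub> \<epsilon>) ** (inv\<^bsub>Ug\<^esub> \<epsilon> ** \<tau> ** \<epsilon>) ** inv\<^bsub>Ug\<^esub> \<epsilon>"
      unfolding ei using ec that by (intro mat_eqI) (simp add: matrix_vector_mul_assoc[symmetric])
  qed
  show ?thesis
    unfolding ul ul'
    using upper_level_conj[OF Hc(1) e ul 1 ul'] upper_level_conj[OF Hc(2) EU_inv[OF e] ul' 2 ul] by blast
qed

text \<open>The long root parameters all of whose multiples give elements of \<open>H\<close> form a submodule; it is
  enough that this submodule contains the generators of the product.\<close>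

lemma EU_pre_product:
  fixes H :: "('a, 'n) tmat set"
  assumes H: "normalised H"
  shows "EU_pre R (odd_form_prod R (upper_level R H) (P 12)) \<subseteq> H"
    "EU_pre R (odd_form_prod R (upper_level R H) (P 12)) \<subseteq> (EU R :: ('a, 'n) tmat set)"
proof -
  obtain J \<Sigma> where ul: "upper_level R H = (J, \<Sigma>)" by (cases "upper_level R H")
  note o = ofi[OF n H ul]
  interpret f: form_ideal R J \<Sigma> by unfold_locales (rule o(1))
  define JK where "JK = ideal_prod ring_of_type_algebra J (P 12)"
  define \<Omega> where "\<Omega> = Omega_min R JK <#>\<^bsub>heis R\<^esub> heis_set_act R \<Sigma> (P 12)"
  have pr: "odd_form_prod R (upper_level R H) (P 12) = (JK, \<Omega>)"
    by (simp add: odd_form_prod_def ul Let_def JK_def \<Omega>_def)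
  have JK: "ideal JK ring_of_type_algebra"
    unfolding JK_def by (rule ideal_prod_type[OF f.J_ideal P_ideal])
  have JKcj: "cj x \<in> JK" if "x \<in> JK" for x
    using that unfolding JK_def
  proof (induction rule: ideal_prod_type_induct)
    case (mult x y)
    then have "cj x \<otimes>\<^bsub>ring_of_type_algebra\<^esub> cj y \<in> ideal_prod ring_of_type_algebra J (P 12)"
      using f.J_cj P_bar by (intro ideal_prod.prod)
    then show ?case by simp
  next
    case (add x y)
    then show ?case using JK by (simp add: JK_def ideal_type_iff)
  qed
  have JKsm: "x \<in> negligible H" if "x \<in> JK" for x
    using product_negligible[OF H ul] that by (simp add: JK_def)
  define N where "N = {\<omega> \<in> \<Delta>. \<forall>k\<in>theta_hb. \<forall>c. EL k (\<omega> \<odot>\<^sub>h c) \<in> H}"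
  have sg: "subgroup N (heis R)"
    unfolding subgroup_heis_iff
  proof (intro conjI ballI)
    show "(0, 0) \<in> N" using normalised_one[OF H] by (simp add: N_def)
    fix \<alpha> assume a: "\<alpha> \<in> N"
    then have "EL k (hneg (\<alpha> \<odot>\<^sub>h c)) \<in> H" if "k \<in> theta_hb" for k c
      using that by (intro EL_H_hneg[OF H] Delta_hact) (auto simp: N_def)
    then show "hneg \<alpha> \<in> N" using a by (auto simp: N_def hact_hneg Delta_hneg)
    fix \<beta> assume b: "\<beta> \<in> N"
    then have "EL k (\<alpha> \<odot>\<^sub>h c \<oplus>\<^sub>h \<beta> \<odot>\<^sub>h c) \<in> H" if "k \<in> theta_hb" for k c
      using that a by (intro EL_H_hplus[OF H]) (auto simp: N_def)
    then show "\<alpha> \<oplus>\<^sub>h \<beta> \<in> N" using a b by (auto simp: N_def hact_hplus Delta_hplus)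
  qed
  have N: "heis_submodule R N"
    using sg by (auto simp: heis_submodule_def N_def hact_hact Delta_hact)
  have eq: "Omega_min R JK = trset JK <#>\<^bsub>heis R\<^esub> heis_set_act R \<Delta> JK"
    by (rule Omega_min_alt)
  have "Omega_min R JK \<subseteq> N"
    unfolding eq
  proof (intro set_mult_heis_least heis_set_act_least)
    show "trset JK \<subseteq> N"
    proof
      fix \<omega> assume "\<omega> \<in> trset JK"
      then obtain x where x: "x \<in> JK" "\<omega> = (0, tr x)" by (auto simp: trset_def)
      have "EL k (\<omega> \<odot>\<^sub>h c) \<in> H" if "k \<in> theta_hb" for k c
        using negligible_D(2)[OF JKsm[OF x(1)] that, of "cj c * c"] by (simp add: x(2) hact_tr mult_ac)
      then show "\<omega> \<in> N" by (simp add: N_def x(2))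
    qed
    fix \<delta> x assume d: "\<delta> \<in> \<Delta>" and x: "x \<in> JK"
    show "\<delta> \<odot>\<^sub>h x \<in> N"
      using negligible_D(3)[OF JKsm[OF x] _ d] by (auto simp: N_def hact_hact Delta_hact d)
  qed (rule sg)+
  moreover have "heis_set_act R \<Sigma> (P 12) \<subseteq> N"
  proof (rule heis_set_act_least[OF sg])
    fix \<omega> r assume w: "\<omega> \<in> \<Sigma>" and r: "r \<in> P 12"
    have "r * c \<in> P 12" for c by (rule P_simps(3)[OF r])
    then show "\<omega> \<odot>\<^sub>h r \<in> N"
      using level_long[OF n H ul] w by (auto simp: N_def long_level_def hact_hact intro!: Delta_hact f.Sg_Delta[OF w])
  qed
  ultimately have "\<Omega> \<subseteq> N" unfolding \<Omega>_def by (intro set_mult_heis_least sg)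
  then have "elem_gens R JK \<Omega> \<subseteq> (elem_gens R JK N :: ('a, 'n) tmat set)"
    unfolding elem_gens_def par_pm_def by fastforce
  also have "elem_gens R JK N = {ES i j x |i j x. apart i j \<and> x \<in> JK} \<union> {EL i \<alpha> |i \<alpha>. i \<in> theta_hb \<and> \<alpha> \<in> N}"
    by (rule elem_gens_alt[OF N]) (use JK in \<open>auto simp: N_def ideal_type_iff\<close>)
  finally have g: "elem_gens R JK \<Omega> \<subseteq> ({ES i j x |i j x. apart i j \<and> x \<in> JK} \<union> {EL i \<alpha> |i \<alpha>. i \<in> theta_hb \<and> \<alpha> \<in> N} :: ('a, 'n) tmat set)" .
  have "EL i \<alpha> \<in> H" if "i \<in> theta_hb" "\<alpha> \<in> N" for i \<alpha>
    using that hact_one[of \<alpha>] unfolding N_def by (metis (mono_tags, lifting) mem_Collect_eq)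
  moreover have "ES i j x \<in> H" if "apart i j" "x \<in> JK" for i j x
    using negligible_D(1)[OF JKsm[OF that(2)] that(1), of 1] by simp
  ultimately have gH: "elem_gens R JK \<Omega> \<subseteq> H" using g by blast
  show "EU_pre R (odd_form_prod R (upper_level R H) (P 12)) \<subseteq> H"
    unfolding pr EU_pre_def prod.case by (rule Ug.generate_subgroup_incl[OF gH normalised_subgroup[OF H]])
  have "elem_gens R JK \<Omega> \<subseteq> (EU R :: ('a, 'n) tmat set)"
    using g ES_EU EL_EU by (force simp: N_def)
  then show "EU_pre R (odd_form_prod R (upper_level R H) (P 12)) \<subseteq> (EU R :: ('a, 'n) tmat set)"
    unfolding pr EU_pre_def prod.case by (rule Ug.generate_subgroup_incl[OF _ subgroup_EU])
qed

text \<open>The elements of the elementary group all of whose elementary conjugates lie in \<open>H\<close> form a normal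
  subgroup. It contains the generators because the conjugates of \<open>H\<close> have the same upper level as \<open>H\<close>.\<close>

theorem EU_rel_product:
  fixes H :: "('a, 'n) tmat set"
  assumes H: "normalised H"
  shows "EU_rel R (odd_form_prod R (upper_level R H) (P 12)) \<subseteq> H"
proof -
  define C where "C = {g \<in> EU R. \<forall>\<epsilon>\<in>EU R. \<epsilon> ** g ** inv\<^bsub>Ug\<^esub> \<epsilon> \<in> H}"
  have cc: "\<epsilon> ** (g ** h) ** inv\<^bsub>Ug\<^esub> \<epsilon> = (\<epsilon> ** g ** inv\<^bsub>Ug\<^esub> \<epsilon>) ** (\<epsilon> ** h ** inv\<^bsub>Ug\<^esub> \<epsilon>)"
    if "\<epsilon> \<in> EU R" for \<epsilon> g h :: "('a, 'n) tmat"
    using that by (intro mat_eqI) (simp add: matrix_vector_mul_assoc[symmetric])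
  have ci: "\<epsilon> ** inv\<^bsub>Ug\<^esub> g ** inv\<^bsub>Ug\<^esub> \<epsilon> = inv\<^bsub>Ug\<^esub> (\<epsilon> ** g ** inv\<^bsub>Ug\<^esub> \<epsilon>)"
    if "\<epsilon> \<in> EU R" "g \<in> EU R" for \<epsilon> g :: "('a, 'n) tmat"
    using that by (simp add: Ug.inv_mult_group Ug.m_assoc del: mult_Ug flip: mult_Ug)
  have Csub: "subgroup C Ug"
  proof (rule Ug.subgroupI)
    show "C \<subseteq> carrier Ug" by (auto simp: C_def)
    have "mat 1 \<in> C" using EU_one normalised_one[OF H] by (auto simp: C_def Ug.r_inv[unfolded mult_Ug one_Ug])
    then show "C \<noteq> {}" by blast
    show "inv\<^bsub>Ug\<^esub> g \<in> C" if "g \<in> C" for g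
      using that normalised_inv[OF H] EU_inv by (auto simp: C_def ci)
    show "g \<otimes>\<^bsub>Ug\<^esub> h \<in> C" if "g \<in> C" "h \<in> C" for g h
      using that normalised_mult[OF H] EU_mult by (auto simp: C_def cc)
  qed
  let ?E = "Ug\<lparr>carrier := EU R\<rparr> :: ('a, 'n) tmat monoid"
  interpret E: group ?E by (rule Ug.subgroup_imp_group[OF subgroup_EU])
  have "C \<lhd> ?E"
    unfolding E.normal_inv_iff
  proof (intro conjI ballI)
    show "subgroup C ?E" by (rule Ug.subgroup_incl[OF Csub subgroup_EU]) (auto simp: C_def)
    fix x g assume "x \<in> carrier ?E" and g: "g \<in> C"
    then have x: "x \<in> EU R" by simp
    have "x ** g ** inv\<^bsub>Ug\<^esub> x \<in> C"
      unfolding C_def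
    proof (intro CollectI conjI ballI)
      show "x ** g ** inv\<^bsub>Ug\<^esub> x \<in> EU R" using x g by (intro EU_mult EU_inv) (auto simp: C_def)
      fix \<epsilon> assume e: "\<epsilon> \<in> (EU R :: ('a, 'n) tmat set)"
      have "\<epsilon> ** (x ** g ** inv\<^bsub>Ug\<^esub> x) ** inv\<^bsub>Ug\<^esub> \<epsilon> = (\<epsilon> ** x) ** g ** inv\<^bsub>Ug\<^esub> (\<epsilon> ** x)"
        using e x by (simp add: Ug.inv_mult_group[unfolded mult_Ug] matrix_mul_assoc)
      also have "\<dots> \<in> H" using g EU_mult[OF e x] by (simp add: C_def)
      finally show "\<epsilon> ** (x ** g ** inv\<^bsub>Ug\<^esub> x) ** inv\<^bsub>Ug\<^esub> \<epsilon> \<in> H" .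
    qed
    then show "x \<otimes>\<^bsub>?E\<^esub> g \<otimes>\<^bsub>?E\<^esub> inv\<^bsub>?E\<^esub> x \<in> C"
      using Ug.m_inv_consistent[OF subgroup_EU x] by simp
  qed
  moreover have "EU_pre R (odd_form_prod R (upper_level R H) (P 12)) \<subseteq> C"
  proof
    fix g :: "('a, 'n) tmat" assume g: "g \<in> EU_pre R (odd_form_prod R (upper_level R H) (P 12))"
    have "\<epsilon> ** g ** inv\<^bsub>Ug\<^esub> \<epsilon> \<in> H" if "\<epsilon> \<in> EU R" for \<epsilon>
    proof -
      have "g \<in> conj_group \<epsilon> H"
        using EU_pre_product(1)[OF normalised_conj_group[OF that H]] g unfolding upper_level_conj_group[OF that H] by blast
      then show ?thesis by (simp add: conj_group_def)
    qed
    then show "g \<in> C" using EU_pre_product(2)[OF H] g by (auto simp: C_def)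
  qed
  ultimately have "EU_rel R (odd_form_prod R (upper_level R H) (P 12)) \<subseteq> C"
    unfolding EU_rel_def normal_closure_def by blast
  then show ?thesis
    using EU_one by (force simp: C_def)
qed

end

end

context unitary
begin

interpretation Ug: group "Ug :: ('a, 'n :: finite) tmat monoid"
  by (rule group_Ug)

context
  fixes G :: "('a, 'n :: finite) tmat set"
  assumes n: "3 \<le> CARD('n)" and G: "subgroup G Ug" and EU_G: "EU R \<subseteq> G"
begin

lemma upper_level_mono:
  assumes "H \<subseteq> H'"
  shows "fst (upper_level R H) \<subseteq> fst (upper_level R (H' :: ('a, 'n) tmat set))"
proof -
  have "upper_Y R H \<subseteq> upper_Y R H'" using assms unfolding upper_Y_def by (intro UN_mono) auto
  then have "upper_Y R H \<union> cj ` upper_Y R H \<subseteq> genideal ring_of_type_algebra (upper_Y R H' \<union> cj ` upper_Y R H')"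
    using genideal_type(2)[of "upper_Y R H' \<union> cj ` upper_Y R H'"] by blast
  then show ?thesis
    unfolding upper_level_def Let_def fst_conv by (intro genideal_type(3) genideal_type(1))
qed

fun chain_exp :: "nat \<Rightarrow> nat" where "chain_exp 0 = 0" | "chain_exp (Suc d) = 12 * chain_exp d + 1"

lemma chain_exp_eq: "(12 ^ d - 1) div 11 = chain_exp d"
proof -
  have "12 ^ d = 11 * chain_exp d + 1" by (induction d) auto
  then show ?thesis by simp
qed

lemma subnormal_step:
  assumes c: "subnormal_chain Ug (Suc d) H G"
  obtains H1 where "subnormal_chain Ug d H1 G" "H \<lhd> Ug\<lparr>carrier := H1\<rparr>" "subgroup H Ug" "subgroup H1 Ug"
proof -
  from c obtain Hs where Hs: "Hs 0 = H" "Hs (Suc d) = G" "\<forall>i\<le>Suc d. subgroup (Hs i) Ug"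
      "\<forall>i<Suc d. Hs i \<lhd> Ug\<lparr>carrier := Hs (Suc i)\<rparr>"
    unfolding subnormal_chain_def by blast
  show ?thesis
  proof (rule that[of "Hs 1"])
    show "subnormal_chain Ug d (Hs 1) G"
      unfolding subnormal_chain_def by (rule exI[of _ "\<lambda>i. Hs (Suc i)"]) (use Hs in auto)
    have "Hs 0 \<lhd> Ug\<lparr>carrier := Hs (Suc 0)\<rparr>" using Hs(4) by blast
    then show "H \<lhd> Ug\<lparr>carrier := Hs 1\<rparr>" by (simp add: Hs(1))
    have "subgroup (Hs 0) Ug" using Hs(3) by blast
    then show "subgroup H Ug" by (simp add: Hs(1))
    show "subgroup (Hs 1) Ug" using Hs(3) by (metis One_nat_def Suc_le_mono zero_le)
  qed
qed

lemma level_pow_relative: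
  assumes "H \<subseteq> carrier Ug"
  shows "relative R (ideal_pow (fst (upper_level R (H :: ('a, 'n) tmat set))) s)"
proof -
  obtain J \<Sigma> where ul: "upper_level R H = (J, \<Sigma>)" by (cases "upper_level R H")
  interpret f: form_ideal R J \<Sigma> by unfold_locales (rule upper_level_odd_form_ideal(1)[OF assms ul])
  interpret J: relative R J
    by (rule relative.intro[OF unitary_axioms relative_axioms.intro[OF f.J_ideal f.J_cj]])
  show ?thesis
    unfolding ul fst_conv by (rule relative.intro[OF unitary_axioms relative_axioms.intro[OF J.P_ideal J.P_bar]])
qed

text \<open>\<open>H\<close> is normal in the next member \<open>H1\<close> of the chain. The larger group contains the relative elementary
  generators for a power of its own ideal, which includes the same power of the ideal of \<open>H\<close>.\<close>

lemma chain_step: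
  assumes c: "subnormal_chain Ug (Suc d) H G"
    and IH: "\<And>H1. subnormal_chain Ug d H1 G \<Longrightarrow> subgroup H1 Ug \<Longrightarrow>
      (\<forall>\<epsilon>\<in>EU R. \<forall>g\<in>relative.rel_gens R (ideal_pow (fst (upper_level R H1)) (chain_exp d)). \<epsilon> ** g ** inv\<^bsub>Ug\<^esub> \<epsilon> \<in> H1)"
  shows "relative.normalised R (ideal_pow (fst (upper_level R H)) (chain_exp d)) H"
proof -
  obtain H1 where H1: "subnormal_chain Ug d H1 G" "H \<lhd> Ug\<lparr>carrier := H1\<rparr>" "subgroup H Ug" "subgroup H1 Ug"
    by (rule subnormal_step[OF c])
  have HH: "H \<subseteq> H1" using normal_imp_subgroup[OF H1(2)] subgroup.subset by fastforce
  interpret r: relative R "ideal_pow (fst (upper_level R H)) (chain_exp d)"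
    by (rule level_pow_relative[OF subgroup.subset[OF H1(3)]])
  interpret r1: relative R "ideal_pow (fst (upper_level R H1)) (chain_exp d)"
    by (rule level_pow_relative[OF subgroup.subset[OF H1(4)]])
  have KK: "ideal_pow (fst (upper_level R H)) (chain_exp d) \<subseteq> ideal_pow (fst (upper_level R H1)) (chain_exp d)"
    by (rule ideal_pow_subset[OF upper_level_mono[OF HH]])
  have "r.rel_gens \<subseteq> (r1.rel_gens :: ('a, 'n) tmat set)"
    unfolding r.rel_gens_def r1.rel_gens_def using KK by blast
  then have "\<epsilon> ** g ** inv\<^bsub>Ug\<^esub> \<epsilon> \<in> H1" if "\<epsilon> \<in> EU R" "g \<in> r.rel_gens" for \<epsilon> g
    using IH[OF H1(1,4)] that by blast
  moreover have "x \<in> nmz Ug H" if x: "x \<in> H1" for x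
  proof -
    interpret E: group "Ug\<lparr>carrier := H1\<rparr>" by (rule Ug.subgroup_imp_group[OF H1(4)])
    have nn: "y ** h ** inv\<^bsub>Ug\<^esub> y \<in> H" if "y \<in> H1" "h \<in> H" for y h
    proof -
      have "y ** h ** inv\<^bsub>Ug\<lparr>carrier := H1\<rparr>\<^esub> y \<in> H"
        using H1(2) that unfolding E.normal_inv_iff by simp
      then show ?thesis unfolding Ug.m_inv_consistent[OF H1(4) that(1)] .
    qed
    have xc: "x \<in> carrier Ug" using subgroup.mem_carrier[OF H1(4) x] .
    show ?thesis
      unfolding nmz_def using nn[OF x] nn[OF subgroup.m_inv_closed[OF H1(4) x]] xc by simp
  qed
  ultimately show ?thesis unfolding r.normalised_def using H1(3) by blast
qed

text \<open>The induction along the chain. The twelvefold power from \<open>EU_rel_product\<close> is multiplied once more by the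
  ideal itself, since the product with the upper level contributes one factor; this is the recursion of
  \<open>chain_exp\<close>.\<close>

lemma chain_gens:
  assumes "subnormal_chain Ug d H G" "subgroup H Ug" "\<epsilon> \<in> EU R"
    "g \<in> relative.rel_gens R (ideal_pow (fst (upper_level R H)) (chain_exp d))"
  shows "\<epsilon> ** g ** inv\<^bsub>Ug\<^esub> \<epsilon> \<in> H"
  using assms
proof (induction d arbitrary: H \<epsilon> g)
  case 0
  interpret r: relative R "ideal_pow (fst (upper_level R H)) (chain_exp 0)"
    by (rule level_pow_relative[OF subgroup.subset[OF 0(2)]])
  have HG: "H = G" using 0(1) by (auto simp: subnormal_chain_def)
  have "g \<in> EU R" using 0(4) ES_EU EL_EU Delta_hact Delta_tr unfolding r.rel_gens_def by blast
  then show ?case using 0(3) EU_mult EU_inv EU_G HG by blast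
next
  case (Suc d)
  define J where "J = fst (upper_level R H)"
  obtain \<Sigma> where ul: "upper_level R H = (J, \<Sigma>)" by (cases "upper_level R H") (simp add: J_def)
  have Hc: "H \<subseteq> carrier Ug" by (rule subgroup.subset[OF Suc.prems(2)])
  interpret r: relative R "ideal_pow J (chain_exp d)" unfolding J_def by (rule level_pow_relative[OF Hc])
  interpret r': relative R "ideal_pow J (chain_exp (Suc d))" unfolding J_def by (rule level_pow_relative[OF Hc])
  interpret f: form_ideal R J \<Sigma> by unfold_locales (rule upper_level_odd_form_ideal(1)[OF Hc ul])
  have nr: "r.normalised H" unfolding J_def by (rule chain_step[OF Suc.prems(1)]) (use Suc.IH in blast)
  have nr': "r.normalised (r.conj_group \<epsilon> H)" by (rule r.normalised_conj_group[OF Suc.prems(3) nr])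
  have ul': "upper_level R (r.conj_group \<epsilon> H) = (J, \<Sigma>)" using r.upper_level_conj_group[OF n Suc.prems(3) nr] ul by simp
  have K: "x \<in> r.negligible (r.conj_group \<epsilon> H)" if "x \<in> ideal_pow J (chain_exp (Suc d))" for x
  proof -
    have "x \<in> ideal_prod ring_of_type_algebra (ideal_pow J (12 * chain_exp d)) J"
      using that by (simp add: ideal_pow_Suc)
    also have "ideal_pow J (12 * chain_exp d) = ideal_pow (ideal_pow J (chain_exp d)) 12"
      by (simp add: ideal_pow_ideal_pow[OF f.J_ideal] mult.commute)
    also have "ideal_prod ring_of_type_algebra (ideal_pow (ideal_pow J (chain_exp d)) 12) J
        = ideal_prod ring_of_type_algebra J (ideal_pow (ideal_pow J (chain_exp d)) 12)"
      by (rule cring.ideal_prod_commute[OF cring_from_type_algebra r.P_ideal f.J_ideal])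
    finally show ?thesis by (rule r.product_negligible[OF n nr' ul'])
  qed
  have "g \<in> r.conj_group \<epsilon> H"
    using Suc.prems(4)[folded J_def] r.negligible_D[OF K, where r = 1] unfolding r'.rel_gens_def by auto
  then show ?case by (simp add: r.conj_group_def)
qed

theorem chain_EU_rel:
  assumes c: "subnormal_chain Ug d H G" and d: "d > 0" and H: "subgroup H Ug" and ul: "upper_level R H = (I, \<Omega>)"
  shows "EU_rel R (odd_form_prod R (upper_level R H) (ideal_pow I ((12 ^ d - 1) div 11 - 1))) \<subseteq> H"
proof -
  obtain d' where d': "d = Suc d'" using d by (cases d) auto
  have Hc: "H \<subseteq> carrier Ug" by (rule subgroup.subset[OF H])
  have I: "fst (upper_level R H) = I" by (simp add: ul)
  interpret r: relative R "ideal_pow I (chain_exp d')" using level_pow_relative[OF Hc, of "chain_exp d'"] by (simp add: I)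
  interpret f: form_ideal R I \<Omega> by unfold_locales (rule upper_level_odd_form_ideal(1)[OF Hc ul])
  have "r.normalised H" using chain_step[OF c[unfolded d']] chain_gens unfolding I by blast
  moreover have "ideal_pow I ((12 ^ d - 1) div 11 - 1) = r.P 12"
    unfolding chain_exp_eq d' by (simp add: ideal_pow_ideal_pow[OF f.J_ideal] mult.commute)
  ultimately show ?thesis using r.EU_rel_product[OF n] by metis
qed

end

end

theorem theorem43:
  fixes R :: "('a :: comm_ring_1) hermitian_form_ring"
    and G H :: "('a, 3) tmat set"
    and I :: "'a set" and \<Omega> :: "('a \<times> 'a) set"
    and d :: nat
  assumes "hermitian_form_ring R"
    and "subgroup G (unitary_group R)"
    and "EU R \<subseteq> G"
    and "d > 0"
    and "subnormal_chain (unitary_group R) d H G"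
    and "upper_level R H = (I, \<Omega>)"
  shows "EU_rel R (odd_form_prod R (upper_level R H) (ideal_pow I ((12 ^ d - 1) div 11 - 1))) \<subseteq> H
       \<and> H \<subseteq> CU_rel R (upper_level R H)"
proof -
  interpret hermitian_form_ring R by (rule assms(1))
  interpret unitary R by unfold_locales
  obtain Hs :: "nat \<Rightarrow> ('a, 3) tmat set" where "Hs 0 = H" "\<forall>i\<le>d. subgroup (Hs i) (unitary_group R)"
    using assms(5) unfolding subnormal_chain_def by blast
  then have H: "subgroup H (unitary_group R)" by auto
  have "3 \<le> CARD(3)" by simp
  from chain_EU_rel[OF this assms(2,3,5,4) H assms(6)] subgroup_le_CU[OF H] show ?thesis by blast
qed

end
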